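(* Let $p$ be a prime number. Let $A$ and $B$ be free groups, let $\langle h\rangle\leqslant A$ and $\langle k\rangle\leqslant B$ be maximal cyclic subgroups, and let $H=\langle h^m\rangle$, $K=\langle k^n\rangle$ for integers $m,n$. Let $\varphi:H\to K$ be an isomorphism and let $G=(A*B;\,H=K,\varphi)$ be the free product of $A$ and $B$ with $H$ and $K$ amalgamated according to $\varphi$. If $m=1$, or $n=1$, or both $m$ and $n$ are $p$-numbers, then all $p'$-isolated cyclic subgroups of $G$ are $p$-separable in $G$.
   Context: A $p$-number is a power $p^s$, $s\geqslant 0$. A subgroup $F$ of a group $X$ is $p$-separable in $X$ if for every $g\in X\setminus F$ there is a homomorphism $\psi$ of $X$ onto a finite $p$-group with $g\psi\notin F\psi$. A subgroup $Y$ of a group $X$ is $p'$-isolated (in $X$) if for every $g\in X$ and every prime $q\neq p$, $g^q\in Y$ implies $g\in Y$. A maximal cyclic subgroup is a cyclic subgroup not properly contained in another cyclic subgroup. *)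

theory Defs
  imports "HOL-Algebra.Generated_Groups" "HOL-Computational_Algebra.Primes"
begin

inductive word_cong :: "('g list \<times> 'g list) set \<Rightarrow> 'g list \<Rightarrow> 'g list \<Rightarrow> bool"
  for R :: "('g list \<times> 'g list) set"
where
  rel: "(l, r) \<in> R \<Longrightarrow> word_cong R (u @ l @ v) (u @ r @ v)"
| refl: "word_cong R u u"
| sym: "word_cong R u v \<Longrightarrow> word_cong R v u"
| trans: "word_cong R u v \<Longrightarrow> word_cong R v w \<Longrightarrow> word_cong R u w"

definition word_rel :: "'g set \<Rightarrow> ('g list \<times> 'g list) set \<Rightarrow> ('g list \<times> 'g list) set"
  where "word_rel S R = {(u, v). u \<in> lists S \<and> v \<in> lists S \<and> word_cong R u v}"

text \<open>
  The monoid presented by the letters \<open>S\<close> and the relations \<open>R\<close>, where \<open>R\<close> is meant to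
  relate words over \<open>S\<close>. Both instances below are groups, because there every letter
  has an inverse modulo the relations.
\<close>

definition word_quotient :: "'g set \<Rightarrow> ('g list \<times> 'g list) set \<Rightarrow> 'g list set monoid"
  where "word_quotient S R =
    \<lparr>carrier = lists S // word_rel S R,
     monoid.mult = (\<lambda>C D. \<Union>u\<in>C. \<Union>v\<in>D. word_rel S R `` {u @ v}),
     monoid.one = word_rel S R `` {[]}\<rparr>"

text \<open>The letter \<open>(True, x)\<close> stands for \<open>x\<close> and \<open>(False, x)\<close> for its inverse.\<close>

definition free_group_on :: "'x set \<Rightarrow> (bool \<times> 'x) list set monoid"
  where "free_group_on X =
    word_quotient (UNIV \<times> X) {([(b, x), (\<not> b, x)], []) | b x. x \<in> X}"

text \<open>
  A basis of a free group can be taken inside the group, so it is no restriction to let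
  the index set \<open>X\<close> have the element type of the group.
\<close>

definition free_group :: "('a, 'c) monoid_scheme \<Rightarrow> bool"
  where "free_group A \<longleftrightarrow> group A \<and> (\<exists>X :: 'a set. A \<cong> free_group_on X)"

text \<open>
  The group \<open>(A * B; H = K, \<phi>)\<close>, presented by the disjoint union of \<open>A\<close> and \<open>B\<close>
  with the multiplication tables of \<open>A\<close> and \<open>B\<close> and the relations
  \<open>x = \<phi> x\<close> for \<open>x \<in> H\<close>. The subgroup \<open>K\<close> enters only as the image of \<open>\<phi>\<close>.
\<close>

definition amalgam_rels ::
    "('a, 'c) monoid_scheme \<Rightarrow> ('b, 'd) monoid_scheme \<Rightarrow> 'a set \<Rightarrow> ('a \<Rightarrow> 'b)
      \<Rightarrow> (('a + 'b) list \<times> ('a + 'b) list) set"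
  where "amalgam_rels A B H \<phi> =
      {([Inl x, Inl y], [Inl (x \<otimes>\<^bsub>A\<^esub> y)]) | x y. x \<in> carrier A \<and> y \<in> carrier A}
    \<union> {([Inr x, Inr y], [Inr (x \<otimes>\<^bsub>B\<^esub> y)]) | x y. x \<in> carrier B \<and> y \<in> carrier B}
    \<union> {([Inl \<one>\<^bsub>A\<^esub>], []), ([Inr \<one>\<^bsub>B\<^esub>], [])}
    \<union> {([Inl x], [Inr (\<phi> x)]) | x. x \<in> H}"

definition amalgam ::
    "('a, 'c) monoid_scheme \<Rightarrow> ('b, 'd) monoid_scheme \<Rightarrow> 'a set \<Rightarrow> ('a \<Rightarrow> 'b)
      \<Rightarrow> ('a + 'b) list set monoid"
  where "amalgam A B H \<phi> =
    word_quotient (Sum_Type.Plus (carrier A) (carrier B)) (amalgam_rels A B H \<phi>)"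

definition cyclic_subgroup :: "'a set \<Rightarrow> ('a, 'c) monoid_scheme \<Rightarrow> bool"
  where "cyclic_subgroup C X \<longleftrightarrow> (\<exists>x \<in> carrier X. C = generate X {x})"

definition maximal_cyclic_subgroup :: "'a set \<Rightarrow> ('a, 'c) monoid_scheme \<Rightarrow> bool"
  where "maximal_cyclic_subgroup C X \<longleftrightarrow>
    cyclic_subgroup C X \<and> \<not> (\<exists>D. cyclic_subgroup D X \<and> C \<subset> D)"

definition p_number :: "nat \<Rightarrow> int \<Rightarrow> bool"
  where "p_number p m \<longleftrightarrow> (\<exists>s :: nat. m = int p ^ s)"

definition finite_p_group :: "nat \<Rightarrow> ('a, 'c) monoid_scheme \<Rightarrow> bool"
  where "finite_p_group p P \<longleftrightarrow>
    group P \<and> finite (carrier P) \<and> (\<exists>s :: nat. order P = p ^ s)"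

definition p'_isolated :: "nat \<Rightarrow> 'a set \<Rightarrow> ('a, 'c) monoid_scheme \<Rightarrow> bool"
  where "p'_isolated p Y X \<longleftrightarrow> subgroup Y X \<and>
    (\<forall>g \<in> carrier X. \<forall>q :: nat. prime q \<and> q \<noteq> p \<and> g [^]\<^bsub>X\<^esub> q \<in> Y \<longrightarrow> g \<in> Y)"

text \<open>
  Every finite group is isomorphic to one whose elements are natural numbers, so the
  quantifier over \<open>P\<close> covers all finite \<open>p\<close>-groups up to isomorphism.
\<close>

definition p_separable :: "nat \<Rightarrow> 'a set \<Rightarrow> ('a, 'c) monoid_scheme \<Rightarrow> bool"
  where "p_separable p F X \<longleftrightarrow> subgroup F X \<and>
    (\<forall>g \<in> carrier X - F. \<exists>(P :: nat monoid) \<psi>.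
       finite_p_group p P \<and> \<psi> \<in> epi X P \<and> \<psi> g \<notin> \<psi> ` F)"

end

theory Submission
  imports Defs "HOL-Algebra.Elementary_Groups" "HOL-Algebra.Sylow" "HOL-Algebra.Multiplicative_Group" "HOL-Library.Countable_Set"
begin

text \<open>
  A normal subgroup \<open>N\<close> of \<open>G\<close> is called open if \<open>G/N\<close> is a finite \<open>p\<close>-group, and the group \<open>G\<close> is
  called tame at \<open>c\<close> if every \<open>g\<close> in the closure of \<open>\<langle>c\<rangle>\<close> satisfies an equation
  \<open>g\<^sup>x = c\<^sup>y\<close> with \<open>p\<close> not dividing \<open>x\<close>. If \<open>\<langle>c\<rangle>\<close> is also \<open>p'\<close>-isolated, this equation puts \<open>g\<close>
  into \<open>\<langle>c\<rangle>\<close>, so that \<open>\<langle>c\<rangle>\<close> is closed, that is, \<open>p\<close>-separable (\<open>p_separable_if_tame\<close>). It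
  therefore suffices to prove that the amalgamated product is tame at each of its elements.

  Tameness is read off from linear coordinates. Let \<open>U\<close> be a group of unitriangular matrices over the
  rational numbers whose denominators are prime to \<open>p\<close>. Suppose that some power of \<open>c\<close> has a nontrivial
  image in \<open>U\<close>, or in the base group of a wreath product of \<open>U\<close> with a finite \<open>p\<close>-group. The
  entries of a matrix on its lowest nonzero superdiagonal are additive on powers. Hence the exponent
  with which an element \<open>g\<close> of the closure of \<open>\<langle>c\<rangle>\<close> arises from \<open>c\<close> is not only a \<open>p\<close>-adic number but a
  quotient \<open>y/x\<close> of two such entries, in which denominators and common factors \<open>p\<close> can be cleared, and if \<open>G\<close> is residually a finite \<open>p\<close>-group, the equation
  \<open>g\<^sup>x = c\<^sup>y\<close> follows (\<open>tame_by_linear_coordinate\<close>). A free group has enough homomorphisms to \<open>U\<close>: map the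
  basis elements to elementary matrices; then the corner entry of the image of
  \<open>e\<^sub>1\<^bsup>z1\<^esup> e\<^sub>2\<^bsup>z2\<^esup> \<dots>\<close> is the product of the exponents, because there is only one path from the first to
  the last index (\<open>colour_path\<close>).

  Now let \<open>G\<close> be an amalgamated product in which a power \<open>h\<^sup>q\<close> is identified with a power \<open>k\<^bsup>q'\<^esup>\<close>, where
  \<open>q\<close> and \<open>q'\<close> are powers of \<open>p\<close>. In the factors the groups \<open>\<langle>h\<^sup>q\<rangle>\<close> and \<open>\<langle>k\<^bsup>q'\<^esup>\<rangle>\<close> are
  closed, and \<open>h\<close> and \<open>k\<close> are central with large order in suitable finite \<open>p\<close>-quotients. The latter
  makes it possible to extend finite \<open>p\<close>-quotients from the factors to \<open>G\<close> (\<open>extend_quotient\<close>).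
  So a reduced word \<open>a\<^sub>0 b\<^sub>1 a\<^sub>1 \<dots>\<close> has a finite \<open>p\<close>-quotient \<open>W\<close> of \<open>G\<close> in
  which no letter falls into the image of the amalgamated subgroup. In the wreath product of \<open>U\<close> with \<open>W\<close>
  let \<open>A\<close> act by pure translations and let \<open>B\<close> act by the translations conjugated by a function on \<open>W\<close>
  that only depends on the cosets of the amalgamated subgroup. The two actions agree on the amalgamated
  subgroup. The word then traces a path through \<open>W\<close>, and its coordinate at the identity is a product of
  elementary matrices indexed by the cosets on this path, of which consecutive ones differ
  (\<open>reduced_image_detected\<close>). This detects every element that is not conjugate into a
  factor, and the factors keep their topology, so \<open>G\<close> is tame. This settles the case in which
  \<open>m\<close> and \<open>n\<close> are \<open>p\<close>-numbers.

  If \<open>m = 1\<close>, write \<open>n = \<plusminus> n' p\<^sup>t\<close> with \<open>n'\<close> prime to \<open>p\<close>. Then \<open>G\<close> is obtained in two steps. The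
  first one adjoins to \<open>A\<close> a root \<open>x\<close> of \<open>h = x\<^bsup>n'\<^esup>\<close>, the second one amalgamates along
  \<open>x = k\<^bsup>q\<^esup>\<close> with \<open>q = p\<^sup>t\<close>, which the previous paragraph covers. What remains is the first step, the
  locale \<open>root_adjunction\<close>. Homomorphisms from \<open>A\<close> to \<open>U\<close> extend because \<open>U\<close> has unique
  \<open>n'\<close>-th roots. An element in the kernel of all of these is again read along a path in a finite
  \<open>p\<close>-group, but now a power of \<open>x\<close> has to produce the nontrivial matrix. For this one
  vertex in each relevant coset of \<open>\<langle>h\<rangle>\<close> is marked, such that the word for \<open>h\<close> picks up an
  elementary matrix just once on each turn around the coset, whereas the letters from \<open>A\<close> avoid all marks
  (\<open>choose_marks\<close>, \<open>marked_hom\<close>). Then \<open>x\<^sup>j\<close> contributes an exponent in \<open>\<int> - qj/n'\<close> with \<open>q\<close> prime to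
  \<open>n'\<close>, and this is not \<open>0\<close> unless \<open>n'\<close> divides \<open>j\<close>.

  The case \<open>n = 1\<close> is symmetric, and if \<open>h\<close> or \<open>k\<close> is trivial then so is the factor that contains it.
\<close>

section \<open>Quotients of prime power order\<close>

text \<open>Demanding finitely many cosets of \<open>p\<close>-power exponent instead of a quotient of order
  \<open>p\<^sup>s\<close> makes preimages and intersections easy to handle; \<open>p_finite_order\<close> compares the two.\<close>

definition p_open :: "nat \<Rightarrow> ('a, 'c) monoid_scheme \<Rightarrow> 'a set \<Rightarrow> bool"
  where "p_open p G N \<longleftrightarrow> N \<lhd> G \<and> finite (rcosets\<^bsub>G\<^esub> N) \<and>
    (\<exists>s. \<forall>g\<in>carrier G. g [^]\<^bsub>G\<^esub> (p ^ s) \<in> N)"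

definition p_finite :: "nat \<Rightarrow> ('a, 'c) monoid_scheme \<Rightarrow> bool"
  where "p_finite p S \<longleftrightarrow> group S \<and> finite (carrier S) \<and>
    (\<exists>s. \<forall>g\<in>carrier S. g [^]\<^bsub>S\<^esub> (p ^ s) = \<one>\<^bsub>S\<^esub>)"

text \<open>Membership of \<open>g\<close> in the closure of \<open>\<langle>c\<rangle>\<close> for the topology given by the open normal subgroups.\<close>

definition in_cyclic_closure :: "nat \<Rightarrow> ('a, 'c) monoid_scheme \<Rightarrow> 'a \<Rightarrow> 'a \<Rightarrow> bool"
  where "in_cyclic_closure p G c g \<longleftrightarrow>
    (\<forall>N. p_open p G N \<longrightarrow> (\<exists>i::int. g \<otimes>\<^bsub>G\<^esub> inv\<^bsub>G\<^esub> (c [^]\<^bsub>G\<^esub> i) \<in> N))"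

definition residually_p :: "nat \<Rightarrow> ('a, 'c) monoid_scheme \<Rightarrow> bool"
  where "residually_p p G \<longleftrightarrow>
    (\<forall>g\<in>carrier G. g \<noteq> \<one>\<^bsub>G\<^esub> \<longrightarrow> (\<exists>N. p_open p G N \<and> g \<notin> N))"

definition tame_closure_at :: "nat \<Rightarrow> ('a, 'c) monoid_scheme \<Rightarrow> 'a \<Rightarrow> bool"
  where "tame_closure_at p G c \<longleftrightarrow>
    (\<forall>g\<in>carrier G. in_cyclic_closure p G c g \<longrightarrow>
      (\<exists>x y::int. \<not> int p dvd x \<and> g [^]\<^bsub>G\<^esub> x = c [^]\<^bsub>G\<^esub> y))"

lemma p_openD:
  assumes "p_open p G N"
  shows "N \<lhd> G" "subgroup N G" "finite (rcosets\<^bsub>G\<^esub> N)" "group G"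
  using assms unfolding p_open_def normal_def by auto

text \<open>Finitely many cosets are counted by any function with finitely many values that separates them.\<close>

lemma p_openI:
  fixes G (structure) and f :: "'a \<Rightarrow> 'b"
  assumes N: "N \<lhd> G" and fin: "finite (f ` carrier G)"
    and f: "\<And>g g'. g \<in> carrier G \<Longrightarrow> g' \<in> carrier G \<Longrightarrow> f g = f g' \<Longrightarrow> g \<otimes>\<^bsub>G\<^esub> inv\<^bsub>G\<^esub> g' \<in> N"
    and ex: "\<And>g. g \<in> carrier G \<Longrightarrow> g [^]\<^bsub>G\<^esub> (p ^ s) \<in> N"
  shows "p_open p G N"
proof -
  interpret normal N G by fact
  have "rcosets\<^bsub>G\<^esub> N \<subseteq> (\<lambda>y. N #> (SOME a. a \<in> carrier G \<and> f a = y)) ` (f ` carrier G)"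
  proof
    fix C assume "C \<in> rcosets\<^bsub>G\<^esub> N"
    then obtain a where a: "a \<in> carrier G" "C = N #> a" unfolding RCOSETS_def by auto
    define b where "b = (SOME b. b \<in> carrier G \<and> f b = f a)"
    have b: "b \<in> carrier G \<and> f b = f a" unfolding b_def by (rule someI[of _ a]) (use a in auto)
    have "a \<otimes> inv b \<in> N" using f a b by auto
    then have "a \<in> N #> b" using a b rcos_module_rev[OF is_group, of b a] by simp
    then have "N #> a = N #> b" using repr_independence b subgroup_axioms by auto
    then show "C \<in> (\<lambda>y. N #> (SOME a. a \<in> carrier G \<and> f a = y)) ` (f ` carrier G)"
      using a unfolding b_def by auto
  qed
  then have "finite (rcosets\<^bsub>G\<^esub> N)" using fin finite_surj by blast
  then show ?thesis unfolding p_open_def using N ex by auto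
qed

lemma p_open_coset_cong:
  assumes "N \<lhd> G" "g \<in> carrier G" "g' \<in> carrier G"
  shows "N #>\<^bsub>G\<^esub> g = N #>\<^bsub>G\<^esub> g' \<longleftrightarrow> g \<otimes>\<^bsub>G\<^esub> inv\<^bsub>G\<^esub> g' \<in> N"
proof -
  interpret normal N G by fact
  show ?thesis
  proof
    assume "N #>\<^bsub>G\<^esub> g = N #>\<^bsub>G\<^esub> g'"
    then have "g \<in> N #>\<^bsub>G\<^esub> g'" using rcos_self[OF assms(2) subgroup_axioms] by simp
    then show "g \<otimes>\<^bsub>G\<^esub> inv\<^bsub>G\<^esub> g' \<in> N" using rcos_module_imp[OF is_group assms(3)] assms(2) by simp
  next
    assume "g \<otimes>\<^bsub>G\<^esub> inv\<^bsub>G\<^esub> g' \<in> N"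
    then have "g \<in> N #>\<^bsub>G\<^esub> g'" using rcos_module_rev[OF is_group assms(3,2)] by simp
    then show "N #>\<^bsub>G\<^esub> g = N #>\<^bsub>G\<^esub> g'"
      using repr_independence[OF _ assms(3) subgroup_axioms] by simp
  qed
qed

lemma p_open_vimage:
  assumes hom: "\<theta> \<in> hom G Y" and G: "group G" and N: "p_open p Y N"
  shows "p_open p G {g \<in> carrier G. \<theta> g \<in> N}"
proof -
  interpret Y: normal N Y using p_openD[OF N] by simp
  interpret h: group_hom G Y \<theta> using hom G Y.is_group by (simp add: group_hom_def group_hom_axioms_def)
  obtain s where s: "\<And>g. g \<in> carrier Y \<Longrightarrow> g [^]\<^bsub>Y\<^esub> (p ^ s) \<in> N" using N unfolding p_open_def by auto
  have nrm: "{g \<in> carrier G. \<theta> g \<in> N} \<lhd> G"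
  proof (rule h.G.normal_invI)
    show "subgroup {g \<in> carrier G. \<theta> g \<in> N} G"
      by (rule h.G.subgroupI) (auto simp: h.one_closed intro: exI[of _ "\<one>\<^bsub>G\<^esub>"])
  next
    fix x y assume "x \<in> {g \<in> carrier G. \<theta> g \<in> N}" "y \<in> carrier G"
    then show "y \<otimes>\<^bsub>G\<^esub> x \<otimes>\<^bsub>G\<^esub> inv\<^bsub>G\<^esub> y \<in> {g \<in> carrier G. \<theta> g \<in> N}"
      using Y.inv_op_closed2[of "\<theta> y" "\<theta> x"] by auto
  qed
  show ?thesis
  proof (rule p_openI[OF nrm, where f = "\<lambda>g. N #>\<^bsub>Y\<^esub> \<theta> g" and s = s])
    show "finite ((\<lambda>g. N #>\<^bsub>Y\<^esub> \<theta> g) ` carrier G)"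
      by (rule finite_subset[OF _ p_openD(3)[OF N]]) (auto simp: RCOSETS_def dest: h.hom_closed)
  next
    fix g g' assume "g \<in> carrier G" "g' \<in> carrier G" "N #>\<^bsub>Y\<^esub> \<theta> g = N #>\<^bsub>Y\<^esub> \<theta> g'"
    then show "g \<otimes>\<^bsub>G\<^esub> inv\<^bsub>G\<^esub> g' \<in> {g \<in> carrier G. \<theta> g \<in> N}"
      using p_open_coset_cong[OF Y.normal_axioms, of "\<theta> g" "\<theta> g'"] by auto
  next
    fix g assume "g \<in> carrier G"
    then show "g [^]\<^bsub>G\<^esub> (p ^ s) \<in> {g \<in> carrier G. \<theta> g \<in> N}" using s[of "\<theta> g"] by (auto simp: h.hom_nat_pow)
  qed
qed

lemma p_open_Int:
  assumes M: "p_open p G M" and N: "p_open p G N"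
  shows "p_open p G (M \<inter> N)"
proof -
  interpret M: normal M G using p_openD[OF M] by simp
  interpret N: normal N G using p_openD[OF N] by simp
  obtain s where s: "\<And>g. g \<in> carrier G \<Longrightarrow> g [^]\<^bsub>G\<^esub> (p ^ s) \<in> M" using M unfolding p_open_def by auto
  obtain t where t: "\<And>g. g \<in> carrier G \<Longrightarrow> g [^]\<^bsub>G\<^esub> (p ^ t) \<in> N" using N unfolding p_open_def by auto
  have nrm: "M \<inter> N \<lhd> G"
  proof (rule M.normal_invI)
    show "subgroup (M \<inter> N) G" using M.subgroup_axioms N.subgroup_axioms M.subgroups_Inter_pair by blast
    show "\<And>x h. x \<in> M \<inter> N \<Longrightarrow> h \<in> carrier G \<Longrightarrow> h \<otimes>\<^bsub>G\<^esub> x \<otimes>\<^bsub>G\<^esub> inv\<^bsub>G\<^esub> h \<in> M \<inter> N"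
      using M.inv_op_closed2 N.inv_op_closed2 by auto
  qed
  show ?thesis
  proof (rule p_openI[OF nrm, where f = "\<lambda>g. (M #>\<^bsub>G\<^esub> g, N #>\<^bsub>G\<^esub> g)" and s = "s + t"])
    show "finite ((\<lambda>g. (M #>\<^bsub>G\<^esub> g, N #>\<^bsub>G\<^esub> g)) ` carrier G)"
      by (rule finite_subset[OF _ finite_cartesian_product[OF p_openD(3)[OF M] p_openD(3)[OF N]]])
        (auto simp: RCOSETS_def)
  next
    fix g g' assume "g \<in> carrier G" "g' \<in> carrier G"
      "(M #>\<^bsub>G\<^esub> g, N #>\<^bsub>G\<^esub> g) = (M #>\<^bsub>G\<^esub> g', N #>\<^bsub>G\<^esub> g')"
    then show "g \<otimes>\<^bsub>G\<^esub> inv\<^bsub>G\<^esub> g' \<in> M \<inter> N"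
      using p_open_coset_cong[OF M.normal_axioms, of g g'] p_open_coset_cong[OF N.normal_axioms, of g g'] by auto
  next
    fix g assume g: "g \<in> carrier G"
    have "g [^]\<^bsub>G\<^esub> (p ^ (s + t)) = (g [^]\<^bsub>G\<^esub> (p ^ t)) [^]\<^bsub>G\<^esub> (p ^ s)"
      using g by (simp add: M.nat_pow_pow power_add mult.commute)
    moreover have "g [^]\<^bsub>G\<^esub> (p ^ (s + t)) = (g [^]\<^bsub>G\<^esub> (p ^ s)) [^]\<^bsub>G\<^esub> (p ^ t)"
      using g by (simp add: M.nat_pow_pow power_add)
    ultimately show "g [^]\<^bsub>G\<^esub> (p ^ (s + t)) \<in> M \<inter> N" using s t g by (metis IntI M.nat_pow_closed)
  qed
qed

lemma p_open_carrier: "group G \<Longrightarrow> p_open p G (carrier G)"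
  by (rule p_openI[where f = "\<lambda>_. ()" and s = 0]) (auto simp: group.normal_inv_iff group.subgroup_self monoid.m_closed group.is_monoid group.inv_closed)

lemma p_open_one: "p_finite p S \<Longrightarrow> p_open p S {\<one>\<^bsub>S\<^esub>}"
proof -
  assume S: "p_finite p S"
  then interpret group S by (simp add: p_finite_def)
  obtain s where "\<And>g. g \<in> carrier S \<Longrightarrow> g [^]\<^bsub>S\<^esub> (p ^ s) = \<one>\<^bsub>S\<^esub>" using S unfolding p_finite_def by auto
  then show ?thesis
    by (intro p_openI[where f = id and s = s]) (use S in \<open>auto simp: one_is_normal p_finite_def\<close>)
qed

lemma p_open_kernel:
  assumes "\<theta> \<in> hom G Y" "group G" "p_finite p Y"
  shows "p_open p G {g \<in> carrier G. \<theta> g = \<one>\<^bsub>Y\<^esub>}"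
  using p_open_vimage[OF assms(1,2) p_open_one[OF assms(3)]] by simp

lemma p_finite_Mod:
  fixes G (structure)
  assumes N: "p_open p G N"
  shows "p_finite p (G Mod N)"
proof -
  interpret normal N G using p_openD[OF N] by simp
  obtain s where s: "\<And>g. g \<in> carrier G \<Longrightarrow> g [^] (p ^ s) \<in> N" using N unfolding p_open_def by auto
  have "C [^]\<^bsub>G Mod N\<^esub> (p ^ s) = \<one>\<^bsub>G Mod N\<^esub>" if C: "C \<in> carrier (G Mod N)" for C
  proof -
    obtain a where a: "a \<in> carrier G" "C = N #> a" using C unfolding carrier_FactGroup by auto
    have "C [^]\<^bsub>G Mod N\<^esub> (p ^ s) = N #> (a [^] (p ^ s))" using FactGroup_pow[OF a(1)] a(2) by simp
    also have "\<dots> = N" using s[OF a(1)] a(1) by (intro coset_join2) (auto simp: subgroup_axioms)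
    finally show ?thesis by (simp add: FactGroup_def)
  qed
  then show ?thesis unfolding p_finite_def using factorgroup_is_group p_openD(3)[OF N]
    by (auto simp: FactGroup_def)
qed

lemma Mod_hom:
  fixes G (structure)
  assumes "N \<lhd> G"
  shows "(\<lambda>g. N #>\<^bsub>G\<^esub> g) \<in> hom G (G Mod N)" "(\<lambda>g. N #>\<^bsub>G\<^esub> g) ` carrier G = carrier (G Mod N)"
    "\<And>g. g \<in> carrier G \<Longrightarrow> N #>\<^bsub>G\<^esub> g = \<one>\<^bsub>G Mod N\<^esub> \<longleftrightarrow> g \<in> N"
proof -
  interpret normal N G by fact
  show "(\<lambda>g. N #> g) \<in> hom G (G Mod N)" by (rule r_coset_hom_Mod)
  show "(\<lambda>g. N #> g) ` carrier G = carrier (G Mod N)" by (simp add: carrier_FactGroup)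
  show "\<And>g. g \<in> carrier G \<Longrightarrow> N #> g = \<one>\<^bsub>G Mod N\<^esub> \<longleftrightarrow> g \<in> N"
    using coset_join1[OF _ _ subgroup_axioms] coset_join2[OF _ subgroup_axioms] by (metis one_FactGroup)
qed

lemma p_open_pow:
  fixes G (structure)
  assumes N: "p_open p G N"
  obtains s where "\<And>g i. g \<in> carrier G \<Longrightarrow> g [^]\<^bsub>G\<^esub> (int p ^ s * i :: int) \<in> N"
proof -
  interpret normal N G using p_openD[OF N] by simp
  obtain s where s: "\<And>g. g \<in> carrier G \<Longrightarrow> g [^] (p ^ s) \<in> N" using N unfolding p_open_def by auto
  show ?thesis
  proof (rule that[of s])
    fix g and i :: int assume g: "g \<in> carrier G"
    have "g [^] (int p ^ s * i) = (g [^] (int (p ^ s))) [^] i" using g by (simp add: int_pow_pow)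
    also have "\<dots> \<in> N" using subgroup_int_pow_closed[OF subgroup_axioms s[OF g]] by (simp only: int_pow_int)
    finally show "g [^] (int p ^ s * i) \<in> N" .
  qed
qed

section \<open>Wreath products\<close>

lemma ext_funcset_mem: "f \<in> A \<rightarrow>\<^sub>E B \<Longrightarrow> v \<in> A \<Longrightarrow> f v \<in> B"
  by (rule PiE_mem)

text \<open>The top group \<open>S\<close> acts on the functions \<open>S \<Rightarrow> P\<close> by translation of the argument. Functions are extensional,
  so that equality in the carrier is equality of values.\<close>

definition wreath :: "('a, 'c) monoid_scheme \<Rightarrow> ('b, 'd) monoid_scheme \<Rightarrow> (('b \<Rightarrow> 'a) \<times> 'b) monoid"
  where "wreath P S =
    \<lparr>carrier = (carrier S \<rightarrow>\<^sub>E carrier P) \<times> carrier S,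
     monoid.mult = (\<lambda>(f, s) (f', s'). (\<lambda>v\<in>carrier S. f v \<otimes>\<^bsub>P\<^esub> f' (v \<otimes>\<^bsub>S\<^esub> s), s \<otimes>\<^bsub>S\<^esub> s')),
     monoid.one = (\<lambda>v\<in>carrier S. \<one>\<^bsub>P\<^esub>, \<one>\<^bsub>S\<^esub>)\<rparr>"

lemma wreath_one: "\<one>\<^bsub>wreath P S\<^esub> = (\<lambda>v\<in>carrier S. \<one>\<^bsub>P\<^esub>, \<one>\<^bsub>S\<^esub>)"
  by (simp add: wreath_def)

lemma wreath_carrier: "w \<in> carrier (wreath P S) \<longleftrightarrow> fst w \<in> carrier S \<rightarrow>\<^sub>E carrier P \<and> snd w \<in> carrier S"
  by (cases w) (auto simp: wreath_def)

lemma wreath_snd_mult: "snd (w \<otimes>\<^bsub>wreath P S\<^esub> w') = snd w \<otimes>\<^bsub>S\<^esub> snd w'"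
  by (cases w, cases w') (simp add: wreath_def)

lemma wreath_fst_mult:
  "v \<in> carrier S \<Longrightarrow> fst (w \<otimes>\<^bsub>wreath P S\<^esub> w') v = fst w v \<otimes>\<^bsub>P\<^esub> fst w' (v \<otimes>\<^bsub>S\<^esub> snd w)"
  by (cases w, cases w') (simp add: wreath_def)

lemma wreath_fst_closed: "w \<in> carrier (wreath P S) \<Longrightarrow> v \<in> carrier S \<Longrightarrow> fst w v \<in> carrier P"
  by (cases w) (auto simp: wreath_def)

lemma wreath_snd_closed: "w \<in> carrier (wreath P S) \<Longrightarrow> snd w \<in> carrier S"
  by (cases w) (auto simp: wreath_def)

lemma wreath_eqI:
  assumes "w \<in> carrier (wreath P S)" "w' \<in> carrier (wreath P S)" "snd w = snd w'"
    "\<And>v. v \<in> carrier S \<Longrightarrow> fst w v = fst w' v"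
  shows "w = w'"
proof -
  have "fst w = fst w'" using assms by (intro PiE_ext[of "fst w" "carrier S" "\<lambda>_. carrier P"]) (auto simp: wreath_carrier)
  then show ?thesis using assms(3) by (simp add: prod_eq_iff)
qed

lemma wreath_group:
  assumes "group P" "group S"
  shows "group (wreath P S)"
proof -
  interpret P: group P by fact
  interpret S: group S by fact
  show ?thesis
  proof (rule groupI)
    show "\<one>\<^bsub>wreath P S\<^esub> \<in> carrier (wreath P S)" by (simp add: wreath_def)
  next
    fix x y assume "x \<in> carrier (wreath P S)" "y \<in> carrier (wreath P S)"
    then show "x \<otimes>\<^bsub>wreath P S\<^esub> y \<in> carrier (wreath P S)" by (cases x, cases y) (auto simp: wreath_def)
  next
    fix x y z assume *: "x \<in> carrier (wreath P S)" "y \<in> carrier (wreath P S)" "z \<in> carrier (wreath P S)"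
    then show "x \<otimes>\<^bsub>wreath P S\<^esub> y \<otimes>\<^bsub>wreath P S\<^esub> z = x \<otimes>\<^bsub>wreath P S\<^esub> (y \<otimes>\<^bsub>wreath P S\<^esub> z)"
      by (cases x, cases y, cases z) (auto simp: wreath_def P.m_assoc S.m_assoc ext_funcset_mem intro!: restrict_ext)
  next
    fix x assume "x \<in> carrier (wreath P S)"
    then show "\<one>\<^bsub>wreath P S\<^esub> \<otimes>\<^bsub>wreath P S\<^esub> x = x"
      by (cases x) (auto simp: wreath_def ext_funcset_mem PiE_iff intro!: extensionalityI[of _ "carrier S"])
  next
    fix x assume x: "x \<in> carrier (wreath P S)"
    obtain f s where fs: "x = (f, s)" "f \<in> carrier S \<rightarrow>\<^sub>E carrier P" "s \<in> carrier S" using x by (cases x) (auto simp: wreath_def)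
    define y where "y = (\<lambda>v\<in>carrier S. inv\<^bsub>P\<^esub> f (v \<otimes>\<^bsub>S\<^esub> inv\<^bsub>S\<^esub> s), inv\<^bsub>S\<^esub> s)"
    have "y \<in> carrier (wreath P S)" using fs by (auto simp: wreath_def y_def)
    moreover have "y \<otimes>\<^bsub>wreath P S\<^esub> x = \<one>\<^bsub>wreath P S\<^esub>"
      using fs by (auto simp: wreath_def y_def ext_funcset_mem intro!: restrict_ext)
    ultimately show "\<exists>y\<in>carrier (wreath P S). y \<otimes>\<^bsub>wreath P S\<^esub> x = \<one>\<^bsub>wreath P S\<^esub>" by blast
  qed
qed

lemma wreath_base_pow:
  assumes "group P" "group S" "w \<in> carrier (wreath P S)" "snd w = \<one>\<^bsub>S\<^esub>" "v \<in> carrier S"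
  shows "snd (w [^]\<^bsub>wreath P S\<^esub> (n::nat)) = \<one>\<^bsub>S\<^esub>" "fst (w [^]\<^bsub>wreath P S\<^esub> n) v = fst w v [^]\<^bsub>P\<^esub> n"
proof -
  interpret P: group P by fact
  interpret S: group S by fact
  interpret W: group "wreath P S" by (rule wreath_group) fact+
  have "snd (w [^]\<^bsub>wreath P S\<^esub> n) = \<one>\<^bsub>S\<^esub> \<and> fst (w [^]\<^bsub>wreath P S\<^esub> n) v = fst w v [^]\<^bsub>P\<^esub> n"
  proof (induction n)
    case 0 then show ?case using assms by (simp add: wreath_one)
  next
    case (Suc n) then show ?case using assms by (simp add: wreath_snd_mult wreath_fst_mult)
  qed
  then show "snd (w [^]\<^bsub>wreath P S\<^esub> (n::nat)) = \<one>\<^bsub>S\<^esub>" "fst (w [^]\<^bsub>wreath P S\<^esub> n) v = fst w v [^]\<^bsub>P\<^esub> n" by auto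
qed

lemma wreath_snd_hom: "group P \<Longrightarrow> group S \<Longrightarrow> snd \<in> hom (wreath P S) S"
  by (auto simp: hom_def wreath_snd_mult wreath_snd_closed)

lemma wreath_snd_pow:
  assumes "group P" "group S" "w \<in> carrier (wreath P S)"
  shows "snd (w [^]\<^bsub>wreath P S\<^esub> (n::nat)) = snd w [^]\<^bsub>S\<^esub> n" "snd (w [^]\<^bsub>wreath P S\<^esub> (i::int)) = snd w [^]\<^bsub>S\<^esub> i"
proof -
  interpret h: group_hom "wreath P S" S snd
    using wreath_group[OF assms(1,2)] wreath_snd_hom[OF assms(1,2)] assms(2)
    by (simp add: group_hom_def group_hom_axioms_def)
  show "snd (w [^]\<^bsub>wreath P S\<^esub> (n::nat)) = snd w [^]\<^bsub>S\<^esub> n" "snd (w [^]\<^bsub>wreath P S\<^esub> (i::int)) = snd w [^]\<^bsub>S\<^esub> i"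
    using assms(3) by (simp_all add: h.hom_nat_pow h.hom_int_pow)
qed

lemma wreath_fst_inv:
  assumes "group P" "group S" "w \<in> carrier (wreath P S)" "v \<in> carrier S"
  shows "fst (inv\<^bsub>wreath P S\<^esub> w) v = inv\<^bsub>P\<^esub> (fst w (v \<otimes>\<^bsub>S\<^esub> inv\<^bsub>S\<^esub> snd w))"
    "snd (inv\<^bsub>wreath P S\<^esub> w) = inv\<^bsub>S\<^esub> snd w"
proof -
  interpret P: group P by fact
  interpret S: group S by fact
  interpret W: group "wreath P S" by (rule wreath_group) fact+
  define y where "y = (\<lambda>v\<in>carrier S. inv\<^bsub>P\<^esub> fst w (v \<otimes>\<^bsub>S\<^esub> inv\<^bsub>S\<^esub> snd w), inv\<^bsub>S\<^esub> snd w)"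
  have y: "y \<in> carrier (wreath P S)" using assms(3) by (auto simp: wreath_carrier y_def PiE_mem)
  have "y \<otimes>\<^bsub>wreath P S\<^esub> w = \<one>\<^bsub>wreath P S\<^esub>"
    by (rule wreath_eqI[OF W.m_closed[OF y assms(3)] W.one_closed])
      (use assms(3) in \<open>auto simp: wreath_fst_mult wreath_snd_mult wreath_one y_def wreath_carrier ext_funcset_mem\<close>)
  then have "inv\<^bsub>wreath P S\<^esub> w = y" using W.inv_equality y assms(3) by blast
  then show "fst (inv\<^bsub>wreath P S\<^esub> w) v = inv\<^bsub>P\<^esub> (fst w (v \<otimes>\<^bsub>S\<^esub> inv\<^bsub>S\<^esub> snd w))"
    "snd (inv\<^bsub>wreath P S\<^esub> w) = inv\<^bsub>S\<^esub> snd w" using assms(4) by (auto simp: y_def)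
qed

lemma wreath_snd_inv:
  "group P \<Longrightarrow> group S \<Longrightarrow> w \<in> carrier (wreath P S) \<Longrightarrow> snd (inv\<^bsub>wreath P S\<^esub> w) = inv\<^bsub>S\<^esub> snd w"
  using wreath_fst_inv(2)[of P S w "\<one>\<^bsub>S\<^esub>"] by (simp add: group.is_monoid monoid.one_closed)

text \<open>The functions with values in \<open>N\<close>, as elements with trivial top component.\<close>

definition wreath_base :: "'a set \<Rightarrow> ('b, 'd) monoid_scheme \<Rightarrow> (('b \<Rightarrow> 'a) \<times> 'b) set"
  where "wreath_base N S = (carrier S \<rightarrow>\<^sub>E N) \<times> {\<one>\<^bsub>S\<^esub>}"

lemma wreath_base_iff:
  "w \<in> carrier (wreath P S) \<Longrightarrow> w \<in> wreath_base N S \<longleftrightarrow> snd w = \<one>\<^bsub>S\<^esub> \<and> (\<forall>v\<in>carrier S. fst w v \<in> N)"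
  by (cases w) (auto simp: wreath_base_def wreath_def PiE_iff)

lemma wreath_base_open:
  assumes N: "p_open p P N" and S: "p_finite p S"
  shows "p_open p (wreath P S) (wreath_base N S)"
proof -
  interpret N: normal N P using p_openD[OF N] by simp
  have gS: "group S" and fS: "finite (carrier S)" using S by (auto simp: p_finite_def)
  interpret S: group S by fact
  interpret W: group "wreath P S" by (rule wreath_group[OF N.is_group gS])
  obtain s where s: "\<And>g. g \<in> carrier P \<Longrightarrow> g [^]\<^bsub>P\<^esub> (p ^ s) \<in> N" using N unfolding p_open_def by auto
  obtain t where t: "\<And>g. g \<in> carrier S \<Longrightarrow> g [^]\<^bsub>S\<^esub> (p ^ t) = \<one>\<^bsub>S\<^esub>" using S unfolding p_finite_def by auto
  have sub: "wreath_base N S \<subseteq> carrier (wreath P S)"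
    using N.subset by (auto simp: wreath_base_def wreath_def PiE_iff)
  have nrm: "wreath_base N S \<lhd> wreath P S"
  proof (rule W.normal_invI)
    show "subgroup (wreath_base N S) (wreath P S)"
    proof (rule W.subgroupI[OF sub])
      have "\<one>\<^bsub>wreath P S\<^esub> \<in> wreath_base N S" by (auto simp: wreath_base_def wreath_one)
      then show "wreath_base N S \<noteq> {}" by auto
    next
      fix a assume a: "a \<in> wreath_base N S"
      then have ac: "a \<in> carrier (wreath P S)" using sub by auto
      have "snd a = \<one>\<^bsub>S\<^esub>" "\<And>v. v \<in> carrier S \<Longrightarrow> fst a v \<in> N" using a wreath_base_iff[OF ac, of N] by auto
      then show "inv\<^bsub>wreath P S\<^esub> a \<in> wreath_base N S"
        by (subst wreath_base_iff[OF W.inv_closed[OF ac]])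
          (auto simp: wreath_fst_inv[OF N.is_group gS ac] wreath_fst_inv(2)[OF N.is_group gS ac S.one_closed])
    next
      fix a b assume "a \<in> wreath_base N S" "b \<in> wreath_base N S"
      then show "a \<otimes>\<^bsub>wreath P S\<^esub> b \<in> wreath_base N S"
        using wreath_base_iff[OF W.m_closed[OF subsetD[OF sub] subsetD[OF sub]], of a b N]
          wreath_base_iff[OF subsetD[OF sub], of a N] wreath_base_iff[OF subsetD[OF sub], of b N]
        by (auto simp: wreath_fst_mult wreath_snd_mult)
    qed
  next
    fix x h assume x: "x \<in> carrier (wreath P S)" and h: "h \<in> wreath_base N S"
    have hc: "h \<in> carrier (wreath P S)" using h sub by auto
    have xc: "fst x v \<in> carrier P" "snd x \<in> carrier S" if "v \<in> carrier S" for v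
      using x that by (auto simp: wreath_carrier)
    have h': "snd h = \<one>\<^bsub>S\<^esub>" "\<And>v. v \<in> carrier S \<Longrightarrow> fst h v \<in> N" using h wreath_base_iff[OF hc] by auto
    show "x \<otimes>\<^bsub>wreath P S\<^esub> h \<otimes>\<^bsub>wreath P S\<^esub> inv\<^bsub>wreath P S\<^esub> x \<in> wreath_base N S"
      using x hc h' xc
      by (subst wreath_base_iff)
        (auto simp: wreath_fst_mult wreath_snd_mult wreath_fst_inv(1)[OF N.is_group gS] wreath_snd_inv[OF N.is_group gS] S.m_assoc wreath_snd_closed
          intro!: N.inv_op_closed2)
  qed
  show ?thesis
  proof (rule p_openI[OF nrm, where f = "\<lambda>w. (\<lambda>v\<in>carrier S. N #>\<^bsub>P\<^esub> fst w v, snd w)" and s = "t + s"])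
    have "(\<lambda>w. (\<lambda>v\<in>carrier S. N #>\<^bsub>P\<^esub> fst w v, snd w)) ` carrier (wreath P S)
      \<subseteq> (carrier S \<rightarrow>\<^sub>E rcosets\<^bsub>P\<^esub> N) \<times> carrier S"
      by (auto simp: wreath_def RCOSETS_def)
    then show "finite ((\<lambda>w. (\<lambda>v\<in>carrier S. N #>\<^bsub>P\<^esub> fst w v, snd w)) ` carrier (wreath P S))"
      by (rule finite_subset) (intro finite_cartesian_product finite_PiE fS p_openD(3)[OF N])
  next
    fix g g' assume g: "g \<in> carrier (wreath P S)" "g' \<in> carrier (wreath P S)"
      and eq: "(\<lambda>v\<in>carrier S. N #>\<^bsub>P\<^esub> fst g v, snd g) = (\<lambda>v\<in>carrier S. N #>\<^bsub>P\<^esub> fst g' v, snd g')"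
    have gc: "fst g v \<in> carrier P" "fst g' v \<in> carrier P" "snd g' \<in> carrier S" if "v \<in> carrier S" for v
      using g that by (auto simp: wreath_carrier)
    have "fst g v \<otimes>\<^bsub>P\<^esub> inv\<^bsub>P\<^esub> fst g' v \<in> N" if v: "v \<in> carrier S" for v
    proof -
      have "N #>\<^bsub>P\<^esub> fst g v = N #>\<^bsub>P\<^esub> fst g' v" using fun_cong[OF conjunct1[OF eq[unfolded prod.inject]], of v] v by simp
      then show ?thesis using p_open_coset_cong[OF N.normal_axioms gc(1)[OF v] gc(2)[OF v]] by simp
    qed
    then show "g \<otimes>\<^bsub>wreath P S\<^esub> inv\<^bsub>wreath P S\<^esub> g' \<in> wreath_base N S"
      using g eq gc by (subst wreath_base_iff)
        (auto simp: wreath_fst_mult wreath_snd_mult wreath_fst_inv(1)[OF N.is_group gS] wreath_snd_inv[OF N.is_group gS] S.m_assoc wreath_snd_closed)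
  next
    fix g assume g: "g \<in> carrier (wreath P S)"
    define k where "k = g [^]\<^bsub>wreath P S\<^esub> (p ^ t)"
    have k: "k \<in> carrier (wreath P S)" "snd k = \<one>\<^bsub>S\<^esub>"
      using g t[OF wreath_snd_closed[OF g]] by (auto simp: k_def wreath_snd_pow[OF N.is_group gS])
    have "g [^]\<^bsub>wreath P S\<^esub> (p ^ (t + s)) = k [^]\<^bsub>wreath P S\<^esub> (p ^ s)"
      using g by (simp add: k_def W.nat_pow_pow power_add)
    also have "\<dots> \<in> wreath_base N S"
      using k s wreath_base_pow[OF N.is_group gS k] wreath_fst_closed[OF k(1)]
      by (subst wreath_base_iff) auto
    finally show "g [^]\<^bsub>wreath P S\<^esub> (p ^ (t + s)) \<in> wreath_base N S" .
  qed
qed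

lemma wreath_p_finite:
  assumes "p_finite p P" "p_finite p S"
  shows "p_finite p (wreath P S)"
proof -
  have g: "group P" "group S" "finite (carrier P)" "finite (carrier S)" using assms by (auto simp: p_finite_def)
  interpret W: group "wreath P S" by (rule wreath_group) fact+
  have "p_open p (wreath P S) (wreath_base {\<one>\<^bsub>P\<^esub>} S)" by (intro wreath_base_open p_open_one assms)
  then obtain s where s: "\<And>g. g \<in> carrier (wreath P S) \<Longrightarrow> g [^]\<^bsub>wreath P S\<^esub> (p ^ s) \<in> wreath_base {\<one>\<^bsub>P\<^esub>} S"
    unfolding p_open_def by auto
  have "wreath_base {\<one>\<^bsub>P\<^esub>} S = {\<one>\<^bsub>wreath P S\<^esub>}"
    by (auto simp: wreath_base_def wreath_one PiE_iff extensional_def)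
  moreover have "finite (carrier (wreath P S))"
    using g by (auto simp: wreath_def intro!: finite_cartesian_product finite_PiE)
  ultimately show ?thesis using s W.is_group unfolding p_finite_def by (metis singletonD)
qed

lemma countable_ext_funcset:
  assumes "finite I" "countable B"
  shows "countable (I \<rightarrow>\<^sub>E B)"
proof -
  obtain xs where xs: "set xs = I" using finite_list[OF assms(1)] by auto
  have "inj_on (\<lambda>f. map f xs) (I \<rightarrow>\<^sub>E B)"
  proof (rule inj_onI)
    fix f g assume fg: "f \<in> I \<rightarrow>\<^sub>E B" "g \<in> I \<rightarrow>\<^sub>E B" "map f xs = map g xs"
    show "f = g" by (rule PiE_ext[OF fg(1,2)]) (use fg(3) xs in auto)
  qed
  moreover have "(\<lambda>f. map f xs) ` (I \<rightarrow>\<^sub>E B) \<subseteq> lists B" using xs by auto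
  ultimately show ?thesis using countable_lists[OF assms(2)] by (meson countable_image_inj_on countable_subset)
qed

lemma wreath_countable:
  "countable (carrier P) \<Longrightarrow> finite (carrier S) \<Longrightarrow> countable (carrier (wreath P S))"
  by (auto simp: wreath_def countable_finite intro!: countable_SIGMA countable_ext_funcset)

section \<open>Rational numbers with denominators prime to \<open>p\<close>\<close>

definition p_integral :: "nat \<Rightarrow> rat \<Rightarrow> bool"
  where "p_integral p q \<longleftrightarrow> (\<exists>a b::int. \<not> int p dvd b \<and> q = of_int a / of_int b)"

definition p_mult :: "nat \<Rightarrow> nat \<Rightarrow> rat \<Rightarrow> bool"
  where "p_mult p k q \<longleftrightarrow> (\<exists>z. p_integral p z \<and> q = of_nat p ^ k * z)"

text \<open>The matrix estimates below are needed modulo the ideals \<open>p\<^sup>k\<close> and modulo \<open>0\<close>, where they are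
  equations. Carrying an arbitrary ideal along gives both at once.\<close>

definition p_ideal :: "nat \<Rightarrow> rat set \<Rightarrow> bool"
  where "p_ideal p I \<longleftrightarrow> 0 \<in> I \<and> (\<forall>x\<in>I. \<forall>y\<in>I. x + y \<in> I) \<and> (\<forall>x\<in>I. \<forall>z. p_integral p z \<longrightarrow> z * x \<in> I)"

context
  fixes p :: nat
  assumes prime: "Factorial_Ring.prime p"
begin

lemma prime_int_p: "Factorial_Ring.prime (int p)" using prime by simp

lemma p_integral_of_int [simp]: "p_integral p (of_int a)"
  unfolding p_integral_def using prime by (intro exI[of _ a] exI[of _ 1]) (auto simp: prime_nat_iff)

lemma p_integral_0 [simp]: "p_integral p 0" and p_integral_1 [simp]: "p_integral p 1"
  and p_integral_of_nat [simp]: "p_integral p (of_nat m)"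
  using p_integral_of_int[of 0] p_integral_of_int[of 1] p_integral_of_int[of "int m"] by simp_all

lemma p_integral_add: assumes "p_integral p x" "p_integral p y" shows "p_integral p (x + y)"
proof -
  obtain a b where 1: "\<not> int p dvd b" "x = of_int a / of_int b" using assms(1) by (auto simp: p_integral_def)
  obtain c d where 2: "\<not> int p dvd d" "y = of_int c / of_int d" using assms(2) by (auto simp: p_integral_def)
  have nz: "b \<noteq> 0" "d \<noteq> 0" using 1 2 by auto
  have "x + y = of_int (a * d + c * b) / of_int (b * d)" using 1 2 nz by (simp add: field_simps)
  moreover have "\<not> int p dvd b * d" using 1 2 prime_dvd_mult_iff[OF prime_int_p] by auto
  ultimately show ?thesis unfolding p_integral_def by blast
qed

lemma p_integral_mult: assumes "p_integral p x" "p_integral p y" shows "p_integral p (x * y)"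
proof -
  obtain a b where 1: "\<not> int p dvd b" "x = of_int a / of_int b" using assms(1) by (auto simp: p_integral_def)
  obtain c d where 2: "\<not> int p dvd d" "y = of_int c / of_int d" using assms(2) by (auto simp: p_integral_def)
  have "x * y = of_int (a * c) / of_int (b * d)" using 1 2 by simp
  moreover have "\<not> int p dvd b * d" using 1 2 prime_dvd_mult_iff[OF prime_int_p] by auto
  ultimately show ?thesis unfolding p_integral_def by blast
qed

lemma p_integral_uminus: "p_integral p x \<Longrightarrow> p_integral p (- x)"
  using p_integral_mult[OF p_integral_of_int[of "-1"]] by auto

lemma p_integral_diff: "p_integral p x \<Longrightarrow> p_integral p y \<Longrightarrow> p_integral p (x - y)"
  using p_integral_add[OF _ p_integral_uminus[of y]] by auto

lemma p_integral_sum: "(\<And>l. l \<in> A \<Longrightarrow> p_integral p (f l)) \<Longrightarrow> p_integral p (\<Sum>l\<in>A. f l)"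
  by (induction A rule: infinite_finite_induct) (auto intro: p_integral_add)

lemma p_integral_divide: assumes "p_integral p x" "\<not> int p dvd n" shows "p_integral p (x / of_int n)"
proof -
  have "p_integral p (1 / of_int n)" unfolding p_integral_def using assms(2) by (intro exI[of _ 1] exI[of _ n]) auto
  then show ?thesis using p_integral_mult[OF assms(1)] by fastforce
qed

lemma p_ideal_zero: "p_ideal p {0}" by (auto simp: p_ideal_def)

lemma p_ideal_mult: "p_ideal p (Collect (p_mult p k))"
  unfolding p_ideal_def
proof (intro conjI ballI allI impI)
  show "0 \<in> Collect (p_mult p k)" by (auto simp: p_mult_def intro!: exI[of _ 0])
next
  fix x y assume "x \<in> Collect (p_mult p k)" "y \<in> Collect (p_mult p k)"
  then obtain a b where "p_integral p a" "x = of_nat p ^ k * a" "p_integral p b" "y = of_nat p ^ k * b"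
    by (auto simp: p_mult_def)
  then show "x + y \<in> Collect (p_mult p k)"
    by (auto simp: p_mult_def distrib_left intro!: exI[of _ "a + b"] p_integral_add)
next
  fix x z assume "x \<in> Collect (p_mult p k)" "p_integral p z"
  then obtain a where "p_integral p a" "x = of_nat p ^ k * a" "p_integral p z" by (auto simp: p_mult_def)
  then show "z * x \<in> Collect (p_mult p k)"
    by (auto simp: p_mult_def intro!: exI[of _ "z * a"] p_integral_mult)
qed

lemma p_ideal_uminus: "p_ideal p I \<Longrightarrow> x \<in> I \<Longrightarrow> - x \<in> I"
  unfolding p_ideal_def using p_integral_of_int[of "-1"] by (metis mult_minus1 of_int_minus of_int_1)

lemma p_ideal_add: "p_ideal p I \<Longrightarrow> x \<in> I \<Longrightarrow> y \<in> I \<Longrightarrow> x + y \<in> I" unfolding p_ideal_def by auto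

lemma p_ideal_diff: "p_ideal p I \<Longrightarrow> x \<in> I \<Longrightarrow> y \<in> I \<Longrightarrow> x - y \<in> I"
  using p_ideal_add[of I x "-y"] p_ideal_uminus[of I y] by simp

lemma p_ideal_times: "p_ideal p I \<Longrightarrow> x \<in> I \<Longrightarrow> p_integral p z \<Longrightarrow> z * x \<in> I" "p_ideal p I \<Longrightarrow> x \<in> I \<Longrightarrow> p_integral p z \<Longrightarrow> x * z \<in> I"
  unfolding p_ideal_def by (auto simp: mult.commute)

lemma p_ideal_sum: "p_ideal p I \<Longrightarrow> (\<And>l. l \<in> A \<Longrightarrow> f l \<in> I) \<Longrightarrow> (\<Sum>l\<in>A. f l) \<in> I"
  by (induction A rule: infinite_finite_induct) (auto intro: p_ideal_add simp: p_ideal_def)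

lemma p_mult_of_int: "p_mult p k (of_int a) \<longleftrightarrow> int p ^ k dvd a"
proof
  assume "p_mult p k (of_int a)"
  then obtain c b :: int where cb: "\<not> int p dvd b" "of_int a = of_nat p ^ k * (of_int c / (of_int b :: rat))"
    unfolding p_mult_def p_integral_def by blast
  then have "b \<noteq> 0" by auto
  with cb have "(of_int (a * b) :: rat) = of_int (int p ^ k * c)" by (simp add: field_simps)
  then have "a * b = int p ^ k * c" using of_int_eq_iff by blast
  then have "int p ^ k dvd a * b" by simp
  moreover have "coprime (int p ^ k) b"
    using cb(1) prime_int_p by (simp add: prime_imp_coprime)
  ultimately show "int p ^ k dvd a" using coprime_dvd_mult_left_iff by blast
next
  assume "int p ^ k dvd a"
  then obtain c where "a = int p ^ k * c" by auto
  then show "p_mult p k (of_int a)" unfolding p_mult_def by (intro exI[of _ "of_int c"]) auto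
qed

lemma p_mult_nonzero: assumes "x \<noteq> 0" "p_integral p x" shows "\<exists>k0. \<forall>k\<ge>k0. \<not> p_mult p k x"
proof -
  obtain a b where 1: "\<not> int p dvd b" "x = of_int a / of_int b" using assms(2) by (auto simp: p_integral_def)
  then have "b \<noteq> 0" by auto
  have a0: "a \<noteq> 0" using 1 assms(1) by auto
  have "\<not> p_mult p k x" if k: "k \<ge> nat \<bar>a\<bar>" for k
  proof
    assume "p_mult p k x"
    then have "p_mult p k (of_int b * x)" using p_ideal_times(1)[OF p_ideal_mult] by simp
    then have "p_mult p k (of_int a)" using 1 \<open>b \<noteq> 0\<close> by simp
    then have "int p ^ k dvd a" by (simp add: p_mult_of_int)
    then have "int p ^ k \<le> \<bar>a\<bar>" using dvd_imp_le_int[OF a0, of "int p ^ k"] by simp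
    moreover have "k < p ^ k" using prime_ge_2_nat[OF prime] by (intro power_gt_expt) auto
    ultimately have "int k < \<bar>a\<bar>" by (metis of_nat_less_iff of_nat_power order_less_le_trans)
    then show False using k by linarith
  qed
  then show ?thesis by blast
qed

lemma p_integral_residue:
  assumes "p_integral p x"
  shows "\<exists>m. 0 \<le> m \<and> m < int p ^ k \<and> p_mult p k (x - of_int m)"
proof -
  obtain a b where 1: "\<not> int p dvd b" "x = of_int a / of_int b" using assms by (auto simp: p_integral_def)
  then have b0: "b \<noteq> 0" by auto
  have pos: "int p ^ k > 0" using prime prime_gt_0_nat by simp
  have "coprime b (int p ^ k)" using prime_imp_coprime[OF prime_int_p 1(1)] by (simp add: coprime_commute)
  then obtain b' where b': "int p ^ k dvd b * b' - 1"
    using bezout_int[of b "int p ^ k"] by (metis coprime_iff_gcd_eq_1 diff_add_cancel dvd_triv_left dvd_minus_iff minus_diff_eq add_diff_cancel_left' mult.commute)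
  define m where "m = (a * b') mod int p ^ k"
  have "int p ^ k dvd m - a * b'" by (simp add: m_def mod_eq_dvd_iff[symmetric])
  then obtain u where u: "m = a * b' + int p ^ k * u" by (metis dvdE add.commute diff_eq_eq)
  obtain v where v: "b * b' = 1 + int p ^ k * v" using b' by (metis dvdE add.commute diff_eq_eq)
  have "a - b * m = a - a * (b * b') - int p ^ k * u * b" by (simp add: u algebra_simps)
  also have "\<dots> = int p ^ k * (- a * v - u * b)" unfolding v by (simp add: algebra_simps)
  finally have "a - b * m = int p ^ k * (- a * v - u * b)" .
  then have "(of_int (a - b * m) :: rat) = of_int (int p ^ k * (- a * v - u * b))" by simp
  then have "(of_int a - of_int b * of_int m :: rat) = of_nat p ^ k * of_int (- a * v - u * b)" by simp
  then have "x - of_int m = of_nat p ^ k * (of_int (- a * v - u * b) / of_int b)"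
    using b0 unfolding 1 by (simp add: diff_divide_distrib[symmetric] field_split_simps del: of_int_diff of_int_mult)
  moreover have "p_integral p (of_int (- a * v - u * b) / of_int b)" using p_integral_divide[OF p_integral_of_int 1(1)] .
  ultimately have "p_mult p k (x - of_int m)" unfolding p_mult_def by blast
  then show ?thesis using pos by (intro exI[of _ m]) (auto simp: m_def)
qed

end

section \<open>Unitriangular groups\<close>

definition mprod :: "('a, 'b) monoid_scheme \<Rightarrow> 'a list \<Rightarrow> 'a"
  where "mprod G xs = foldr (\<otimes>\<^bsub>G\<^esub>) xs \<one>\<^bsub>G\<^esub>"

lemma mprod_simps [simp]: "mprod G [] = \<one>\<^bsub>G\<^esub>" "mprod G (x # xs) = x \<otimes>\<^bsub>G\<^esub> mprod G xs"
  by (simp_all add: mprod_def)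

lemma mprod_closed: "Group.monoid G \<Longrightarrow> set xs \<subseteq> carrier G \<Longrightarrow> mprod G xs \<in> carrier G"
  by (induction xs) (auto simp: monoid.m_closed)

lemma mprod_append:
  "Group.monoid G \<Longrightarrow> set xs \<subseteq> carrier G \<Longrightarrow> set ys \<subseteq> carrier G \<Longrightarrow>
    mprod G (xs @ ys) = mprod G xs \<otimes>\<^bsub>G\<^esub> mprod G ys"
  by (induction xs) (auto simp: monoid.m_assoc monoid.l_one mprod_closed)

text \<open>A unitriangular matrix \<open>1 + M\<close> is represented by its strictly upper triangular part \<open>M\<close>; the
  multiplication is \<open>(1 + M)(1 + N) - 1\<close>.\<close>

definition umult :: "(nat \<Rightarrow> nat \<Rightarrow> rat) \<Rightarrow> (nat \<Rightarrow> nat \<Rightarrow> rat) \<Rightarrow> nat \<Rightarrow> nat \<Rightarrow> rat"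
  where "umult M N i j = M i j + N i j + (\<Sum>l\<in>{i<..<j}. M i l * N l j)"

definition ut :: "nat \<Rightarrow> nat \<Rightarrow> (nat \<Rightarrow> nat \<Rightarrow> rat) monoid"
  where "ut p r = \<lparr>carrier = {M. (\<forall>i j. p_integral p (M i j)) \<and> (\<forall>i j. \<not> (i < j \<and> j < r) \<longrightarrow> M i j = 0)},
    monoid.mult = umult, monoid.one = (\<lambda>_ _. 0)\<rparr>"

definition ut_cong :: "nat \<Rightarrow> nat \<Rightarrow> nat \<Rightarrow> (nat \<Rightarrow> nat \<Rightarrow> rat) set"
  where "ut_cong p r k = {M \<in> carrier (ut p r). \<forall>i j. p_mult p k (M i j)}"

lemma ut_mult: "M \<otimes>\<^bsub>ut p r\<^esub> N = umult M N" and ut_one: "\<one>\<^bsub>ut p r\<^esub> = (\<lambda>_ _. 0)"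
  by (auto simp: ut_def)

lemma ut_carrier: "M \<in> carrier (ut p r) \<longleftrightarrow> (\<forall>i j. p_integral p (M i j)) \<and> (\<forall>i j. \<not> (i < j \<and> j < r) \<longrightarrow> M i j = 0)"
  by (auto simp: ut_def)

text \<open>The matrix \<open>1 + \<gamma> N\<close>, where row \<open>i\<close> has the colour \<open>C i\<close> and \<open>N\<close> has its ones just above the
  diagonal in the rows of colour \<open>c\<close>. If adjacent rows have different colours, then \<open>N\<^sup>2 = 0\<close>, and
  products of matrices of the same colour add their parameters.\<close>

definition colour_elem :: "(nat \<Rightarrow> 'c) \<Rightarrow> nat \<Rightarrow> 'c \<Rightarrow> rat \<Rightarrow> nat \<Rightarrow> nat \<Rightarrow> rat"
  where "colour_elem C r c \<gamma> i j = (if j = Suc i \<and> j < r \<and> C i = c then \<gamma> else 0)"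

lemma umult_assoc: "umult (umult M N) K = umult M (umult N K)"
proof (intro ext)
  fix i j
  have "(\<Sum>l\<in>{i<..<j}. (\<Sum>l'\<in>{i<..<l}. M i l' * N l' l) * K l j)
      = (\<Sum>l\<in>{i<..<j}. \<Sum>l'\<in>{l'\<in>{i<..<j}. l' < l}. M i l' * N l' l * K l j)"
    by (intro sum.cong refl) (auto simp: sum_distrib_right intro!: sum.cong)
  also have "\<dots> = (\<Sum>l'\<in>{i<..<j}. \<Sum>l\<in>{l\<in>{i<..<j}. l' < l}. M i l' * N l' l * K l j)"
    by (rule sum.swap_restrict) auto
  also have "\<dots> = (\<Sum>l'\<in>{i<..<j}. M i l' * (\<Sum>l\<in>{l'<..<j}. N l' l * K l j))"
    by (intro sum.cong refl) (auto simp: sum_distrib_left mult.assoc intro!: sum.cong)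
  finally show "umult (umult M N) K i j = umult M (umult N K) i j"
    by (simp add: umult_def sum.distrib algebra_simps)
qed

context
  fixes p :: nat
  assumes prime: "Factorial_Ring.prime p"
begin

lemma ut_m_closed: "M \<in> carrier (ut p r) \<Longrightarrow> N \<in> carrier (ut p r) \<Longrightarrow> umult M N \<in> carrier (ut p r)"
  unfolding ut_carrier umult_def
  by (auto intro!: p_integral_add[OF prime] p_integral_sum[OF prime] p_integral_mult[OF prime] sum.neutral)

text \<open>If the factors change from the superdiagonal \<open>\<delta>\<close> upwards, the product changes on this superdiagonal by the sum
  of the two changes, because all mixed terms involve an entry below it.\<close>

lemma umult_pert:
  assumes I: "p_ideal p I" and int: "\<And>i j. p_integral p (M' i j)" "\<And>i j. p_integral p (N i j)"
    and M: "\<And>i j. j < i + \<delta> \<Longrightarrow> M' i j - M i j \<in> I" and N: "\<And>i j. j < i + \<delta> \<Longrightarrow> N' i j - N i j \<in> I"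
  shows "j \<le> i + \<delta> \<Longrightarrow> umult M' N' i j - umult M N i j - (M' i j - M i j) - (N' i j - N i j) \<in> I"
    and "j < i + \<delta> \<Longrightarrow> umult M' N' i j - umult M N i j \<in> I"
proof -
  show 1: "umult M' N' i j - umult M N i j - (M' i j - M i j) - (N' i j - N i j) \<in> I" if j: "j \<le> i + \<delta>" for j
  proof -
    have "umult M' N' i j - umult M N i j - (M' i j - M i j) - (N' i j - N i j)
      = (\<Sum>l\<in>{i<..<j}. M' i l * N' l j) - (\<Sum>l\<in>{i<..<j}. M i l * N l j)"
      by (simp add: umult_def)
    also have "\<dots> = (\<Sum>l\<in>{i<..<j}. M' i l * (N' l j - N l j) + (M' i l - M i l) * N l j)"
      by (simp add: sum_subtractf[symmetric] algebra_simps)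
    also have "\<dots> \<in> I"
      using j by (intro p_ideal_sum[OF prime I] p_ideal_add[OF prime I] p_ideal_times[OF prime I] M N int) auto
    finally show ?thesis .
  qed
  show "umult M' N' i j - umult M N i j \<in> I" if j: "j < i + \<delta>"
  proof -
    have "(umult M' N' i j - umult M N i j - (M' i j - M i j) - (N' i j - N i j)) + (M' i j - M i j) + (N' i j - N i j) \<in> I"
      using j by (intro p_ideal_add[OF prime I] 1 M N) auto
    then show ?thesis by simp
  qed
qed

lemma ut_group: "group (ut p r)"
proof (rule groupI)
  fix x assume x: "x \<in> carrier (ut p r)"
  have "\<exists>V\<in>carrier (ut p r). \<forall>i j. j < i + \<delta> \<longrightarrow> umult V x i j = 0" for \<delta>
  proof (induction \<delta>)
    case 0
    show ?case using x by (intro bexI[of _ "\<lambda>_ _. 0"]) (auto simp: ut_carrier umult_def p_integral_0[OF prime])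
  next
    case (Suc \<delta>)
    then obtain V where V: "V \<in> carrier (ut p r)" "\<And>i j. j < i + \<delta> \<Longrightarrow> umult V x i j = 0" by blast
    define V' where "V' = (\<lambda>i j. V i j - (if j = i + \<delta> then umult V x i j else 0))"
    have c: "umult V x \<in> carrier (ut p r)" using ut_m_closed[OF V(1) x] .
    have V': "V' \<in> carrier (ut p r)" using V(1) c
      by (auto simp: ut_carrier V'_def intro!: p_integral_diff[OF prime] p_integral_0[OF prime])
    have "umult V' x i j = 0" if j: "j < i + Suc \<delta>" for i j
    proof -
      have "umult V' x i j - umult V x i j - (V' i j - V i j) - (x i j - x i j) \<in> {0}"
        by (rule umult_pert(1)[OF p_ideal_zero[OF prime], where \<delta> = \<delta>]) (use V' x j in \<open>auto simp: ut_carrier V'_def\<close>)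
      then show ?thesis using V(2)[of j i] j by (auto simp: V'_def split: if_splits)
    qed
    then show ?case using V' by blast
  qed
  from this[of r] obtain V where V: "V \<in> carrier (ut p r)" "\<And>i j. j < i + r \<Longrightarrow> umult V x i j = 0" by blast
  have "umult V x i j = 0" for i j
    using V(2)[of j i] ut_m_closed[OF V(1) x] by (cases "j < r") (auto simp: ut_carrier)
  then have "umult V x = (\<lambda>_ _. 0)" by (intro ext)
  then show "\<exists>y\<in>carrier (ut p r). y \<otimes>\<^bsub>ut p r\<^esub> x = \<one>\<^bsub>ut p r\<^esub>" using V(1) by (auto simp: ut_mult ut_one)
next
  fix x assume "x \<in> carrier (ut p r)"
  show "\<one>\<^bsub>ut p r\<^esub> \<otimes>\<^bsub>ut p r\<^esub> x = x" by (auto simp: ut_mult ut_one umult_def fun_eq_iff)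
qed (auto simp: ut_mult ut_one umult_assoc ut_m_closed, auto simp: ut_carrier p_integral_0[OF prime])

text \<open>The source of unique roots: to first order, a change of the matrix is multiplied by \<open>n\<close> in its
  \<open>n\<close>-th power.\<close>

lemma ut_pow_pert:
  assumes I: "p_ideal p I" and c: "M \<in> carrier (ut p r)" "M' \<in> carrier (ut p r)"
    and M: "\<And>i j. j < i + \<delta> \<Longrightarrow> M' i j - M i j \<in> I"
  shows "j < i + \<delta> \<Longrightarrow> (M' [^]\<^bsub>ut p r\<^esub> (n::nat)) i j - (M [^]\<^bsub>ut p r\<^esub> n) i j \<in> I"
    and "j \<le> i + \<delta> \<Longrightarrow> (M' [^]\<^bsub>ut p r\<^esub> n) i j - (M [^]\<^bsub>ut p r\<^esub> n) i j - of_nat n * (M' i j - M i j) \<in> I"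
proof -
  interpret group "ut p r" by (rule ut_group)
  have "(\<forall>i j. j < i + \<delta> \<longrightarrow> (M' [^]\<^bsub>ut p r\<^esub> n) i j - (M [^]\<^bsub>ut p r\<^esub> n) i j \<in> I) \<and>
    (\<forall>i j. j \<le> i + \<delta> \<longrightarrow> (M' [^]\<^bsub>ut p r\<^esub> n) i j - (M [^]\<^bsub>ut p r\<^esub> n) i j - of_nat n * (M' i j - M i j) \<in> I)"
  proof (induction n)
    case 0 then show ?case using I by (auto simp: ut_one p_ideal_def)
  next
    case (Suc n)
    let ?A = "M' [^]\<^bsub>ut p r\<^esub> n" and ?B = "M [^]\<^bsub>ut p r\<^esub> n"
    have ab: "?A \<in> carrier (ut p r)" "?B \<in> carrier (ut p r)" using c by auto
    have int: "\<And>i j. p_integral p (?A i j)" "\<And>i j. p_integral p (M i j)" using ab c by (auto simp: ut_carrier)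
    have lo: "\<And>i j. j < i + \<delta> \<Longrightarrow> ?A i j - ?B i j \<in> I" using Suc by auto
    have "umult ?A M' i j - umult ?B M i j - of_nat (Suc n) * (M' i j - M i j) \<in> I" if j: "j \<le> i + \<delta>" for i j
    proof -
      have "umult ?A M' i j - umult ?B M i j - (?A i j - ?B i j) - (M' i j - M i j) \<in> I"
        using umult_pert(1)[OF I int lo M j] .
      moreover have "?A i j - ?B i j - of_nat n * (M' i j - M i j) \<in> I" using Suc j by auto
      ultimately show ?thesis using p_ideal_add[OF prime I] by (fastforce simp: algebra_simps)
    qed
    then show ?case using umult_pert(2)[OF I int lo M] by (auto simp: ut_mult)
  qed
  then show "j < i + \<delta> \<Longrightarrow> (M' [^]\<^bsub>ut p r\<^esub> n) i j - (M [^]\<^bsub>ut p r\<^esub> n) i j \<in> I"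
    "j \<le> i + \<delta> \<Longrightarrow> (M' [^]\<^bsub>ut p r\<^esub> n) i j - (M [^]\<^bsub>ut p r\<^esub> n) i j - of_nat n * (M' i j - M i j) \<in> I" by auto
qed

text \<open>Two roots of the same matrix agree on one superdiagonal after the other.\<close>

lemma ut_root_unique:
  assumes c: "M \<in> carrier (ut p r)" "M' \<in> carrier (ut p r)"
    and n: "n > 0" and eq: "M' [^]\<^bsub>ut p r\<^esub> (n::nat) = M [^]\<^bsub>ut p r\<^esub> n"
  shows "M' = M"
proof -
  have *: "\<forall>i j. j < i + \<delta> \<longrightarrow> M' i j = M i j" for \<delta>
  proof (induction \<delta>)
    case 0 then show ?case using c by (auto simp: ut_carrier)
  next
    case (Suc \<delta>)
    show ?case
    proof (intro allI impI)
      fix i j assume j: "j < i + Suc \<delta>"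
      have "(M' [^]\<^bsub>ut p r\<^esub> n) i j - (M [^]\<^bsub>ut p r\<^esub> n) i j - of_nat n * (M' i j - M i j) \<in> {0}"
        by (rule ut_pow_pert(2)[OF p_ideal_zero[OF prime] c, where \<delta> = \<delta>]) (use Suc j in auto)
      then show "M' i j = M i j" using eq n by simp
    qed
  qed
  have "M' i j = M i j" for i j using *[of "Suc j"] by simp
  then show ?thesis by (intro ext)
qed

text \<open>The root is corrected on one superdiagonal after the other, which requires division by \<open>n\<close> only.\<close>

lemma ut_root_exists:
  assumes x: "x \<in> carrier (ut p r)" and n: "\<not> p dvd n"
  shows "\<exists>y\<in>carrier (ut p r). y [^]\<^bsub>ut p r\<^esub> (n::nat) = x"
proof -
  interpret group "ut p r" by (rule ut_group)
  have n0: "n \<noteq> 0" using n by (metis dvd_0_right)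
  have n': "\<not> int p dvd int n" using n by simp
  have "\<exists>V\<in>carrier (ut p r). \<forall>i j. j < i + \<delta> \<longrightarrow> (V [^]\<^bsub>ut p r\<^esub> n) i j = x i j" for \<delta>
  proof (induction \<delta>)
    case 0
    have "\<one>\<^bsub>ut p r\<^esub> [^]\<^bsub>ut p r\<^esub> n = \<one>\<^bsub>ut p r\<^esub>" by simp
    then show ?case using x by (intro bexI[of _ "\<one>\<^bsub>ut p r\<^esub>"]) (auto simp: ut_carrier ut_one p_integral_0[OF prime])
  next
    case (Suc \<delta>)
    then obtain V where V: "V \<in> carrier (ut p r)" "\<And>i j. j < i + \<delta> \<Longrightarrow> (V [^]\<^bsub>ut p r\<^esub> n) i j = x i j" by blast
    define V' where "V' = (\<lambda>i j. V i j + (if j = i + \<delta> then (x i j - (V [^]\<^bsub>ut p r\<^esub> n) i j) / of_int (int n) else 0))"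
    have c: "V [^]\<^bsub>ut p r\<^esub> n \<in> carrier (ut p r)" using V(1) by auto
    have V': "V' \<in> carrier (ut p r)" using V(1) c x p_integral_divide[OF prime p_integral_diff[OF prime] n']
      by (auto simp: ut_carrier V'_def intro!: p_integral_add[OF prime] p_integral_0[OF prime])
    have "(V' [^]\<^bsub>ut p r\<^esub> n) i j = x i j" if j: "j < i + Suc \<delta>" for i j
    proof -
      have "(V' [^]\<^bsub>ut p r\<^esub> n) i j - (V [^]\<^bsub>ut p r\<^esub> n) i j - of_nat n * (V' i j - V i j) \<in> {0}"
        by (rule ut_pow_pert(2)[OF p_ideal_zero[OF prime] V(1) V', where \<delta> = \<delta>]) (use j in \<open>auto simp: V'_def\<close>)
      then show ?thesis using V(2)[of j i] j n0 by (auto simp: V'_def split: if_splits)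
    qed
    then show ?case using V' by blast
  qed
  from this[of r] obtain V where V: "V \<in> carrier (ut p r)" "\<And>i j. j < i + r \<Longrightarrow> (V [^]\<^bsub>ut p r\<^esub> n) i j = x i j" by blast
  have c: "V [^]\<^bsub>ut p r\<^esub> n \<in> carrier (ut p r)" using V(1) by auto
  have "(V [^]\<^bsub>ut p r\<^esub> n) i j = x i j" for i j
    using V(2)[of j i] c x by (cases "j < r") (auto simp: ut_carrier)
  then have "V [^]\<^bsub>ut p r\<^esub> n = x" by (intro ext)
  then show ?thesis using V(1) by blast
qed

lemma umult_cong:
  assumes I: "p_ideal p I" and c: "M' \<in> carrier (ut p r)" "N \<in> carrier (ut p r)"
    and M: "\<And>i j. M' i j - M i j \<in> I" and N: "\<And>i j. N' i j - N i j \<in> I"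
  shows "umult M' N' i j - umult M N i j \<in> I"
  using umult_pert(2)[OF I, where M' = M' and N = N and M = M and N' = N' and \<delta> = "Suc j" and i = i and j = j] assms
  by (auto simp: ut_carrier)

lemma ut_cong_iff:
  assumes "M \<in> carrier (ut p r)" "N \<in> carrier (ut p r)"
  shows "M \<otimes>\<^bsub>ut p r\<^esub> inv\<^bsub>ut p r\<^esub> N \<in> ut_cong p r k \<longleftrightarrow> (\<forall>i j. p_mult p k (M i j - N i j))"
proof -
  interpret group "ut p r" by (rule ut_group)
  let ?I = "Collect (p_mult p k)"
  have I: "p_ideal p ?I" by (rule p_ideal_mult[OF prime])
  have z: "0 \<in> ?I" using I by (auto simp: p_ideal_def)
  let ?K = "M \<otimes>\<^bsub>ut p r\<^esub> inv\<^bsub>ut p r\<^esub> N"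
  have K: "?K \<in> carrier (ut p r)" using assms by simp
  have e1: "umult ?K N = M" using assms by (simp flip: ut_mult[of p r] add: m_assoc)
  have e2: "umult N (inv\<^bsub>ut p r\<^esub> N) = (\<lambda>_ _. 0)" using assms by (simp flip: ut_mult[of p r] ut_one[of p r])
  have e3: "umult \<one>\<^bsub>ut p r\<^esub> N = N" using assms by (simp flip: ut_mult[of p r])
  show ?thesis
  proof
    assume "?K \<in> ut_cong p r k"
    then have "\<And>i j. ?K i j - \<one>\<^bsub>ut p r\<^esub> i j \<in> ?I" by (auto simp: ut_cong_def ut_one)
    from umult_cong[OF I K assms(2) this, of N] show "\<forall>i j. p_mult p k (M i j - N i j)"
      unfolding e1 e3 using z by auto
  next
    assume "\<forall>i j. p_mult p k (M i j - N i j)"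
    then have "\<And>i j. M i j - N i j \<in> ?I" by auto
    from umult_cong[OF I assms(1) inv_closed[OF assms(2)] this, of "inv\<^bsub>ut p r\<^esub> N"]
    show "?K \<in> ut_cong p r k" unfolding e2 using z K by (auto simp: ut_cong_def ut_mult)
  qed
qed

lemma ut_cong_open: "p_open p (ut p r) (ut_cong p r k)"
proof -
  interpret group "ut p r" by (rule ut_group)
  let ?I = "Collect (p_mult p k)"
  have I: "p_ideal p ?I" by (rule p_ideal_mult[OF prime])
  have z: "0 \<in> ?I" using I by (auto simp: p_ideal_def)
  have cc: "M \<in> carrier (ut p r)" "\<And>i j. p_mult p k (M i j)" if "M \<in> ut_cong p r k" for M
    using that by (auto simp: ut_cong_def)
  have one: "\<one>\<^bsub>ut p r\<^esub> \<in> ut_cong p r k" using z one_closed by (auto simp: ut_cong_def ut_one)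
  have div: "a \<otimes>\<^bsub>ut p r\<^esub> inv\<^bsub>ut p r\<^esub> b \<in> ut_cong p r k" if "a \<in> ut_cong p r k" "b \<in> ut_cong p r k" for a b
    using cc[OF that(1)] cc[OF that(2)] p_ideal_diff[OF prime I] by (subst ut_cong_iff) auto
  have inv: "inv\<^bsub>ut p r\<^esub> b \<in> ut_cong p r k" if "b \<in> ut_cong p r k" for b
    using div[OF one that] cc(1)[OF that] by simp
  have nrm: "ut_cong p r k \<lhd> ut p r"
  proof (rule normal_invI)
    show "subgroup (ut_cong p r k) (ut p r)"
    proof (rule subgroupI)
      fix a b assume "a \<in> ut_cong p r k" "b \<in> ut_cong p r k"
      then show "a \<otimes>\<^bsub>ut p r\<^esub> b \<in> ut_cong p r k" using div[OF _ inv, of a b] cc(1)[of b] by simp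
    qed (use cc one inv in auto)
  next
    fix x h assume x: "x \<in> carrier (ut p r)" and h: "h \<in> ut_cong p r k"
    have "\<And>i j. h i j - \<one>\<^bsub>ut p r\<^esub> i j \<in> ?I" using cc[OF h] by (auto simp: ut_one)
    from umult_cong[OF I x one_closed _ this, of x] have "\<And>i j. umult x h i j - umult x \<one>\<^bsub>ut p r\<^esub> i j \<in> ?I" using z by auto
    then have "\<forall>i j. p_mult p k ((x \<otimes>\<^bsub>ut p r\<^esub> h) i j - x i j)" using x by (simp flip: ut_mult[of p r])
    then show "x \<otimes>\<^bsub>ut p r\<^esub> h \<otimes>\<^bsub>ut p r\<^esub> inv\<^bsub>ut p r\<^esub> x \<in> ut_cong p r k"
      using x cc[OF h] by (subst ut_cong_iff) auto
  qed
  define res where "res = (\<lambda>x. SOME m. 0 \<le> m \<and> m < int p ^ k \<and> p_mult p k (x - of_int m))"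
  have res: "0 \<le> res x \<and> res x < int p ^ k \<and> p_mult p k (x - of_int (res x))" if "p_integral p x" for x
    unfolding res_def by (rule someI_ex[OF p_integral_residue[OF prime that]])
  show ?thesis
  proof (rule p_openI[OF nrm, where f = "\<lambda>M. (\<lambda>ij\<in>{..<r} \<times> {..<r}. res (M (fst ij) (snd ij)))" and s = "k * r"])
    show "finite ((\<lambda>M. \<lambda>ij\<in>{..<r} \<times> {..<r}. res (M (fst ij) (snd ij))) ` carrier (ut p r))"
    proof (rule finite_subset)
      show "(\<lambda>M. \<lambda>ij\<in>{..<r} \<times> {..<r}. res (M (fst ij) (snd ij))) ` carrier (ut p r)
        \<subseteq> ({..<r} \<times> {..<r}) \<rightarrow>\<^sub>E {0..<int p ^ k}"
      proof (intro image_subsetI, rule restrict_PiE_iff[THEN iffD2], rule ballI)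
        fix M ij assume "M \<in> carrier (ut p r)"
        then show "res (M (fst ij) (snd ij)) \<in> {0..<int p ^ k}"
          using res[of "M (fst ij) (snd ij)"] by (auto simp: ut_carrier)
      qed
    qed (auto intro: finite_PiE)
  next
    fix g g' assume g: "g \<in> carrier (ut p r)" "g' \<in> carrier (ut p r)"
      and eq: "(\<lambda>ij\<in>{..<r} \<times> {..<r}. res (g (fst ij) (snd ij))) = (\<lambda>ij\<in>{..<r} \<times> {..<r}. res (g' (fst ij) (snd ij)))"
    have "p_mult p k (g i j - g' i j)" for i j
    proof (cases "i < j \<and> j < r")
      case True
      then have e: "res (g i j) = res (g' i j)" using fun_cong[OF eq, of "(i, j)"] by auto
      have "(g i j - of_int (res (g i j))) - (g' i j - of_int (res (g' i j))) \<in> ?I"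
      proof (rule p_ideal_diff[OF prime I])
        show "g i j - of_int (res (g i j)) \<in> ?I" using g res[of "g i j"] by (simp add: ut_carrier)
        show "g' i j - of_int (res (g' i j)) \<in> ?I" using g res[of "g' i j"] by (simp add: ut_carrier)
      qed
      then show ?thesis by (simp add: e)
    next
      case False then show ?thesis using g z by (auto simp: ut_carrier)
    qed
    then show "g \<otimes>\<^bsub>ut p r\<^esub> inv\<^bsub>ut p r\<^esub> g' \<in> ut_cong p r k" using ut_cong_iff[OF g] by simp
  next
    fix g assume g: "g \<in> carrier (ut p r)"
    have "\<forall>i j. j \<le> i + \<delta> \<longrightarrow> (g [^]\<^bsub>ut p r\<^esub> (p ^ (k * \<delta>))) i j \<in> ?I" for \<delta>
    proof (induction \<delta>)
      case 0 then show ?case using g z by (auto simp: ut_carrier)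
    next
      case (Suc \<delta>)
      let ?V = "g [^]\<^bsub>ut p r\<^esub> (p ^ (k * \<delta>))"
      have V: "?V \<in> carrier (ut p r)" using g by simp
      have e: "g [^]\<^bsub>ut p r\<^esub> (p ^ (k * Suc \<delta>)) = ?V [^]\<^bsub>ut p r\<^esub> (p ^ k)"
        using g by (simp add: nat_pow_pow power_add mult.commute)
      have o: "\<one>\<^bsub>ut p r\<^esub> [^]\<^bsub>ut p r\<^esub> (p ^ k) = \<one>\<^bsub>ut p r\<^esub>" by simp
      show ?case
      proof (intro allI impI)
        fix i j assume j: "j \<le> i + Suc \<delta>"
        have "(?V [^]\<^bsub>ut p r\<^esub> (p ^ k)) i j - (\<one>\<^bsub>ut p r\<^esub> [^]\<^bsub>ut p r\<^esub> (p ^ k)) i j - of_nat (p ^ k) * (?V i j - \<one>\<^bsub>ut p r\<^esub> i j) \<in> ?I"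
          by (rule ut_pow_pert(2)[OF I one_closed V _ j]) (use Suc in \<open>auto simp: ut_one\<close>)
        moreover have "of_nat (p ^ k) * (?V i j - \<one>\<^bsub>ut p r\<^esub> i j) \<in> ?I"
          using V by (auto simp: p_mult_def ut_one ut_carrier)
        ultimately show "(g [^]\<^bsub>ut p r\<^esub> (p ^ (k * Suc \<delta>))) i j \<in> ?I"
          using p_ideal_add[OF prime I] unfolding e o by (metis (no_types, lifting) diff_add_cancel diff_zero ut_one)
      qed
    qed
    from this[of r] have "(g [^]\<^bsub>ut p r\<^esub> (p ^ (k * r))) i j \<in> ?I" for i j
      using z nat_pow_closed[OF g, of "p ^ (k * r)"] by (cases "j < r") (auto simp: ut_carrier)
    then show "g [^]\<^bsub>ut p r\<^esub> (p ^ (k * r)) \<in> ut_cong p r k" using g by (auto simp: ut_cong_def)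
  qed
qed

text \<open>On the lowest nonzero superdiagonal taking powers multiplies the entries.\<close>

lemma ut_leading:
  assumes M: "M \<in> carrier (ut p r)" "M \<noteq> \<one>\<^bsub>ut p r\<^esub>"
  obtains i j where "M i j \<noteq> 0" "\<And>n. (M [^]\<^bsub>ut p r\<^esub> (n::nat)) i j = of_nat n * M i j"
proof -
  interpret group "ut p r" by (rule ut_group)
  obtain i0 j0 where ij0: "M i0 j0 \<noteq> 0" using M(2) by (auto simp: ut_one fun_eq_iff)
  then have "\<exists>i. M i (i + (j0 - i0)) \<noteq> 0" 
  proof (intro exI[of _ i0])
    have "i0 < j0" using ij0 M(1) by (auto simp: ut_carrier)
    then show "M i0 (i0 + (j0 - i0)) \<noteq> 0" using ij0 by simp
  qed
  then have ex: "\<exists>\<delta> i. M i (i + \<delta>) \<noteq> 0" by blast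
  define \<delta> where "\<delta> = (LEAST \<delta>. \<exists>i. M i (i + \<delta>) \<noteq> 0)"
  obtain i where i: "M i (i + \<delta>) \<noteq> 0" using LeastI_ex[OF ex] unfolding \<delta>_def by blast
  have lo: "M i' j' = 0" if "j' < i' + \<delta>" for i' j'
  proof (rule ccontr)
    assume nz: "M i' j' \<noteq> 0"
    then have "i' < j'" using M(1) by (auto simp: ut_carrier)
    then have "M i' (i' + (j' - i')) \<noteq> 0" using nz by simp
    then have "\<delta> \<le> j' - i'" unfolding \<delta>_def by (intro Least_le) blast
    then show False using that \<open>i' < j'\<close> by linarith
  qed
  have "(M [^]\<^bsub>ut p r\<^esub> n) i (i + \<delta>) = of_nat n * M i (i + \<delta>)" for n :: nat
  proof -
    have o: "\<one>\<^bsub>ut p r\<^esub> [^]\<^bsub>ut p r\<^esub> n = \<one>\<^bsub>ut p r\<^esub>" by simp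
    have "(M [^]\<^bsub>ut p r\<^esub> n) i (i + \<delta>) - (\<one>\<^bsub>ut p r\<^esub> [^]\<^bsub>ut p r\<^esub> n) i (i + \<delta>) - of_nat n * (M i (i + \<delta>) - \<one>\<^bsub>ut p r\<^esub> i (i + \<delta>)) \<in> {0}"
      by (rule ut_pow_pert(2)[OF p_ideal_zero[OF prime] one_closed M(1), where \<delta> = \<delta>]) (simp_all add: lo ut_one[of p r] del: nat_pow_one)
    then show ?thesis unfolding o by (simp add: ut_one)
  qed
  then show ?thesis using that i by blast
qed

lemma ut_countable: "countable (carrier (ut p r))"
proof -
  have "inj_on (\<lambda>M. map (\<lambda>i. map (M i) [0..<r]) [0..<r]) (carrier (ut p r))"
  proof (rule inj_onI)
    fix M N assume MN: "M \<in> carrier (ut p r)" "N \<in> carrier (ut p r)"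
      and "map (\<lambda>i. map (M i) [0..<r]) [0..<r] = map (\<lambda>i. map (N i) [0..<r]) [0..<r]"
    then have "M i j = N i j" if "i < r" "j < r" for i j using that by auto
    then show "M = N" using MN by (intro ext) (metis (full_types) ut_carrier order_less_trans)
  qed
  then show ?thesis by (rule countableI')
qed

lemma colour_elem_closed: "p_integral p \<gamma> \<Longrightarrow> colour_elem C r c \<gamma> \<in> carrier (ut p r)"
  by (auto simp: ut_carrier colour_elem_def p_integral_0[OF prime])

lemma colour_elem_0: "colour_elem C r c 0 = \<one>\<^bsub>ut p r\<^esub>"
  by (auto simp: colour_elem_def ut_one fun_eq_iff)

lemma colour_elem_mult:
  assumes "\<And>i. Suc (Suc i) < r \<Longrightarrow> C i \<noteq> C (Suc i)"
  shows "colour_elem C r c \<gamma> \<otimes>\<^bsub>ut p r\<^esub> colour_elem C r c \<gamma>' = colour_elem C r c (\<gamma> + \<gamma>')"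
proof -
  have "(\<Sum>l\<in>{i<..<j}. colour_elem C r c \<gamma> i l * colour_elem C r c \<gamma>' l j) = 0" for i j
    by (rule sum.neutral) (use assms[of i] in \<open>auto simp: colour_elem_def\<close>)
  then show ?thesis by (auto simp: ut_mult umult_def colour_elem_def fun_eq_iff)
qed

lemma colour_elem_pow:
  assumes C: "\<And>i. Suc (Suc i) < r \<Longrightarrow> C i \<noteq> C (Suc i)" and g: "p_integral p \<gamma>"
  shows "colour_elem C r c \<gamma> [^]\<^bsub>ut p r\<^esub> (n::nat) = colour_elem C r c (of_nat n * \<gamma>)"
    "inv\<^bsub>ut p r\<^esub> colour_elem C r c \<gamma> = colour_elem C r c (- \<gamma>)"
    "colour_elem C r c \<gamma> [^]\<^bsub>ut p r\<^esub> (z::int) = colour_elem C r c (of_int z * \<gamma>)"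
proof -
  interpret group "ut p r" by (rule ut_group)
  have cl: "colour_elem C r c \<delta> \<in> carrier (ut p r)" if "p_integral p \<delta>" for \<delta> using colour_elem_closed that .
  have mult: "colour_elem C r c a \<otimes>\<^bsub>ut p r\<^esub> colour_elem C r c b = colour_elem C r c (a + b)" for a b
    by (rule colour_elem_mult) (rule C)
  show n: "colour_elem C r c \<gamma> [^]\<^bsub>ut p r\<^esub> (n::nat) = colour_elem C r c (of_nat n * \<gamma>)" for n
    by (induction n) (simp_all add: colour_elem_0 mult algebra_simps)
  have inv: "inv\<^bsub>ut p r\<^esub> colour_elem C r c \<delta> = colour_elem C r c (- \<delta>)" if "p_integral p \<delta>" for \<delta>
    by (rule inv_equality)
      (simp_all add: mult colour_elem_0 cl that p_integral_uminus[OF prime])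
  show "inv\<^bsub>ut p r\<^esub> colour_elem C r c \<gamma> = colour_elem C r c (- \<gamma>)" by (rule inv[OF g])
  show "colour_elem C r c \<gamma> [^]\<^bsub>ut p r\<^esub> (z::int) = colour_elem C r c (of_int z * \<gamma>)"
  proof (cases z)
    case (nonneg n) then show ?thesis by (simp add: int_pow_int n)
  next
    case (neg n)
    have "p_integral p (of_nat (Suc n) * \<gamma>)" by (intro p_integral_mult[OF prime] g p_integral_of_nat[OF prime])
    have "colour_elem C r c \<gamma> [^]\<^bsub>ut p r\<^esub> z = inv\<^bsub>ut p r\<^esub> (colour_elem C r c \<gamma> [^]\<^bsub>ut p r\<^esub> Suc n)"
      unfolding neg by (rule int_pow_neg_int[OF cl[OF g]])
    also have "\<dots> = colour_elem C r c (- (of_nat (Suc n) * \<gamma>))" unfolding n by (rule inv) fact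
    also have "- (of_nat (Suc n) * \<gamma>) = of_int z * \<gamma>" by (simp add: neg algebra_simps)
    finally show ?thesis .
  qed
qed

text \<open>An entry at distance \<open>R\<close> in a product of \<open>R\<close> matrices of this kind takes one step
  \<open>i \<rightarrow> i + 1\<close> from each factor. Since the colours of the rows are those of the factors, the
  only choice contributes the product of all parameters.\<close>

lemma colour_path:
  assumes "length xs < r" "\<And>i. i < length xs \<Longrightarrow> C i = fst (xs ! i)" "\<And>x. x \<in> set xs \<Longrightarrow> p_integral p (snd x)"
  shows "xs \<noteq> [] \<Longrightarrow> mprod (ut p r) (map (\<lambda>(c, \<gamma>). colour_elem C r c \<gamma>) xs) 0 (length xs) = (\<Prod>x\<leftarrow>xs. snd x)"
proof -
  interpret group "ut p r" by (rule ut_group)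
  let ?m = "\<lambda>xs. mprod (ut p r) (map (\<lambda>(c, \<gamma>). colour_elem C r c \<gamma>) xs)"
  have "(\<forall>j > length xs. ?m xs 0 j = 0) \<and> (xs \<noteq> [] \<longrightarrow> ?m xs 0 (length xs) = (\<Prod>x\<leftarrow>xs. snd x))"
    using assms
  proof (induction xs rule: rev_induct)
    case Nil then show ?case by (simp add: ut_one)
  next
    case (snoc x xs)
    obtain c \<gamma> where x: "x = (c, \<gamma>)" by (cases x)
    have IH: "(\<forall>j > length xs. ?m xs 0 j = 0) \<and> (xs \<noteq> [] \<longrightarrow> ?m xs 0 (length xs) = (\<Prod>x\<leftarrow>xs. snd x))"
    proof (rule snoc.IH)
      show "length xs < r" using snoc.prems(1) by simp
      show "C i = fst (xs ! i)" if "i < length xs" for i using snoc.prems(2)[of i] that by (simp add: nth_append)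
      show "p_integral p (snd y)" if "y \<in> set xs" for y using snoc.prems(3)[of y] that by simp
    qed
    have C: "C (length xs) = c" using snoc.prems(2)[of "length xs"] x by simp
    have g: "set (map (\<lambda>(c, \<gamma>). colour_elem C r c \<gamma>) (xs @ [x])) \<subseteq> carrier (ut p r)"

    proof
      fix M assume "M \<in> set (map (\<lambda>(c, \<gamma>). colour_elem C r c \<gamma>) (xs @ [x]))"
      then obtain y where "y \<in> set (xs @ [x])" "M = colour_elem C r (fst y) (snd y)" by (force simp: case_prod_beta)
      then show "M \<in> carrier (ut p r)" using colour_elem_closed[OF snoc.prems(3)] by simp
    qed
    have m: "?m (xs @ [x]) = umult (?m xs) (colour_elem C r c \<gamma>)"
    proof -
      have "set (map (\<lambda>(c, \<gamma>). colour_elem C r c \<gamma>) xs) \<subseteq> carrier (ut p r)" "colour_elem C r c \<gamma> \<in> carrier (ut p r)"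
        using g x by auto
      then have "?m (xs @ [x]) = ?m xs \<otimes>\<^bsub>ut p r\<^esub> colour_elem C r c \<gamma>"
        using mprod_append[OF is_monoid, of "map (\<lambda>(c, \<gamma>). colour_elem C r c \<gamma>) xs" "[colour_elem C r c \<gamma>]"] x
        by (simp only: map_append list.map prod.case mprod_simps) simp
      then show ?thesis by (simp only: ut_mult)
    qed
    have e: "?m (xs @ [x]) 0 j = ?m xs 0 j + colour_elem C r c \<gamma> 0 j +
      (if j \<ge> 2 then ?m xs 0 (j - 1) * colour_elem C r c \<gamma> (j - 1) j else 0)" for j
    proof -
      have "(\<Sum>l\<in>{0<..<j}. ?m xs 0 l * colour_elem C r c \<gamma> l j)
        = (\<Sum>l\<in>{0<..<j}. if l = j - 1 then ?m xs 0 l * colour_elem C r c \<gamma> l j else 0)"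
        by (intro sum.cong refl) (auto simp: colour_elem_def)
      also have "\<dots> = (if j \<ge> 2 then ?m xs 0 (j - 1) * colour_elem C r c \<gamma> (j - 1) j else 0)"
        by (subst sum.delta) auto
      finally show ?thesis unfolding m umult_def by (simp only:)
    qed
    show ?case
    proof (intro conjI allI impI)
      fix j assume "j > length (xs @ [x])"
      then have "?m xs 0 j = 0" "?m xs 0 (j - 1) = 0" "colour_elem C r c \<gamma> 0 j = 0 \<or> xs = []"
        using IH by (auto simp: colour_elem_def)
      then show "?m (xs @ [x]) 0 j = 0" using \<open>j > length (xs @ [x])\<close> unfolding e by (auto simp: colour_elem_def)
    next
      show "?m (xs @ [x]) 0 (length (xs @ [x])) = (\<Prod>x\<leftarrow>xs @ [x]. snd x)"
      proof (cases "xs = []")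
        case True
        then show ?thesis unfolding e using snoc.prems(1) C x by (simp add: colour_elem_def ut_one)
      next
        case False
        then have "length xs \<ge> 1" by (cases xs) auto
        then show ?thesis unfolding e using False IH snoc.prems(1) C x by (simp add: colour_elem_def)
      qed
    qed
  qed
  then show "xs \<noteq> [] \<Longrightarrow> ?m xs 0 (length xs) = (\<Prod>x\<leftarrow>xs. snd x)" by blast
qed

end

section \<open>Tameness from linear coordinates\<close>

text \<open>Modulo an open subgroup a negative exponent may be replaced by a positive one, since \<open>c\<close> has finite order there.\<close>

lemma in_cyclic_closure_nat:
  assumes p: "p > 0" and "in_cyclic_closure p G c g" and N: "p_open p G N" and c: "c \<in> carrier G" "g \<in> carrier G"
  shows "\<exists>n::nat. g \<otimes>\<^bsub>G\<^esub> inv\<^bsub>G\<^esub> (c [^]\<^bsub>G\<^esub> n) \<in> N"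
proof -
  interpret normal N G using p_openD[OF N] by simp
  obtain i :: int where i: "g \<otimes>\<^bsub>G\<^esub> inv\<^bsub>G\<^esub> (c [^]\<^bsub>G\<^esub> i) \<in> N" using assms unfolding in_cyclic_closure_def by blast
  obtain s where s: "\<And>g i. g \<in> carrier G \<Longrightarrow> g [^]\<^bsub>G\<^esub> (int p ^ s * i :: int) \<in> N" using p_open_pow[OF N] by blast
  define j where "j = int p ^ s * \<bar>i\<bar>"
  have "int p ^ s \<ge> 1" using p by simp
  then have "j \<ge> \<bar>i\<bar>" unfolding j_def by (metis abs_ge_zero mult_le_cancel_right1 not_le)
  then have ji: "j + i \<ge> 0" by linarith
  have "c [^]\<^bsub>G\<^esub> (nat (j + i)) = c [^]\<^bsub>G\<^esub> (j + i)" using ji by (metis int_pow_int nat_0_le)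
  also have "\<dots> = c [^]\<^bsub>G\<^esub> j \<otimes>\<^bsub>G\<^esub> c [^]\<^bsub>G\<^esub> i" using c by (simp add: int_pow_mult)
  finally have "g \<otimes>\<^bsub>G\<^esub> inv\<^bsub>G\<^esub> (c [^]\<^bsub>G\<^esub> (nat (j + i))) = g \<otimes>\<^bsub>G\<^esub> inv\<^bsub>G\<^esub> (c [^]\<^bsub>G\<^esub> i) \<otimes>\<^bsub>G\<^esub> inv\<^bsub>G\<^esub> (c [^]\<^bsub>G\<^esub> j)"
    using c by (simp add: inv_mult_group m_assoc)
  also have "\<dots> \<in> N" using i s[OF c(1), of "\<bar>i\<bar>"] by (simp add: j_def m_inv_closed)
  finally show ?thesis by blast
qed

lemma Mod_eq_pow:
  assumes N: "N \<lhd> G" and c: "c \<in> carrier G" "g \<in> carrier G"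
    and "g \<otimes>\<^bsub>G\<^esub> inv\<^bsub>G\<^esub> (c [^]\<^bsub>G\<^esub> (n::nat)) \<in> N"
  shows "g [^]\<^bsub>G\<^esub> (M::nat) \<otimes>\<^bsub>G\<^esub> inv\<^bsub>G\<^esub> ((c [^]\<^bsub>G\<^esub> M) [^]\<^bsub>G\<^esub> n) \<in> N"
    and "g [^]\<^bsub>G\<^esub> (X::int) \<otimes>\<^bsub>G\<^esub> inv\<^bsub>G\<^esub> (c [^]\<^bsub>G\<^esub> (int n * X)) \<in> N"
proof -
  interpret normal N G by fact
  have e: "N #>\<^bsub>G\<^esub> g = N #>\<^bsub>G\<^esub> (c [^]\<^bsub>G\<^esub> n)" using p_open_coset_cong[OF N] assms by simp
  have "N #>\<^bsub>G\<^esub> (g [^]\<^bsub>G\<^esub> M) = (N #>\<^bsub>G\<^esub> g) [^]\<^bsub>G Mod N\<^esub> M" using c by (simp add: FactGroup_pow)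
  also have "\<dots> = N #>\<^bsub>G\<^esub> ((c [^]\<^bsub>G\<^esub> n) [^]\<^bsub>G\<^esub> M)" unfolding e using c by (simp add: FactGroup_pow)
  also have "(c [^]\<^bsub>G\<^esub> n) [^]\<^bsub>G\<^esub> M = (c [^]\<^bsub>G\<^esub> M) [^]\<^bsub>G\<^esub> n" using c by (simp add: nat_pow_pow mult.commute)
  finally show "g [^]\<^bsub>G\<^esub> (M::nat) \<otimes>\<^bsub>G\<^esub> inv\<^bsub>G\<^esub> ((c [^]\<^bsub>G\<^esub> M) [^]\<^bsub>G\<^esub> n) \<in> N"
    using p_open_coset_cong[OF N] c by simp
  have "N #>\<^bsub>G\<^esub> (g [^]\<^bsub>G\<^esub> X) = (N #>\<^bsub>G\<^esub> g) [^]\<^bsub>G Mod N\<^esub> X" using c by (simp add: FactGroup_int_pow)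
  also have "\<dots> = N #>\<^bsub>G\<^esub> ((c [^]\<^bsub>G\<^esub> n) [^]\<^bsub>G\<^esub> X)" unfolding e using c by (simp add: FactGroup_int_pow)
  also have "(c [^]\<^bsub>G\<^esub> n) [^]\<^bsub>G\<^esub> X = c [^]\<^bsub>G\<^esub> (int n * X)" using c by (metis int_pow_int int_pow_pow)
  finally show "g [^]\<^bsub>G\<^esub> X \<otimes>\<^bsub>G\<^esub> inv\<^bsub>G\<^esub> (c [^]\<^bsub>G\<^esub> (int n * X)) \<in> N"
    using p_open_coset_cong[OF N] c by simp
qed

context
  fixes p :: nat
  assumes prime: "Factorial_Ring.prime p"
begin

text \<open>The hypothesis says that modulo high powers of \<open>p\<close> the exponent \<open>n\<close> with \<open>g \<equiv> c\<^sup>n\<close> is a solution of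
  \<open>n x = y\<close>. Clearing denominators and the common power of \<open>p\<close> turns this into integers with
  \<open>n X \<equiv> Y\<close> and \<open>p\<close> not dividing \<open>X\<close>; hence \<open>g\<^sup>X \<equiv> c\<^sup>Y\<close> modulo every open subgroup.\<close>

lemma tame_by_linear_coordinate:
  fixes G (structure)
  assumes G: "group G" and rp: "residually_p p G" and c: "c \<in> carrier G" and g: "g \<in> carrier G"
    and cl: "in_cyclic_closure p G c g"
    and x: "x \<noteq> 0" "p_integral p x" "p_integral p y"
    and lin: "\<And>k. \<exists>N. p_open p G N \<and> (\<forall>n::nat. g \<otimes>\<^bsub>G\<^esub> inv\<^bsub>G\<^esub> (c [^]\<^bsub>G\<^esub> n) \<in> N \<longrightarrow> p_mult p k (y - of_nat n * x))"
  shows "\<exists>X Y::int. \<not> int p dvd X \<and> g [^]\<^bsub>G\<^esub> X = c [^]\<^bsub>G\<^esub> Y"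
proof -
  interpret group G by fact
  note I = p_ideal_mult[OF prime]
  have pp: "Factorial_Ring.prime (int p)" by (rule prime_int_p[OF prime])
  obtain a b where 1: "\<not> int p dvd b" "x = of_int a / of_int b" using x(2) by (auto simp: p_integral_def)
  obtain a' b' where 2: "\<not> int p dvd b'" "y = of_int a' / of_int b'" using x(3) by (auto simp: p_integral_def)
  have nz: "b \<noteq> 0" "b' \<noteq> 0" using 1 2 by auto
  define X0 Y0 where "X0 = a * b'" and "Y0 = a' * b"
  have X0: "X0 \<noteq> 0" using x 1 nz by (auto simp: X0_def)
  have scale: "int p ^ k dvd Y0 - int n * X0" if "p_mult p k (y - of_nat n * x)" for k n
  proof -
    have "p_mult p k (of_int (b * b') * (y - of_nat n * x))"
      using p_ideal_times(1)[OF prime I, of "y - of_nat n * x" k] that p_integral_of_int[OF prime, of "b * b'"] by simp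
    moreover have "of_int (b * b') * (y - of_nat n * x) = of_int (Y0 - int n * X0)"
      using nz by (simp add: 1 2 X0_def Y0_def field_simps)
    ultimately show ?thesis using p_mult_of_int[OF prime] by metis
  qed
  obtain X v where X: "X0 = int p ^ v * X" "\<not> int p dvd X"
    using multiplicity_decompose'[OF X0 , of "int p"] pp by (metis not_prime_unit)
  have pos: "int p ^ v > 0" using prime prime_gt_0_nat by simp
  have cl': "\<exists>n::nat. g \<otimes> inv (c [^] n) \<in> N" if "p_open p G N" for N
    by (rule in_cyclic_closure_nat[OF _ cl that c g]) (use prime prime_gt_0_nat in auto)
  obtain N where N: "p_open p G N" "\<And>n::nat. g \<otimes> inv (c [^] n) \<in> N \<Longrightarrow> p_mult p v (y - of_nat n * x)" using lin by blast
  obtain n :: nat where "g \<otimes> inv (c [^] n) \<in> N" using cl'[OF N(1)] by blast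
  then have "int p ^ v dvd Y0 - int n * X0" using scale N(2) by blast
  then have "int p ^ v dvd Y0" by (simp add: X(1) dvd_diff_left_iff)
  then obtain Y where Y: "Y0 = int p ^ v * Y" by auto
  have "g [^] X = c [^] Y"
  proof (rule ccontr)
    assume ne: "g [^] X \<noteq> c [^] Y"
    have "g [^] X \<otimes> inv (c [^] Y) \<noteq> \<one>"
      using ne c g by (metis int_pow_closed inv_closed inv_equality inv_inv)
    then obtain M where M: "p_open p G M" "g [^] X \<otimes> inv (c [^] Y) \<notin> M"
      using rp c g unfolding residually_p_def by (meson int_pow_closed inv_closed m_closed)
    interpret M: normal M G using p_openD[OF M(1)] by simp
    obtain s where s: "\<And>g i. g \<in> carrier G \<Longrightarrow> g [^] (int p ^ s * i :: int) \<in> M" using p_open_pow[OF M(1)] by blast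
    obtain N where N: "p_open p G N" "\<And>n::nat. g \<otimes> inv (c [^] n) \<in> N \<Longrightarrow> p_mult p (v + s) (y - of_nat n * x)"
      using lin by blast
    obtain n :: nat where n: "g \<otimes> inv (c [^] n) \<in> M \<inter> N" using cl'[OF p_open_Int[OF M(1) N(1)]] by blast
    then have "int p ^ (v + s) dvd Y0 - int n * X0" using scale N(2) by blast
    moreover have "Y0 - int n * X0 = int p ^ v * (Y - int n * X)" by (simp add: X Y algebra_simps)
    ultimately have "int p ^ v * int p ^ s dvd int p ^ v * (Y - int n * X)" by (simp only: power_add)
    then have "int p ^ s dvd Y - int n * X" using pos by (metis dvd_mult_cancel_left less_irrefl)
    then obtain j' where "Y - int n * X = int p ^ s * j'" by auto
    then have j: "int n * X = Y + int p ^ s * (- j')" by simp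
    define j where "j = - j'"
    note j = j[folded j_def]
    have "g [^] X \<otimes> inv (c [^] (int n * X)) \<in> M" using Mod_eq_pow(2)[OF M.normal_axioms c g, of n X] n by simp
    moreover have "int n * X = int p ^ s * j + Y" using j by simp
    ultimately have "g [^] X \<otimes> inv (c [^] (int p ^ s * j) \<otimes> c [^] Y) \<in> M" using c by (simp add: int_pow_mult)
    moreover have "g [^] X \<otimes> inv (c [^] (int p ^ s * j) \<otimes> c [^] Y) \<otimes> c [^] (int p ^ s * j) = g [^] X \<otimes> inv (c [^] Y)"
      using int_pow_closed[OF g, of X] int_pow_closed[OF c, of Y] int_pow_closed[OF c, of "int p ^ s * j"]
      by (simp add: inv_mult_group m_assoc)
    ultimately show False using M(2) s[OF c, of j] M.m_closed by metis
  qed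
  then show ?thesis using X(2) by blast
qed

text \<open>The power \<open>M\<close> serves to move the image of \<open>c\<close> into the base group. A nontrivial coordinate of it
  excludes \<open>c\<close> from an open subgroup and provides the linear coordinate for tameness.\<close>

lemma wreath_ut_detects:
  assumes G: "group G" and S: "p_finite p S" and \<theta>: "\<theta> \<in> hom G (wreath (ut p r) S)" and c: "c \<in> carrier G"
    and M: "snd (\<theta> (c [^]\<^bsub>G\<^esub> (M::nat))) = \<one>\<^bsub>S\<^esub>" and v: "v \<in> carrier S"
    and ne: "fst (\<theta> (c [^]\<^bsub>G\<^esub> M)) v \<noteq> \<one>\<^bsub>ut p r\<^esub>"
  shows "\<exists>N. p_open p G N \<and> c \<notin> N" and "residually_p p G \<Longrightarrow> tame_closure_at p G c"
proof -
  interpret U: group "ut p r" by (rule ut_group[OF prime])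
  interpret S: group S using S by (simp add: p_finite_def)
  interpret W: group "wreath (ut p r) S" by (rule wreath_group[OF U.is_group S.is_group])
  interpret h: group_hom G "wreath (ut p r) S" \<theta>
    using G \<theta> W.is_group by (simp add: group_hom_def group_hom_axioms_def)
  define N where "N k = {g \<in> carrier G. \<theta> g \<in> wreath_base (ut_cong p r k) S}" for k
  have N: "p_open p G (N k)" for k unfolding N_def by (rule p_open_vimage[OF \<theta> G wreath_base_open[OF ut_cong_open[OF prime] S]])
  let ?w = "\<theta> (c [^]\<^bsub>G\<^esub> M)"
  have w: "?w \<in> carrier (wreath (ut p r) S)" using c by simp
  let ?f = "fst ?w v"
  have f: "?f \<in> carrier (ut p r)" by (rule wreath_fst_closed[OF w v])
  obtain i j where ij: "?f i j \<noteq> 0" "\<And>n. (?f [^]\<^bsub>ut p r\<^esub> (n::nat)) i j = of_nat n * ?f i j"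
    using ut_leading[OF prime f ne] by blast
  have int: "p_integral p (?f i j)" using f by (simp add: ut_carrier)
  show "\<exists>N. p_open p G N \<and> c \<notin> N"
  proof -
    obtain k where k: "\<not> p_mult p k (?f i j)" using p_mult_nonzero[OF prime ij(1) int] by blast
    interpret Nk: normal "N k" G using p_openD[OF N] by simp
    have "c \<notin> N k"
    proof
      assume "c \<in> N k"
      then have "c [^]\<^bsub>G\<^esub> M \<in> N k" using h.G.subgroup_int_pow_closed[OF Nk.subgroup_axioms, of c "int M"] by (simp only: int_pow_int)
      then have "?w \<in> wreath_base (ut_cong p r k) S" unfolding N_def by blast
      then have "?f \<in> ut_cong p r k" using wreath_base_iff[OF w, THEN iffD1] v by blast
      then show False using k by (simp add: ut_cong_def)
    qed
    then show ?thesis using N by blast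
  qed
  show "tame_closure_at p G c" if rp: "residually_p p G"
    unfolding tame_closure_at_def
  proof (intro ballI impI)
    fix g assume g: "g \<in> carrier G" and cl: "in_cyclic_closure p G c g"
    let ?u = "\<theta> (g [^]\<^bsub>G\<^esub> M)"
    have u: "?u \<in> carrier (wreath (ut p r) S)" using g by simp
    have uc: "fst ?u v \<in> carrier (ut p r)" by (rule wreath_fst_closed[OF u v])
    show "\<exists>X Y::int. \<not> int p dvd X \<and> g [^]\<^bsub>G\<^esub> X = c [^]\<^bsub>G\<^esub> Y"
    proof (rule tame_by_linear_coordinate[OF G rp c g cl ij(1) int, where y = "fst ?u v i j"])
      show "p_integral p (fst ?u v i j)" using uc by (simp add: ut_carrier)
    next
      fix k
      have "p_mult p k (fst ?u v i j - of_nat n * ?f i j)" if n: "g \<otimes>\<^bsub>G\<^esub> inv\<^bsub>G\<^esub> (c [^]\<^bsub>G\<^esub> n) \<in> N k" for n :: nat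
      proof -
        let ?z = "?w [^]\<^bsub>wreath (ut p r) S\<^esub> n"
        have z: "?z \<in> carrier (wreath (ut p r) S)" "snd ?z = \<one>\<^bsub>S\<^esub>" "fst ?z v = ?f [^]\<^bsub>ut p r\<^esub> n"
          using w wreath_base_pow[OF U.is_group S.is_group w M v] by auto
        have "g [^]\<^bsub>G\<^esub> M \<otimes>\<^bsub>G\<^esub> inv\<^bsub>G\<^esub> ((c [^]\<^bsub>G\<^esub> M) [^]\<^bsub>G\<^esub> n) \<in> N k"
          using Mod_eq_pow(1)[OF _ c g n] p_openD(1)[OF N] by blast
        then have "?u \<otimes>\<^bsub>wreath (ut p r) S\<^esub> inv\<^bsub>wreath (ut p r) S\<^esub> ?z \<in> wreath_base (ut_cong p r k) S"
          using c g by (simp add: N_def h.hom_nat_pow)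
        then have b: "snd (?u \<otimes>\<^bsub>wreath (ut p r) S\<^esub> inv\<^bsub>wreath (ut p r) S\<^esub> ?z) = \<one>\<^bsub>S\<^esub>"
          "fst (?u \<otimes>\<^bsub>wreath (ut p r) S\<^esub> inv\<^bsub>wreath (ut p r) S\<^esub> ?z) v \<in> ut_cong p r k"
          using wreath_base_iff[OF W.m_closed[OF u W.inv_closed[OF z(1)]]] v by auto
        have su: "snd ?u = \<one>\<^bsub>S\<^esub>"
          using b(1) z(2) wreath_snd_closed[OF u] by (simp add: wreath_snd_mult wreath_snd_inv[OF U.is_group S.is_group z(1)])
        have "fst ?u v \<otimes>\<^bsub>ut p r\<^esub> inv\<^bsub>ut p r\<^esub> (?f [^]\<^bsub>ut p r\<^esub> n) \<in> ut_cong p r k"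
          using b(2) su z v by (simp add: wreath_fst_mult wreath_fst_inv(1)[OF U.is_group S.is_group z(1)])
        then show ?thesis using ut_cong_iff[OF prime uc U.nat_pow_closed[OF f]] ij(2) by metis
      qed
      then show "\<exists>N. p_open p G N \<and> (\<forall>n::nat. g \<otimes>\<^bsub>G\<^esub> inv\<^bsub>G\<^esub> (c [^]\<^bsub>G\<^esub> n) \<in> N \<longrightarrow> p_mult p k (fst ?u v i j - of_nat n * ?f i j))"
        using N by blast
    qed
  qed
qed

lemma ut_detects:
  assumes G: "group G" and \<tau>: "\<tau> \<in> hom G (ut p r)" and c: "c \<in> carrier G" and ne: "\<tau> c \<noteq> \<one>\<^bsub>ut p r\<^esub>"
  shows "\<exists>k. c \<notin> {g \<in> carrier G. \<tau> g \<in> ut_cong p r k}" and "residually_p p G \<Longrightarrow> tame_closure_at p G c"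
proof -
  interpret U: group "ut p r" by (rule ut_group[OF prime])
  interpret h: group_hom G "ut p r" \<tau>
    using G \<tau> U.is_group by (simp add: group_hom_def group_hom_axioms_def)
  have f: "\<tau> c \<in> carrier (ut p r)" using c by simp
  obtain i j where ij: "\<tau> c i j \<noteq> 0" "\<And>n. (\<tau> c [^]\<^bsub>ut p r\<^esub> (n::nat)) i j = of_nat n * \<tau> c i j"
    using ut_leading[OF prime f ne] by blast
  have int: "p_integral p (\<tau> c i j)" using f by (simp add: ut_carrier)
  show "\<exists>k. c \<notin> {g \<in> carrier G. \<tau> g \<in> ut_cong p r k}"
    using p_mult_nonzero[OF prime ij(1) int] by (auto simp: ut_cong_def)
  have N: "p_open p G {g \<in> carrier G. \<tau> g \<in> ut_cong p r k}" for k by (rule p_open_vimage[OF \<tau> G ut_cong_open[OF prime]])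
  show "tame_closure_at p G c" if rp: "residually_p p G"
    unfolding tame_closure_at_def
  proof (intro ballI impI)
    fix g assume g: "g \<in> carrier G" and cl: "in_cyclic_closure p G c g"
    have uc: "\<tau> g \<in> carrier (ut p r)" using g by simp
    show "\<exists>X Y::int. \<not> int p dvd X \<and> g [^]\<^bsub>G\<^esub> X = c [^]\<^bsub>G\<^esub> Y"
    proof (rule tame_by_linear_coordinate[OF G rp c g cl ij(1) int, where y = "\<tau> g i j"])
      show "p_integral p (\<tau> g i j)" using uc by (simp add: ut_carrier)
    next
      fix k
      have "p_mult p k (\<tau> g i j - of_nat n * \<tau> c i j)"
        if n: "g \<otimes>\<^bsub>G\<^esub> inv\<^bsub>G\<^esub> (c [^]\<^bsub>G\<^esub> n) \<in> {g \<in> carrier G. \<tau> g \<in> ut_cong p r k}" for n :: nat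
      proof -
        have "\<tau> g \<otimes>\<^bsub>ut p r\<^esub> inv\<^bsub>ut p r\<^esub> (\<tau> c [^]\<^bsub>ut p r\<^esub> n) \<in> ut_cong p r k" using n c g by (simp add: h.hom_nat_pow)
        then show ?thesis using ut_cong_iff[OF prime uc U.nat_pow_closed[OF f]] ij(2) by metis
      qed
      then show "\<exists>N. p_open p G N \<and> (\<forall>n::nat. g \<otimes>\<^bsub>G\<^esub> inv\<^bsub>G\<^esub> (c [^]\<^bsub>G\<^esub> n) \<in> N \<longrightarrow> p_mult p k (\<tau> g i j - of_nat n * \<tau> c i j))"
        using N by blast
    qed
  qed
qed

text \<open>If another prime \<open>q\<close> divided the order, a Sylow subgroup would contain an element whose order divides
  both a power of \<open>q\<close> and a power of \<open>p\<close>.\<close>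

lemma p_finite_order:
  assumes S: "p_finite p S" shows "\<exists>s. order S = p ^ s"
proof -
  interpret group S using S by (simp add: p_finite_def)
  have fin: "finite (carrier S)" using S by (simp add: p_finite_def)
  obtain s where s: "\<And>g. g \<in> carrier S \<Longrightarrow> g [^]\<^bsub>S\<^esub> (p ^ s) = \<one>\<^bsub>S\<^esub>" using S unfolding p_finite_def by auto
  have pos: "order S > 0" using fin by (simp add: order_gt_0_iff_finite)
  obtain m where m: "order S = p ^ multiplicity p (order S) * m" "\<not> p dvd m"
    using multiplicity_decompose'[of "order S" p] pos prime by (metis not_prime_unit not_less0)
  have "m = 1"
  proof (rule ccontr)
    assume "m \<noteq> 1"
    then obtain q where q: "Factorial_Ring.prime q" "q dvd m" using prime_factor_nat by blast
    then have qp: "q \<noteq> p" using m(2) by blast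
    define a where "a = multiplicity q (order S)"
    obtain b where b: "order S = q ^ a * b" "\<not> q dvd b"
      using multiplicity_decompose'[of "order S" q] pos q(1) unfolding a_def by (metis not_prime_unit not_less0)
    have "q dvd order S" using q(2) m(1) by (metis dvd_mult)
    then have "a \<noteq> 0" using b by (metis mult_1 power_0)
    obtain H where H: "subgroup H S" "card H = q ^ a" using sylow_thm[OF q(1) is_group b(1) fin] by blast
    then have "card H > 1" using \<open>a \<noteq> 0\<close> q(1) by (metis one_less_power prime_gt_1_nat neq0_conv)
    then obtain x where x: "x \<in> H" "x \<noteq> \<one>\<^bsub>S\<^esub>"
      by (metis One_nat_def card.empty card_le_Suc0_iff_eq card_ge_0_finite gr_implies_not0 not_le subgroup.one_closed[OF H(1)] zero_less_one order_less_trans)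
    then have xc: "x \<in> carrier S" using H(1) subgroup.subset by blast
    interpret HG: group "S\<lparr>carrier := H\<rparr>" by (rule subgroup.subgroup_is_group[OF H(1) is_group])
    have "x [^]\<^bsub>S\<lparr>carrier := H\<rparr>\<^esub> order (S\<lparr>carrier := H\<rparr>) = \<one>\<^bsub>S\<lparr>carrier := H\<rparr>\<^esub>" using x HG.pow_order_eq_1 by simp
    then have "x [^]\<^bsub>S\<^esub> (q ^ a) = \<one>\<^bsub>S\<^esub>" using H(2) by (simp add: order_def nat_pow_consistent[symmetric])
    then have "ord x dvd q ^ a" "ord x dvd p ^ s" using s[OF xc] pow_eq_id[OF xc] by auto
    moreover have "coprime (q ^ a) (p ^ s)" using q(1) prime qp by (simp add: primes_coprime)
    ultimately have "ord x = 1" by (metis coprime_common_divisor nat_dvd_1_iff_1)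
    then show False using x xc ord_eq_1 by blast
  qed
  then show ?thesis using m(1) by auto
qed

end

text \<open>Universal properties and separability quantify over groups whose elements are natural numbers. Countable
  groups can be moved there.\<close>

lemma transport_nat:
  fixes Y :: "('y, 'z) monoid_scheme"
  assumes "group Y" "countable (carrier Y)"
  obtains Y' :: "nat monoid" and t where "group Y'" "t \<in> iso Y Y'"
proof -
  interpret group Y by fact
  define t where "t = to_nat_on (carrier Y)"
  have inj: "inj_on t (carrier Y)" unfolding t_def by (rule inj_on_to_nat_on[OF assms(2)])
  define u where "u = inv_into (carrier Y) t"
  have u: "u (t x) = x" if "x \<in> carrier Y" for x unfolding u_def by (rule inv_into_f_f[OF inj that])
  define Y' where "Y' = \<lparr>carrier = t ` carrier Y, monoid.mult = (\<lambda>a b. t (u a \<otimes>\<^bsub>Y\<^esub> u b)), one = t \<one>\<^bsub>Y\<^esub>\<rparr>"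
  have "group Y'"
  proof (rule groupI)
    fix x assume "x \<in> carrier Y'"
    then obtain a where "a \<in> carrier Y" "x = t a" by (auto simp: Y'_def)
    then show "\<exists>y\<in>carrier Y'. y \<otimes>\<^bsub>Y'\<^esub> x = \<one>\<^bsub>Y'\<^esub>" by (auto simp: Y'_def u intro!: bexI[of _ "inv\<^bsub>Y\<^esub> a"])
  qed (auto simp: Y'_def u m_assoc)
  moreover have "t \<in> iso Y Y'" using inj by (auto simp: iso_def hom_def bij_betw_def Y'_def u)
  ultimately show ?thesis using that by blast
qed

text \<open>Isolation with respect to primes yields isolation with respect to all exponents prime to \<open>p\<close>, by induction on the
  prime factors. With tameness it follows that \<open>\<langle>c\<rangle>\<close> is closed.\<close>

lemma p_separable_if_tame:
  fixes G (structure)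
  assumes prime: "Factorial_Ring.prime p" and G: "group G" and tame: "\<And>c. c \<in> carrier G \<Longrightarrow> tame_closure_at p G c"
    and C: "cyclic_subgroup C G" "p'_isolated p C G"
  shows "p_separable p C G"
proof -
  interpret group G by fact
  obtain c where c: "c \<in> carrier G" "C = generate G {c}" using C(1) by (auto simp: cyclic_subgroup_def)
  have Ci: "C = {c [^] i | i. i \<in> (UNIV :: int set)}" using generate_pow[OF c(1)] c(2) by simp
  have sub: "subgroup C G" using C(2) by (simp add: p'_isolated_def)
  interpret C: subgroup C G by fact
  have iso: "g \<in> C" if "g \<in> carrier G" "\<not> p dvd n" "g [^] n \<in> C" for g and n :: nat
    using that
  proof (induction n arbitrary: g rule: less_induct)
    case (less n)
    have n0: "n \<noteq> 0" using less.prems(2) by (metis dvd_0_right)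
    show ?case
    proof (cases "n = 1")
      case True then show ?thesis using less.prems by simp
    next
      case False
      then obtain q where q: "Factorial_Ring.prime q" "q dvd n" using prime_factor_nat by blast
      then obtain m where m: "n = q * m" by auto
      have "q \<noteq> p" using q less.prems(2) by blast
      have "(g [^] m) [^] q \<in> C" using less.prems m by (simp add: nat_pow_pow mult.commute)
      then have "g [^] m \<in> C" using C(2) q(1) \<open>q \<noteq> p\<close> less.prems(1) unfolding p'_isolated_def by blast
      moreover have "m < n" using m n0 q(1) prime_gt_1_nat[of q] by (cases "m = 0") auto
      moreover have "\<not> p dvd m" using less.prems(2) m by auto
      ultimately show ?thesis using less.IH less.prems(1) by blast
    qed
  qed
  show ?thesis unfolding p_separable_def
  proof (intro conjI sub ballI)
    fix g assume g: "g \<in> carrier G - C"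
    have "\<not> in_cyclic_closure p G c g"
    proof
      assume "in_cyclic_closure p G c g"
      then obtain x y :: int where xy: "\<not> int p dvd x" "g [^] x = c [^] y"
        using tame[OF c(1)] g unfolding tame_closure_at_def by blast
      then have gx: "g [^] x \<in> C" using Ci by auto
      have "g [^] (nat \<bar>x\<bar>) \<in> C"
      proof (cases "x \<ge> 0")
        case True then show ?thesis using gx by (metis abs_of_nonneg int_pow_int nat_0_le)
      next
        case False
        then have "g [^] (nat \<bar>x\<bar>) = g [^] (- x)" by (metis abs_of_nonpos int_pow_int nat_0_le abs_ge_zero linear)
        also have "\<dots> = inv (g [^] x)" using g by (simp add: int_pow_neg)
        finally show ?thesis using gx by simp
      qed
      moreover have "\<not> p dvd nat \<bar>x\<bar>" using xy(1) by (simp add: int_dvd_int_iff[symmetric])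
      ultimately show False using iso g by blast
    qed
    then obtain N where N: "p_open p G N" "\<And>i::int. g \<otimes> inv (c [^] i) \<notin> N" unfolding in_cyclic_closure_def by blast
    have nrm: "N \<lhd> G" using p_openD[OF N(1)] by simp
    interpret N: normal N G by fact
    have S: "p_finite p (G Mod N)" by (rule p_finite_Mod[OF N(1)])
    then have gS: "group (G Mod N)" and fS: "finite (carrier (G Mod N))" by (auto simp: p_finite_def)
    obtain P :: "nat monoid" and t where P: "group P" "t \<in> iso (G Mod N) P"
      using transport_nat[OF gS countable_finite[OF fS]] by blast
    have bij: "bij_betw t (carrier (G Mod N)) (carrier P)" using P(2) by (simp add: iso_def)
    define \<psi> where "\<psi> = t \<circ> (\<lambda>g. N #> g)"
    have hom: "\<psi> \<in> hom G P" 
    using Mod_hom(1)[OF nrm] P(2) unfolding \<psi>_def iso_def hom_def by (auto simp: Pi_iff)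
    have "\<psi> ` carrier G = carrier P"
      unfolding \<psi>_def image_comp[symmetric] Mod_hom(2)[OF nrm] using bij by (simp add: bij_betw_def)
    then have "\<psi> \<in> epi G P" using hom by (simp add: epi_def)
    moreover have "finite_p_group p P"
    proof -
      have "order P = order (G Mod N)" using bij_betw_same_card[OF bij] by (simp add: order_def)
      then show ?thesis using p_finite_order[OF prime S] P(1) bij_betw_finite[OF bij] fS by (simp add: finite_p_group_def)
    qed
    moreover have "\<psi> g \<notin> \<psi> ` C"
    proof
      assume "\<psi> g \<in> \<psi> ` C"
      then obtain i :: int where i: "\<psi> g = \<psi> (c [^] i)" using Ci by auto
      have "N #> g = N #> (c [^] i)"
      proof (rule inj_onD[OF bij_betw_imp_inj_on[OF bij]])
        show "t (N #> g) = t (N #> (c [^] i))" using i by (simp add: \<psi>_def)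
      qed (use g c Mod_hom(2)[OF nrm] in auto)
      then show False using p_open_coset_cong[OF nrm] N(2) g c by simp
    qed
    ultimately show "\<exists>(P :: nat monoid) \<psi>. finite_p_group p P \<and> \<psi> \<in> epi G P \<and> \<psi> g \<notin> \<psi> ` C" by blast
  qed
qed

section \<open>Groups given by generators and relations\<close>

lemma word_cong_append: "word_cong R u v \<Longrightarrow> word_cong R (a @ u @ b) (a @ v @ b)"
proof (induction rule: word_cong.induct)
  case (rel l r u v)
  then show ?case using word_cong.rel[of l r R "a @ u" "v @ b"] by simp
qed (auto intro: word_cong.intros)

lemma word_cong_mult: "word_cong R u u' \<Longrightarrow> word_cong R v v' \<Longrightarrow> word_cong R (u @ v) (u' @ v')"
  using word_cong_append[of R u u' "[]" v] word_cong_append[of R v v' u' "[]"] by (auto intro: word_cong.trans)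

locale presentation =
  fixes S :: "'g set" and R :: "('g list \<times> 'g list) set"
  assumes rels: "R \<subseteq> lists S \<times> lists S"
begin

abbreviation "Q \<equiv> word_quotient S R"

definition cls :: "'g list \<Rightarrow> 'g list set" where "cls w = word_rel S R `` {w}"

lemma equiv_word_rel: "equiv (lists S) (word_rel S R)"
  by (rule equivI) (auto simp: word_rel_def refl_on_def sym_def trans_def intro: word_cong.intros)

lemma cls_eq_iff: "u \<in> lists S \<Longrightarrow> v \<in> lists S \<Longrightarrow> cls u = cls v \<longleftrightarrow> word_cong R u v"
  unfolding cls_def by (subst eq_equiv_class_iff[OF equiv_word_rel]) (auto simp: word_rel_def)

lemma carrier_iff: "C \<in> carrier Q \<longleftrightarrow> (\<exists>w\<in>lists S. C = cls w)"
  by (auto simp: word_quotient_def cls_def quotient_def)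

lemma cls_carrier [simp]: "w \<in> lists S \<Longrightarrow> cls w \<in> carrier Q"
  by (auto simp: carrier_iff)

lemma mem_cls: "u \<in> cls w \<longleftrightarrow> u \<in> lists S \<and> w \<in> lists S \<and> word_cong R w u"
  by (auto simp: cls_def word_rel_def)

lemma cls_mult:
  assumes "u \<in> lists S" "v \<in> lists S"
  shows "cls u \<otimes>\<^bsub>Q\<^esub> cls v = cls (u @ v)"
proof -
  have "cls (u' @ v') = cls (u @ v)" if "u' \<in> cls u" "v' \<in> cls v" for u' v'
    using that assms by (subst cls_eq_iff) (auto simp: mem_cls intro: word_cong_mult word_cong.sym)
  moreover have "u \<in> cls u" "v \<in> cls v" using assms by (auto simp: mem_cls intro: word_cong.refl)
  ultimately have "(\<Union>u'\<in>cls u. \<Union>v'\<in>cls v. cls (u' @ v')) = cls (u @ v)" by blast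
  then show ?thesis by (simp add: word_quotient_def cls_def)
qed

lemma one_cls: "\<one>\<^bsub>Q\<^esub> = cls []" by (simp add: word_quotient_def cls_def)

lemma group_Q:
  assumes inv: "\<And>s. s \<in> S \<Longrightarrow> \<exists>s'\<in>S. word_cong R [s', s] []"
  shows "group Q"
proof (rule groupI)
  fix x assume "x \<in> carrier Q"
  then obtain w where w: "w \<in> lists S" "x = cls w" by (auto simp: carrier_iff)
  have "\<exists>w'\<in>lists S. word_cong R (w' @ w) []" using w(1)
  proof (induction w)
    case Nil then show ?case by (auto intro: word_cong.refl)
  next
    case (Cons s w)
    then obtain w' where w': "w' \<in> lists S" "word_cong R (w' @ w) []" by auto
    obtain s' where s': "s' \<in> S" "word_cong R [s', s] []" using inv[of s] Cons.hyps by auto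
    have "word_cong R (w' @ [s', s] @ w) (w' @ [] @ w)" by (rule word_cong_append[OF s'(2)])
    then have "word_cong R ((w' @ [s']) @ s # w) []" using w'(2) by (auto intro: word_cong.trans)
    then show ?case using w'(1) s'(1) by (intro bexI[of _ "w' @ [s']"]) auto
  qed
  then obtain w' where "w' \<in> lists S" "word_cong R (w' @ w) []" by blast
  then show "\<exists>y\<in>carrier Q. y \<otimes>\<^bsub>Q\<^esub> x = \<one>\<^bsub>Q\<^esub>"
    using w by (intro bexI[of _ "cls w'"]) (auto simp: cls_mult one_cls cls_eq_iff)
next
  fix x y z assume "x \<in> carrier Q" "y \<in> carrier Q" "z \<in> carrier Q"
  then show "x \<otimes>\<^bsub>Q\<^esub> y \<otimes>\<^bsub>Q\<^esub> z = x \<otimes>\<^bsub>Q\<^esub> (y \<otimes>\<^bsub>Q\<^esub> z)"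
    unfolding carrier_iff by (elim bexE) (simp add: cls_mult)
next
  fix x y assume "x \<in> carrier Q" "y \<in> carrier Q"
  then show "x \<otimes>\<^bsub>Q\<^esub> y \<in> carrier Q" unfolding carrier_iff by (elim bexE) (auto simp: cls_mult intro!: bexI[of _ "_ @ _"])
next
  fix x assume "x \<in> carrier Q"
  then show "\<one>\<^bsub>Q\<^esub> \<otimes>\<^bsub>Q\<^esub> x = x" unfolding carrier_iff by (elim bexE) (simp add: cls_mult one_cls)
qed (simp add: one_cls)

lemma cls_mprod: "w \<in> lists S \<Longrightarrow> cls w = mprod Q (map (\<lambda>s. cls [s]) w)"
proof (induction w)
  case (Cons s w)
  then show ?case using cls_mult[of "[s]" w] by (simp only: list.map mprod_simps) simp
qed (simp add: one_cls)

lemma universal: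
  assumes Y: "group Y" and f: "f \<in> S \<rightarrow> carrier Y"
    and R: "\<And>l r. (l, r) \<in> R \<Longrightarrow> mprod Y (map f l) = mprod Y (map f r)"
  shows "\<exists>\<theta>\<in>hom Q Y. \<forall>w\<in>lists S. \<theta> (cls w) = mprod Y (map f w)"
proof -
  interpret Y: group Y by fact
  define f' where "f' s = (if s \<in> S then f s else \<one>\<^bsub>Y\<^esub>)" for s
  have f': "f' s \<in> carrier Y" for s using f unfolding f'_def by auto
  have ff': "map f w = map f' w" if "w \<in> lists S" for w using that unfolding f'_def by auto
  have cl: "mprod Y (map f' w) \<in> carrier Y" for w by (rule mprod_closed[OF Y.is_monoid]) (use f' in auto)
  have app: "mprod Y (map f' (u @ v)) = mprod Y (map f' u) \<otimes>\<^bsub>Y\<^esub> mprod Y (map f' v)" for u v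
    unfolding map_append by (rule mprod_append[OF Y.is_monoid]) (use f' in auto)
  have sound: "mprod Y (map f' u) = mprod Y (map f' v)" if "word_cong R u v" for u v using that
  proof (induction rule: word_cong.induct)
    case (rel l r u v)
    then have "l \<in> lists S" "r \<in> lists S" using rels by auto
    then have "mprod Y (map f' l) = mprod Y (map f' r)" using R[OF rel] ff'[of l] ff'[of r] by metis
    then show ?case by (simp only: app)
  qed auto
  define \<theta> where "\<theta> C = mprod Y (map f' (SOME w. w \<in> C))" for C
  have \<theta>: "\<theta> (cls w) = mprod Y (map f' w)" if w: "w \<in> lists S" for w
  proof -
    have "(SOME u. u \<in> cls w) \<in> cls w" by (rule someI[of _ w]) (use w in \<open>auto simp: mem_cls intro: word_cong.refl\<close>)
    then have "word_cong R w (SOME u. u \<in> cls w)" using mem_cls by blast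
    from sound[OF this] show ?thesis unfolding \<theta>_def by simp
  qed
  have "\<theta> \<in> hom Q Y"
  proof (rule homI)
    fix x assume "x \<in> carrier Q"
    then obtain w where "w \<in> lists S" "x = cls w" unfolding carrier_iff by blast
    then show "\<theta> x \<in> carrier Y" using \<theta> cl by metis
  next
    fix x y assume "x \<in> carrier Q" "y \<in> carrier Q"
    then obtain u v where "u \<in> lists S" "x = cls u" "v \<in> lists S" "y = cls v" unfolding carrier_iff by blast
    then show "\<theta> (x \<otimes>\<^bsub>Q\<^esub> y) = \<theta> x \<otimes>\<^bsub>Y\<^esub> \<theta> y" using \<theta>[of u] \<theta>[of v] \<theta>[of "u @ v"] app[of u v] cls_mult[of u v]
      by (simp only: append_in_lists_conv)
  qed
  moreover have "\<theta> (cls w) = mprod Y (map f w)" if "w \<in> lists S" for w using \<theta>[OF that] ff'[OF that] by metis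
  ultimately show ?thesis by blast
qed

end

section \<open>Bases of free groups\<close>

definition letter :: "('a, 'c) monoid_scheme \<Rightarrow> ('x \<Rightarrow> 'a) \<Rightarrow> bool \<times> 'x \<Rightarrow> 'a"
  where "letter A e y = (if fst y then e (snd y) else inv\<^bsub>A\<^esub> e (snd y))"

definition ev :: "('a, 'c) monoid_scheme \<Rightarrow> ('x \<Rightarrow> 'a) \<Rightarrow> (bool \<times> 'x) list \<Rightarrow> 'a"
  where "ev A e w = mprod A (map (letter A e) w)"

text \<open>The universal property has to fix the type of the targets. Groups on the natural numbers cover all countable
  targets.\<close>

definition free_basis :: "('a, 'c) monoid_scheme \<Rightarrow> 'x set \<Rightarrow> ('x \<Rightarrow> 'a) \<Rightarrow> bool"
  where "free_basis A X e \<longleftrightarrow> group A \<and> e \<in> X \<rightarrow> carrier A \<and>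
    (\<forall>a\<in>carrier A. \<exists>w\<in>lists (UNIV \<times> X). a = ev A e w) \<and>
    (\<forall>(Y :: nat monoid) f. group Y \<longrightarrow> f \<in> X \<rightarrow> carrier Y \<longrightarrow> (\<exists>\<alpha>\<in>hom A Y. \<forall>x\<in>X. \<alpha> (e x) = f x))"

lemma iso_inv_into:
  assumes "t \<in> iso Y Y'" "group Y"
  shows "inv_into (carrier Y) t \<in> iso Y' Y" "\<And>y. y \<in> carrier Y \<Longrightarrow> inv_into (carrier Y) t (t y) = y"
  using group.iso_set_sym[OF assms(2,1)] assms(1) by (auto simp: iso_def bij_betw_def)

lemma letter_hom:
  assumes "\<alpha> \<in> hom A Y" "group A" "group Y" "e (snd y) \<in> carrier A"
  shows "\<alpha> (letter A e y) = letter Y (\<alpha> \<circ> e) y"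
proof -
  interpret h: group_hom A Y \<alpha> using assms by (simp add: group_hom_def group_hom_axioms_def)
  show ?thesis using assms(4) by (auto simp: letter_def)
qed

lemma letter_closed: "group A \<Longrightarrow> e (snd y) \<in> carrier A \<Longrightarrow> letter A e y \<in> carrier A"
  by (auto simp: letter_def group.inv_closed)

lemma mprod_hom:
  assumes "\<alpha> \<in> hom A Y" "group A" "group Y" "set xs \<subseteq> carrier A"
  shows "\<alpha> (mprod A xs) = mprod Y (map \<alpha> xs)"
proof -
  interpret h: group_hom A Y \<alpha> using assms by (simp add: group_hom_def group_hom_axioms_def)
  show ?thesis using assms(4) by (induction xs) (auto simp: mprod_closed[OF h.G.is_monoid])
qed

lemma ev_closed: "group A \<Longrightarrow> e \<in> X \<rightarrow> carrier A \<Longrightarrow> w \<in> lists (UNIV \<times> X) \<Longrightarrow> ev A e w \<in> carrier A"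
  unfolding ev_def by (rule mprod_closed) (auto simp: group.is_monoid intro!: letter_closed)

lemma ev_hom:
  assumes "\<alpha> \<in> hom A Y" "group A" "group Y" "e \<in> X \<rightarrow> carrier A" "w \<in> lists (UNIV \<times> X)"
  shows "\<alpha> (ev A e w) = ev Y (\<alpha> \<circ> e) w"
proof -
  have "\<alpha> (ev A e w) = mprod Y (map \<alpha> (map (letter A e) w))"
    unfolding ev_def by (rule mprod_hom[OF assms(1-3)]) (use assms in \<open>auto intro!: letter_closed\<close>)
  also have "map \<alpha> (map (letter A e) w) = map (letter Y (\<alpha> \<circ> e)) w"
    using assms(4,5) by (auto simp: Pi_iff intro!: letter_hom[OF assms(1-3)])
  finally show ?thesis by (simp add: ev_def)
qed

lemma free_basis_iso:
  assumes F: "free_basis F X e" and t: "t \<in> iso F A" and A: "group A"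
  shows "free_basis A X (t \<circ> e)"
proof -
  have gF: "group F" and e: "e \<in> X \<rightarrow> carrier F" using F by (auto simp: free_basis_def)
  have th: "t \<in> hom F A" and tb: "bij_betw t (carrier F) (carrier A)" using t by (auto simp: iso_def)
  show ?thesis unfolding free_basis_def
  proof (intro conjI ballI allI impI A)
    show "t \<circ> e \<in> X \<rightarrow> carrier A" using e th by (auto simp: hom_def Pi_iff)
  next
    fix a assume "a \<in> carrier A"
    then obtain b where b: "b \<in> carrier F" "a = t b" using tb by (auto simp: bij_betw_def)
    then obtain w where "w \<in> lists (UNIV \<times> X)" "b = ev F e w" using F unfolding free_basis_def by blast
    then show "\<exists>w\<in>lists (UNIV \<times> X). a = ev A (t \<circ> e) w" using b ev_hom[OF th gF A e] by blast
  next
    fix Y :: "nat monoid" and f assume Y: "group Y" "f \<in> X \<rightarrow> carrier Y"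
    then obtain \<alpha> where \<alpha>: "\<alpha> \<in> hom F Y" "\<And>x. x \<in> X \<Longrightarrow> \<alpha> (e x) = f x" using F unfolding free_basis_def by blast
    let ?u = "inv_into (carrier F) t"
    have "\<alpha> \<circ> ?u \<in> hom A Y"
      using iso_inv_into(1)[OF t gF] \<alpha>(1) by (auto simp: iso_def hom_def Pi_iff)
    moreover have "(\<alpha> \<circ> ?u) ((t \<circ> e) x) = f x" if "x \<in> X" for x
      using that iso_inv_into(2)[OF t gF] e \<alpha>(2) by (auto simp: Pi_iff)
    ultimately show "\<exists>\<alpha>\<in>hom A Y. \<forall>x\<in>X. \<alpha> ((t \<circ> e) x) = f x" by blast
  qed
qed

lemma free_basis_free_group_on: "\<exists>e. free_basis (free_group_on X) X e"
proof -
  define R where "R = {([(b, x), (\<not> b, x)], [] :: (bool \<times> 'a) list) | b x. x \<in> X}"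
  interpret presentation "UNIV \<times> X" R by unfold_locales (auto simp: R_def)
  have Q: "free_group_on X = Q" by (simp add: free_group_on_def R_def)
  have r: "word_cong R [(b, x), (\<not> b, x)] []" if "x \<in> X" for b x
    using word_cong.rel[of "[(b, x), (\<not> b, x)]" "[]" R "[]" "[]"] that by (auto simp: R_def)
  have gQ: "group Q"
  proof (rule group_Q)
    fix s :: "bool \<times> 'a" assume "s \<in> UNIV \<times> X"
    then show "\<exists>s'\<in>UNIV \<times> X. word_cong R [s', s] []"
      using r[of "snd s" "\<not> fst s"] by (intro bexI[of _ "(\<not> fst s, snd s)"]) auto
  qed
  define e where "e x = cls [(True, x)]" for x
  have eX: "e \<in> X \<rightarrow> carrier Q" by (auto simp: e_def)
  have letQ: "letter Q e y = cls [y]" if "snd y \<in> X" for y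
  proof (cases "fst y")
    case True then show ?thesis by (cases y) (auto simp: letter_def e_def)
  next
    case False
    then obtain x where y: "y = (False, x)" by (cases y) auto
    have "cls [(False, x)] \<otimes>\<^bsub>Q\<^esub> cls [(True, x)] = \<one>\<^bsub>Q\<^esub>"
      using that y r[of x False] by (simp add: cls_mult one_cls cls_eq_iff)
    then have "inv\<^bsub>Q\<^esub> cls [(True, x)] = cls [(False, x)]"
      using that y by (intro group.inv_equality[OF gQ]) auto
    then show ?thesis using y by (simp add: letter_def e_def)
  qed
  have "free_basis Q X e" unfolding free_basis_def
  proof (intro conjI ballI allI impI gQ eX)
    fix a assume "a \<in> carrier Q"
    then obtain w where w: "w \<in> lists (UNIV \<times> X)" "a = cls w" by (auto simp: carrier_iff)
    have "map (letter Q e) w = map (\<lambda>s. cls [s]) w" using w letQ by auto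
    then have "a = ev Q e w" using w cls_mprod[of w] unfolding ev_def by metis
    then show "\<exists>w\<in>lists (UNIV \<times> X). a = ev Q e w" using w(1) by blast
  next
    fix Y :: "nat monoid" and f assume Y: "group Y" "f \<in> X \<rightarrow> carrier Y"
    interpret Y: group Y by fact
    have "\<exists>\<theta>\<in>hom Q Y. \<forall>w\<in>lists (UNIV \<times> X). \<theta> (cls w) = mprod Y (map (letter Y f) w)"
    proof (rule universal[OF Y(1)])
      show "letter Y f \<in> UNIV \<times> X \<rightarrow> carrier Y" using Y(2) by (auto intro!: letter_closed[OF Y(1)])
      show "mprod Y (map (letter Y f) l) = mprod Y (map (letter Y f) r)" if "(l, r) \<in> R" for l r
        using that Y(2) by (auto simp: R_def letter_def Pi_iff)
    qed
    then obtain \<theta> where \<theta>: "\<theta> \<in> hom Q Y" "\<And>w. w \<in> lists (UNIV \<times> X) \<Longrightarrow> \<theta> (cls w) = mprod Y (map (letter Y f) w)" by blast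
    have "\<theta> (e x) = f x" if "x \<in> X" for x
      using \<theta>(2)[of "[(True, x)]"] that Y(2) by (auto simp: e_def letter_def Pi_iff)
    then show "\<exists>\<alpha>\<in>hom Q Y. \<forall>x\<in>X. \<alpha> (e x) = f x" using \<theta>(1) by blast
  qed
  then show ?thesis using Q by auto
qed

lemma free_group_basis:
  fixes A :: "('a, 'c) monoid_scheme"
  assumes "free_group A"
  obtains X :: "'a set" and e where "free_basis A X e"
proof -
  obtain X :: "'a set" where A: "group A" "A \<cong> free_group_on X" using assms by (auto simp: free_group_def)
  obtain e where e: "free_basis (free_group_on X) X e" using free_basis_free_group_on[of X] by blast
  then have g: "group (free_group_on X)" by (simp add: free_basis_def)
  obtain t where "t \<in> iso A (free_group_on X)" using A(2) by (auto simp: is_iso_def)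
  then have "inv_into (carrier A) t \<in> iso (free_group_on X) A" by (rule iso_inv_into(1)[OF _ A(1)])
  then have "free_basis A X (inv_into (carrier A) t \<circ> e)" by (rule free_basis_iso[OF e _ A(1)])
  then show ?thesis by (rule that)
qed

lemma free_basis_universal:
  assumes F: "free_basis A X e" and Y: "group Y" "countable (carrier Y)" and f: "f \<in> X \<rightarrow> carrier Y"
  shows "\<exists>\<alpha>\<in>hom A Y. \<forall>x\<in>X. \<alpha> (e x) = f x"
proof -
  obtain Y' :: "nat monoid" and t where t: "group Y'" "t \<in> iso Y Y'" using transport_nat[OF Y] by blast
  have "t \<circ> f \<in> X \<rightarrow> carrier Y'" using f t(2) by (auto simp: iso_def hom_def)
  then obtain \<alpha> where \<alpha>: "\<alpha> \<in> hom A Y'" "\<And>x. x \<in> X \<Longrightarrow> \<alpha> (e x) = t (f x)"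
    using F t(1) unfolding free_basis_def by (metis comp_apply)
  let ?u = "inv_into (carrier Y) t"
  have "?u \<circ> \<alpha> \<in> hom A Y" using iso_inv_into(1)[OF t(2) Y(1)] \<alpha>(1) by (auto simp: iso_def hom_def Pi_iff)
  moreover have "(?u \<circ> \<alpha>) (e x) = f x" if "x \<in> X" for x
    using that \<alpha>(2) iso_inv_into(2)[OF t(2) Y(1)] f by auto
  ultimately show ?thesis by blast
qed

section \<open>Amalgamated products of groups\<close>

text \<open>An amalgamated product along cyclic subgroups generated by \<open>h\<close> and \<open>k\<close>, characterised by its generators and
  its universal property. No presentation is fixed, so that one group can be seen as an amalgamated product in
  different ways.\<close>

locale amalgamation =
  A: group A + B: group B + G: group G
  for A :: "('a, 'ca) monoid_scheme" and B :: "('b, 'cb) monoid_scheme" and G :: "('g, 'cg) monoid_scheme" +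
  fixes \<iota>A :: "'a \<Rightarrow> 'g" and \<iota>B :: "'b \<Rightarrow> 'g" and h :: 'a and k :: 'b
  assumes homA: "\<iota>A \<in> hom A G" and homB: "\<iota>B \<in> hom B G"
    and h: "h \<in> carrier A" and k: "k \<in> carrier B" and glue: "\<iota>A h = \<iota>B k"
    and gen: "carrier G \<subseteq> generate G (\<iota>A ` carrier A \<union> \<iota>B ` carrier B)"
    and universal_nat: "\<And>(Y :: nat monoid) \<alpha> \<beta>. group Y \<Longrightarrow> \<alpha> \<in> hom A Y \<Longrightarrow> \<beta> \<in> hom B Y \<Longrightarrow> \<alpha> h = \<beta> k \<Longrightarrow>
      \<exists>\<theta>\<in>hom G Y. (\<forall>a\<in>carrier A. \<theta> (\<iota>A a) = \<alpha> a) \<and> (\<forall>b\<in>carrier B. \<theta> (\<iota>B b) = \<beta> b)"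
begin

sublocale hA: group_hom A G \<iota>A by unfold_locales (rule homA)
sublocale hB: group_hom B G \<iota>B by unfold_locales (rule homB)

lemma universal:
  assumes Y: "group Y" "countable (carrier Y)" and \<alpha>: "\<alpha> \<in> hom A Y" and \<beta>: "\<beta> \<in> hom B Y" and eq: "\<alpha> h = \<beta> k"
  shows "\<exists>\<theta>\<in>hom G Y. (\<forall>a\<in>carrier A. \<theta> (\<iota>A a) = \<alpha> a) \<and> (\<forall>b\<in>carrier B. \<theta> (\<iota>B b) = \<beta> b)"
proof -
  obtain Y' :: "nat monoid" and t where t: "group Y'" "t \<in> iso Y Y'" using transport_nat[OF Y] by blast
  have th: "t \<in> hom Y Y'" using t(2) by (simp add: iso_def)
  obtain \<theta> where \<theta>: "\<theta> \<in> hom G Y'" "\<And>a. a \<in> carrier A \<Longrightarrow> \<theta> (\<iota>A a) = t (\<alpha> a)" "\<And>b. b \<in> carrier B \<Longrightarrow> \<theta> (\<iota>B b) = t (\<beta> b)"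
    using universal_nat[OF t(1) Group.hom_compose[OF \<alpha> th] Group.hom_compose[OF \<beta> th]] eq by auto
  let ?u = "inv_into (carrier Y) t"
  have "?u \<circ> \<theta> \<in> hom G Y" using iso_inv_into(1)[OF t(2) Y(1)] \<theta>(1) by (auto simp: iso_def hom_def Pi_iff)
  moreover have "(?u \<circ> \<theta>) (\<iota>A a) = \<alpha> a" if "a \<in> carrier A" for a
    using that \<theta>(2) iso_inv_into(2)[OF t(2) Y(1)] \<alpha> by (auto simp: hom_def)
  moreover have "(?u \<circ> \<theta>) (\<iota>B b) = \<beta> b" if "b \<in> carrier B" for b
    using that \<theta>(3) iso_inv_into(2)[OF t(2) Y(1)] \<beta> by (auto simp: hom_def)
  ultimately show ?thesis by blast
qed

lemma swap: "amalgamation B A G \<iota>B \<iota>A k h"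
proof unfold_locales
  show "carrier G \<subseteq> generate G (\<iota>B ` carrier B \<union> \<iota>A ` carrier A)" using gen by (simp add: Un_commute)
  fix Y :: "nat monoid" and \<alpha> \<beta> assume "group Y" "\<alpha> \<in> hom B Y" "\<beta> \<in> hom A Y" "\<alpha> k = \<beta> h"
  then show "\<exists>\<theta>\<in>hom G Y. (\<forall>a\<in>carrier B. \<theta> (\<iota>B a) = \<alpha> a) \<and> (\<forall>b\<in>carrier A. \<theta> (\<iota>A b) = \<beta> b)"
    using universal_nat[of Y \<beta> \<alpha>] by auto
qed (use homA homB h k glue in auto)

end

text \<open>The presented group, with a universal property for targets of arbitrary type.\<close>

locale amalgam_data = A: group A + B: group B
  for A :: "('a, 'ca) monoid_scheme" and B :: "('b, 'cb) monoid_scheme" +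
  fixes H :: "'a set" and \<phi> :: "'a \<Rightarrow> 'b"
  assumes H: "H \<subseteq> carrier A" and \<phi>: "\<phi> \<in> H \<rightarrow> carrier B"
begin

lemma Plus_iff [simp]: "Inl a \<in> Sum_Type.Plus P R \<longleftrightarrow> a \<in> P" "Inr b \<in> Sum_Type.Plus P R \<longleftrightarrow> b \<in> R"
  by auto

sublocale presentation "Sum_Type.Plus (carrier A) (carrier B)" "amalgam_rels A B H \<phi>"
  by unfold_locales (use H \<phi> in \<open>auto simp: amalgam_rels_def Pi_iff\<close>)

definition "inA a = cls [Inl a]"
definition "inB b = cls [Inr b]"

lemma amalgam_Q: "amalgam A B H \<phi> = Q" by (simp add: amalgam_def)

lemma word_cong_rel: "(l, r) \<in> amalgam_rels A B H \<phi> \<Longrightarrow> word_cong (amalgam_rels A B H \<phi>) l r"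
  using word_cong.rel[of l r _ "[]" "[]"] by simp

lemma rel_A: "x \<in> carrier A \<Longrightarrow> y \<in> carrier A \<Longrightarrow> word_cong (amalgam_rels A B H \<phi>) [Inl x, Inl y] [Inl (x \<otimes>\<^bsub>A\<^esub> y)]"
  by (rule word_cong_rel) (auto simp: amalgam_rels_def)

lemma rel_B: "x \<in> carrier B \<Longrightarrow> y \<in> carrier B \<Longrightarrow> word_cong (amalgam_rels A B H \<phi>) [Inr x, Inr y] [Inr (x \<otimes>\<^bsub>B\<^esub> y)]"
  by (rule word_cong_rel) (auto simp: amalgam_rels_def)

lemma rel_one: "word_cong (amalgam_rels A B H \<phi>) [Inl \<one>\<^bsub>A\<^esub>] []" "word_cong (amalgam_rels A B H \<phi>) [Inr \<one>\<^bsub>B\<^esub>] []"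
  by (rule word_cong_rel, simp add: amalgam_rels_def)+

lemma amalgam_group: "group Q"
proof (rule group_Q)
  fix s assume "s \<in> Sum_Type.Plus (carrier A) (carrier B)"
  then consider (l) a where "s = Inl a" "a \<in> carrier A" | (r) b where "s = Inr b" "b \<in> carrier B" by auto
  then show "\<exists>s'\<in>Sum_Type.Plus (carrier A) (carrier B). word_cong (amalgam_rels A B H \<phi>) [s', s] []"
  proof cases
    case l
    then show ?thesis using rel_A[of "inv\<^bsub>A\<^esub> a" a] rel_one word_cong.trans
      by (intro bexI[of _ "Inl (inv\<^bsub>A\<^esub> a)"]) auto
  next
    case r
    then show ?thesis using rel_B[of "inv\<^bsub>B\<^esub> b" b] rel_one word_cong.trans
      by (intro bexI[of _ "Inr (inv\<^bsub>B\<^esub> b)"]) auto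
  qed
qed

lemma in_hom: "inA \<in> hom A Q" "inB \<in> hom B Q"
proof -
  have "cls [Inl (x \<otimes>\<^bsub>A\<^esub> y)] = cls [Inl x] \<otimes>\<^bsub>Q\<^esub> cls [Inl y]" if "x \<in> carrier A" "y \<in> carrier A" for x y
    using that rel_A[OF that] by (simp add: cls_mult cls_eq_iff word_cong.sym)
  moreover have "cls [Inr (x \<otimes>\<^bsub>B\<^esub> y)] = cls [Inr x] \<otimes>\<^bsub>Q\<^esub> cls [Inr y]" if "x \<in> carrier B" "y \<in> carrier B" for x y
    using that rel_B[OF that] by (simp add: cls_mult cls_eq_iff word_cong.sym)
  ultimately show "inA \<in> hom A Q" "inB \<in> hom B Q" unfolding inA_def inB_def by (auto intro!: homI cls_carrier)
qed

lemma in_glue: "x \<in> H \<Longrightarrow> inA x = inB (\<phi> x)"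
proof -
  assume x: "x \<in> H"
  then have "([Inl x], [Inr (\<phi> x)]) \<in> amalgam_rels A B H \<phi>" by (auto simp: amalgam_rels_def)
  then have "word_cong (amalgam_rels A B H \<phi>) [Inl x] [Inr (\<phi> x)]" by (rule word_cong_rel)
  moreover have "x \<in> carrier A" "\<phi> x \<in> carrier B" using x H \<phi> by auto
  ultimately show "inA x = inB (\<phi> x)" by (simp add: inA_def inB_def cls_eq_iff)
qed

lemma in_gen: "carrier Q \<subseteq> generate Q (inA ` carrier A \<union> inB ` carrier B)"
proof
  fix x assume "x \<in> carrier Q"
  then obtain w where w: "w \<in> lists (Sum_Type.Plus (carrier A) (carrier B))" "x = cls w" by (auto simp: carrier_iff)
  have "cls w \<in> generate Q (inA ` carrier A \<union> inB ` carrier B)" using w(1)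
  proof (induction w)
    case Nil then show ?case using generate.one[of Q] by (simp add: one_cls)
  next
    case (Cons s w)
    then have "cls [s] \<in> inA ` carrier A \<union> inB ` carrier B" by (auto simp: inA_def inB_def)
    then have "cls [s] \<otimes>\<^bsub>Q\<^esub> cls w \<in> generate Q (inA ` carrier A \<union> inB ` carrier B)"
      using Cons.IH by (intro generate.eng[OF generate.incl])
    moreover have "cls [s] \<otimes>\<^bsub>Q\<^esub> cls w = cls (s # w)" using cls_mult[of "[s]" w] Cons.hyps by simp
    ultimately show ?case by simp
  qed
  then show "x \<in> generate Q (inA ` carrier A \<union> inB ` carrier B)" using w by simp
qed

lemma amalgam_universal:
  assumes Y: "group Y" and \<alpha>: "\<alpha> \<in> hom A Y" and \<beta>: "\<beta> \<in> hom B Y" and eq: "\<And>x. x \<in> H \<Longrightarrow> \<alpha> x = \<beta> (\<phi> x)"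
  shows "\<exists>\<theta>\<in>hom Q Y. (\<forall>a\<in>carrier A. \<theta> (inA a) = \<alpha> a) \<and> (\<forall>b\<in>carrier B. \<theta> (inB b) = \<beta> b)"
proof -
  interpret a: group_hom A Y \<alpha> using A.is_group Y \<alpha> by (simp add: group_hom_def group_hom_axioms_def)
  interpret b: group_hom B Y \<beta> using B.is_group Y \<beta> by (simp add: group_hom_def group_hom_axioms_def)
  have "\<exists>\<theta>\<in>hom Q Y. \<forall>w\<in>lists (Sum_Type.Plus (carrier A) (carrier B)). \<theta> (cls w) = mprod Y (map (case_sum \<alpha> \<beta>) w)"
  proof (rule universal[OF Y])
    show "case_sum \<alpha> \<beta> \<in> Sum_Type.Plus (carrier A) (carrier B) \<rightarrow> carrier Y" by auto
    show "mprod Y (map (case_sum \<alpha> \<beta>) l) = mprod Y (map (case_sum \<alpha> \<beta>) r)" if "(l, r) \<in> amalgam_rels A B H \<phi>" for l r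
      using that eq H \<phi> by (auto simp: amalgam_rels_def Pi_iff subset_iff)
  qed
  then obtain \<theta> where \<theta>: "\<theta> \<in> hom Q Y"
    "\<And>w. w \<in> lists (Sum_Type.Plus (carrier A) (carrier B)) \<Longrightarrow> \<theta> (cls w) = mprod Y (map (case_sum \<alpha> \<beta>) w)" by blast
  have "\<theta> (inA a) = \<alpha> a" if "a \<in> carrier A" for a using \<theta>(2)[of "[Inl a]"] that by (simp add: inA_def)
  moreover have "\<theta> (inB b) = \<beta> b" if "b \<in> carrier B" for b using \<theta>(2)[of "[Inr b]"] that by (simp add: inB_def)
  ultimately show ?thesis using \<theta>(1) by blast
qed

text \<open>As \<open>H\<close> is cyclic, the single relation \<open>h = \<phi> h\<close> implies the relations \<open>x = \<phi> x\<close> for all \<open>x\<close> in \<open>H\<close>.\<close>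

lemma amalgam_amalgamation:
  assumes h: "h \<in> carrier A" "H = generate A {h}" and \<phi>h: "\<phi> \<in> hom (A\<lparr>carrier := H\<rparr>) B"
  shows "amalgamation A B (amalgam A B H \<phi>) inA inB h (\<phi> h)"
proof -
  interpret Q: group Q by (rule amalgam_group)
  have hH: "h \<in> H" using h by (auto intro: generate.incl)
  show ?thesis unfolding amalgam_Q
  proof unfold_locales
    show "\<phi> h \<in> carrier B" using \<phi> hH by auto
    show "inA h = inB (\<phi> h)" by (rule in_glue[OF hH])
    fix Y :: "nat monoid" and \<alpha> \<beta> assume Y: "group Y" "\<alpha> \<in> hom A Y" "\<beta> \<in> hom B Y" "\<alpha> h = \<beta> (\<phi> h)"
    interpret a: group_hom A Y \<alpha> using A.is_group Y by (simp add: group_hom_def group_hom_axioms_def)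
    interpret b: group_hom B Y \<beta> using B.is_group Y by (simp add: group_hom_def group_hom_axioms_def)
    have sub: "subgroup H A" using h A.generate_is_subgroup by simp
    interpret f: group_hom "A\<lparr>carrier := H\<rparr>" B \<phi>
      using \<phi>h B.is_group subgroup.subgroup_is_group[OF sub A.is_group] by (simp add: group_hom_def group_hom_axioms_def)
    have "\<alpha> x = \<beta> (\<phi> x)" if xH: "x \<in> H" for x
    proof -
      obtain i :: int where i: "x = h [^]\<^bsub>A\<^esub> i" using xH unfolding h(2) A.generate_pow[OF h(1)] by blast
      have "\<phi> x = \<phi> h [^]\<^bsub>B\<^esub> i" using f.hom_int_pow[of h i] hH i A.int_pow_consistent[OF sub hH, of i] by simp
      then show ?thesis using i h Y(4) \<phi> hH by (auto simp: a.hom_int_pow b.hom_int_pow Pi_iff)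
    qed
    then show "\<exists>\<theta>\<in>hom Q Y. (\<forall>a\<in>carrier A. \<theta> (inA a) = \<alpha> a) \<and> (\<forall>b\<in>carrier B. \<theta> (inB b) = \<beta> b)"
      by (rule amalgam_universal[OF Y(1-3)])
  qed (use h in_hom in_gen in auto)
qed

end

section \<open>Groups separated by unitriangular representations\<close>

definition ut_separated :: "nat \<Rightarrow> ('a, 'c) monoid_scheme \<Rightarrow> bool"
  where "ut_separated p G \<longleftrightarrow> (\<forall>a\<in>carrier G. a \<noteq> \<one>\<^bsub>G\<^esub> \<longrightarrow> (\<exists>r. \<exists>\<tau>\<in>hom G (ut p r). \<tau> a \<noteq> \<one>\<^bsub>ut p r\<^esub>))"

text \<open>There are finite \<open>p\<close>-quotients in which the image of \<open>h\<close> is central and of arbitrarily large order.\<close>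

definition central_mod_p :: "nat \<Rightarrow> ('a, 'c) monoid_scheme \<Rightarrow> 'a \<Rightarrow> bool"
  where "central_mod_p p G h \<longleftrightarrow> (\<forall>e. \<exists>N. p_open p G N \<and>
    (\<forall>g\<in>carrier G. g \<otimes>\<^bsub>G\<^esub> h \<otimes>\<^bsub>G\<^esub> inv\<^bsub>G\<^esub> g \<otimes>\<^bsub>G\<^esub> inv\<^bsub>G\<^esub> h \<in> N) \<and>
    (\<forall>i::int. h [^]\<^bsub>G\<^esub> i \<in> N \<longrightarrow> int p ^ e dvd i))"

text \<open>A matrix whose only entry above the diagonal is in the last column of the first row; these matrices are central.\<close>

definition corner :: "nat \<Rightarrow> rat \<Rightarrow> nat \<Rightarrow> nat \<Rightarrow> rat"
  where "corner r c i j = (if i = 0 \<and> 0 < j \<and> Suc j = r then c else 0)"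

context
  fixes p :: nat
  assumes prime: "Factorial_Ring.prime p"
begin

lemma corner_closed: "p_integral p c \<Longrightarrow> corner r c \<in> carrier (ut p r)"
  by (auto simp: ut_carrier corner_def p_integral_0[OF prime])

lemma corner_mult: "M \<in> carrier (ut p r) \<Longrightarrow> umult M (corner r c) = (\<lambda>i j. M i j + corner r c i j)"
  "M \<in> carrier (ut p r) \<Longrightarrow> umult (corner r c) M = (\<lambda>i j. M i j + corner r c i j)"
proof -
  assume M: "M \<in> carrier (ut p r)"
  have "(\<Sum>l\<in>{i<..<j}. M i l * corner r c l j) = 0" for i j by (rule sum.neutral) (auto simp: corner_def)
  then show "umult M (corner r c) = (\<lambda>i j. M i j + corner r c i j)" by (auto simp: umult_def fun_eq_iff)
  have "(\<Sum>l\<in>{i<..<j}. corner r c i l * M l j) = 0" for i j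
  proof (rule sum.neutral, rule ballI)
    fix l assume l: "l \<in> {i<..<j}"
    then have "\<not> (l < j \<and> j < r) \<or> Suc l \<noteq> r" by auto
    then show "corner r c i l * M l j = 0" using M unfolding ut_carrier corner_def by auto
  qed
  then show "umult (corner r c) M = (\<lambda>i j. M i j + corner r c i j)" by (auto simp: umult_def fun_eq_iff)
qed

lemma corner_pow: assumes c: "p_integral p c" shows "corner r c [^]\<^bsub>ut p r\<^esub> (n::nat) = corner r (of_nat n * c)"
    "corner r c [^]\<^bsub>ut p r\<^esub> (z::int) = corner r (of_int z * c)"
proof -
  interpret group "ut p r" by (rule ut_group[OF prime])
  have 0: "corner r 0 = \<one>\<^bsub>ut p r\<^esub>" by (auto simp: corner_def ut_one fun_eq_iff)
  have add: "corner r a \<otimes>\<^bsub>ut p r\<^esub> corner r b = corner r (a + b)" if "p_integral p a" for a b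
    using corner_mult(1)[OF corner_closed[OF that]] by (auto simp: ut_mult corner_def fun_eq_iff)
  show n: "corner r c [^]\<^bsub>ut p r\<^esub> (n::nat) = corner r (of_nat n * c)" for n
  proof (induction n)
    case 0 then show ?case by (simp add: \<open>corner r 0 = \<one>\<^bsub>ut p r\<^esub>\<close>)
  next
    case (Suc n)
    then show ?case using add[OF p_integral_mult[OF prime p_integral_of_nat[OF prime] c], of n c] by (simp add: algebra_simps)
  qed
  show "corner r c [^]\<^bsub>ut p r\<^esub> (z::int) = corner r (of_int z * c)"
  proof (cases z)
    case (nonneg n) then show ?thesis by (simp add: int_pow_int n)
  next
    case (neg n)
    have i: "p_integral p (of_nat (Suc n) * c)" by (intro p_integral_mult[OF prime] c p_integral_of_nat[OF prime])
    have "inv\<^bsub>ut p r\<^esub> corner r (of_nat (Suc n) * c) = corner r (- (of_nat (Suc n) * c))"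
      using i p_integral_uminus[OF prime i] by (intro inv_equality corner_closed) (simp_all add: add 0)
    then have "corner r c [^]\<^bsub>ut p r\<^esub> z = corner r (- (of_nat (Suc n) * c))"
      unfolding neg int_pow_neg_int[OF corner_closed[OF c]] n .
    also have "- (of_nat (Suc n) * c) = of_int z * c" by (simp add: neg algebra_simps)
    finally show ?thesis .
  qed
qed

lemma p_mult_scale:
  assumes "c \<noteq> 0" "p_integral p c"
  shows "\<exists>k. \<forall>n::int. p_mult p k (of_int n * c) \<longrightarrow> int p ^ e dvd n"
proof -
  note pp = prime_int_p[OF prime]
  obtain a b where 1: "\<not> int p dvd b" "c = of_int a / of_int b" using assms(2) by (auto simp: p_integral_def)
  have nz: "b \<noteq> 0" "a \<noteq> 0" using 1 assms(1) by auto
  obtain v a' where a': "a = int p ^ v * a'" "\<not> int p dvd a'"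
    using multiplicity_decompose'[OF nz(2), of "int p"] pp by (metis not_prime_unit)
  have "int p ^ e dvd n" if "p_mult p (v + e) (of_int n * c)" for n
  proof -
    have "p_mult p (v + e) (of_int b * (of_int n * c))"
      using p_ideal_times(1)[OF prime p_ideal_mult[OF prime], of "of_int n * c" "v + e" "of_int b"] that p_integral_of_int[OF prime] by simp
    then have "p_mult p (v + e) (of_int (n * a))" using nz 1 by simp
    then have "int p ^ (v + e) dvd n * a" using p_mult_of_int[OF prime] by blast
    then have "int p ^ v * int p ^ e dvd int p ^ v * (n * a')" by (simp add: power_add a' mult.left_commute)
    moreover have "int p ^ v \<noteq> 0" using pp by (metis not_prime_0 power_not_zero)
    ultimately have "int p ^ e dvd n * a'" by (metis dvd_mult_cancel_left)
    moreover have "coprime (int p ^ e) a'" using prime_imp_coprime[OF pp a'(2)] by simp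
    ultimately show ?thesis using coprime_dvd_mult_left_iff by blast
  qed
  then show ?thesis by blast
qed

lemma central_if_corner:
  assumes G: "group G" and h: "h \<in> carrier G" and \<tau>: "\<tau> \<in> hom G (ut p r)"
    and c: "\<tau> h = corner r c" "p_integral p c" "c \<noteq> 0" and r: "r \<ge> 2"
  shows "central_mod_p p G h"
  unfolding central_mod_p_def
proof
  fix e
  interpret U: group "ut p r" by (rule ut_group[OF prime])
  interpret t: group_hom G "ut p r" \<tau> using G \<tau> U.is_group by (simp add: group_hom_def group_hom_axioms_def)
  obtain k where k: "\<And>n::int. p_mult p k (of_int n * c) \<Longrightarrow> int p ^ e dvd n" using p_mult_scale[OF c(3,2)] by blast
  let ?N = "{g \<in> carrier G. \<tau> g \<in> ut_cong p r k}"
  have N: "p_open p G ?N" by (rule p_open_vimage[OF \<tau> G ut_cong_open[OF prime]])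
  interpret UN: normal "ut_cong p r k" "ut p r" using p_openD[OF ut_cong_open[OF prime]] by blast
  have "g \<otimes>\<^bsub>G\<^esub> h \<otimes>\<^bsub>G\<^esub> inv\<^bsub>G\<^esub> g \<otimes>\<^bsub>G\<^esub> inv\<^bsub>G\<^esub> h \<in> ?N" if g: "g \<in> carrier G" for g
  proof -
    have "\<tau> g \<otimes>\<^bsub>ut p r\<^esub> \<tau> h = \<tau> h \<otimes>\<^bsub>ut p r\<^esub> \<tau> g"
      using corner_mult[of "\<tau> g" r c] g by (simp add: ut_mult c(1))
    then have "\<tau> g \<otimes>\<^bsub>ut p r\<^esub> \<tau> h \<otimes>\<^bsub>ut p r\<^esub> inv\<^bsub>ut p r\<^esub> \<tau> g = \<tau> h"
      using g h by (metis U.inv_solve_right t.hom_closed U.m_closed)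
    then have "\<tau> (g \<otimes>\<^bsub>G\<^esub> h \<otimes>\<^bsub>G\<^esub> inv\<^bsub>G\<^esub> g \<otimes>\<^bsub>G\<^esub> inv\<^bsub>G\<^esub> h) = \<one>\<^bsub>ut p r\<^esub>" using g h by simp
    then show ?thesis using g h UN.one_closed by simp
  qed
  moreover have "int p ^ e dvd i" if "h [^]\<^bsub>G\<^esub> i \<in> ?N" for i :: int
  proof (rule k)
    have "corner r (of_int i * c) \<in> ut_cong p r k" using that h by (simp add: t.hom_int_pow c(1) corner_pow[OF c(2)])
    then have "p_mult p k (corner r (of_int i * c) 0 (r - 1))" unfolding ut_cong_def by blast
    then show "p_mult p k (of_int i * c)" using r by (simp add: corner_def)
  qed
  ultimately show "\<exists>N. p_open p G N \<and> (\<forall>g\<in>carrier G. g \<otimes>\<^bsub>G\<^esub> h \<otimes>\<^bsub>G\<^esub> inv\<^bsub>G\<^esub> g \<otimes>\<^bsub>G\<^esub> inv\<^bsub>G\<^esub> h \<in> N) \<and>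
    (\<forall>i::int. h [^]\<^bsub>G\<^esub> i \<in> N \<longrightarrow> int p ^ e dvd i)" using N by blast
qed

text \<open>Take a representation of minimal size \<open>r\<close> in which \<open>h\<close> is not trivial. Deleting the last row and column, or the first
  ones, yields representations of size \<open>r - 1\<close>, so they send \<open>h\<close> to the identity, which leaves only the corner entry.\<close>

lemma corner_representation:
  assumes G: "group G" and us: "ut_separated p G" and h: "h \<in> carrier G" "h \<noteq> \<one>\<^bsub>G\<^esub>"
  obtains r \<tau> c where "\<tau> \<in> hom G (ut p r)" "\<tau> h = corner r c" "p_integral p c" "c \<noteq> 0" "r \<ge> 2"
proof -
  define P where "P r \<longleftrightarrow> (\<exists>\<tau>\<in>hom G (ut p r). \<tau> h \<noteq> \<one>\<^bsub>ut p r\<^esub>)" for r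
  have "\<exists>r. P r" using us h unfolding ut_separated_def P_def by blast
  define r where "r = (LEAST r. P r)"
  have "P r" unfolding r_def by (rule LeastI_ex) fact
  then obtain \<tau> where \<tau>: "\<tau> \<in> hom G (ut p r)" "\<tau> h \<noteq> \<one>\<^bsub>ut p r\<^esub>" unfolding P_def by blast
  have th: "\<tau> h \<in> carrier (ut p r)" using \<tau>(1) h by (auto simp: hom_def)
  obtain i0 j0 where ij0: "\<tau> h i0 j0 \<noteq> 0" using \<tau>(2) by (auto simp: ut_one fun_eq_iff)
  have r2: "r \<ge> 2"
  proof -
    have "i0 < j0 \<and> j0 < r" using ij0 th unfolding ut_carrier by blast
    then show ?thesis by linarith
  qed
  have small: "\<sigma> (\<tau> h) = \<one>\<^bsub>ut p (r - 1)\<^esub>" if "\<sigma> \<in> hom (ut p r) (ut p (r - 1))" for \<sigma>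
  proof (rule ccontr)
    assume "\<sigma> (\<tau> h) \<noteq> \<one>\<^bsub>ut p (r - 1)\<^esub>"
    moreover have "\<sigma> \<circ> \<tau> \<in> hom G (ut p (r - 1))" by (rule Group.hom_compose[OF \<tau>(1) that])
    ultimately have "P (r - 1)" unfolding P_def by (intro bexI[of _ "\<sigma> \<circ> \<tau>"]) auto
    then have "r \<le> r - 1" unfolding r_def by (rule Least_le)
    then show False using r2 by linarith
  qed
  have up: "(\<lambda>M i j. if j < r - 1 then M i j else 0) \<in> hom (ut p r) (ut p (r - 1))"
  proof (rule homI)
    fix M assume "M \<in> carrier (ut p r)"
    then show "(\<lambda>i j. if j < r - 1 then M i j else 0) \<in> carrier (ut p (r - 1))"
      by (auto simp: ut_carrier p_integral_0[OF prime])
  next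
    fix M N assume MN: "M \<in> carrier (ut p r)" "N \<in> carrier (ut p r)"
    show "(\<lambda>i j. if j < r - 1 then (M \<otimes>\<^bsub>ut p r\<^esub> N) i j else 0) =
      (\<lambda>i j. if j < r - 1 then M i j else 0) \<otimes>\<^bsub>ut p (r - 1)\<^esub> (\<lambda>i j. if j < r - 1 then N i j else 0)"
      by (auto simp: ut_mult umult_def fun_eq_iff intro!: sum.cong)
  qed
  have low: "(\<lambda>M i j. M (Suc i) (Suc j)) \<in> hom (ut p r) (ut p (r - 1))"
  proof (rule homI)
    fix M assume "M \<in> carrier (ut p r)"
    moreover have "\<not> (Suc i < Suc j \<and> Suc j < r)" if "\<not> (i < j \<and> j < r - 1)" for i j using that by linarith
    ultimately show "(\<lambda>i j. M (Suc i) (Suc j)) \<in> carrier (ut p (r - 1))" unfolding ut_carrier by blast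
  next
    fix M N assume MN: "M \<in> carrier (ut p r)" "N \<in> carrier (ut p r)"
    have "(\<Sum>l\<in>{Suc i<..<Suc j}. M (Suc i) l * N l (Suc j)) = (\<Sum>l\<in>{i<..<j}. M (Suc i) (Suc l) * N (Suc l) (Suc j))" for i j
      by (rule sum.reindex_bij_witness[of _ Suc "\<lambda>l. l - 1"]) auto
    then show "(\<lambda>i j. (M \<otimes>\<^bsub>ut p r\<^esub> N) (Suc i) (Suc j)) =
      (\<lambda>i j. M (Suc i) (Suc j)) \<otimes>\<^bsub>ut p (r - 1)\<^esub> (\<lambda>i j. N (Suc i) (Suc j))"
      by (auto simp: ut_mult umult_def fun_eq_iff)
  qed
  have z1: "\<tau> h i j = 0" if "j < r - 1" for i j

  proof -
    have "(\<lambda>M i j. if j < r - 1 then M i j else 0) (\<tau> h) i j = \<one>\<^bsub>ut p (r - 1)\<^esub> i j" by (rule fun_cong[OF fun_cong[OF small[OF up]]])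
    then show ?thesis using that by (simp add: ut_one)
  qed
  have z2: "\<tau> h (Suc i) (Suc j) = 0" for i j

  proof -
    have "(\<lambda>M i j. M (Suc i) (Suc j)) (\<tau> h) i j = \<one>\<^bsub>ut p (r - 1)\<^esub> i j" by (rule fun_cong[OF fun_cong[OF small[OF low]]])
    then show ?thesis by (simp add: ut_one)
  qed
  have "\<tau> h i j = corner r (\<tau> h 0 (r - 1)) i j" for i j
  proof (cases "i = 0 \<and> Suc j = r")
    case True then show ?thesis using r2 by (auto simp: corner_def)
  next
    case False
    have "\<tau> h i j = 0"
    proof (cases "i < j \<and> j < r")
      case True
      show ?thesis
      proof (cases i)
        case 0
        then have "j < r - 1" using True False by linarith
        then show ?thesis by (rule z1)
      next
        case (Suc i')
        then show ?thesis using True z2[of i' "j - 1"] by simp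
      qed
    next
      case False then show ?thesis using th unfolding ut_carrier by blast
    qed
    then show ?thesis using False by (auto simp: corner_def)
  qed
  then have eq: "\<tau> h = corner r (\<tau> h 0 (r - 1))" by (intro ext)
  moreover have "\<tau> h 0 (r - 1) \<noteq> 0"
  proof
    assume "\<tau> h 0 (r - 1) = 0"
    then have "corner r (\<tau> h 0 (r - 1)) = \<one>\<^bsub>ut p r\<^esub>" by (auto simp: corner_def ut_one fun_eq_iff)
    then show False using \<tau>(2) eq by metis
  qed
  moreover have "p_integral p (\<tau> h 0 (r - 1))" using th unfolding ut_carrier by blast
  ultimately show ?thesis using that \<tau>(1) r2 by blast
qed

lemma ut_separated_residually_p: "group G \<Longrightarrow> ut_separated p G \<Longrightarrow> residually_p p G"
  unfolding residually_p_def
proof (intro ballI impI)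
  fix g assume G: "group G" "ut_separated p G" and g: "g \<in> carrier G" "g \<noteq> \<one>\<^bsub>G\<^esub>"
  obtain r \<tau> where \<tau>: "\<tau> \<in> hom G (ut p r)" "\<tau> g \<noteq> \<one>\<^bsub>ut p r\<^esub>" using G(2) g unfolding ut_separated_def by blast
  obtain k where "g \<notin> {g \<in> carrier G. \<tau> g \<in> ut_cong p r k}" using ut_detects(1)[OF prime G(1) \<tau>(1) g(1) \<tau>(2)] by blast
  then show "\<exists>N. p_open p G N \<and> g \<notin> N" using p_open_vimage[OF \<tau>(1) G(1) ut_cong_open[OF prime]] by blast
qed

lemma tame_at_one:
  assumes "group G" "residually_p p G" shows "tame_closure_at p G \<one>\<^bsub>G\<^esub>"
  unfolding tame_closure_at_def
proof (intro ballI impI)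
  interpret group G by fact
  fix g assume g: "g \<in> carrier G" "in_cyclic_closure p G \<one>\<^bsub>G\<^esub> g"
  have "g = \<one>\<^bsub>G\<^esub>"
  proof (rule ccontr)
    assume "g \<noteq> \<one>\<^bsub>G\<^esub>"
    then obtain N where "p_open p G N" "g \<notin> N" using assms(2) g(1) unfolding residually_p_def by blast
    then show False using g unfolding in_cyclic_closure_def by auto
  qed
  moreover have "\<not> int p dvd 1" using prime_int_p[OF prime] not_prime_unit by blast
  ultimately show "\<exists>x y::int. \<not> int p dvd x \<and> g [^]\<^bsub>G\<^esub> x = \<one>\<^bsub>G\<^esub> [^]\<^bsub>G\<^esub> y" by (intro exI[of _ 1] exI[of _ 0]) simp
qed

lemma ut_separated_tame:
  assumes "group G" "ut_separated p G" "c \<in> carrier G" shows "tame_closure_at p G c"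
proof (cases "c = \<one>\<^bsub>G\<^esub>")
  case True then show ?thesis using tame_at_one[OF assms(1) ut_separated_residually_p[OF assms(1,2)]] by simp
next
  case False
  then obtain r \<tau> where "\<tau> \<in> hom G (ut p r)" "\<tau> c \<noteq> \<one>\<^bsub>ut p r\<^esub>" using assms unfolding ut_separated_def by blast
  then show ?thesis by (rule ut_detects(2)[OF prime assms(1) _ assms(3) _ ut_separated_residually_p[OF assms(1,2)]])
qed

text \<open>Roots are unique because they are unique in all unitriangular groups.\<close>

lemma ut_separated_root_unique:
  assumes G: "group G" "ut_separated p G" and ab: "a \<in> carrier G" "b \<in> carrier G"
    and s: "s \<noteq> 0" and eq: "a [^]\<^bsub>G\<^esub> (s::int) = b [^]\<^bsub>G\<^esub> s"
  shows "a = b"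
proof (rule ccontr)
  assume ne: "a \<noteq> b"
  interpret group G by fact
  have "a \<otimes>\<^bsub>G\<^esub> inv\<^bsub>G\<^esub> b \<noteq> \<one>\<^bsub>G\<^esub>" using ne ab by (metis inv_closed inv_equality inv_inv)
  then obtain r \<tau> where \<tau>: "\<tau> \<in> hom G (ut p r)" "\<tau> (a \<otimes>\<^bsub>G\<^esub> inv\<^bsub>G\<^esub> b) \<noteq> \<one>\<^bsub>ut p r\<^esub>"
    using G(2) ab unfolding ut_separated_def by (meson inv_closed m_closed)
  interpret U: group "ut p r" by (rule ut_group[OF prime])
  interpret t: group_hom G "ut p r" \<tau> using G \<tau> U.is_group by (simp add: group_hom_def group_hom_axioms_def)
  obtain n :: nat where n: "n > 0" "s = int n \<or> s = - int n" 
    by (rule that[of "nat \<bar>s\<bar>"]) (use s in auto)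
  have "a [^]\<^bsub>G\<^esub> n = b [^]\<^bsub>G\<^esub> n"
    using n(2)
  proof
    assume "s = int n" then show ?thesis using eq by (simp add: int_pow_int)
  next
    assume "s = - int n"
    then have "inv\<^bsub>G\<^esub> (a [^]\<^bsub>G\<^esub> n) = inv\<^bsub>G\<^esub> (b [^]\<^bsub>G\<^esub> n)" using eq ab by (simp add: int_pow_neg_int)
    then show ?thesis using ab by (metis inv_inv nat_pow_closed)
  qed
  then have "\<tau> a [^]\<^bsub>ut p r\<^esub> n = \<tau> b [^]\<^bsub>ut p r\<^esub> n" using ab by (metis t.hom_nat_pow)
  then have "\<tau> a = \<tau> b" using ut_root_unique[OF prime t.hom_closed[OF ab(2)] t.hom_closed[OF ab(1)] n(1)] by blast
  then show False using \<tau>(2) ab by simp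
qed

lemma conj_int_pow:
  fixes G (structure)
  assumes "group G" "a \<in> carrier G" "h \<in> carrier G"
  shows "(a \<otimes> h \<otimes> inv a) [^] (s::int) = a \<otimes> h [^] s \<otimes> inv a"
proof -
  interpret group G by fact
  have c: "inv a \<otimes> (a \<otimes> z) = z" if "z \<in> carrier G" for z using assms(2) that by (simp add: m_assoc[symmetric])
  have "(\<lambda>x. a \<otimes> x \<otimes> inv a) \<in> hom G G"
    by (rule homI) (use assms(2) in \<open>simp_all add: m_assoc c\<close>)
  then interpret h: group_hom G G "\<lambda>x. a \<otimes> x \<otimes> inv a" by (simp add: group_hom_def group_hom_axioms_def group_axioms)
  show ?thesis using h.hom_int_pow[OF assms(3)] by simp
qed

lemma ut_separated_commute:
  fixes G (structure)
  assumes G: "group G" "ut_separated p G" and ah: "a \<in> carrier G" "h \<in> carrier G"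
    and s: "s \<noteq> 0" and eq: "a \<otimes> h [^] (s::int) = h [^] s \<otimes> a"
  shows "a \<otimes> h = h \<otimes> a"
proof -
  interpret group G by fact
  have "(a \<otimes> h \<otimes> inv a) [^] s = h [^] s" 
    unfolding conj_int_pow[OF G(1) ah] eq using ah by (simp add: m_assoc)
  then have "a \<otimes> h \<otimes> inv a = h" using ut_separated_root_unique[OF G _ _ s] ah by simp
  then show ?thesis using ah by (metis inv_solve_right m_closed inv_closed)
qed

text \<open>In a corner representation \<open>h\<close> is central and has infinite order, so a conjugate of \<open>h\<close> cannot be another power of it.\<close>

lemma ut_separated_normaliser:
  fixes G (structure)
  assumes G: "group G" "ut_separated p G" and ah: "a \<in> carrier G" "h \<in> carrier G"
    and eq: "a \<otimes> h \<otimes> inv a = h [^] (i::int)"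
  shows "a \<otimes> h = h \<otimes> a"
proof (cases "h = \<one>")
  interpret group G by fact
  case True then show ?thesis using ah by simp
next
  interpret group G by fact
  case False
  obtain r \<tau> c where \<tau>: "\<tau> \<in> hom G (ut p r)" "\<tau> h = corner r c" "p_integral p c" "c \<noteq> 0" "r \<ge> 2"
    by (rule corner_representation[OF G ah(2) False])
  interpret U: group "ut p r" by (rule ut_group[OF prime])
  interpret t: group_hom G "ut p r" \<tau> using G \<tau> U.is_group by (simp add: group_hom_def group_hom_axioms_def)
  have "\<tau> a \<otimes>\<^bsub>ut p r\<^esub> \<tau> h = \<tau> h \<otimes>\<^bsub>ut p r\<^esub> \<tau> a"
    using corner_mult[of "\<tau> a" r c] ah by (simp add: ut_mult \<tau>(2))
  then have "\<tau> a \<otimes>\<^bsub>ut p r\<^esub> \<tau> h \<otimes>\<^bsub>ut p r\<^esub> inv\<^bsub>ut p r\<^esub> \<tau> a = \<tau> h"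
    using ah by (metis U.inv_solve_right t.hom_closed U.m_closed)
  then have "\<tau> (a \<otimes> h \<otimes> inv a) = \<tau> h" using ah by simp
  then have "corner r c = corner r (of_int i * c)" using eq ah by (simp add: t.hom_int_pow \<tau>(2) corner_pow[OF \<tau>(3)])
  from fun_cong[OF fun_cong[OF this], of 0 "r - 1"] have "c = of_int i * c" using \<tau>(5) by (simp add: corner_def)
  then have "i = 1" using \<tau>(4) by simp
  then have "a \<otimes> h \<otimes> inv a = h" using eq ah by simp
  then show ?thesis using ah by (metis inv_solve_right m_closed inv_closed)
qed

end

section \<open>Reduced words in free groups\<close>

definition inv_letter :: "bool \<times> 'x \<Rightarrow> bool \<times> 'x"
  where "inv_letter y = (\<not> fst y, snd y)"

definition reduced :: "(bool \<times> 'x) list \<Rightarrow> bool"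
  where "reduced w \<longleftrightarrow> successively (\<lambda>y z. z \<noteq> inv_letter y) w"

definition inv_word :: "(bool \<times> 'x) list \<Rightarrow> (bool \<times> 'x) list"
  where "inv_word w = map inv_letter (rev w)"

lemma inv_letter_simps [simp]: "inv_letter (inv_letter y) = y" "snd (inv_letter y) = snd y" "fst (inv_letter y) = (\<not> fst y)"
  "inv_letter y \<noteq> y" "inv_letter y = inv_letter z \<longleftrightarrow> y = z"
  by (auto simp: inv_letter_def prod_eq_iff)

lemma reduced_append: "reduced (u @ v) \<longleftrightarrow> reduced u \<and> reduced v \<and> (u = [] \<or> v = [] \<or> hd v \<noteq> inv_letter (last u))"
  by (auto simp: reduced_def successively_append_iff)

lemma reduced_Cons: "reduced (y # w) \<longleftrightarrow> reduced w \<and> (w = [] \<or> hd w \<noteq> inv_letter y)"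
  by (cases w) (auto simp: reduced_def)

lemma reduced_Nil [simp]: "reduced []" by (simp add: reduced_def)

lemma reduced_inv_word: "reduced w \<Longrightarrow> reduced (inv_word w)"
proof (induction w)
  case (Cons y w)
  then show ?case
    by (cases w) (auto simp: inv_word_def reduced_append reduced_Cons dest: sym)
qed (simp add: inv_word_def)

lemma length_inv_word [simp]: "length (inv_word w) = length w" by (simp add: inv_word_def)

lemma not_reduced_split:
  assumes "\<not> reduced w" obtains u y v where "w = u @ y # inv_letter y # v"
proof -
  have "\<exists>u y v. w = u @ y # inv_letter y # v" using assms
  proof (induction w)
    case (Cons y w)
    show ?case
    proof (cases "reduced w")
      case True
      then obtain v where "w = inv_letter y # v" using Cons.prems by (cases w) (auto simp: reduced_Cons)
      then have "y # w = [] @ y # inv_letter y # v" by simp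
      then show ?thesis by blast
    next
      case False
      then obtain u z v where "w = u @ z # inv_letter z # v" using Cons.IH by blast
      then have "y # w = (y # u) @ z # inv_letter z # v" by simp
      then show ?thesis by blast
    qed
  qed simp
  then show ?thesis using that by blast
qed

locale free_group_basis =
  fixes p :: nat and A :: "('a, 'c) monoid_scheme" and X :: "'x set" and e :: "'x \<Rightarrow> 'a"
  assumes prime: "Factorial_Ring.prime p" and basis: "free_basis A X e"
begin

sublocale group A using basis by (simp add: free_basis_def)

lemma eX: "e \<in> X \<rightarrow> carrier A" using basis by (simp add: free_basis_def)

abbreviation "words \<equiv> lists (UNIV \<times> X)"

lemma ev_in [simp]: "w \<in> words \<Longrightarrow> ev A e w \<in> carrier A"
  by (rule ev_closed[OF is_group eX])

lemma letter_in [simp]: "snd y \<in> X \<Longrightarrow> letter A e y \<in> carrier A"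
  using eX by (auto intro!: letter_closed[OF is_group])

lemma ev_Nil [simp]: "ev A e [] = \<one>\<^bsub>A\<^esub>" and ev_Cons [simp]: "ev A e (y # w) = letter A e y \<otimes>\<^bsub>A\<^esub> ev A e w"
  by (simp_all add: ev_def)

lemma ev_append: "u \<in> words \<Longrightarrow> v \<in> words \<Longrightarrow> ev A e (u @ v) = ev A e u \<otimes>\<^bsub>A\<^esub> ev A e v"
  unfolding ev_def map_append by (rule mprod_append[OF is_monoid]) auto

lemma letter_inv: "snd y \<in> X \<Longrightarrow> letter A e (inv_letter y) = inv\<^bsub>A\<^esub> letter A e y"
proof -
  assume "snd y \<in> X"
  then have "e (snd y) \<in> carrier A" using eX by auto
  then show ?thesis by (simp add: letter_def)
qed

lemma inv_word_words [simp]: "w \<in> words \<Longrightarrow> inv_word w \<in> words"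
  by (auto simp: inv_word_def inv_letter_def mem_Times_iff)

lemma ev_inv_word: "w \<in> words \<Longrightarrow> ev A e (inv_word w) = inv\<^bsub>A\<^esub> ev A e w"
proof (induction w)
  case (Cons y w)
  then have c: "snd y \<in> X" "w \<in> words" by auto
  have "ev A e (inv_word (y # w)) = ev A e (inv_word w @ [inv_letter y])" by (simp add: inv_word_def)
  also have "\<dots> = inv\<^bsub>A\<^esub> ev A e w \<otimes>\<^bsub>A\<^esub> inv\<^bsub>A\<^esub> letter A e y"
    using c Cons.IH ev_append[of "inv_word w" "[inv_letter y]"] by (simp add: letter_inv mem_Times_iff)
  also have "\<dots> = inv\<^bsub>A\<^esub> ev A e (y # w)" using c by (simp add: inv_mult_group)
  finally show ?case .
qed (simp add: inv_word_def)

lemma ev_cancel: "u \<in> words \<Longrightarrow> snd y \<in> X \<Longrightarrow> v \<in> words \<Longrightarrow> ev A e (u @ y # inv_letter y # v) = ev A e (u @ v)"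
proof -
  assume c: "u \<in> words" "snd y \<in> X" "v \<in> words"
  have "ev A e (y # inv_letter y # v) = ev A e v"
    using c by (simp add: letter_inv m_assoc[symmetric])
  moreover have "y # inv_letter y # v \<in> words" using c by (auto simp: mem_Times_iff)
  ultimately show ?thesis using c by (simp only: ev_append)
qed

text \<open>The length is recorded because it shows that a word which is as short as its reduced form is itself reduced.\<close>

lemma reduced_form:
  assumes "w \<in> words"
  shows "\<exists>v\<in>words. reduced v \<and> ev A e v = ev A e w \<and> length v \<le> length w \<and> (length v = length w \<longrightarrow> reduced w)"
  using assms
proof (induction "length w" arbitrary: w rule: less_induct)
  case less
  show ?case
  proof (cases "reduced w")
    case True then show ?thesis using less.prems by blast
  next
    case False
    then obtain u y v where w: "w = u @ y # inv_letter y # v" by (rule not_reduced_split)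
    have c: "u \<in> words" "snd y \<in> X" "v \<in> words" using less.prems w by auto
    have "u @ v \<in> words" "length (u @ v) < length w" using c w by auto
    then obtain v' where "v' \<in> words" "reduced v'" "ev A e v' = ev A e (u @ v)" "length v' \<le> length (u @ v)"
      using less.hyps by blast
    then show ?thesis using ev_cancel[OF c] w by (intro bexI[of _ v']) auto
  qed
qed

lemma word_exists: "a \<in> carrier A \<Longrightarrow> \<exists>w\<in>words. a = ev A e w"
  using basis by (simp add: free_basis_def)

text \<open>Equal adjacent letters are collected into powers. The sign of the first exponent is recorded for the induction: by
  reducedness a letter that is prepended to its own syllable has the same sign.\<close>

lemma syllables:
  assumes "reduced w" "w \<in> words" "w \<noteq> []"
  shows "\<exists>xs :: ('x \<times> int) list. xs \<noteq> [] \<and> fst (hd xs) = snd (hd w) \<and> (snd (hd xs) > 0 \<longleftrightarrow> fst (hd w)) \<and>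
    successively (\<lambda>a b. fst a \<noteq> fst b) xs \<and> (\<forall>x\<in>set xs. fst x \<in> X \<and> snd x \<noteq> 0) \<and>
    ev A e w = mprod A (map (\<lambda>(x, z). e x [^]\<^bsub>A\<^esub> z) xs)"
  using assms
proof (induction w)
  case (Cons y w)
  obtain b x where y: "y = (b, x)" by (cases y)
  have x: "x \<in> X" "e x \<in> carrier A" and wX: "w \<in> words" using Cons.prems y eX by auto
  define s :: int where "s = (if b then 1 else - 1)"
  have ly: "letter A e y = e x [^]\<^bsub>A\<^esub> s" using x by (simp add: y letter_def s_def int_pow_neg)
  show ?case
  proof (cases "w = []")
    case True
    then show ?thesis using x ly by (intro exI[of _ "[(x, s)]"]) (auto simp: s_def y)
  next
    case False
    have red: "reduced w" and hd: "hd w \<noteq> inv_letter y" using Cons.prems False by (auto simp: reduced_Cons)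
    from Cons.IH[OF red wX False] obtain xs :: "('x \<times> int) list" where xs: "xs \<noteq> []" "fst (hd xs) = snd (hd w)"
      "snd (hd xs) > 0 \<longleftrightarrow> fst (hd w)" "successively (\<lambda>a b. fst a \<noteq> fst b) xs" "\<forall>x\<in>set xs. fst x \<in> X \<and> snd x \<noteq> 0"
      "ev A e w = mprod A (map (\<lambda>(x, z). e x [^]\<^bsub>A\<^esub> z) xs)" by blast
    obtain x' z xs' where xs': "xs = (x', z) # xs'" using xs(1) by (metis list.exhaust surj_pair)
    have z: "z \<noteq> 0" "x' \<in> X" using xs(5) xs' by auto
    have x'c: "e x' \<in> carrier A" using z(2) eX by auto
    have rest: "mprod A (map (\<lambda>(x, z). e x [^]\<^bsub>A\<^esub> z) xs') \<in> carrier A"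
      using xs(5) xs' eX by (intro mprod_closed[OF is_monoid]) (auto simp: Pi_iff)
    show ?thesis
    proof (cases "x' = x")
      case True
      have "fst (hd w) = b" using hd xs(2) xs' True y by (auto simp: inv_letter_def prod_eq_iff)
      then have sg: "z > 0 \<longleftrightarrow> b" using xs(3) xs' by simp
      have nz: "s + z \<noteq> 0" "s + z > 0 \<longleftrightarrow> b" using sg z(1) by (auto simp: s_def)
      have "ev A e (y # w) = e x [^]\<^bsub>A\<^esub> (s + z) \<otimes>\<^bsub>A\<^esub> mprod A (map (\<lambda>(x, z). e x [^]\<^bsub>A\<^esub> z) xs')"
        using x rest by (simp add: ly xs(6) xs' True int_pow_mult m_assoc)
      moreover have "successively (\<lambda>a b. fst a \<noteq> fst b) ((x, s + z) # xs')"
        using xs(4) xs' True by (cases xs') auto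
      ultimately show ?thesis using nz x xs(5) xs' y
        by (intro exI[of _ "(x, s + z) # xs'"]) auto
    next
      case False
      have "ev A e (y # w) = mprod A (map (\<lambda>(x, z). e x [^]\<^bsub>A\<^esub> z) ((x, s) # xs))" by (simp add: ly xs(6))
      moreover have "successively (\<lambda>a b. fst a \<noteq> fst b) ((x, s) # xs)" using xs(4) xs' False by simp
      ultimately show ?thesis using x xs(5) y by (intro exI[of _ "(x, s) # xs"]) (auto simp: s_def)
    qed
  qed
qed simp

text \<open>Each basis element becomes its own colour, and the rows are coloured by the syllables of the word.\<close>

lemma reduced_detected:
  assumes "reduced w" "w \<in> words" "w \<noteq> []"
  shows "\<exists>r. \<exists>\<tau>\<in>hom A (ut p r). \<tau> (ev A e w) \<noteq> \<one>\<^bsub>ut p r\<^esub>"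
proof -
  obtain xs :: "('x \<times> int) list" where xs: "xs \<noteq> []" "successively (\<lambda>a b. fst a \<noteq> fst b) xs"
    "\<forall>x\<in>set xs. fst x \<in> X \<and> snd x \<noteq> 0" "ev A e w = mprod A (map (\<lambda>(x, z). e x [^]\<^bsub>A\<^esub> z) xs)"
    using syllables[OF assms] by blast
  define r where "r = Suc (length xs)"
  define C where "C i = fst (xs ! i)" for i
  have C: "C i \<noteq> C (Suc i)" if "Suc (Suc i) < r" for i
    using xs(2) that by (simp add: C_def r_def successively_conv_nth)
  interpret U: group "ut p r" by (rule ut_group[OF prime])
  have "(\<lambda>x. colour_elem C r x 1) \<in> X \<rightarrow> carrier (ut p r)"
    by (intro funcsetI colour_elem_closed[OF prime] p_integral_1[OF prime])
  then obtain \<tau> where \<tau>: "\<tau> \<in> hom A (ut p r)" "\<And>x. x \<in> X \<Longrightarrow> \<tau> (e x) = colour_elem C r x 1"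
    using free_basis_universal[OF basis U.is_group ut_countable[OF prime]] by blast
  interpret t: group_hom A "ut p r" \<tau> using \<tau> U.is_group is_group by (simp add: group_hom_def group_hom_axioms_def)
  define ys where "ys = map (\<lambda>(x, z). (x, of_int z :: rat)) xs"
  have "\<tau> (ev A e w) = mprod (ut p r) (map \<tau> (map (\<lambda>(x, z). e x [^]\<^bsub>A\<^esub> z) xs))"
    unfolding xs(4) by (rule mprod_hom[OF \<tau>(1) is_group U.is_group]) (use xs(3) eX in \<open>auto simp: Pi_iff\<close>)
  also have "map \<tau> (map (\<lambda>(x, z). e x [^]\<^bsub>A\<^esub> z) xs) = map (\<lambda>(c, \<gamma>). colour_elem C r c \<gamma>) ys"
    unfolding ys_def map_map
  proof (rule map_cong[OF HOL.refl])
    fix y assume y: "y \<in> set xs"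
    obtain x z where xz: "y = (x, z)" by (cases y)
    then have x: "x \<in> X" using xs(3) y by fastforce
    then have x: "x \<in> X" "e x \<in> carrier A" using eX by auto
    have "\<tau> (e x [^]\<^bsub>A\<^esub> z) = colour_elem C r x 1 [^]\<^bsub>ut p r\<^esub> z" using x \<tau>(2) by (simp add: t.hom_int_pow)
    also have "\<dots> = colour_elem C r x (of_int z * 1)" by (rule colour_elem_pow(3)[OF prime _ p_integral_1[OF prime]]) (rule C)
    finally show "(\<tau> \<circ> (\<lambda>(x, z). e x [^]\<^bsub>A\<^esub> z)) y = ((\<lambda>(c, \<gamma>). colour_elem C r c \<gamma>) \<circ> (\<lambda>(x, z). (x, of_int z))) y"
      by (simp add: xz)
  qed
  finally have "\<tau> (ev A e w) 0 (length ys) = (\<Prod>y\<leftarrow>ys. snd y)"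
  proof (simp only:, intro colour_path[OF prime])
    show "length ys < r" "ys \<noteq> []" using xs(1) by (simp_all add: ys_def r_def)
    show "C i = fst (ys ! i)" if "i < length ys" for i using that by (simp add: ys_def C_def case_prod_beta)
    show "p_integral p (snd y)" if "y \<in> set ys" for y using that p_integral_of_int[OF prime] by (auto simp: ys_def)
  qed
  moreover have "(\<Prod>y\<leftarrow>ys. snd y) \<noteq> 0" using xs(3) by (auto simp: ys_def prod_list_zero_iff)
  ultimately have "\<tau> (ev A e w) \<noteq> \<one>\<^bsub>ut p r\<^esub>" by (auto simp: ut_one)
  then show ?thesis using \<tau>(1) by blast
qed

lemma reduced_nontrivial: "reduced w \<Longrightarrow> w \<in> words \<Longrightarrow> ev A e w = \<one>\<^bsub>A\<^esub> \<Longrightarrow> w = []"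
proof (rule ccontr)
  assume w: "reduced w" "w \<in> words" "ev A e w = \<one>\<^bsub>A\<^esub>" "w \<noteq> []"
  obtain r \<tau> where "\<tau> \<in> hom A (ut p r)" "\<tau> (ev A e w) \<noteq> \<one>\<^bsub>ut p r\<^esub>" using reduced_detected[OF w(1,2,4)] by blast
  then show False using w(3) hom_one[OF _ is_group ut_group[OF prime]] by metis
qed

lemma ut_separated: "ut_separated p A"
  unfolding ut_separated_def
proof (intro ballI impI)
  fix a assume a: "a \<in> carrier A" "a \<noteq> \<one>\<^bsub>A\<^esub>"
  obtain w where "w \<in> words" "a = ev A e w" using word_exists[OF a(1)] by blast
  then obtain v where v: "v \<in> words" "reduced v" "a = ev A e v" using reduced_form[of w] by metis
  have "v \<noteq> []" using a(2) v(3) by auto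
  then show "\<exists>r. \<exists>\<tau>\<in>hom A (ut p r). \<tau> a \<noteq> \<one>\<^bsub>ut p r\<^esub>" using reduced_detected[OF v(2,1)] v(3) by simp
qed

lemma reduced_unique:
  assumes "reduced u" "reduced v" "u \<in> words" "v \<in> words" "ev A e u = ev A e v"
  shows "u = v"
  using assms
proof (induction u arbitrary: v)
  case Nil
  then show ?case using reduced_nontrivial[of v] by simp
next
  case (Cons y u)
  show ?case
  proof (cases v)
    case Nil then show ?thesis using reduced_nontrivial[of "y # u"] Cons.prems by simp
  next
    case (Cons z v')
    have c: "snd y \<in> X" "u \<in> words" "snd z \<in> X" "v' \<in> words" using Cons.prems Cons by auto
    show ?thesis
    proof (cases "y = z")
      case True
      then have "ev A e u = ev A e v'" using Cons.prems(5) Cons c by simp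
      moreover have "reduced u" "reduced v'" using Cons.prems Cons by (auto simp: reduced_Cons)
      ultimately have "u = v'" using c by (intro Cons.IH) auto
      then show ?thesis using Cons True by simp
    next
      case False
      have "reduced (inv_word (y # u) @ v)"
        using reduced_inv_word[OF Cons.prems(1)] Cons.prems(2) Cons False
        by (simp add: reduced_append reduced_Cons inv_word_def)
      moreover have "ev A e (inv_word (y # u) @ v) = \<one>\<^bsub>A\<^esub>"
        using Cons.prems by (subst ev_append) (auto simp: ev_inv_word)
      ultimately have "inv_word (y # u) @ v = []"
        using Cons.prems by (intro reduced_nontrivial) auto
      then show ?thesis by (simp add: Cons)
    qed
  qed
qed

lemma ev_replicate: "w \<in> words \<Longrightarrow> ev A e (concat (replicate n w)) = ev A e w [^]\<^bsub>A\<^esub> n"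
proof (induction n)
  case (Suc n)
  have "concat (replicate n w) \<in> words" using Suc.prems by auto
  then have "ev A e (concat (replicate (Suc n) w)) = ev A e w \<otimes>\<^bsub>A\<^esub> ev A e w [^]\<^bsub>A\<^esub> n"
    using Suc by (simp add: ev_append)
  also have "\<dots> = ev A e w [^]\<^bsub>A\<^esub> Suc n" using Suc.prems by (simp only: nat_pow_Suc2[OF ev_in])
  finally show ?case .
qed simp

text \<open>If \<open>v u\<close> is reduced, then so is \<open>u v\<close>: both words represent the same element and have the same length. By
  uniqueness of reduced words \<open>u v = v u\<close> as lists, and two commuting lists are repetitions of a common one.\<close>

lemma commuting_aux:
  assumes u: "reduced u" "u \<in> words" and v: "reduced (v @ u)" "v \<in> words" "v \<noteq> []"
    and eq: "ev A e (u @ v) = ev A e (v @ u)"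
  shows "\<exists>z\<in>words. \<exists>i j. ev A e u = ev A e z [^]\<^bsub>A\<^esub> (i::nat) \<and> ev A e v = ev A e z [^]\<^bsub>A\<^esub> (j::nat)"
proof -
  have uv: "u @ v \<in> words" "v @ u \<in> words" using u v by auto
  obtain w where w: "w \<in> words" "reduced w" "ev A e w = ev A e (u @ v)" "length w \<le> length (u @ v)"
    "length w = length (u @ v) \<longrightarrow> reduced (u @ v)" using reduced_form[OF uv(1)] by blast
  have "w = v @ u" by (rule reduced_unique) (use w v uv eq in auto)
  then have "reduced (u @ v)" using w by simp
  then have "u @ v = v @ u" using reduced_unique v uv eq by blast
  then obtain m n z where z: "concat (replicate m z) = u" "concat (replicate n z) = v"
    using comm_append_are_replicate by metis
  have "n \<noteq> 0" using z v(3) by auto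
  then have "z \<in> words" using z(2) v(2) by (cases n) auto
  then show ?thesis using ev_replicate[of z] z by metis
qed

text \<open>If \<open>v v\<close> is reduced, then a reduced word can cancel with \<open>v\<close> or with its inverse from the right, but not with both.
  One of the two therefore satisfies the hypothesis of \<open>commuting_aux\<close>.\<close>

lemma commuting_common_root:
  assumes ab: "a \<in> carrier A" "b \<in> carrier A" and b: "b = ev A e v" "v \<in> words" "reduced (v @ v)" "v \<noteq> []"
    and comm: "a \<otimes>\<^bsub>A\<^esub> b = b \<otimes>\<^bsub>A\<^esub> a"
  shows "\<exists>z\<in>carrier A. \<exists>(i::int) (j::int). a = z [^]\<^bsub>A\<^esub> i \<and> b = z [^]\<^bsub>A\<^esub> j"
proof -
  have rv: "reduced v" "hd v \<noteq> inv_letter (last v)" using b by (auto simp: reduced_append)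
  obtain w where "w \<in> words" "a = ev A e w" using word_exists[OF ab(1)] by blast
  then obtain u where u: "u \<in> words" "reduced u" "a = ev A e u" using reduced_form[of w] by metis
  have res: ?thesis if v': "reduced (v' @ u)" "v' \<in> words" "v' \<noteq> []" and b': "ev A e v' = b \<or> ev A e v' = inv\<^bsub>A\<^esub> b" for v'
  proof -
    have "ev A e (u @ v') = ev A e (v' @ u)"
      using b' comm ab u v' by (auto simp: ev_append m_assoc inv_solve_left inv_solve_right) (metis inv_solve_left' inv_solve_right ab m_assoc inv_closed m_closed)
    then obtain z i j where z: "z \<in> words" "ev A e u = ev A e z [^]\<^bsub>A\<^esub> (i::nat)" "ev A e v' = ev A e z [^]\<^bsub>A\<^esub> (j::nat)"
      using commuting_aux[OF u(2,1) v'] by blast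
    have "a = ev A e z [^]\<^bsub>A\<^esub> int i" using z u by (simp add: int_pow_int)
    moreover have "b = ev A e z [^]\<^bsub>A\<^esub> int j \<or> b = ev A e z [^]\<^bsub>A\<^esub> (- int j)"
      using b' z ab by (metis int_pow_int int_pow_neg_int inv_inv ev_in)
    ultimately obtain k :: int where "a = ev A e z [^]\<^bsub>A\<^esub> int i" "b = ev A e z [^]\<^bsub>A\<^esub> k" by blast
    then show ?thesis using ev_in[OF z(1)] by blast
  qed
  show ?thesis
  proof (cases "reduced (v @ u)")
    case True
    then show ?thesis using res b by blast
  next
    case False
    then have hu: "u \<noteq> []" "hd u = inv_letter (last v)" using rv(1) u(2) b(4) by (auto simp: reduced_append)
    have "last (inv_word v) = inv_letter (hd v)" "inv_word v \<noteq> []" using b(4) by (auto simp: inv_word_def last_map last_rev)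
    then have "reduced (inv_word v @ u)"
      using reduced_inv_word[OF rv(1)] u(2) hu rv(2) by (auto simp: reduced_append)
    then show ?thesis using res[of "inv_word v"] b \<open>inv_word v \<noteq> []\<close> ev_inv_word by auto
  qed
qed

text \<open>A shortest word among those that represent conjugates of \<open>b\<close> is cyclically reduced, since rotating it cannot lead to
  cancellation.\<close>

lemma cyclically_reduced_conjugate:
  assumes b: "b \<in> carrier A"
  obtains c v where "c \<in> carrier A" "v \<in> words" "reduced (v @ v)" "c \<otimes>\<^bsub>A\<^esub> b \<otimes>\<^bsub>A\<^esub> inv\<^bsub>A\<^esub> c = ev A e v"
proof -
  define P where "P n \<longleftrightarrow> (\<exists>c\<in>carrier A. \<exists>v\<in>words. length v = n \<and> c \<otimes>\<^bsub>A\<^esub> b \<otimes>\<^bsub>A\<^esub> inv\<^bsub>A\<^esub> c = ev A e v)" for n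
  obtain w where "w \<in> words" "b = ev A e w" using word_exists[OF b] by blast
  then have "P (length w)" unfolding P_def using b by (intro bexI[of _ "\<one>\<^bsub>A\<^esub>"] bexI[of _ w]) auto
  define n where "n = (LEAST n. P n)"
  have "P n" unfolding n_def by (rule LeastI) fact
  then obtain c v where cv: "c \<in> carrier A" "v \<in> words" "length v = n" "c \<otimes>\<^bsub>A\<^esub> b \<otimes>\<^bsub>A\<^esub> inv\<^bsub>A\<^esub> c = ev A e v"
    unfolding P_def by blast
  have least: "n \<le> m" if "P m" for m unfolding n_def using that by (rule Least_le)
  have "reduced (v @ v)"
  proof (rule ccontr)
    assume "\<not> reduced (v @ v)"
    then consider "\<not> reduced v" | "reduced v" "v \<noteq> []" "hd v = inv_letter (last v)" by (auto simp: reduced_append)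
    then show False
    proof cases
      case 1
      obtain v' where v': "v' \<in> words" "reduced v'" "ev A e v' = ev A e v" "length v' \<le> length v" "length v' = length v \<longrightarrow> reduced v"
        using reduced_form[OF cv(2)] by blast
      then have "P (length v')" unfolding P_def using cv by metis
      moreover have "length v' < length v" using v' 1 by fastforce
      ultimately show False using least cv(3) by fastforce
    next
      case 2
      define y where "y = last v"
      obtain v1 where v1: "v = v1 @ [y]" using 2(2) unfolding y_def by (metis append_butlast_last_id)
      have hy: "hd v = inv_letter y" using 2(3) by (simp add: y_def)
      have "v1 \<noteq> []"
      proof
        assume "v1 = []"
        then have "hd v = y" by (subst v1) simp
        then show False using hy by (metis inv_letter_simps(4))
      qed
      then obtain z v2 where zv: "v1 = z # v2" by (cases v1) auto
      have "hd v = z" by (subst v1) (simp add: zv)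
      then have v2: "v1 = inv_letter y # v2" using hy zv by simp
      have c: "snd y \<in> X" "v2 \<in> words" using cv(2) v1 v2 by auto
      let ?y = "letter A e y"
      have "?y \<otimes>\<^bsub>A\<^esub> c \<otimes>\<^bsub>A\<^esub> b \<otimes>\<^bsub>A\<^esub> inv\<^bsub>A\<^esub> (?y \<otimes>\<^bsub>A\<^esub> c) = ?y \<otimes>\<^bsub>A\<^esub> (c \<otimes>\<^bsub>A\<^esub> b \<otimes>\<^bsub>A\<^esub> inv\<^bsub>A\<^esub> c) \<otimes>\<^bsub>A\<^esub> inv\<^bsub>A\<^esub> ?y"
        using c cv(1) b by (simp add: inv_mult_group m_assoc)
      also have "\<dots> = ?y \<otimes>\<^bsub>A\<^esub> (inv\<^bsub>A\<^esub> ?y \<otimes>\<^bsub>A\<^esub> (ev A e v2 \<otimes>\<^bsub>A\<^esub> ?y)) \<otimes>\<^bsub>A\<^esub> inv\<^bsub>A\<^esub> ?y"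
        unfolding cv(4) v1 v2 using c by (simp add: ev_append letter_inv mem_Times_iff)
      also have "\<dots> = ev A e v2" using c by (simp add: m_assoc[symmetric]) (simp add: m_assoc)
      finally have "P (length v2)" unfolding P_def using c cv(1) by (intro bexI[of _ "?y \<otimes>\<^bsub>A\<^esub> c"] bexI[of _ v2]) auto
      then show False using least[of "length v2"] cv(3) v1 v2 by simp
    qed
  qed
  then show ?thesis using that cv by blast
qed

end

text \<open>Instead of conjugating \<open>h\<close>, the basis is conjugated, so that nothing has to be transported back.\<close>

lemma cyclically_reduced_basis:
  fixes p :: nat
  assumes prime: "Factorial_Ring.prime p" and F: "free_basis A X e" and h: "h \<in> carrier A"
  obtains e' v where "free_basis A X e'" "v \<in> lists (UNIV \<times> X)" "reduced (v @ v)" "h = ev A e' v"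
proof -
  interpret free_group_basis p A X e by unfold_locales fact+
  obtain c v where cv: "c \<in> carrier A" "v \<in> words" "reduced (v @ v)" "c \<otimes>\<^bsub>A\<^esub> h \<otimes>\<^bsub>A\<^esub> inv\<^bsub>A\<^esub> c = ev A e v"
    using cyclically_reduced_conjugate[OF h] by blast
  define t where "t a = inv\<^bsub>A\<^esub> c \<otimes>\<^bsub>A\<^esub> a \<otimes>\<^bsub>A\<^esub> c" for a
  have c1: "inv\<^bsub>A\<^esub> c \<otimes>\<^bsub>A\<^esub> (c \<otimes>\<^bsub>A\<^esub> z) = z" "c \<otimes>\<^bsub>A\<^esub> (inv\<^bsub>A\<^esub> c \<otimes>\<^bsub>A\<^esub> z) = z" if "z \<in> carrier A" for z
    using cv(1) that by (simp_all add: m_assoc[symmetric])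
  have th: "t \<in> hom A A" by (rule homI) (use cv(1) in \<open>simp_all add: t_def m_assoc c1\<close>)
  have "bij_betw t (carrier A) (carrier A)"
    by (rule bij_betw_byWitness[of _ "\<lambda>a. c \<otimes>\<^bsub>A\<^esub> a \<otimes>\<^bsub>A\<^esub> inv\<^bsub>A\<^esub> c"]) (use cv(1) in \<open>auto simp: t_def m_assoc c1\<close>)
  then have t: "t \<in> iso A A" using th by (simp add: iso_def)
  have "h = t (ev A e v)" unfolding cv(4)[symmetric] t_def using cv(1) h by (simp add: m_assoc c1)
  also have "\<dots> = ev A (t \<circ> e) v" by (rule ev_hom[OF th is_group is_group eX cv(2)])
  finally show ?thesis using that[OF free_basis_iso[OF F t is_group] cv(2,3)] by blast
qed

section \<open>Maximal cyclic subgroups of free groups\<close>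

text \<open>The basis is chosen such that \<open>h\<close> is represented by a cyclically reduced word \<open>w\<close>.\<close>

locale free_group_max_cyclic = free_group_basis p A X e
  for p and A :: "('a, 'c) monoid_scheme" and X :: "'x set" and e +
  fixes h :: 'a and w :: "(bool \<times> 'x) list"
  assumes hw: "w \<in> words" "reduced (w @ w)" "h = ev A e w" and h1: "h \<noteq> \<one>\<^bsub>A\<^esub>"
    and maximal: "maximal_cyclic_subgroup (generate A {h}) A"
begin

lemma h_in [simp]: "h \<in> carrier A" using hw by simp

lemma w_ne: "w \<noteq> []" using hw(3) h1 by auto

text \<open>A commuting element and \<open>h\<close> are powers of a common element, which is a power of \<open>h\<close> by maximality.\<close>

lemma centraliser:
  assumes a: "a \<in> carrier A" and comm: "a \<otimes>\<^bsub>A\<^esub> h = h \<otimes>\<^bsub>A\<^esub> a"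
  shows "\<exists>i::int. a = h [^]\<^bsub>A\<^esub> i"
proof -
  obtain z and i j :: int where z: "z \<in> carrier A" "a = z [^]\<^bsub>A\<^esub> i" "h = z [^]\<^bsub>A\<^esub> j"
    using commuting_common_root[OF a h_in hw(3,1,2) w_ne comm] by blast
  have "generate A {h} \<subseteq> generate A {z}"
    unfolding generate_pow[OF h_in] generate_pow[OF z(1)] using z by (auto simp: int_pow_pow)
  moreover have "cyclic_subgroup (generate A {z}) A" using z(1) by (auto simp: cyclic_subgroup_def)
  ultimately have "generate A {h} = generate A {z}" using maximal by (auto simp: maximal_cyclic_subgroup_def)
  then have "a \<in> generate A {h}" using z(2) generate_pow[OF z(1)] by auto
  then show ?thesis using generate_pow[OF h_in] by auto
qed

text \<open>A root of a power of \<open>h\<close> commutes with this power, hence with \<open>h\<close>, by uniqueness of roots.\<close>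

lemma isolated:
  assumes a: "a \<in> carrier A" and x: "x \<noteq> 0" and eq: "a [^]\<^bsub>A\<^esub> (x::int) = h [^]\<^bsub>A\<^esub> (y::int)"
  shows "\<exists>i::int. a = h [^]\<^bsub>A\<^esub> i"
proof -
  have "h \<otimes>\<^bsub>A\<^esub> a [^]\<^bsub>A\<^esub> x = a [^]\<^bsub>A\<^esub> x \<otimes>\<^bsub>A\<^esub> h"
    unfolding eq using int_pow_mult[of h 1 y] int_pow_mult[of h y 1] by (simp add: add.commute)
  then have "h \<otimes>\<^bsub>A\<^esub> a = a \<otimes>\<^bsub>A\<^esub> h" by (rule ut_separated_commute[OF prime is_group ut_separated h_in a x])
  then show ?thesis by (intro centraliser[OF a]) simp
qed

text \<open>By uniqueness of roots already \<open>a h a\<^sup>-\<^sup>1\<close> commutes with \<open>h\<close>, so it is a power of \<open>h\<close>, and by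
  \<open>ut_separated_normaliser\<close> it equals \<open>h\<close>.\<close>

lemma conj_commute:
  assumes a: "a \<in> carrier A" and s: "s \<noteq> 0"
    and comm: "h \<otimes>\<^bsub>A\<^esub> (a \<otimes>\<^bsub>A\<^esub> h [^]\<^bsub>A\<^esub> (s::int) \<otimes>\<^bsub>A\<^esub> inv\<^bsub>A\<^esub> a) = (a \<otimes>\<^bsub>A\<^esub> h [^]\<^bsub>A\<^esub> s \<otimes>\<^bsub>A\<^esub> inv\<^bsub>A\<^esub> a) \<otimes>\<^bsub>A\<^esub> h"
  shows "\<exists>i::int. a = h [^]\<^bsub>A\<^esub> i"
proof -
  let ?b = "a \<otimes>\<^bsub>A\<^esub> h \<otimes>\<^bsub>A\<^esub> inv\<^bsub>A\<^esub> a"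
  have b: "?b \<in> carrier A" using a by simp
  have "h \<otimes>\<^bsub>A\<^esub> ?b [^]\<^bsub>A\<^esub> s = ?b [^]\<^bsub>A\<^esub> s \<otimes>\<^bsub>A\<^esub> h" using comm by (simp only: conj_int_pow[OF prime is_group a h_in])
  then have "h \<otimes>\<^bsub>A\<^esub> ?b = ?b \<otimes>\<^bsub>A\<^esub> h" by (rule ut_separated_commute[OF prime is_group ut_separated h_in b s])
  then obtain i :: int where "?b = h [^]\<^bsub>A\<^esub> i" using centraliser[OF b] by auto
  then have "a \<otimes>\<^bsub>A\<^esub> h = h \<otimes>\<^bsub>A\<^esub> a" by (rule ut_separated_normaliser[OF prime is_group ut_separated a h_in])
  then show ?thesis by (rule centraliser[OF a])
qed

lemma pow_ne_one: "s \<noteq> 0 \<Longrightarrow> h [^]\<^bsub>A\<^esub> (s::int) \<noteq> \<one>\<^bsub>A\<^esub>"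
  using ut_separated_root_unique[OF prime is_group ut_separated h_in one_closed, of s] h1 by auto

lemma concat_replicate_reduced: "reduced (concat (replicate n w)) \<and> (n > 0 \<longrightarrow> hd (concat (replicate n w)) = hd w)"
proof (induction n)
  case (Suc n)
  then show ?case using hw(2) w_ne by (cases n) (auto simp: reduced_append)
qed simp

text \<open>A power of \<open>h\<close> is represented by a power of \<open>w\<close> or of its inverse, which is reduced and therefore its only reduced word. Its length is
  a multiple of the length of \<open>w\<close>.\<close>

lemma proper_prefix_not_power:
  assumes j: "0 < j" "j < length w"
  shows "ev A e (take j w) \<noteq> h [^]\<^bsub>A\<^esub> (i::int)"
proof
  assume eq: "ev A e (take j w) = h [^]\<^bsub>A\<^esub> i"
  have t: "take j w \<in> words" using hw(1) by (auto dest: in_set_takeD)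
  have rt: "reduced (take j w)" using hw(2) append_take_drop_id[of j w] by (metis reduced_append)
  define n where "n = nat \<bar>i\<bar>"
  define v where "v = (if i \<ge> 0 then w else inv_word w)"
  have cw: "concat (replicate n w) \<in> words" using hw(1) by auto
  have "\<exists>v\<in>words. reduced v \<and> length v = n * length w \<and> ev A e v = h [^]\<^bsub>A\<^esub> i"
  proof (cases "i \<ge> 0")
    case True
    then have "h [^]\<^bsub>A\<^esub> i = h [^]\<^bsub>A\<^esub> n" unfolding n_def by (metis abs_of_nonneg int_pow_int nat_0_le)
    then show ?thesis using cw concat_replicate_reduced[of n] ev_replicate[OF hw(1)] hw(3)
      by (intro bexI[of _ "concat (replicate n w)"]) (auto simp: length_concat sum_list_replicate)
  next
    case False
    then have "i = - int n" by (simp add: n_def)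
    then have "h [^]\<^bsub>A\<^esub> i = inv\<^bsub>A\<^esub> (h [^]\<^bsub>A\<^esub> n)" by (simp add: int_pow_neg_int)
    then show ?thesis using cw concat_replicate_reduced[of n] ev_replicate[OF hw(1)] hw(3) ev_inv_word[OF cw]
      by (intro bexI[of _ "inv_word (concat (replicate n w))"])
        (auto simp: length_concat sum_list_replicate reduced_inv_word simp del: in_lists_conv_set)
  qed
  then obtain v where "v \<in> words" "reduced v" "length v = n * length w" "ev A e v = h [^]\<^bsub>A\<^esub> i" by blast
  then have "length (take j w) = n * length w" using reduced_unique[OF rt _ t] eq by metis
  then have "j = n * length w" using j by simp
  then show False using j by (cases n) auto
qed

end

section \<open>Extending finite quotients to an amalgamated product\<close>

text \<open>A homomorphism \<open>\<chi>\<close> on a normal subgroup, the kernel of \<open>\<pi>\<close>, that is invariant under conjugation extends to a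
  monomial representation of the whole group: \<open>b\<close> is multiplied by coset representatives \<open>\<sigma>\<close> from both sides,
  and \<open>\<chi>\<close> is applied to the resulting elements of the kernel. On the kernel itself all coordinates are
  equal to \<open>\<chi>\<close>.\<close>

lemma wreath_lift:
  assumes B: "group B" and P: "group P" and S: "group S"
    and \<pi>: "\<pi> \<in> hom B S" "\<pi> ` carrier B = carrier S"
    and \<chi>: "\<And>v. v \<in> carrier B \<Longrightarrow> \<pi> v = \<one>\<^bsub>S\<^esub> \<Longrightarrow> \<chi> v \<in> carrier P"
      "\<And>v v'. v \<in> carrier B \<Longrightarrow> \<pi> v = \<one>\<^bsub>S\<^esub> \<Longrightarrow> v' \<in> carrier B \<Longrightarrow> \<pi> v' = \<one>\<^bsub>S\<^esub> \<Longrightarrow> \<chi> (v \<otimes>\<^bsub>B\<^esub> v') = \<chi> v \<otimes>\<^bsub>P\<^esub> \<chi> v'"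
      "\<And>v b. v \<in> carrier B \<Longrightarrow> \<pi> v = \<one>\<^bsub>S\<^esub> \<Longrightarrow> b \<in> carrier B \<Longrightarrow> \<chi> (b \<otimes>\<^bsub>B\<^esub> v \<otimes>\<^bsub>B\<^esub> inv\<^bsub>B\<^esub> b) = \<chi> v"
  shows "\<exists>\<beta>\<in>hom B (wreath P S). \<forall>v\<in>carrier B. \<pi> v = \<one>\<^bsub>S\<^esub> \<longrightarrow> snd (\<beta> v) = \<one>\<^bsub>S\<^esub> \<and> (\<forall>s\<in>carrier S. fst (\<beta> v) s = \<chi> v)"
proof -
  interpret B: group B by fact
  interpret P: group P by fact
  interpret S: group S by fact
  interpret W: group "wreath P S" by (rule wreath_group[OF P S])
  interpret h: group_hom B S \<pi> using B S \<pi> by (simp add: group_hom_def group_hom_axioms_def)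
  define \<sigma> where "\<sigma> s = (SOME b. b \<in> carrier B \<and> \<pi> b = s)" for s
  have \<sigma>: "\<sigma> s \<in> carrier B" "\<pi> (\<sigma> s) = s" if "s \<in> carrier S" for s
  proof -
    have "s \<in> \<pi> ` carrier B" using \<pi>(2) that by simp
    then have "\<exists>b. b \<in> carrier B \<and> \<pi> b = s" by blast
    then have "\<sigma> s \<in> carrier B \<and> \<pi> (\<sigma> s) = s" unfolding \<sigma>_def by (rule someI_ex)
    then show "\<sigma> s \<in> carrier B" "\<pi> (\<sigma> s) = s" by auto
  qed
  define d where "d b s = \<sigma> s \<otimes>\<^bsub>B\<^esub> b \<otimes>\<^bsub>B\<^esub> inv\<^bsub>B\<^esub> \<sigma> (s \<otimes>\<^bsub>S\<^esub> \<pi> b)" for b s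
  have d: "d b s \<in> carrier B" "\<pi> (d b s) = \<one>\<^bsub>S\<^esub>" if "b \<in> carrier B" "s \<in> carrier S" for b s
    using that \<sigma> by (simp_all add: d_def)
  define \<beta> where "\<beta> b = (\<lambda>s\<in>carrier S. \<chi> (d b s), \<pi> b)" for b
  have bc: "\<beta> b \<in> carrier (wreath P S)" if "b \<in> carrier B" for b
    using that d \<chi>(1) by (auto simp: \<beta>_def wreath_carrier)
  have "\<beta> \<in> hom B (wreath P S)"
  proof (rule homI)
    fix b b' assume b: "b \<in> carrier B" "b' \<in> carrier B"
    show "\<beta> (b \<otimes>\<^bsub>B\<^esub> b') = \<beta> b \<otimes>\<^bsub>wreath P S\<^esub> \<beta> b'"
    proof (rule wreath_eqI[of _ P S])
      fix s assume s: "s \<in> carrier S"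
      have s': "s \<otimes>\<^bsub>S\<^esub> \<pi> b \<in> carrier S" using s b by simp
      have "d (b \<otimes>\<^bsub>B\<^esub> b') s = d b s \<otimes>\<^bsub>B\<^esub> d b' (s \<otimes>\<^bsub>S\<^esub> \<pi> b)"
      proof -
        have "inv\<^bsub>B\<^esub> \<sigma> (s \<otimes>\<^bsub>S\<^esub> \<pi> b) \<otimes>\<^bsub>B\<^esub> (\<sigma> (s \<otimes>\<^bsub>S\<^esub> \<pi> b) \<otimes>\<^bsub>B\<^esub> z) = z" if "z \<in> carrier B" for z
          using that \<sigma>(1)[OF s'] by (simp add: B.m_assoc[symmetric])
        moreover have "\<sigma> (s \<otimes>\<^bsub>S\<^esub> (\<pi> b \<otimes>\<^bsub>S\<^esub> \<pi> b')) \<in> carrier B" using \<sigma>(1) s b by simp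
        ultimately show ?thesis using s b \<sigma>(1)[OF s] \<sigma>(1)[OF s'] by (simp add: d_def B.m_assoc S.m_assoc)
      qed
      then show "fst (\<beta> (b \<otimes>\<^bsub>B\<^esub> b')) s = fst (\<beta> b \<otimes>\<^bsub>wreath P S\<^esub> \<beta> b') s"
        using s s' b d \<chi>(2) by (simp add: wreath_fst_mult \<beta>_def)
    next
      show "snd (\<beta> (b \<otimes>\<^bsub>B\<^esub> b')) = snd (\<beta> b \<otimes>\<^bsub>wreath P S\<^esub> \<beta> b')" using b by (simp add: wreath_snd_mult \<beta>_def)
    qed (use bc b in auto)
  qed (rule bc)
  moreover have "snd (\<beta> v) = \<one>\<^bsub>S\<^esub> \<and> (\<forall>s\<in>carrier S. fst (\<beta> v) s = \<chi> v)" if "v \<in> carrier B" "\<pi> v = \<one>\<^bsub>S\<^esub>" for v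
    using that \<chi>(3) \<sigma>(1) by (simp add: \<beta>_def d_def)
  ultimately show ?thesis by blast
qed

lemma p_open_finite:
  assumes "finite F" "group G" "\<And>x. x \<in> F \<Longrightarrow> \<exists>N. p_open p G N \<and> Q x N"
    and mono: "\<And>x N N'. Q x N \<Longrightarrow> N' \<subseteq> N \<Longrightarrow> Q x N'"
  shows "\<exists>N. p_open p G N \<and> (\<forall>x\<in>F. Q x N)"
  using assms(1,3)
proof (induction F rule: finite_induct)
  case empty then show ?case using p_open_carrier[OF assms(2)] by blast
next
  case (insert x F)
  obtain N where N: "p_open p G N" "\<forall>x\<in>F. Q x N" using insert.IH insert.prems by blast
  obtain M where M: "p_open p G M" "Q x M" using insert.prems by blast
  have "\<forall>y\<in>insert x F. Q y (M \<inter> N)" using M(2) N(2) mono by (metis Int_lower1 Int_lower2 insertE)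
  then show ?case using p_open_Int[OF M(1) N(1)] by blast
qed

context amalgamation
begin

abbreviation inH :: "'a \<Rightarrow> bool" where "inH a \<equiv> \<exists>i::int. a = h [^]\<^bsub>A\<^esub> i"
abbreviation inK :: "'b \<Rightarrow> bool" where "inK b \<equiv> \<exists>i::int. b = k [^]\<^bsub>B\<^esub> i"

text \<open>A word \<open>b\<^sub>1 a\<^sub>1 b\<^sub>2 a\<^sub>2 \<dots>\<close> that alternates between the factors is stored as the list of its pairs
  \<open>(b\<^sub>i, a\<^sub>i)\<close>. In a reduced one the last letter from \<open>A\<close> is unrestricted, so that it may be trivial.\<close>

definition pairs :: "('b \<times> 'a) list \<Rightarrow> 'g"
  where "pairs ws = foldr (\<lambda>(b, a) y. \<iota>B b \<otimes>\<^bsub>G\<^esub> (\<iota>A a \<otimes>\<^bsub>G\<^esub> y)) ws \<one>\<^bsub>G\<^esub>"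

definition reduced_pairs :: "('b \<times> 'a) list \<Rightarrow> bool"
  where "reduced_pairs ws \<longleftrightarrow> set ws \<subseteq> carrier B \<times> carrier A \<and> (\<forall>x\<in>set ws. \<not> inK (fst x)) \<and> (\<forall>x\<in>set (butlast ws). \<not> inH (snd x))"

lemma pairs_simps [simp]: "pairs [] = \<one>\<^bsub>G\<^esub>" "pairs ((b, a) # ws) = \<iota>B b \<otimes>\<^bsub>G\<^esub> (\<iota>A a \<otimes>\<^bsub>G\<^esub> pairs ws)"
  by (simp_all add: pairs_def)

lemma pairs_closed [simp]: "set ws \<subseteq> carrier B \<times> carrier A \<Longrightarrow> pairs ws \<in> carrier G"
  by (induction ws) auto

lemma pairs_append: "set us \<subseteq> carrier B \<times> carrier A \<Longrightarrow> set ws \<subseteq> carrier B \<times> carrier A \<Longrightarrow>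
    pairs (us @ ws) = pairs us \<otimes>\<^bsub>G\<^esub> pairs ws"
  by (induction us) (auto simp: G.m_assoc)

lemma glue_pow: "\<iota>A (h [^]\<^bsub>A\<^esub> (i::int)) = \<iota>B (k [^]\<^bsub>B\<^esub> i)"
  using h k glue by (simp add: hA.hom_int_pow hB.hom_int_pow)

lemma inK_mult: "b \<in> carrier B \<Longrightarrow> inK (b \<otimes>\<^bsub>B\<^esub> k [^]\<^bsub>B\<^esub> (i::int)) \<Longrightarrow> inK b"
proof -
  assume b: "b \<in> carrier B" and "inK (b \<otimes>\<^bsub>B\<^esub> k [^]\<^bsub>B\<^esub> i)"
  then obtain j :: int where "b \<otimes>\<^bsub>B\<^esub> k [^]\<^bsub>B\<^esub> i = k [^]\<^bsub>B\<^esub> j" by blast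
  then have "b = k [^]\<^bsub>B\<^esub> j \<otimes>\<^bsub>B\<^esub> inv\<^bsub>B\<^esub> (k [^]\<^bsub>B\<^esub> i)" using b k by (metis B.inv_solve_right B.int_pow_closed)
  also have "\<dots> = k [^]\<^bsub>B\<^esub> (j - i)" using k by (simp add: B.int_pow_diff)
  finally show ?thesis by blast
qed

lemma reduced_pairs_Cons:
  "reduced_pairs ((b, a) # ws) \<longleftrightarrow> b \<in> carrier B \<and> a \<in> carrier A \<and> \<not> inK b \<and> (ws \<noteq> [] \<longrightarrow> \<not> inH a) \<and> reduced_pairs ws"
  by (cases "ws = []") (auto simp: reduced_pairs_def)

text \<open>The induction step for normal forms: letters in the amalgamated subgroup move to the other factor and are
  absorbed by a neighbour.\<close>

lemma mult_B_reduced: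
  assumes b: "b \<in> carrier B" and a: "a \<in> carrier A" and ws: "reduced_pairs ws"
  shows "\<exists>a'\<in>carrier A. \<exists>ws'. reduced_pairs ws' \<and> \<iota>B b \<otimes>\<^bsub>G\<^esub> (\<iota>A a \<otimes>\<^bsub>G\<^esub> pairs ws) = \<iota>A a' \<otimes>\<^bsub>G\<^esub> pairs ws'"
proof -
  have wc: "set ws \<subseteq> carrier B \<times> carrier A" using ws by (simp add: reduced_pairs_def)
  have absorb: "\<exists>a'\<in>carrier A. \<exists>ws'. reduced_pairs ws' \<and> \<iota>B b' \<otimes>\<^bsub>G\<^esub> (\<iota>A a \<otimes>\<^bsub>G\<^esub> pairs ws) = \<iota>A a' \<otimes>\<^bsub>G\<^esub> pairs ws'"
    if K: "inK b'" and a: "a \<in> carrier A" and ws: "reduced_pairs ws" for b' a ws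
  proof -
    obtain i :: int where i: "b' = k [^]\<^bsub>B\<^esub> i" using K by blast
    have wc: "set ws \<subseteq> carrier B \<times> carrier A" using ws by (simp add: reduced_pairs_def)
    have "\<iota>B b' \<otimes>\<^bsub>G\<^esub> (\<iota>A a \<otimes>\<^bsub>G\<^esub> pairs ws) = \<iota>A (h [^]\<^bsub>A\<^esub> i \<otimes>\<^bsub>A\<^esub> a) \<otimes>\<^bsub>G\<^esub> pairs ws"
      using a h wc unfolding i by (simp flip: glue_pow add: G.m_assoc)
    then show ?thesis using a h ws by (intro bexI[of _ "h [^]\<^bsub>A\<^esub> i \<otimes>\<^bsub>A\<^esub> a"] exI[of _ ws]) auto
  qed
  show ?thesis
  proof (cases "inK b")
    case True then show ?thesis using absorb a ws by blast
  next
    case nK: False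
    show ?thesis
    proof (cases "inH a")
      case False
      then have "reduced_pairs ((b, a) # ws)" using nK b a ws by (simp add: reduced_pairs_Cons)
      then show ?thesis using b a wc by (intro bexI[of _ "\<one>\<^bsub>A\<^esub>"] exI[of _ "(b, a) # ws"]) auto
    next
      case True
      then obtain i :: int where i: "a = h [^]\<^bsub>A\<^esub> i" by blast
      let ?b = "b \<otimes>\<^bsub>B\<^esub> k [^]\<^bsub>B\<^esub> i"
      have bc: "?b \<in> carrier B" using b k by simp
      have nb: "\<not> inK ?b" using nK inK_mult[OF b] by blast
      have e: "\<iota>B b \<otimes>\<^bsub>G\<^esub> (\<iota>A a \<otimes>\<^bsub>G\<^esub> pairs ws) = \<iota>B ?b \<otimes>\<^bsub>G\<^esub> pairs ws"
        using b k wc unfolding i glue_pow by (simp add: G.m_assoc)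
      show ?thesis
      proof (cases ws)
        case Nil
        then have "reduced_pairs [(?b, \<one>\<^bsub>A\<^esub>)]" using nb bc by (simp add: reduced_pairs_Cons) (simp add: reduced_pairs_def)
        then show ?thesis unfolding e using Nil bc by (intro bexI[of _ "\<one>\<^bsub>A\<^esub>"] exI[of _ "[(?b, \<one>\<^bsub>A\<^esub>)]"]) auto
      next
        case (Cons x ws')
        obtain b1 a1 where x: "x = (b1, a1)" by (cases x)
        have r: "b1 \<in> carrier B" "a1 \<in> carrier A" "ws' \<noteq> [] \<longrightarrow> \<not> inH a1" "reduced_pairs ws'"
          using ws unfolding Cons x reduced_pairs_Cons by auto
        have wc': "set ws' \<subseteq> carrier B \<times> carrier A" using r(4) by (simp add: reduced_pairs_def)
        have e2: "\<iota>B ?b \<otimes>\<^bsub>G\<^esub> pairs ws = \<iota>B (?b \<otimes>\<^bsub>B\<^esub> b1) \<otimes>\<^bsub>G\<^esub> (\<iota>A a1 \<otimes>\<^bsub>G\<^esub> pairs ws')"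
          using bc r wc' unfolding Cons x by (simp add: G.m_assoc del: hB.hom_mult) (simp add: hB.hom_mult G.m_assoc)
        show ?thesis
        proof (cases "inK (?b \<otimes>\<^bsub>B\<^esub> b1)")
          case True then show ?thesis unfolding e e2 using absorb r by blast
        next
          case False
          then have "reduced_pairs ((?b \<otimes>\<^bsub>B\<^esub> b1, a1) # ws')" using bc r by (simp add: reduced_pairs_Cons)
          then show ?thesis unfolding e e2 using bc r wc'
            by (intro bexI[of _ "\<one>\<^bsub>A\<^esub>"] exI[of _ "(?b \<otimes>\<^bsub>B\<^esub> b1, a1) # ws'"]) auto
        qed
      qed
    qed
  qed
qed

lemma normal_form:
  assumes g: "g \<in> carrier G"
  obtains a ws where "a \<in> carrier A" "reduced_pairs ws" "g = \<iota>A a \<otimes>\<^bsub>G\<^esub> pairs ws"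
proof -
  define NF where "NF = {\<iota>A a \<otimes>\<^bsub>G\<^esub> pairs ws | a ws. a \<in> carrier A \<and> reduced_pairs ws}"
  have NFc: "NF \<subseteq> carrier G" by (auto simp: NF_def reduced_pairs_def)
  have A_in: "\<iota>A a \<otimes>\<^bsub>G\<^esub> y \<in> NF" if "a \<in> carrier A" "y \<in> NF" for a y
  proof -
    obtain a' ws where y: "y = \<iota>A a' \<otimes>\<^bsub>G\<^esub> pairs ws" "a' \<in> carrier A" "reduced_pairs ws" using \<open>y \<in> NF\<close> unfolding NF_def by blast
    then have "\<iota>A a \<otimes>\<^bsub>G\<^esub> y = \<iota>A (a \<otimes>\<^bsub>A\<^esub> a') \<otimes>\<^bsub>G\<^esub> pairs ws" using that by (simp add: G.m_assoc reduced_pairs_def)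
    then show ?thesis using y that unfolding NF_def by blast
  qed
  have B_in: "\<iota>B b \<otimes>\<^bsub>G\<^esub> y \<in> NF" if "b \<in> carrier B" "y \<in> NF" for b y
    using that mult_B_reduced[OF that(1)] unfolding NF_def by blast
  have gen_in: "x \<otimes>\<^bsub>G\<^esub> y \<in> NF" if "x \<in> generate G (\<iota>A ` carrier A \<union> \<iota>B ` carrier B)" "y \<in> NF" for x y
    using that
  proof (induction arbitrary: y rule: generate.induct)
    case one then show ?case using NFc by auto
  next
    case (incl x) then show ?case using A_in B_in by auto
  next
    case (inv x)
    from inv(1) show ?case
    proof
      assume "x \<in> \<iota>A ` carrier A"
      then obtain a where "a \<in> carrier A" "x = \<iota>A a" by auto
      then show ?thesis using A_in[of "inv\<^bsub>A\<^esub> a" y] inv(2) by simp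
    next
      assume "x \<in> \<iota>B ` carrier B"
      then obtain b where "b \<in> carrier B" "x = \<iota>B b" by auto
      then show ?thesis using B_in[of "inv\<^bsub>B\<^esub> b" y] inv(2) by simp
    qed
  next
    case (eng x1 x2)
    have sub: "\<iota>A ` carrier A \<union> \<iota>B ` carrier B \<subseteq> carrier G" by auto
    have "x1 \<in> carrier G" "x2 \<in> carrier G" "y \<in> carrier G"
      using eng G.generate_in_carrier[OF sub] NFc by auto
    then show ?case using eng by (simp add: G.m_assoc)
  qed
  have "\<one>\<^bsub>G\<^esub> \<in> NF"
  proof -
    have "\<one>\<^bsub>G\<^esub> = \<iota>A \<one>\<^bsub>A\<^esub> \<otimes>\<^bsub>G\<^esub> pairs []" by simp
    moreover have "reduced_pairs []" by (simp add: reduced_pairs_def)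
    ultimately show ?thesis unfolding NF_def by blast
  qed
  then have "g \<otimes>\<^bsub>G\<^esub> \<one>\<^bsub>G\<^esub> \<in> NF" using gen_in gen g by blast
  then have "g \<in> NF" using g by simp
  then show ?thesis using that unfolding NF_def by blast
qed

text \<open>The quotient \<open>P = A/NA\<close> is put diagonally into the base of a wreath product \<open>P wr S\<close>. For \<open>B\<close> choose a quotient \<open>Q\<close>
  in which \<open>k\<close> is central and of order divisible by the exponent of \<open>P\<close>. Then the image of \<open>k\<close> can be mapped
  to that of \<open>h\<close>, and \<open>wreath_lift\<close> extends this map from the preimage of \<open>\<langle>k\<rangle>\<close> to all of \<open>B\<close>.\<close>

lemma extend_quotient:
  assumes prime: "Factorial_Ring.prime p" and cB: "central_mod_p p B k" and NA: "p_open p A NA"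
  shows "\<exists>N. p_open p G N \<and> (\<forall>a\<in>carrier A. \<iota>A a \<in> N \<longrightarrow> a \<in> NA)"
proof -
  define P where "P = A Mod NA"
  have nA: "NA \<lhd> A" using p_openD[OF NA] by simp
  have fP: "p_finite p P" unfolding P_def by (rule p_finite_Mod[OF NA])
  interpret P: group P using fP by (simp add: p_finite_def)
  define pA where "pA = (\<lambda>a. NA #>\<^bsub>A\<^esub> a)"
  have pA: "pA \<in> hom A P" "\<And>a. a \<in> carrier A \<Longrightarrow> pA a = \<one>\<^bsub>P\<^esub> \<longleftrightarrow> a \<in> NA"
    unfolding pA_def P_def using Mod_hom[OF nA] by auto
  interpret pA: group_hom A P pA by unfold_locales (rule pA(1))
  obtain s where s: "\<And>x i. x \<in> carrier A \<Longrightarrow> x [^]\<^bsub>A\<^esub> (int p ^ s * i :: int) \<in> NA" using p_open_pow[OF NA] by blast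
  obtain NB where NB': "p_open p B NB" "\<forall>g\<in>carrier B. g \<otimes>\<^bsub>B\<^esub> k \<otimes>\<^bsub>B\<^esub> inv\<^bsub>B\<^esub> g \<otimes>\<^bsub>B\<^esub> inv\<^bsub>B\<^esub> k \<in> NB"
    "\<forall>i::int. k [^]\<^bsub>B\<^esub> i \<in> NB \<longrightarrow> int p ^ s dvd i"
    using spec[OF cB[unfolded central_mod_p_def], of s] by (elim exE conjE)
  note NB = NB'(1) bspec[OF NB'(2)] mp[OF spec[OF NB'(3)]]
  have nB: "NB \<lhd> B" using p_openD[OF NB(1)] by simp
  define Q where "Q = B Mod NB"
  have fQ: "p_finite p Q" unfolding Q_def by (rule p_finite_Mod[OF NB(1)])
  interpret Q: group Q using fQ by (simp add: p_finite_def)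
  define pB where "pB = (\<lambda>b. NB #>\<^bsub>B\<^esub> b)"
  have pB: "pB \<in> hom B Q" "pB ` carrier B = carrier Q" "\<And>b. b \<in> carrier B \<Longrightarrow> pB b = \<one>\<^bsub>Q\<^esub> \<longleftrightarrow> b \<in> NB"
    unfolding pB_def Q_def using Mod_hom[OF nB] by auto
  interpret pB: group_hom B Q pB by unfold_locales (rule pB(1))
  define z where "z = pB k"
  have z: "z \<in> carrier Q" using k by (simp add: z_def)
  have central: "q \<otimes>\<^bsub>Q\<^esub> z \<otimes>\<^bsub>Q\<^esub> inv\<^bsub>Q\<^esub> q = z" if q: "q \<in> carrier Q" for q
  proof -
    obtain b where b: "b \<in> carrier B" "q = pB b" using q pB(2) by auto
    have "pB (b \<otimes>\<^bsub>B\<^esub> k \<otimes>\<^bsub>B\<^esub> inv\<^bsub>B\<^esub> b \<otimes>\<^bsub>B\<^esub> inv\<^bsub>B\<^esub> k) = \<one>\<^bsub>Q\<^esub>"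
      by (rule pB(3)[THEN iffD2, OF _ NB(2)[OF b(1)]]) (use b k in simp)
    then have "q \<otimes>\<^bsub>Q\<^esub> z \<otimes>\<^bsub>Q\<^esub> inv\<^bsub>Q\<^esub> q \<otimes>\<^bsub>Q\<^esub> inv\<^bsub>Q\<^esub> z = \<one>\<^bsub>Q\<^esub>" using b k by (simp add: z_def)
    then show ?thesis using q z by (metis Q.inv_closed Q.inv_equality Q.inv_inv Q.m_closed)
  qed
  have conj_pow: "q \<otimes>\<^bsub>Q\<^esub> z [^]\<^bsub>Q\<^esub> (i::int) \<otimes>\<^bsub>Q\<^esub> inv\<^bsub>Q\<^esub> q = z [^]\<^bsub>Q\<^esub> i" if q: "q \<in> carrier Q" for q i
    using conj_int_pow[OF prime Q.is_group q z, of i] central[OF q] by simp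
  define Z where "Z = generate Q {z}"
  have Zi: "Z = {z [^]\<^bsub>Q\<^esub> i | i. i \<in> (UNIV :: int set)}" unfolding Z_def by (rule Q.generate_pow[OF z])
  have Zn: "Z \<lhd> Q"
  proof (rule Q.normal_invI)
    show "subgroup Z Q" unfolding Z_def by (rule Q.generate_is_subgroup) (use z in simp)
    show "q \<otimes>\<^bsub>Q\<^esub> y \<otimes>\<^bsub>Q\<^esub> inv\<^bsub>Q\<^esub> q \<in> Z" if "q \<in> carrier Q" "y \<in> Z" for q y
      using that conj_pow[OF that(1)] Zi by auto
  qed
  interpret Z: normal Z Q by fact
  obtain t where t: "\<And>g. g \<in> carrier Q \<Longrightarrow> g [^]\<^bsub>Q\<^esub> (p ^ t) = \<one>\<^bsub>Q\<^esub>" using fQ unfolding p_finite_def by blast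
  have Zo: "p_open p Q Z"
    by (rule p_openI[OF Zn, where f = "\<lambda>x. x" and s = t]) (use fQ t Z.one_closed in \<open>auto simp: p_finite_def\<close>)
  define V where "V = {b \<in> carrier B. pB b \<in> Z}"
  have Vo: "p_open p B V" unfolding V_def by (rule p_open_vimage[OF pB(1) B.is_group Zo])
  have nV: "V \<lhd> B" using p_openD[OF Vo] by simp
  define S where "S = B Mod V"
  have fS: "p_finite p S" unfolding S_def by (rule p_finite_Mod[OF Vo])
  interpret S: group S using fS by (simp add: p_finite_def)
  define \<pi> where "\<pi> = (\<lambda>b. V #>\<^bsub>B\<^esub> b)"
  have \<pi>: "\<pi> \<in> hom B S" "\<pi> ` carrier B = carrier S" "\<And>b. b \<in> carrier B \<Longrightarrow> \<pi> b = \<one>\<^bsub>S\<^esub> \<longleftrightarrow> b \<in> V"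
    unfolding \<pi>_def S_def using Mod_hom[OF nV] by auto
  let ?x = "pA h"
  have x: "?x \<in> carrier P" using h by simp
  have well: "?x [^]\<^bsub>P\<^esub> i = ?x [^]\<^bsub>P\<^esub> j" if "z [^]\<^bsub>Q\<^esub> i = z [^]\<^bsub>Q\<^esub> j" for i j :: int
  proof -
    have "z [^]\<^bsub>Q\<^esub> (i - j) = \<one>\<^bsub>Q\<^esub>" using that z by (simp add: Q.int_pow_diff)
    then have "pB (k [^]\<^bsub>B\<^esub> (i - j)) = \<one>\<^bsub>Q\<^esub>" using k by (simp add: z_def pB.hom_int_pow)
    then have "int p ^ s dvd i - j" using NB(3) pB(3) k by simp
    then obtain l where "i - j = int p ^ s * l" by auto
    then have "h [^]\<^bsub>A\<^esub> (i - j) \<in> NA" using s[OF h] by simp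
    then have "pA (h [^]\<^bsub>A\<^esub> (i - j)) = \<one>\<^bsub>P\<^esub>" using pA(2) h by simp
    then have "?x [^]\<^bsub>P\<^esub> i \<otimes>\<^bsub>P\<^esub> inv\<^bsub>P\<^esub> (?x [^]\<^bsub>P\<^esub> j) = \<one>\<^bsub>P\<^esub>" using h x by (simp add: pA.hom_int_pow P.int_pow_diff)
    then show ?thesis using x by (metis P.inv_closed P.inv_equality P.inv_inv P.int_pow_closed)
  qed
  define \<chi> where "\<chi> b = ?x [^]\<^bsub>P\<^esub> (SOME i::int. pB b = z [^]\<^bsub>Q\<^esub> i)" for b
  have \<chi>: "\<chi> b = ?x [^]\<^bsub>P\<^esub> i" if "pB b = z [^]\<^bsub>Q\<^esub> i" for b and i :: int
  proof -
    have "pB b = z [^]\<^bsub>Q\<^esub> (SOME i::int. pB b = z [^]\<^bsub>Q\<^esub> i)" by (rule someI[of _ i]) fact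
    then show ?thesis unfolding \<chi>_def using well that by metis
  qed
  have V: "\<exists>i::int. pB b = z [^]\<^bsub>Q\<^esub> i" if "b \<in> carrier B" "\<pi> b = \<one>\<^bsub>S\<^esub>" for b
    using that \<pi>(3) by (auto simp: V_def Zi)
  have "\<exists>\<beta>\<in>hom B (wreath P S). \<forall>v\<in>carrier B. \<pi> v = \<one>\<^bsub>S\<^esub> \<longrightarrow> snd (\<beta> v) = \<one>\<^bsub>S\<^esub> \<and> (\<forall>s\<in>carrier S. fst (\<beta> v) s = \<chi> v)"
  proof (rule wreath_lift[OF B.is_group P.is_group S.is_group \<pi>(1,2)])
    fix v assume v: "v \<in> carrier B" "\<pi> v = \<one>\<^bsub>S\<^esub>"
    obtain i :: int where i: "pB v = z [^]\<^bsub>Q\<^esub> i" using V[OF v] by blast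
    then show "\<chi> v \<in> carrier P" using \<chi> x by simp
    show "\<chi> (v \<otimes>\<^bsub>B\<^esub> v') = \<chi> v \<otimes>\<^bsub>P\<^esub> \<chi> v'" if v': "v' \<in> carrier B" "\<pi> v' = \<one>\<^bsub>S\<^esub>" for v'
    proof -
      obtain j :: int where j: "pB v' = z [^]\<^bsub>Q\<^esub> j" using V[OF v'] by blast
      have "pB (v \<otimes>\<^bsub>B\<^esub> v') = z [^]\<^bsub>Q\<^esub> (i + j)" using v v' i j z by (simp add: Q.int_pow_mult)
      then show ?thesis using \<chi>[OF i] \<chi>[OF j] \<chi>[of "v \<otimes>\<^bsub>B\<^esub> v'" "i + j"] x by (simp add: P.int_pow_mult)
    qed
    show "\<chi> (b \<otimes>\<^bsub>B\<^esub> v \<otimes>\<^bsub>B\<^esub> inv\<^bsub>B\<^esub> b) = \<chi> v" if b: "b \<in> carrier B" for b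
    proof -
      have "pB (b \<otimes>\<^bsub>B\<^esub> v \<otimes>\<^bsub>B\<^esub> inv\<^bsub>B\<^esub> b) = z [^]\<^bsub>Q\<^esub> i" using b v i conj_pow[of "pB b" i] by simp
      then show ?thesis using \<chi>[OF i] \<chi> by simp
    qed
  qed
  then obtain \<beta> where \<beta>: "\<beta> \<in> hom B (wreath P S)"
    "\<And>v. v \<in> carrier B \<Longrightarrow> \<pi> v = \<one>\<^bsub>S\<^esub> \<Longrightarrow> snd (\<beta> v) = \<one>\<^bsub>S\<^esub> \<and> (\<forall>s\<in>carrier S. fst (\<beta> v) s = \<chi> v)" by blast
  interpret W: group "wreath P S" by (rule wreath_group[OF P.is_group S.is_group])
  define \<alpha> where "\<alpha> a = (\<lambda>s\<in>carrier S. pA a, \<one>\<^bsub>S\<^esub>)" for a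
  have \<alpha>c: "\<alpha> a \<in> carrier (wreath P S)" if "a \<in> carrier A" for a using that by (auto simp: \<alpha>_def wreath_carrier)
  have \<alpha>: "\<alpha> \<in> hom A (wreath P S)"
  proof (rule homI)
    fix a a' assume a: "a \<in> carrier A" "a' \<in> carrier A"
    show "\<alpha> (a \<otimes>\<^bsub>A\<^esub> a') = \<alpha> a \<otimes>\<^bsub>wreath P S\<^esub> \<alpha> a'"
      by (rule wreath_eqI[of _ P S]) (use a \<alpha>c in \<open>auto simp: wreath_snd_mult wreath_fst_mult, auto simp: \<alpha>_def\<close>)
  qed (rule \<alpha>c)
  have kV: "\<pi> k = \<one>\<^bsub>S\<^esub>" 
  proof -
    have "pB k \<in> Z" unfolding Zi using Q.int_pow_1[OF z] by (force simp: z_def)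
    then show ?thesis using \<pi>(3)[OF k] k by (simp add: V_def)
  qed
  have "\<alpha> h = \<beta> k"
  proof (rule wreath_eqI[of _ P S])
    show "\<beta> k \<in> carrier (wreath P S)" using \<beta>(1) k by (auto simp: hom_def)
    show "snd (\<alpha> h) = snd (\<beta> k)" using \<beta>(2)[OF k kV] by (simp add: \<alpha>_def)
    fix s assume s: "s \<in> carrier S"
    have "\<chi> k = ?x" using \<chi>[of k 1] z x by (simp add: z_def[symmetric])
    then show "fst (\<alpha> h) s = fst (\<beta> k) s" using \<beta>(2)[OF k kV] s by (simp add: \<alpha>_def)
  qed (rule \<alpha>c[OF h])
  moreover have fW: "p_finite p (wreath P S)" by (rule wreath_p_finite[OF fP fS])
  ultimately obtain \<theta> where \<theta>: "\<theta> \<in> hom G (wreath P S)" "\<And>a. a \<in> carrier A \<Longrightarrow> \<theta> (\<iota>A a) = \<alpha> a"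
    using universal[OF W.is_group _ \<alpha> \<beta>(1)] by (metis countable_finite p_finite_def)
  have "a \<in> NA" if a: "a \<in> carrier A" "\<iota>A a \<in> {g \<in> carrier G. \<theta> g = \<one>\<^bsub>wreath P S\<^esub>}" for a
  proof -
    have "\<alpha> a = \<one>\<^bsub>wreath P S\<^esub>" using a \<theta>(2) by simp
    then have "(\<lambda>s\<in>carrier S. pA a) = (\<lambda>s\<in>carrier S. \<one>\<^bsub>P\<^esub>)" by (simp add: \<alpha>_def wreath_one)
    from fun_cong[OF this, of "\<one>\<^bsub>S\<^esub>"] have "pA a = \<one>\<^bsub>P\<^esub>" by simp
    then show ?thesis using pA(2) a(1) by simp
  qed
  then show ?thesis using p_open_kernel[OF \<theta>(1) G.is_group fW] by blast
qed

end

section \<open>Reading reduced words in a wreath product\<close>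

definition cyclic_coset :: "('a, 'c) monoid_scheme \<Rightarrow> 'a \<Rightarrow> 'a \<Rightarrow> 'a set"
  where "cyclic_coset P x u = {u \<otimes>\<^bsub>P\<^esub> x [^]\<^bsub>P\<^esub> (i::int) | i. True}"

lemma cyclic_coset_shift:
  fixes P (structure)
  assumes "group P" "x \<in> carrier P" "u \<in> carrier P"
  shows "cyclic_coset P x (u \<otimes> x [^] (i::int)) = cyclic_coset P x u"
proof -
  interpret group P by fact
  have "\<exists>k. u \<otimes> x [^] i \<otimes> x [^] j = u \<otimes> x [^] (k::int)" for j :: int
    using assms by (intro exI[of _ "i + j"]) (simp add: int_pow_mult m_assoc)
  moreover have "\<exists>k. u \<otimes> x [^] j = u \<otimes> x [^] i \<otimes> x [^] (k::int)" for j :: int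
  proof -
    have "x [^] j = x [^] i \<otimes> x [^] (j - i)" using int_pow_mult[OF assms(2), of i "j - i"] by simp
    then show ?thesis using assms by (intro exI[of _ "j - i"]) (simp add: m_assoc)
  qed
  ultimately show ?thesis unfolding cyclic_coset_def by (fastforce simp: set_eq_iff)
qed

lemma cyclic_coset_self: "group P \<Longrightarrow> u \<in> carrier P \<Longrightarrow> u \<in> cyclic_coset P x u"
proof -
  assume "group P" "u \<in> carrier P"
  then interpret group P by simp
  show "u \<in> cyclic_coset P x u" unfolding cyclic_coset_def using \<open>u \<in> carrier P\<close> by (intro CollectI exI[of _ "0::int"]) simp
qed

lemma cyclic_coset_subset: "group P \<Longrightarrow> x \<in> carrier P \<Longrightarrow> u \<in> carrier P \<Longrightarrow> cyclic_coset P x u \<subseteq> carrier P"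
  unfolding cyclic_coset_def by (auto simp: group.int_pow_closed group.is_monoid monoid.m_closed)

lemma cyclic_coset_eq: "group P \<Longrightarrow> x \<in> carrier P \<Longrightarrow> u \<in> carrier P \<Longrightarrow> v \<in> cyclic_coset P x u \<Longrightarrow>
    cyclic_coset P x v = cyclic_coset P x u"
  using cyclic_coset_shift[of P x u] unfolding cyclic_coset_def by blast

lemma cyclic_coset_mult:
  assumes "group P" "x \<in> carrier P" "u \<in> carrier P" "s \<in> carrier P"
    and eq: "cyclic_coset P x u = cyclic_coset P x (u \<otimes>\<^bsub>P\<^esub> s)"
  shows "\<exists>i::int. s = x [^]\<^bsub>P\<^esub> i"
proof -
  interpret group P by fact
  have "u \<otimes>\<^bsub>P\<^esub> s \<in> cyclic_coset P x u" using cyclic_coset_self[OF assms(1), of "u \<otimes>\<^bsub>P\<^esub> s"] assms by simp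
  then obtain i :: int where "u \<otimes>\<^bsub>P\<^esub> s = u \<otimes>\<^bsub>P\<^esub> x [^]\<^bsub>P\<^esub> i" unfolding cyclic_coset_def by blast
  then show ?thesis using assms by (metis Units_eq Units_l_cancel int_pow_closed)
qed

definition cyclic_closed :: "nat \<Rightarrow> ('a, 'c) monoid_scheme \<Rightarrow> 'a \<Rightarrow> bool"
  where "cyclic_closed p G h \<longleftrightarrow> (\<forall>a\<in>carrier G. (\<nexists>i::int. a = h [^]\<^bsub>G\<^esub> i) \<longrightarrow>
    (\<exists>N. p_open p G N \<and> (\<forall>i::int. a \<otimes>\<^bsub>G\<^esub> inv\<^bsub>G\<^esub> (h [^]\<^bsub>G\<^esub> i) \<notin> N)))"

context amalgamation
begin

text \<open>Let \<open>\<alpha>\<close> map \<open>A\<close> to pure translations by \<open>\<rho>\<close>, and let \<open>\<beta>\<close> map \<open>B\<close> to translations conjugated by the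
  function \<open>\<phi>\<close>, which takes at \<open>v\<close> the elementary matrix whose colour is the coset \<open>v\<langle>x\<rangle>\<close>. Both
  send the amalgamated element to the same translation, since \<open>\<phi>\<close> is constant on cosets. In the image of a
  word each letter from \<open>B\<close> contributes \<open>\<phi>(v)\<^sup>-\<^sup>1 \<phi>(v b)\<close>, where \<open>v\<close> is the vertex that the word has reached.
  Adjacent cosets are different because no letter lies in \<open>\<langle>x\<rangle>\<close>, so with rows coloured by
  the cosets on the path the corner entry is a product of signs.\<close>

lemma reduced_image_detected:
  assumes prime: "Factorial_Ring.prime p" and W: "p_finite p W" and \<rho>: "\<rho> \<in> hom G W"
    and ws: "set ws \<subseteq> carrier B \<times> carrier A" "ws \<noteq> []"
    and sepB: "\<And>x i. x \<in> set ws \<Longrightarrow> \<rho> (\<iota>B (fst x)) \<noteq> \<rho> (\<iota>A h) [^]\<^bsub>W\<^esub> (i::int)"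
    and sepA: "\<And>x i. x \<in> set (butlast ws) \<Longrightarrow> \<rho> (\<iota>A (snd x)) \<noteq> \<rho> (\<iota>A h) [^]\<^bsub>W\<^esub> (i::int)"
  obtains r \<theta> where "\<theta> \<in> hom G (wreath (ut p r) W)"
    "\<And>a v. a \<in> carrier A \<Longrightarrow> v \<in> carrier W \<Longrightarrow> fst (\<theta> (\<iota>A a)) v = \<one>\<^bsub>ut p r\<^esub>"
    "\<And>g. g \<in> carrier G \<Longrightarrow> snd (\<theta> g) = \<rho> g"
    "fst (\<theta> (pairs ws)) \<one>\<^bsub>W\<^esub> \<noteq> \<one>\<^bsub>ut p r\<^esub>"
proof -
  interpret W: group W using W by (simp add: p_finite_def)
  interpret \<rho>: group_hom G W \<rho> by unfold_locales (rule \<rho>)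
  define x where "x = \<rho> (\<iota>A h)"
  have x: "x \<in> carrier W" using h by (simp add: x_def)
  define col where "col = cyclic_coset W x"
  have col_eq: "\<exists>i::int. s = x [^]\<^bsub>W\<^esub> i" if "u \<in> carrier W" "s \<in> carrier W" "col u = col (u \<otimes>\<^bsub>W\<^esub> s)" for u s
    using cyclic_coset_mult[OF W.is_group x that(1,2)] that(3) by (simp add: col_def)
  have col_x: "col (u \<otimes>\<^bsub>W\<^esub> x) = col u" if u: "u \<in> carrier W" for u
    using cyclic_coset_shift[OF W.is_group x u, of 1] x by (simp add: col_def)
  define rB where "rB b = \<rho> (\<iota>B b)" for b
  define rA where "rA a = \<rho> (\<iota>A a)" for a
  have rB: "rB b \<in> carrier W" if "b \<in> carrier B" for b using that by (simp add: rB_def)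
  have rA: "rA a \<in> carrier W" if "a \<in> carrier A" for a using that by (simp add: rA_def)
  \<comment> \<open>The factors of the coordinate at \<open>v\<close>, as pairs of a coset and a parameter, along the path of the word.\<close>
  define verts where "verts = rec_list (\<lambda>_. []) (\<lambda>y _ rec v. (col v, -1 :: rat) # (col (v \<otimes>\<^bsub>W\<^esub> rB (fst y)), 1) # rec (v \<otimes>\<^bsub>W\<^esub> rB (fst y) \<otimes>\<^bsub>W\<^esub> rA (snd y)))"
  have verts [simp]: "verts [] v = []" "verts ((b, a) # us) v = (col v, -1) # (col (v \<otimes>\<^bsub>W\<^esub> rB b), 1) # verts us (v \<otimes>\<^bsub>W\<^esub> rB b \<otimes>\<^bsub>W\<^esub> rA a)"
    for b a us v by (simp_all add: verts_def)
  have hd_verts: "us \<noteq> [] \<Longrightarrow> verts us v \<noteq> [] \<and> fst (hd (verts us v)) = col v" for us v by (cases us) auto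
  have alt: "successively (\<lambda>y z. fst y \<noteq> fst z) (verts us v)"
    if "set us \<subseteq> carrier B \<times> carrier A" "v \<in> carrier W" "\<And>y i. y \<in> set us \<Longrightarrow> rB (fst y) \<noteq> x [^]\<^bsub>W\<^esub> (i::int)"
      "\<And>y i. y \<in> set (butlast us) \<Longrightarrow> rA (snd y) \<noteq> x [^]\<^bsub>W\<^esub> (i::int)" for us v
    using that
  proof (induction us arbitrary: v)
    case (Cons y us)
    obtain b a where y: "y = (b, a)" by (cases y)
    have c: "b \<in> carrier B" "a \<in> carrier A" "set us \<subseteq> carrier B \<times> carrier A" using Cons.prems(1) y by auto
    let ?u = "v \<otimes>\<^bsub>W\<^esub> rB b" and ?v = "v \<otimes>\<^bsub>W\<^esub> rB b \<otimes>\<^bsub>W\<^esub> rA a"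
    have vc: "?u \<in> carrier W" "?v \<in> carrier W" using c rA rB Cons.prems(2) by auto
    have 1: "col v \<noteq> col ?u" using col_eq[OF Cons.prems(2) rB[OF c(1)]] Cons.prems(3)[of y] y by auto
    have IH: "successively (\<lambda>y z. fst y \<noteq> fst z) (verts us ?v)"
    proof (rule Cons.IH[OF c(3) vc(2)])
      show "rB (fst z) \<noteq> x [^]\<^bsub>W\<^esub> (i::int)" if "z \<in> set us" for z i using Cons.prems(3)[of z] that by simp
      show "rA (snd z) \<noteq> x [^]\<^bsub>W\<^esub> (i::int)" if "z \<in> set (butlast us)" for z i
        using Cons.prems(4)[of z] that by (cases us) auto
    qed
    show ?case
    proof (cases "us = []")
      case True then show ?thesis using 1 y by simp
    next
      case False
      then have "col ?u \<noteq> col ?v" using col_eq[OF vc(1) rA[OF c(2)]] Cons.prems(4)[of y] y by auto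
      then show ?thesis using 1 IH hd_verts[OF False, of ?v] y by (cases "verts us ?v") auto
    qed
  qed simp
  define xs where "xs = verts ws \<one>\<^bsub>W\<^esub>"
  define r where "r = Suc (length xs)"
  define C where "C i = fst (xs ! i)" for i
  have "successively (\<lambda>y z. fst y \<noteq> fst z) xs"
    unfolding xs_def by (rule alt[OF ws(1) W.one_closed]) (use sepA sepB in \<open>auto simp: rA_def rB_def x_def\<close>)
  then have C: "C i \<noteq> C (Suc i)" if "Suc (Suc i) < r" for i
    using that by (simp add: C_def r_def successively_conv_nth)
  interpret U: group "ut p r" by (rule ut_group[OF prime])
  have cwr: "countable (carrier (wreath (ut p r) W))"
    using W by (intro wreath_countable ut_countable[OF prime]) (simp add: p_finite_def)
  interpret WR: group "wreath (ut p r) W" by (rule wreath_group[OF U.is_group W.is_group])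
  define \<phi> where "\<phi> u = colour_elem C r (col u) 1" for u
  have \<phi>: "\<phi> u \<in> carrier (ut p r)" for u
    unfolding \<phi>_def by (rule colour_elem_closed[OF prime p_integral_1[OF prime]])
  have \<phi>i: "inv\<^bsub>ut p r\<^esub> \<phi> u = colour_elem C r (col u) (- 1)" for u
    unfolding \<phi>_def by (rule colour_elem_pow(2)[OF prime _ p_integral_1[OF prime]]) (rule C)
  define \<alpha> where "\<alpha> a = (\<lambda>v\<in>carrier W. \<one>\<^bsub>ut p r\<^esub>, rA a)" for a
  define \<beta> where "\<beta> b = (\<lambda>v\<in>carrier W. inv\<^bsub>ut p r\<^esub> \<phi> v \<otimes>\<^bsub>ut p r\<^esub> \<phi> (v \<otimes>\<^bsub>W\<^esub> rB b), rB b)" for b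
  have \<alpha>c: "\<alpha> a \<in> carrier (wreath (ut p r) W)" if "a \<in> carrier A" for a using that rA by (auto simp: \<alpha>_def wreath_carrier)
  have \<beta>c: "\<beta> b \<in> carrier (wreath (ut p r) W)" if "b \<in> carrier B" for b using that rB \<phi> by (auto simp: \<beta>_def wreath_carrier)
  have \<alpha>: "\<alpha> \<in> hom A (wreath (ut p r) W)"
  proof (rule homI)
    fix a a' assume a: "a \<in> carrier A" "a' \<in> carrier A"
    show "\<alpha> (a \<otimes>\<^bsub>A\<^esub> a') = \<alpha> a \<otimes>\<^bsub>wreath (ut p r) W\<^esub> \<alpha> a'"
    proof (rule wreath_eqI[of _ "ut p r" W])
      fix v assume v: "v \<in> carrier W"
      have "v \<otimes>\<^bsub>W\<^esub> rA a \<in> carrier W" using v rA a by simp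
      then show "fst (\<alpha> (a \<otimes>\<^bsub>A\<^esub> a')) v = fst (\<alpha> a \<otimes>\<^bsub>wreath (ut p r) W\<^esub> \<alpha> a') v"
        using v by (simp add: wreath_fst_mult) (simp add: \<alpha>_def)
    qed (use a \<alpha>c in \<open>auto simp: wreath_snd_mult\<close>, use a in \<open>auto simp: \<alpha>_def rA_def\<close>)
  qed (rule \<alpha>c)
  have \<beta>: "\<beta> \<in> hom B (wreath (ut p r) W)"
  proof (rule homI)
    fix b b' assume b: "b \<in> carrier B" "b' \<in> carrier B"
    have rm: "rB (b \<otimes>\<^bsub>B\<^esub> b') = rB b \<otimes>\<^bsub>W\<^esub> rB b'" using b by (simp add: rB_def)
    show "\<beta> (b \<otimes>\<^bsub>B\<^esub> b') = \<beta> b \<otimes>\<^bsub>wreath (ut p r) W\<^esub> \<beta> b'"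
    proof (rule wreath_eqI[of _ "ut p r" W])
      fix v assume v: "v \<in> carrier W"
      have v': "v \<otimes>\<^bsub>W\<^esub> rB b \<in> carrier W" using v rB b by simp
      have "inv\<^bsub>ut p r\<^esub> \<phi> v \<otimes>\<^bsub>ut p r\<^esub> \<phi> (v \<otimes>\<^bsub>W\<^esub> rB b) \<otimes>\<^bsub>ut p r\<^esub> (inv\<^bsub>ut p r\<^esub> \<phi> (v \<otimes>\<^bsub>W\<^esub> rB b) \<otimes>\<^bsub>ut p r\<^esub> z) = inv\<^bsub>ut p r\<^esub> \<phi> v \<otimes>\<^bsub>ut p r\<^esub> z"
        if "z \<in> carrier (ut p r)" for z
        using that \<phi>[of v] \<phi>[of "v \<otimes>\<^bsub>W\<^esub> rB b"] by (metis U.inv_closed U.inv_solve_left U.m_assoc U.m_closed)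
      then show "fst (\<beta> (b \<otimes>\<^bsub>B\<^esub> b')) v = fst (\<beta> b \<otimes>\<^bsub>wreath (ut p r) W\<^esub> \<beta> b') v"
        using v v' \<phi> rB b by (simp add: wreath_fst_mult \<beta>_def rm W.m_assoc)
    qed (use b \<beta>c in \<open>auto simp: wreath_snd_mult\<close>, use b rm in \<open>auto simp: \<beta>_def\<close>)
  qed (rule \<beta>c)
  have "\<alpha> h = \<beta> k"
  proof (rule wreath_eqI[OF \<alpha>c[OF h] \<beta>c[OF k]])
    have rk: "rB k = x" using glue by (simp add: rB_def x_def)
    show "snd (\<alpha> h) = snd (\<beta> k)" using rk by (simp add: \<alpha>_def \<beta>_def rA_def x_def)
    fix v assume v: "v \<in> carrier W"
    have "\<phi> (v \<otimes>\<^bsub>W\<^esub> x) = \<phi> v" using col_x[OF v] by (simp add: \<phi>_def)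
    then show "fst (\<alpha> h) v = fst (\<beta> k) v" using v rk \<phi>[of v] by (simp add: \<alpha>_def \<beta>_def)
  qed
  then obtain \<theta> where \<theta>: "\<theta> \<in> hom G (wreath (ut p r) W)" "\<forall>a\<in>carrier A. \<theta> (\<iota>A a) = \<alpha> a" "\<forall>b\<in>carrier B. \<theta> (\<iota>B b) = \<beta> b"
    using universal[OF WR.is_group cwr \<alpha> \<beta>] by blast
  interpret \<theta>: group_hom G "wreath (ut p r) W" \<theta> by unfold_locales (rule \<theta>(1))
  have snd_pairs: "snd (\<theta> (pairs us)) = \<rho> (pairs us)" if "set us \<subseteq> carrier B \<times> carrier A" for us
    using that
  proof (induction us)
    case Nil then show ?case by (simp add: wreath_one)
  next
    case (Cons y us)
    obtain b a where y: "y = (b, a)" by (cases y)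
    have c: "b \<in> carrier B" "a \<in> carrier A" "set us \<subseteq> carrier B \<times> carrier A" using Cons.prems y by auto
    have "snd (\<theta> (\<iota>B b)) = rB b" "snd (\<theta> (\<iota>A a)) = rA a" using \<theta> c by (auto simp: \<alpha>_def \<beta>_def)
    then show ?case using c Cons.IH by (simp add: y wreath_snd_mult rA_def rB_def)
  qed
  have snd_\<theta>: "snd (\<theta> g) = \<rho> g" if g: "g \<in> carrier G" for g
  proof -
    obtain a us where a: "a \<in> carrier A" "reduced_pairs us" "g = \<iota>A a \<otimes>\<^bsub>G\<^esub> pairs us" using normal_form[OF g] by metis
    have us: "set us \<subseteq> carrier B \<times> carrier A" using a(2) by (simp add: reduced_pairs_def)
    have "snd (\<theta> (\<iota>A a)) = rA a" using \<theta>(2) a(1) by (auto simp: \<alpha>_def)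
    then show ?thesis using a us snd_pairs[OF us] by (simp add: wreath_snd_mult rA_def)
  qed
  have fst_pairs: "fst (\<theta> (pairs us)) v = mprod (ut p r) (map (\<lambda>(c, \<gamma>). colour_elem C r c \<gamma>) (verts us v))"
    if "set us \<subseteq> carrier B \<times> carrier A" "v \<in> carrier W" for us v
    using that
  proof (induction us arbitrary: v)
    case Nil then show ?case by (simp add: wreath_one)
  next
    case (Cons y us)
    obtain b a where y: "y = (b, a)" by (cases y)
    have c: "b \<in> carrier B" "a \<in> carrier A" "set us \<subseteq> carrier B \<times> carrier A" using Cons.prems y by auto
    let ?u = "v \<otimes>\<^bsub>W\<^esub> rB b" and ?v = "v \<otimes>\<^bsub>W\<^esub> rB b \<otimes>\<^bsub>W\<^esub> rA a"
    have vc: "?u \<in> carrier W" "?v \<in> carrier W" using c rA rB Cons.prems(2) by auto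
    have pc: "\<theta> (pairs us) \<in> carrier (wreath (ut p r) W)" using c by simp
    have f: "fst (\<theta> (pairs us)) ?v \<in> carrier (ut p r)" by (rule wreath_fst_closed[OF pc vc(2)])
    have tb: "\<theta> (\<iota>B b) = \<beta> b" and ta: "\<theta> (\<iota>A a) = \<alpha> a" using \<theta> c by auto
    have sb: "snd (\<beta> b) = rB b" and sa: "snd (\<alpha> a) = rA a" by (auto simp: \<beta>_def \<alpha>_def)
    have fb: "fst (\<beta> b) v = inv\<^bsub>ut p r\<^esub> \<phi> v \<otimes>\<^bsub>ut p r\<^esub> \<phi> ?u" using Cons.prems(2) by (simp add: \<beta>_def)
    have fa: "fst (\<alpha> a) ?u = \<one>\<^bsub>ut p r\<^esub>" using vc by (simp add: \<alpha>_def)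
    have "fst (\<theta> (pairs (y # us))) v = inv\<^bsub>ut p r\<^esub> \<phi> v \<otimes>\<^bsub>ut p r\<^esub> \<phi> ?u \<otimes>\<^bsub>ut p r\<^esub> fst (\<theta> (pairs us)) ?v"
      using c Cons.prems(2) vc f by (simp add: y tb ta wreath_fst_mult sb sa fb fa)
    also have "\<dots> = inv\<^bsub>ut p r\<^esub> \<phi> v \<otimes>\<^bsub>ut p r\<^esub> (\<phi> ?u \<otimes>\<^bsub>ut p r\<^esub> fst (\<theta> (pairs us)) ?v)"
      using \<phi> f by (simp add: U.m_assoc)
    finally show ?case using Cons.IH[OF c(3) vc(2)] by (simp add: y \<phi>i) (simp add: \<phi>_def)
  qed
  have vsgn: "y \<in> set (verts us v) \<Longrightarrow> snd y = 1 \<or> snd y = - 1" for y us v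
    by (induction us arbitrary: v) auto
  have xs_ne: "xs \<noteq> []" using hd_verts[OF ws(2)] by (simp add: xs_def)
  have "fst (\<theta> (pairs ws)) \<one>\<^bsub>W\<^esub> 0 (length xs) = (\<Prod>y\<leftarrow>xs. snd y)"
    unfolding fst_pairs[OF ws(1) W.one_closed] xs_def[symmetric]
  proof (rule colour_path[OF prime])
    show "p_integral p (snd y)" if "y \<in> set xs" for y
      using vsgn[of y ws "\<one>\<^bsub>W\<^esub>"] that p_integral_1[OF prime] p_integral_uminus[OF prime p_integral_1[OF prime]] by (auto simp: xs_def)
  qed (use xs_ne in \<open>auto simp: r_def C_def\<close>)
  moreover have "(\<Prod>y\<leftarrow>xs. snd y) \<noteq> 0" using vsgn[of _ ws "\<one>\<^bsub>W\<^esub>"] by (force simp: prod_list_zero_iff xs_def)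
  ultimately have "fst (\<theta> (pairs ws)) \<one>\<^bsub>W\<^esub> \<noteq> \<one>\<^bsub>ut p r\<^esub>" by (auto simp: ut_one)
  then show ?thesis using that[OF \<theta>(1)] \<theta>(2) snd_\<theta> by (auto simp: \<alpha>_def)
qed

end

section \<open>Amalgamation along closed cyclic subgroups\<close>

lemma tame_conj:
  fixes G (structure)
  assumes prime: "Factorial_Ring.prime p" and G: "group G" and x: "x \<in> carrier G" and c: "c \<in> carrier G"
    and t: "tame_closure_at p G (x \<otimes> c \<otimes> inv x)"
  shows "tame_closure_at p G c"
  unfolding tame_closure_at_def
proof (intro ballI impI)
  interpret group G by fact
  fix g assume g: "g \<in> carrier G" "in_cyclic_closure p G c g"
  have cancel: "inv x \<otimes> (x \<otimes> z) = z" if "z \<in> carrier G" for z using that x by (simp add: m_assoc[symmetric])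
  have cl: "in_cyclic_closure p G (x \<otimes> c \<otimes> inv x) (x \<otimes> g \<otimes> inv x)"
    unfolding in_cyclic_closure_def
  proof (intro allI impI)
    fix N assume N: "p_open p G N"
    interpret N: normal N G using p_openD[OF N] by simp
    obtain i :: int where i: "g \<otimes> inv (c [^] i) \<in> N" using g(2) N unfolding in_cyclic_closure_def by blast
    have "x \<otimes> g \<otimes> inv x \<otimes> inv ((x \<otimes> c \<otimes> inv x) [^] i) = x \<otimes> (g \<otimes> inv (c [^] i)) \<otimes> inv x"
      unfolding conj_int_pow[OF prime G x c] using x c g(1) by (simp add: inv_mult_group m_assoc cancel)
    then show "\<exists>i::int. x \<otimes> g \<otimes> inv x \<otimes> inv ((x \<otimes> c \<otimes> inv x) [^] i) \<in> N" using N.inv_op_closed2[OF x i] by metis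
  qed
  have xg: "x \<otimes> g \<otimes> inv x \<in> carrier G" using x g(1) by simp
  obtain a b :: int where ab: "\<not> int p dvd a" "(x \<otimes> g \<otimes> inv x) [^] a = (x \<otimes> c \<otimes> inv x) [^] b"
    using mp[OF bspec[OF t[unfolded tame_closure_at_def] xg] cl] by blast
  have "x \<otimes> g [^] a \<otimes> inv x = x \<otimes> c [^] b \<otimes> inv x" using ab(2) x c g(1) by (simp only: conj_int_pow[OF prime G])
  then have "g [^] a = c [^] b" using x c g(1) by simp
  then show "\<exists>a b::int. \<not> int p dvd a \<and> g [^] a = c [^] b" using ab(1) by blast
qed

lemma tame_swap:
  fixes G (structure)
  assumes "Factorial_Ring.prime p" "group G" "x \<in> carrier G" "y \<in> carrier G" "tame_closure_at p G (y \<otimes> x)"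
  shows "tame_closure_at p G (x \<otimes> y)"
proof -
  interpret group G by fact
  have "y \<otimes> (x \<otimes> y) \<otimes> inv y = y \<otimes> x" using assms by (simp add: m_assoc)
  then show ?thesis using tame_conj[OF assms(1,2,4), of "x \<otimes> y"] assms by simp
qed


locale tame_amalgamation = amalgamation A B G \<iota>A \<iota>B h k
  for p :: nat and A :: "('a, 'ca) monoid_scheme" and B :: "('b, 'cb) monoid_scheme" and G :: "('g, 'cg) monoid_scheme"
    and \<iota>A \<iota>B h k +
  assumes prime: "Factorial_Ring.prime p"
    and rpA: "residually_p p A" and rpB: "residually_p p B"
    and tameA: "\<And>c. c \<in> carrier A \<Longrightarrow> tame_closure_at p A c" and tameB: "\<And>c. c \<in> carrier B \<Longrightarrow> tame_closure_at p B c"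
    and cenA: "central_mod_p p A h" and cenB: "central_mod_p p B k"
    and closedA: "cyclic_closed p A h" and closedB: "cyclic_closed p B k"
begin

lemma swap_tame: "tame_amalgamation p B A G \<iota>B \<iota>A k h"
  unfolding tame_amalgamation_def tame_amalgamation_axioms_def
  using swap prime rpA rpB tameA tameB cenA cenB closedA closedB by blast

text \<open>Closedness of \<open>\<langle>h\<rangle>\<close> in \<open>A\<close> persists in \<open>G\<close>, because the quotient of \<open>A\<close> that separates \<open>a\<close> extends.\<close>

lemma separate_A:
  assumes a: "a \<in> carrier A" "\<not> inH a"
  shows "\<exists>N. p_open p G N \<and> (\<forall>i::int. \<iota>A a \<otimes>\<^bsub>G\<^esub> inv\<^bsub>G\<^esub> (\<iota>A h [^]\<^bsub>G\<^esub> i) \<notin> N)"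
proof -
  obtain NA where NA: "p_open p A NA" "\<forall>i::int. a \<otimes>\<^bsub>A\<^esub> inv\<^bsub>A\<^esub> (h [^]\<^bsub>A\<^esub> i) \<notin> NA"
    using closedA a unfolding cyclic_closed_def by blast
  obtain N where N: "p_open p G N" "\<forall>a\<in>carrier A. \<iota>A a \<in> N \<longrightarrow> a \<in> NA"
    using extend_quotient[OF prime cenB NA(1)] by blast
  have "\<iota>A a \<otimes>\<^bsub>G\<^esub> inv\<^bsub>G\<^esub> (\<iota>A h [^]\<^bsub>G\<^esub> i) \<notin> N" for i :: int
  proof -
    have e: "\<iota>A a \<otimes>\<^bsub>G\<^esub> inv\<^bsub>G\<^esub> (\<iota>A h [^]\<^bsub>G\<^esub> i) = \<iota>A (a \<otimes>\<^bsub>A\<^esub> inv\<^bsub>A\<^esub> (h [^]\<^bsub>A\<^esub> i))"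
      using a h by (simp add: hA.hom_int_pow)
    have "a \<otimes>\<^bsub>A\<^esub> inv\<^bsub>A\<^esub> (h [^]\<^bsub>A\<^esub> i) \<in> carrier A" using a h by simp
    then show ?thesis unfolding e using N(2) NA(2) by blast
  qed
  then show ?thesis using N(1) by blast
qed

text \<open>The list \<open>vs\<close> is a part of \<open>ws\<close>: in a reduced word the last letter from \<open>A\<close> may lie in the amalgamated subgroup, in a
  cyclically reduced one it may not.\<close>

lemma reduced_quotient:
  assumes ws: "set ws \<subseteq> carrier B \<times> carrier A" "\<And>x. x \<in> set ws \<Longrightarrow> \<not> inK (fst x)" "\<And>x. x \<in> set vs \<Longrightarrow> \<not> inH (snd x)"
    and vs: "set vs \<subseteq> set ws"
  obtains N where "p_open p G N"
    "\<And>x i. x \<in> set ws \<Longrightarrow> N #>\<^bsub>G\<^esub> \<iota>B (fst x) \<noteq> (N #>\<^bsub>G\<^esub> \<iota>A h) [^]\<^bsub>G Mod N\<^esub> (i::int)"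
    "\<And>x i. x \<in> set vs \<Longrightarrow> N #>\<^bsub>G\<^esub> \<iota>A (snd x) \<noteq> (N #>\<^bsub>G\<^esub> \<iota>A h) [^]\<^bsub>G Mod N\<^esub> (i::int)"
proof -
  interpret S: tame_amalgamation p B A G \<iota>B \<iota>A k h by (rule swap_tame)
  define F where "F = (\<lambda>x. \<iota>B (fst x)) ` set ws \<union> (\<lambda>x. \<iota>A (snd x)) ` set vs"
  define Q where "Q g N \<longleftrightarrow> (\<forall>i::int. g \<otimes>\<^bsub>G\<^esub> inv\<^bsub>G\<^esub> (\<iota>A h [^]\<^bsub>G\<^esub> i) \<notin> N)" for g N
  have "\<exists>N. p_open p G N \<and> (\<forall>g\<in>F. Q g N)"
  proof (rule p_open_finite)
    fix g assume "g \<in> F"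
    then show "\<exists>N. p_open p G N \<and> Q g N"
    proof (unfold F_def, elim UnE imageE)
      fix x assume x: "g = \<iota>B (fst x)" "x \<in> set ws"
      have "fst x \<in> carrier B" using x ws(1) by (auto simp: mem_Times_iff)
      then show ?thesis using S.separate_A[of "fst x"] ws(2)[OF x(2)] unfolding Q_def x(1) glue by blast
    next
      fix x assume x: "g = \<iota>A (snd x)" "x \<in> set vs"
      have "snd x \<in> carrier A" using x ws(1) vs by (auto simp: mem_Times_iff)
      then show ?thesis using separate_A[of "snd x"] ws(3)[OF x(2)] unfolding Q_def x(1) by blast
    qed
  next
    fix g N N' assume "Q g N" "N' \<subseteq> N" then show "Q g N'" unfolding Q_def by blast
  qed (auto simp: F_def G.is_group)
  then obtain N where N: "p_open p G N" "\<And>g. g \<in> F \<Longrightarrow> Q g N" by blast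
  interpret N: normal N G using p_openD[OF N(1)] by simp
  have key: "N #>\<^bsub>G\<^esub> g \<noteq> (N #>\<^bsub>G\<^esub> \<iota>A h) [^]\<^bsub>G Mod N\<^esub> (i::int)" if g: "g \<in> F" "g \<in> carrier G" for g i
  proof -
    have "(N #>\<^bsub>G\<^esub> \<iota>A h) [^]\<^bsub>G Mod N\<^esub> i = N #>\<^bsub>G\<^esub> (\<iota>A h [^]\<^bsub>G\<^esub> i)" using h by (simp add: N.FactGroup_int_pow)
    then show ?thesis using p_open_coset_cong[OF N.normal_axioms g(2), of "\<iota>A h [^]\<^bsub>G\<^esub> i"] N(2)[OF g(1)] h by (simp add: Q_def)
  qed
  show ?thesis
  proof (rule that[OF N(1)])
    fix x and i :: int
    show "N #>\<^bsub>G\<^esub> \<iota>B (fst x) \<noteq> (N #>\<^bsub>G\<^esub> \<iota>A h) [^]\<^bsub>G Mod N\<^esub> i" if "x \<in> set ws"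
      by (rule key) (use that ws(1) in \<open>auto simp: F_def mem_Times_iff\<close>)
    show "N #>\<^bsub>G\<^esub> \<iota>A (snd x) \<noteq> (N #>\<^bsub>G\<^esub> \<iota>A h) [^]\<^bsub>G Mod N\<^esub> i" if "x \<in> set vs"
      by (rule key) (use that ws(1) vs in \<open>auto simp: F_def mem_Times_iff\<close>)
  qed
qed

text \<open>The homomorphism that detects the word has trivial base coordinates on \<open>A\<close>. Multiplication by elements of \<open>A\<close> on
  both sides therefore only translates the coordinates of the word.\<close>

lemma A_closed:
  assumes a: "a \<in> carrier A" and ws: "reduced_pairs ws" "ws \<noteq> []"
  shows "\<exists>N. p_open p G N \<and> (\<forall>a'\<in>carrier A. \<iota>A a \<otimes>\<^bsub>G\<^esub> pairs ws \<otimes>\<^bsub>G\<^esub> inv\<^bsub>G\<^esub> \<iota>A a' \<notin> N)"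
proof -
  have wsc: "set ws \<subseteq> carrier B \<times> carrier A" using ws(1) by (simp add: reduced_pairs_def)
  have bl: "set (butlast ws) \<subseteq> set ws" by (auto dest: in_set_butlastD)
  obtain N where N: "p_open p G N"
    "\<And>x i. x \<in> set ws \<Longrightarrow> N #>\<^bsub>G\<^esub> \<iota>B (fst x) \<noteq> (N #>\<^bsub>G\<^esub> \<iota>A h) [^]\<^bsub>G Mod N\<^esub> (i::int)"
    "\<And>x i. x \<in> set (butlast ws) \<Longrightarrow> N #>\<^bsub>G\<^esub> \<iota>A (snd x) \<noteq> (N #>\<^bsub>G\<^esub> \<iota>A h) [^]\<^bsub>G Mod N\<^esub> (i::int)"
    by (rule reduced_quotient[OF wsc _ _ bl]) (use ws(1) in \<open>auto simp: reduced_pairs_def\<close>)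
  define W where "W = G Mod N"
  define \<rho> where "\<rho> = (\<lambda>g. N #>\<^bsub>G\<^esub> g)"
  have W: "p_finite p W" unfolding W_def by (rule p_finite_Mod[OF N(1)])
  interpret W: group W using W by (simp add: p_finite_def)
  have \<rho>: "\<rho> \<in> hom G W" unfolding \<rho>_def W_def by (rule Mod_hom(1)[OF p_openD(1)[OF N(1)]])
  interpret \<rho>: group_hom G W \<rho> by unfold_locales (rule \<rho>)
  obtain r \<theta> where \<theta>: "\<theta> \<in> hom G (wreath (ut p r) W)"
    "\<And>a v. a \<in> carrier A \<Longrightarrow> v \<in> carrier W \<Longrightarrow> fst (\<theta> (\<iota>A a)) v = \<one>\<^bsub>ut p r\<^esub>"
    "\<And>g. g \<in> carrier G \<Longrightarrow> snd (\<theta> g) = \<rho> g"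
    "fst (\<theta> (pairs ws)) \<one>\<^bsub>W\<^esub> \<noteq> \<one>\<^bsub>ut p r\<^esub>"
    by (rule reduced_image_detected[OF prime W \<rho> wsc ws(2)]) (use N in \<open>auto simp: \<rho>_def W_def\<close>)
  interpret U: group "ut p r" by (rule ut_group[OF prime])
  interpret WR: group "wreath (ut p r) W" by (rule wreath_group[OF U.is_group W.is_group])
  interpret \<theta>: group_hom G "wreath (ut p r) W" \<theta> by unfold_locales (rule \<theta>(1))
  have pc: "pairs ws \<in> carrier G" using wsc by simp
  let ?f = "fst (\<theta> (pairs ws)) \<one>\<^bsub>W\<^esub>"
  have f: "?f \<in> carrier (ut p r)" using wreath_fst_closed[OF \<theta>.hom_closed[OF pc] W.one_closed] .
  obtain i j where ij: "?f i j \<noteq> 0" using \<theta>(4) by (auto simp: ut_one fun_eq_iff)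
  obtain m where m: "\<not> p_mult p m (?f i j)" using p_mult_nonzero[OF prime ij] f by (auto simp: ut_carrier)
  let ?M = "{g \<in> carrier G. \<theta> g \<in> wreath_base (ut_cong p r m) W}"
  have M: "p_open p G ?M" by (rule p_open_vimage[OF \<theta>(1) G.is_group wreath_base_open[OF ut_cong_open[OF prime] W]])
  have "\<iota>A a \<otimes>\<^bsub>G\<^esub> pairs ws \<otimes>\<^bsub>G\<^esub> inv\<^bsub>G\<^esub> \<iota>A a' \<notin> ?M" if a': "a' \<in> carrier A" for a'
  proof
    assume in_M: "\<iota>A a \<otimes>\<^bsub>G\<^esub> pairs ws \<otimes>\<^bsub>G\<^esub> inv\<^bsub>G\<^esub> \<iota>A a' \<in> ?M"
    let ?v = "inv\<^bsub>W\<^esub> \<rho> (\<iota>A a)"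
    have v: "?v \<in> carrier W" using a by simp
    let ?u = "\<one>\<^bsub>W\<^esub> \<otimes>\<^bsub>W\<^esub> \<rho> (pairs ws)"
    have u: "?u \<in> carrier W" using pc by simp
    have e: "\<iota>A a \<otimes>\<^bsub>G\<^esub> pairs ws \<otimes>\<^bsub>G\<^esub> inv\<^bsub>G\<^esub> \<iota>A a' = \<iota>A a \<otimes>\<^bsub>G\<^esub> (pairs ws \<otimes>\<^bsub>G\<^esub> \<iota>A (inv\<^bsub>A\<^esub> a'))"
      using a a' pc by (simp add: G.m_assoc)
    have "fst (\<theta> (\<iota>A a \<otimes>\<^bsub>G\<^esub> (pairs ws \<otimes>\<^bsub>G\<^esub> \<iota>A (inv\<^bsub>A\<^esub> a')))) ?v = ?f"
    proof -
      have "\<theta> (\<iota>A a \<otimes>\<^bsub>G\<^esub> (pairs ws \<otimes>\<^bsub>G\<^esub> \<iota>A (inv\<^bsub>A\<^esub> a'))) =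
        \<theta> (\<iota>A a) \<otimes>\<^bsub>wreath (ut p r) W\<^esub> (\<theta> (pairs ws) \<otimes>\<^bsub>wreath (ut p r) W\<^esub> \<theta> (\<iota>A (inv\<^bsub>A\<^esub> a')))"
        using a a' pc by (simp del: hA.hom_inv)
      moreover have "?v \<otimes>\<^bsub>W\<^esub> snd (\<theta> (\<iota>A a)) = \<one>\<^bsub>W\<^esub>" using \<theta>(3) a by simp
      moreover have "fst (\<theta> (\<iota>A (inv\<^bsub>A\<^esub> a'))) ?u = \<one>\<^bsub>ut p r\<^esub>" by (rule \<theta>(2)[OF A.inv_closed[OF a'] u])
      ultimately show ?thesis using v f \<theta>(2)[OF a v] \<theta>(3)[OF pc] by (simp only: wreath_fst_mult W.one_closed) simp
    qed
    moreover have "fst (\<theta> (\<iota>A a \<otimes>\<^bsub>G\<^esub> (pairs ws \<otimes>\<^bsub>G\<^esub> \<iota>A (inv\<^bsub>A\<^esub> a')))) ?v \<in> ut_cong p r m"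
    proof -
      have "\<iota>A a \<otimes>\<^bsub>G\<^esub> (pairs ws \<otimes>\<^bsub>G\<^esub> \<iota>A (inv\<^bsub>A\<^esub> a')) \<in> ?M" using in_M unfolding e .
      then show ?thesis using v wreath_base_iff[OF \<theta>.hom_closed] by blast
    qed
    ultimately show False using m by (simp add: ut_cong_def)
  qed
  then show ?thesis using M by blast
qed

lemma residually_p_G: "residually_p p G"
  unfolding residually_p_def
proof (intro ballI impI)
  fix g assume g: "g \<in> carrier G" "g \<noteq> \<one>\<^bsub>G\<^esub>"
  obtain a ws where n: "a \<in> carrier A" "reduced_pairs ws" "g = \<iota>A a \<otimes>\<^bsub>G\<^esub> pairs ws" using normal_form[OF g(1)] by metis
  show "\<exists>N. p_open p G N \<and> g \<notin> N"
  proof (cases "ws = []")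
    case True
    then have ga: "g = \<iota>A a" using n by simp
    then have "a \<noteq> \<one>\<^bsub>A\<^esub>" using g(2) by auto
    then obtain NA where "p_open p A NA" "a \<notin> NA" using rpA n(1) unfolding residually_p_def by blast
    then show ?thesis using extend_quotient[OF prime cenB] n(1) ga by blast
  next
    case False
    obtain N where N: "p_open p G N" "\<forall>a'\<in>carrier A. \<iota>A a \<otimes>\<^bsub>G\<^esub> pairs ws \<otimes>\<^bsub>G\<^esub> inv\<^bsub>G\<^esub> \<iota>A a' \<notin> N"
      using A_closed[OF n(1,2) False] by blast
    have "g \<otimes>\<^bsub>G\<^esub> inv\<^bsub>G\<^esub> \<iota>A \<one>\<^bsub>A\<^esub> \<notin> N" using N(2) n(3) by blast
    then show ?thesis using N(1) g(1) by auto
  qed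
qed

text \<open>The factor \<open>A\<close> is closed in \<open>G\<close> and carries the topology induced from \<open>G\<close>, so the closures of \<open>\<langle>a\<rangle>\<close> in \<open>A\<close> and
  in \<open>G\<close> coincide.\<close>

lemma tame_A:
  assumes a: "a \<in> carrier A" shows "tame_closure_at p G (\<iota>A a)"
  unfolding tame_closure_at_def
proof (intro ballI impI)
  fix g assume g: "g \<in> carrier G" and cl: "in_cyclic_closure p G (\<iota>A a) g"
  have pw: "\<iota>A a [^]\<^bsub>G\<^esub> (i::int) = \<iota>A (a [^]\<^bsub>A\<^esub> i)" for i using a by (simp add: hA.hom_int_pow)
  obtain a0 ws where n: "a0 \<in> carrier A" "reduced_pairs ws" "g = \<iota>A a0 \<otimes>\<^bsub>G\<^esub> pairs ws" using normal_form[OF g(1)] by metis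
  have "ws = []"
  proof (rule ccontr)
    assume "ws \<noteq> []"
    then obtain N where N: "p_open p G N" "\<forall>a'\<in>carrier A. \<iota>A a0 \<otimes>\<^bsub>G\<^esub> pairs ws \<otimes>\<^bsub>G\<^esub> inv\<^bsub>G\<^esub> \<iota>A a' \<notin> N"
      using A_closed[OF n(1,2)] by blast
    obtain i :: int where "g \<otimes>\<^bsub>G\<^esub> inv\<^bsub>G\<^esub> (\<iota>A a [^]\<^bsub>G\<^esub> i) \<in> N" using cl N(1) unfolding in_cyclic_closure_def by blast
    then show False using N(2) a unfolding pw n(3) by auto
  qed
  then have ga: "g = \<iota>A a0" using n by simp
  have "in_cyclic_closure p A a a0" unfolding in_cyclic_closure_def
  proof (intro allI impI)
    fix NA assume "p_open p A NA"
    then obtain N where N: "p_open p G N" "\<forall>a\<in>carrier A. \<iota>A a \<in> N \<longrightarrow> a \<in> NA"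
      using extend_quotient[OF prime cenB] by blast
    obtain i :: int where "g \<otimes>\<^bsub>G\<^esub> inv\<^bsub>G\<^esub> (\<iota>A a [^]\<^bsub>G\<^esub> i) \<in> N" using cl N(1) unfolding in_cyclic_closure_def by blast
    then have "\<iota>A (a0 \<otimes>\<^bsub>A\<^esub> inv\<^bsub>A\<^esub> (a [^]\<^bsub>A\<^esub> i)) \<in> N" using a n(1) unfolding pw ga by simp
    then show "\<exists>i::int. a0 \<otimes>\<^bsub>A\<^esub> inv\<^bsub>A\<^esub> (a [^]\<^bsub>A\<^esub> i) \<in> NA" using N(2) a n(1) by blast
  qed
  then obtain x y :: int where xy: "\<not> int p dvd x" "a0 [^]\<^bsub>A\<^esub> x = a [^]\<^bsub>A\<^esub> y"
    using tameA[OF a] n(1) unfolding tame_closure_at_def by blast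
  have "\<iota>A a0 [^]\<^bsub>G\<^esub> x = \<iota>A a [^]\<^bsub>G\<^esub> y" using xy(2) a n(1) by (metis hA.hom_int_pow)
  then show "\<exists>x y::int. \<not> int p dvd x \<and> g [^]\<^bsub>G\<^esub> x = \<iota>A a [^]\<^bsub>G\<^esub> y" using xy(1) ga by blast
qed

lemma tame_B: "b \<in> carrier B \<Longrightarrow> tame_closure_at p G (\<iota>B b)"
  using tame_amalgamation.tame_A[OF swap_tame] .

lemma pairs_pow: "set ws \<subseteq> carrier B \<times> carrier A \<Longrightarrow> pairs (concat (replicate n ws)) = pairs ws [^]\<^bsub>G\<^esub> n"
proof (induction n)
  case (Suc n)
  have "set (concat (replicate n ws)) \<subseteq> carrier B \<times> carrier A" using Suc.prems by auto
  then have "pairs (concat (replicate (Suc n) ws)) = pairs ws \<otimes>\<^bsub>G\<^esub> pairs ws [^]\<^bsub>G\<^esub> n"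
    using Suc by (simp add: pairs_append)
  also have "\<dots> = pairs ws [^]\<^bsub>G\<^esub> Suc n" using Suc.prems by (simp only: G.nat_pow_Suc2[OF pairs_closed])
  finally show ?case .
qed simp

text \<open>All powers of a cyclically reduced word are reduced, so a power that is trivial in the finite quotient \<open>W\<close> is
  still detected, now by an element of the base group.\<close>

lemma tame_cyclically_reduced:
  assumes ws: "set ws \<subseteq> carrier B \<times> carrier A" "ws \<noteq> []"
    and K: "\<And>x. x \<in> set ws \<Longrightarrow> \<not> inK (fst x)" and H: "\<And>x. x \<in> set ws \<Longrightarrow> \<not> inH (snd x)"
  shows "tame_closure_at p G (pairs ws)"
proof -
  obtain N where N: "p_open p G N"
    "\<And>x i. x \<in> set ws \<Longrightarrow> N #>\<^bsub>G\<^esub> \<iota>B (fst x) \<noteq> (N #>\<^bsub>G\<^esub> \<iota>A h) [^]\<^bsub>G Mod N\<^esub> (i::int)"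
    "\<And>x i. x \<in> set ws \<Longrightarrow> N #>\<^bsub>G\<^esub> \<iota>A (snd x) \<noteq> (N #>\<^bsub>G\<^esub> \<iota>A h) [^]\<^bsub>G Mod N\<^esub> (i::int)"
    by (rule reduced_quotient[OF ws(1) K H]) auto
  define W where "W = G Mod N"
  define \<rho> where "\<rho> = (\<lambda>g. N #>\<^bsub>G\<^esub> g)"
  have W: "p_finite p W" unfolding W_def by (rule p_finite_Mod[OF N(1)])
  interpret W: group W using W by (simp add: p_finite_def)
  have \<rho>: "\<rho> \<in> hom G W" unfolding \<rho>_def W_def by (rule Mod_hom(1)[OF p_openD(1)[OF N(1)]])
  interpret \<rho>: group_hom G W \<rho> by unfold_locales (rule \<rho>)
  obtain s where s: "\<And>g. g \<in> carrier W \<Longrightarrow> g [^]\<^bsub>W\<^esub> (p ^ s) = \<one>\<^bsub>W\<^esub>" using W unfolding p_finite_def by auto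
  have ps: "p ^ s > 0" using prime prime_gt_0_nat by simp
  define us where "us = concat (replicate (p ^ s) ws)"
  have setus: "set us = set ws" using ps by (auto simp: us_def)
  have us: "set us \<subseteq> carrier B \<times> carrier A" "us \<noteq> []" using ws setus by auto
  have bl: "set (butlast us) \<subseteq> set ws" using setus by (auto dest: in_set_butlastD)
  obtain r \<theta> where \<theta>: "\<theta> \<in> hom G (wreath (ut p r) W)"
    "\<And>a v. a \<in> carrier A \<Longrightarrow> v \<in> carrier W \<Longrightarrow> fst (\<theta> (\<iota>A a)) v = \<one>\<^bsub>ut p r\<^esub>"
    "\<And>g. g \<in> carrier G \<Longrightarrow> snd (\<theta> g) = \<rho> g"
    "fst (\<theta> (pairs us)) \<one>\<^bsub>W\<^esub> \<noteq> \<one>\<^bsub>ut p r\<^esub>"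
    by (rule reduced_image_detected[OF prime W \<rho> us]) (use N bl in \<open>auto simp: \<rho>_def W_def setus\<close>)
  have c: "pairs ws \<in> carrier G" using ws by simp
  have eq: "pairs us = pairs ws [^]\<^bsub>G\<^esub> (p ^ s)" unfolding us_def by (rule pairs_pow[OF ws(1)])
  show ?thesis
  proof (rule wreath_ut_detects(2)[OF prime G.is_group W \<theta>(1) c _ W.one_closed _ residually_p_G, where M = "p ^ s"])
    show "snd (\<theta> (pairs ws [^]\<^bsub>G\<^esub> (p ^ s))) = \<one>\<^bsub>W\<^esub>" using \<theta>(3) c s by (simp add: \<rho>.hom_nat_pow)
    show "fst (\<theta> (pairs ws [^]\<^bsub>G\<^esub> (p ^ s))) \<one>\<^bsub>W\<^esub> \<noteq> \<one>\<^bsub>ut p r\<^esub>" using \<theta>(4) eq by simp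
  qed
qed

text \<open>By conjugation the last letter of a reduced word is moved to the front. Either the result is cyclically reduced, or
  letters merge and the word becomes shorter, until a single factor is reached.\<close>

theorem tame: assumes g: "g \<in> carrier G" shows "tame_closure_at p G g"
proof -
  have "tame_closure_at p G (\<iota>A a \<otimes>\<^bsub>G\<^esub> pairs ws)" if "a \<in> carrier A" "reduced_pairs ws" for a ws
    using that
  proof (induction "length ws" arbitrary: a ws rule: less_induct)
    case less
    have wsc: "set ws \<subseteq> carrier B \<times> carrier A" using less.prems by (simp add: reduced_pairs_def)
    show ?case
    proof (cases ws rule: rev_cases)
      case Nil then show ?thesis using tame_A less.prems by simp
    next
      case (snoc ws1 y)
      obtain bn an where y: "y = (bn, an)" by (cases y)
      have c: "bn \<in> carrier B" "an \<in> carrier A" "set ws1 \<subseteq> carrier B \<times> carrier A" using wsc snoc y by auto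
      have nbn: "\<not> inK bn" and n1: "\<And>x. x \<in> set ws1 \<Longrightarrow> \<not> inK (fst x)" "\<And>x. x \<in> set ws1 \<Longrightarrow> \<not> inH (snd x)"
        using less.prems(2) snoc y by (auto simp: reduced_pairs_def)
      let ?a = "an \<otimes>\<^bsub>A\<^esub> a"
      have ac: "?a \<in> carrier A" using c less.prems by simp
      have e1: "pairs ws \<otimes>\<^bsub>G\<^esub> \<iota>A a = pairs (ws1 @ [(bn, ?a)])"
        using c less.prems(1) by (simp add: snoc y pairs_append G.m_assoc)
      have "tame_closure_at p G (pairs (ws1 @ [(bn, ?a)]))"
      proof (cases "inH ?a")
        case False
        show ?thesis by (rule tame_cyclically_reduced) (use c ac nbn n1 False in auto)
      next
        case True
        then obtain i :: int where i: "?a = h [^]\<^bsub>A\<^esub> i" by blast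
        let ?b = "bn \<otimes>\<^bsub>B\<^esub> k [^]\<^bsub>B\<^esub> i"
        have bc: "?b \<in> carrier B" using c k by simp
        have e2: "pairs (ws1 @ [(bn, ?a)]) = pairs ws1 \<otimes>\<^bsub>G\<^esub> \<iota>B ?b"
          using c k h by (simp add: pairs_append i glue_pow)
        show ?thesis
        proof (cases ws1)
          case Nil then show ?thesis unfolding e2 using tame_B[OF bc] bc by simp
        next
          case (Cons x ws2)
          obtain b1 a1 where x: "x = (b1, a1)" by (cases x)
          have c1: "b1 \<in> carrier B" "a1 \<in> carrier A" "set ws2 \<subseteq> carrier B \<times> carrier A" using c(3) Cons x by auto
          let ?b' = "?b \<otimes>\<^bsub>B\<^esub> b1"
          have b'c: "?b' \<in> carrier B" using bc c1 by simp
          have e3: "\<iota>B ?b \<otimes>\<^bsub>G\<^esub> pairs ws1 = pairs ((?b', a1) # ws2)"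
            using hB.hom_mult[OF bc c1(1)] bc c1 by (simp only: Cons x pairs_simps) (simp add: G.m_assoc del: hB.hom_mult)
          have "tame_closure_at p G (pairs ((?b', a1) # ws2))"
          proof (cases "inK ?b'")
            case True
            then obtain j :: int where j: "?b' = k [^]\<^bsub>B\<^esub> j" by blast
            have e4: "pairs ((?b', a1) # ws2) = \<iota>A (h [^]\<^bsub>A\<^esub> j \<otimes>\<^bsub>A\<^esub> a1) \<otimes>\<^bsub>G\<^esub> pairs ws2"
              using h c1 unfolding j by (simp flip: glue_pow add: G.m_assoc)
            have "reduced_pairs ws2"
              unfolding reduced_pairs_def
            proof (intro conjI ballI)
              show "set ws2 \<subseteq> carrier B \<times> carrier A" by (rule c1(3))
              show "\<not> inK (fst z)" if "z \<in> set ws2" for z using n1(1)[of z] that Cons by simp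
              show "\<not> inH (snd z)" if "z \<in> set (butlast ws2)" for z
                using n1(2)[of z] in_set_butlastD[OF that] Cons by simp
            qed
            moreover have "length ws2 < length ws" using snoc Cons by simp
            ultimately show ?thesis unfolding e4 using h c1 by (intro less.hyps) auto
          next
            case False
            show ?thesis
            proof (rule tame_cyclically_reduced)
              show "set ((?b', a1) # ws2) \<subseteq> carrier B \<times> carrier A" using c1 b'c by simp
              show "\<not> inK (fst z)" if z: "z \<in> set ((?b', a1) # ws2)" for z
              proof (cases "z = (?b', a1)")
                case True then show ?thesis using \<open>\<not> inK ?b'\<close> by simp
              next
                case False
                then have "z \<in> set ws1" using z Cons by simp
                then show ?thesis by (rule n1(1))
              qed
              show "\<not> inH (snd z)" if z: "z \<in> set ((?b', a1) # ws2)" for z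
              proof (cases "z = (?b', a1)")
                case True
                have "(b1, a1) \<in> set ws1" using x Cons by simp
                from n1(2)[OF this] show ?thesis using True by simp
              next
                case False
                then have "z \<in> set ws1" using z Cons by simp
                then show ?thesis by (rule n1(2))
              qed
            qed simp
          qed
          then show ?thesis unfolding e2 using tame_swap[OF prime G.is_group, of "pairs ws1" "\<iota>B ?b"] bc c(3) e3 by simp
        qed
      qed
      then show ?thesis
        using tame_swap[OF prime G.is_group, of "\<iota>A a" "pairs ws"] less.prems(1) wsc e1 by simp
    qed
  qed
  then show ?thesis using normal_form[OF g] by metis
qed

end

section \<open>Marked vertices and roots\<close>

lemma finite_avoid:
  fixes n0 :: nat
  assumes "finite I" "card I < n0" and B: "\<And>i s s'. i \<in> I \<Longrightarrow> s < n0 \<Longrightarrow> s' < n0 \<Longrightarrow> B i s \<Longrightarrow> B i s' \<Longrightarrow> s = s'"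
  shows "\<exists>s<n0. \<forall>i\<in>I. \<not> B i s"
proof (rule ccontr)
  assume "\<not> ?thesis"
  then have "\<forall>s\<in>{..<n0}. \<exists>i. i \<in> I \<and> B i s" by blast
  then obtain f where f: "\<forall>s\<in>{..<n0}. f s \<in> I \<and> B (f s) s" using bchoice by metis
  then have "inj_on f {..<n0}" using B by (intro inj_onI) (metis lessThan_iff)
  moreover have "f ` {..<n0} \<subseteq> I" using f by blast
  ultimately have "n0 \<le> card I" using card_inj_on_le[OF _ _ assms(1)] by fastforce
  then show False using assms(2) by simp
qed

text \<open>One vertex is marked in each coset \<open>u\<langle>x\<rangle>\<close> with \<open>u \<in> Us\<close>. It is sought among the vertices \<open>u h\<^sup>s\<close> with
  \<open>s < n0\<close>. An element of \<open>Z\<close> excludes at most one \<open>s\<close>, because these vertices are distinct. A pair \<open>(u', t)\<close> excludes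
  at most one \<open>s\<close>, because two solutions of \<open>u h\<^sup>s \<in> u'\<langle>x\<rangle> W t\<close> would make \<open>W t\<close> conjugate a power
  of \<open>h\<close> into \<open>\<langle>x\<rangle>\<close>. So the bound on \<open>n0\<close> leaves one value of \<open>s\<close>.\<close>

lemma choose_marks:
  fixes P (structure) and W :: "nat \<Rightarrow> 'a"
  assumes P: "group P" and x: "x \<in> carrier P" and h: "h = x [^] (n::nat)"
    and Us: "finite Us" "Us \<subseteq> carrier P" and Z: "finite Z" and T: "finite T" "\<And>t. t \<in> T \<Longrightarrow> W t \<in> carrier P"
    and n0: "card Z + card Us * card T < n0"
    and h_ord: "\<And>s. 0 < s \<Longrightarrow> s < n0 \<Longrightarrow> h [^] (s::nat) \<noteq> \<one>"
    and conj: "\<And>s t i. 0 < s \<Longrightarrow> s < n0 \<Longrightarrow> t \<in> T \<Longrightarrow> W t \<otimes> h [^] (s::nat) \<otimes> inv (W t) \<noteq> x [^] (i::int)"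
  obtains D where "D \<subseteq> carrier P" "D \<inter> Z = {}" "\<And>u. u \<in> Us \<Longrightarrow> \<exists>d. D \<inter> cyclic_coset P x u = {d}"
    "\<And>u v t. u \<in> Us \<Longrightarrow> v \<in> cyclic_coset P x u \<Longrightarrow> t \<in> T \<Longrightarrow> v \<otimes> W t \<notin> D"
proof -
  interpret group P by fact
  have hc: "h \<in> carrier P" using x h by simp
  have hx: "h [^] (s::nat) = x [^] (int (n * s))" for s unfolding h int_pow_int using x by (simp add: nat_pow_pow)
  define bad where "bad u i s = (case i of Inl z \<Rightarrow> u \<otimes> h [^] (s::nat) = z
    | Inr (u', t) \<Rightarrow> \<exists>v\<in>cyclic_coset P x u'. u \<otimes> h [^] s = v \<otimes> W t)" for u i s
  have "\<exists>s<n0. \<forall>i\<in>Inl ` Z \<union> Inr ` (Us \<times> T). \<not> bad u i s" if u: "u \<in> carrier P" for u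
  proof (rule finite_avoid)
    show "finite (Inl ` Z \<union> Inr ` (Us \<times> T))" using Z T Us by simp
    have "card (Inl ` Z \<union> Inr ` (Us \<times> T)) = card Z + card Us * card T"
      using Z T Us by (subst card_Un_disjoint) (auto simp: card_image card_cartesian_product)
    then show "card (Inl ` Z \<union> Inr ` (Us \<times> T)) < n0" using n0 by simp
  next
    fix i s s' assume i: "i \<in> Inl ` Z \<union> Inr ` (Us \<times> T)" and s: "s < n0" "s' < n0" and b: "bad u i s" "bad u i s'"
    have cancel: "a = b" if ab: "a \<le> b" "b < n0" "bad u i a" "bad u i b" for a b
    proof (rule ccontr)
      assume "a \<noteq> b"
      then have d: "0 < b - a" "b - a < n0" using ab by auto
      have split: "h [^] b = h [^] a \<otimes> h [^] (b - a)" using ab(1) hc by (simp add: nat_pow_mult)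
      from i show False
      proof
        assume "i \<in> Inl ` Z"
        then obtain z where "i = Inl z" by blast
        then have "u \<otimes> h [^] a = u \<otimes> h [^] b" using ab by (simp add: bad_def)
        then have "h [^] (b - a) = \<one>" using u hc by (simp add: split)
        then show False using h_ord[OF d] by simp
      next
        assume "i \<in> Inr ` (Us \<times> T)"
        then obtain u' t where ut: "i = Inr (u', t)" "u' \<in> Us" "t \<in> T" by blast
        have u': "u' \<in> carrier P" and Wt: "W t \<in> carrier P" using ut Us T by auto
        obtain j j' :: int where j: "u \<otimes> h [^] a = u' \<otimes> x [^] j \<otimes> W t" "u \<otimes> h [^] b = u' \<otimes> x [^] j' \<otimes> W t"
          using ab(3,4) unfolding bad_def ut(1) cyclic_coset_def by auto
        have "u' \<otimes> x [^] j' \<otimes> W t = u' \<otimes> x [^] j \<otimes> W t \<otimes> h [^] (b - a)"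
          using j(2) u hc unfolding split j(1)[symmetric] by (simp add: m_assoc)
        then have "x [^] j' \<otimes> W t = x [^] j \<otimes> (W t \<otimes> h [^] (b - a))" using u' x Wt hc by (simp add: m_assoc)
        moreover have "x [^] j' = x [^] j \<otimes> x [^] (j' - j)" using int_pow_mult[OF x, of j "j' - j"] by simp
        ultimately have "x [^] (j' - j) \<otimes> W t = W t \<otimes> h [^] (b - a)" using x Wt hc by (simp add: m_assoc)
        then have "W t \<otimes> h [^] (b - a) \<otimes> inv (W t) = x [^] (j' - j)" using x Wt hc by (metis inv_solve_right int_pow_closed m_closed nat_pow_closed)
        then show False using conj[OF d ut(3)] by blast
      qed
    qed
    show "s = s'" using cancel[of s s'] cancel[of s' s] s b by (cases "s \<le> s'") auto
  qed
  then have "\<forall>u\<in>carrier P. \<exists>s. s < n0 \<and> (\<forall>i\<in>Inl ` Z \<union> Inr ` (Us \<times> T). \<not> bad u i s)" by blast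
  then obtain s where s: "\<forall>u\<in>carrier P. s u < n0 \<and> (\<forall>i\<in>Inl ` Z \<union> Inr ` (Us \<times> T). \<not> bad u i (s u))" using bchoice by metis
  \<comment> \<open>Several members of \<open>Us\<close> may lie in the same coset, which must receive only one mark.\<close>
  define rep where "rep K = (SOME u. u \<in> Us \<and> cyclic_coset P x u = K)" for K
  have rep: "rep (cyclic_coset P x u) \<in> Us \<and> cyclic_coset P x (rep (cyclic_coset P x u)) = cyclic_coset P x u" if "u \<in> Us" for u
    unfolding rep_def by (rule someI[of _ u]) (use that in auto)
  define m where "m u = u \<otimes> h [^] s u" for u
  define D where "D = (\<lambda>K. m (rep K)) ` cyclic_coset P x ` Us"
  have m: "m u \<in> carrier P" "cyclic_coset P x (m u) = cyclic_coset P x u" "m u \<notin> Z"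
     "\<And>u' v t. u' \<in> Us \<Longrightarrow> v \<in> cyclic_coset P x u' \<Longrightarrow> t \<in> T \<Longrightarrow> v \<otimes> W t \<noteq> m u" if "u \<in> Us" for u
  proof -
    have u: "u \<in> carrier P" using that Us by auto
    then show "m u \<in> carrier P" using hc by (simp add: m_def)
    show "cyclic_coset P x (m u) = cyclic_coset P x u" unfolding m_def hx by (rule cyclic_coset_shift[OF P x u])
    show "m u \<notin> Z" using s u by (force simp: bad_def m_def)
    fix u' v t assume "u' \<in> Us" "v \<in> cyclic_coset P x u'" "t \<in> T"
    moreover from this have "\<not> bad u (Inr (u', t)) (s u)" using s u by blast
    ultimately show "v \<otimes> W t \<noteq> m u" unfolding bad_def m_def by force
  qed
  have DE: "\<exists>u\<in>Us. d = m u" if "d \<in> D" for d using that rep unfolding D_def by blast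
  show ?thesis
  proof (rule that[of D])
    show "D \<subseteq> carrier P" "D \<inter> Z = {}" using DE m by blast+
    fix u assume u: "u \<in> Us"
    have "D \<inter> cyclic_coset P x u = {m (rep (cyclic_coset P x u))}"
    proof
      show "{m (rep (cyclic_coset P x u))} \<subseteq> D \<inter> cyclic_coset P x u"
        using rep[OF u] m(2)[of "rep (cyclic_coset P x u)"] m(1)[of "rep (cyclic_coset P x u)"] u
          cyclic_coset_self[OF P, of "m (rep (cyclic_coset P x u))"] unfolding D_def by auto
      show "D \<inter> cyclic_coset P x u \<subseteq> {m (rep (cyclic_coset P x u))}"
      proof
        fix d assume d: "d \<in> D \<inter> cyclic_coset P x u"
        then obtain u' where u': "u' \<in> Us" "d = m (rep (cyclic_coset P x u'))" unfolding D_def by blast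
        have "cyclic_coset P x d = cyclic_coset P x u'" using u' rep[OF u'(1)] m(2) by auto
        moreover have "cyclic_coset P x d = cyclic_coset P x u" using d cyclic_coset_eq[OF P x] u Us by blast
        ultimately show "d \<in> {m (rep (cyclic_coset P x u))}" using u' by simp
      qed
    qed
    then show "\<exists>d. D \<inter> cyclic_coset P x u = {d}" by blast
    show "v \<otimes> W t \<notin> D" if "v \<in> cyclic_coset P x u" "t \<in> T" for v t using DE m(4) u that by blast
  qed
qed

text \<open>A power \<open>g\<^sup>O\<close> of \<open>g\<close> lies in the base group and has an \<open>n\<close>-th root \<open>R\<close> there, coordinate by coordinate. It
  commutes with \<open>g\<close> because roots in unitriangular groups are unique. If \<open>n l = 1 + O q\<close>, then \<open>g\<^sup>l R\<^sup>-\<^sup>q\<close> is an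
  \<open>n\<close>-th root of \<open>g\<close>.\<close>

lemma wreath_ut_root:
  assumes prime: "Factorial_Ring.prime p" and P: "p_finite p P" and g: "g \<in> carrier (wreath (ut p r) P)" and n: "\<not> p dvd n"
  obtains R l q where "R \<in> carrier (wreath (ut p r) P)" "snd R = \<one>\<^bsub>P\<^esub>"
    "R [^]\<^bsub>wreath (ut p r) P\<^esub> n = g [^]\<^bsub>wreath (ut p r) P\<^esub> group.ord P (snd g)"
    "g \<otimes>\<^bsub>wreath (ut p r) P\<^esub> R = R \<otimes>\<^bsub>wreath (ut p r) P\<^esub> g" "n * l = 1 + group.ord P (snd g) * q"
proof -
  interpret P: group P using P by (simp add: p_finite_def)
  interpret U: group "ut p r" by (rule ut_group[OF prime])
  let ?W = "wreath (ut p r) P"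
  interpret W: group ?W by (rule wreath_group[OF U.is_group P.is_group])
  have n0: "n > 0" using n by (cases n) auto
  have sg: "snd g \<in> carrier P" by (rule wreath_snd_closed[OF g])
  let ?O = "P.ord (snd g)"
  obtain s where "\<And>a. a \<in> carrier P \<Longrightarrow> a [^]\<^bsub>P\<^esub> (p ^ s) = \<one>\<^bsub>P\<^esub>" using P unfolding p_finite_def by auto
  then have "?O dvd p ^ s" using P.pow_eq_id[OF sg] sg by blast
  moreover have "coprime n (p ^ s)" using n prime by (metis coprime_commute prime_imp_coprime coprime_power_left_iff)
  ultimately have cop: "gcd n ?O = 1" by (metis coprime_divisors coprime_imp_gcd_eq_1 dvd_refl)
  obtain l q where lq: "n * l = ?O * q + 1" using bezout_nat[of n ?O] n0 cop by auto
  let ?G = "g [^]\<^bsub>?W\<^esub> ?O"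
  have G: "?G \<in> carrier ?W" "snd ?G = \<one>\<^bsub>P\<^esub>" using g sg by (auto simp: wreath_snd_pow(1)[OF U.is_group P.is_group g])
  define root where "root M = (SOME y. y \<in> carrier (ut p r) \<and> y [^]\<^bsub>ut p r\<^esub> n = M)" for M
  have root: "root M \<in> carrier (ut p r) \<and> root M [^]\<^bsub>ut p r\<^esub> n = M" if "M \<in> carrier (ut p r)" for M
    unfolding root_def by (rule someI_ex[of "\<lambda>y. y \<in> carrier (ut p r) \<and> y [^]\<^bsub>ut p r\<^esub> n = M"])
      (use ut_root_exists[OF prime that n] in blast)
  define R where "R = (\<lambda>v\<in>carrier P. root (fst ?G v), \<one>\<^bsub>P\<^esub>)"
  have R: "R \<in> carrier ?W" "snd R = \<one>\<^bsub>P\<^esub>" using root wreath_fst_closed[OF G(1)] by (auto simp: R_def wreath_carrier)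
  have Rn: "R [^]\<^bsub>?W\<^esub> n = ?G"
  proof (rule wreath_eqI[OF W.nat_pow_closed[OF R(1)] G(1)])
    show "snd (R [^]\<^bsub>?W\<^esub> n) = snd ?G" using G(2) R by (simp add: wreath_snd_pow(1)[OF U.is_group P.is_group R(1)])
    fix v assume v: "v \<in> carrier P"
    show "fst (R [^]\<^bsub>?W\<^esub> n) v = fst ?G v"
      unfolding wreath_base_pow(2)[OF U.is_group P.is_group R v] using root[OF wreath_fst_closed[OF G(1) v]] v by (simp add: R_def)
  qed
  define R' where "R' = g \<otimes>\<^bsub>?W\<^esub> R \<otimes>\<^bsub>?W\<^esub> inv\<^bsub>?W\<^esub> g"
  have R': "R' \<in> carrier ?W" "snd R' = \<one>\<^bsub>P\<^esub>" using g R sg by (auto simp: R'_def wreath_snd_mult wreath_snd_inv[OF U.is_group P.is_group])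
  have "R' [^]\<^bsub>?W\<^esub> n = g \<otimes>\<^bsub>?W\<^esub> R [^]\<^bsub>?W\<^esub> n \<otimes>\<^bsub>?W\<^esub> inv\<^bsub>?W\<^esub> g"
    using conj_int_pow[OF prime W.is_group g R(1), of "int n"] by (simp add: R'_def int_pow_int)
  also have "\<dots> = ?G" unfolding Rn using g by (metis W.inv_solve_right W.nat_pow_Suc W.nat_pow_Suc2 W.nat_pow_closed W.m_closed)
  finally have "R' [^]\<^bsub>?W\<^esub> n = R [^]\<^bsub>?W\<^esub> n" using Rn by simp
  have "R' = R"
  proof (rule wreath_eqI[OF R'(1) R(1)])
    show "snd R' = snd R" using R' R by simp
    fix v assume v: "v \<in> carrier P"
    have "fst R' v [^]\<^bsub>ut p r\<^esub> n = fst R v [^]\<^bsub>ut p r\<^esub> n"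
      using \<open>R' [^]\<^bsub>?W\<^esub> n = R [^]\<^bsub>?W\<^esub> n\<close> wreath_base_pow(2)[OF U.is_group P.is_group R' v] wreath_base_pow(2)[OF U.is_group P.is_group R v] by metis
    then show "fst R' v = fst R v" using ut_root_unique[OF prime] wreath_fst_closed[OF R(1) v] wreath_fst_closed[OF R'(1) v] n0 by blast
  qed
  then have "g \<otimes>\<^bsub>?W\<^esub> R = R \<otimes>\<^bsub>?W\<^esub> g" using g R(1) by (metis R'_def W.inv_solve_right W.m_closed)
  then show ?thesis using that R Rn lq by (metis add.commute)
qed


lemma wreath_base_int_pow:
  assumes P: "group P" and S: "group S" and w: "w \<in> carrier (wreath P S)" "snd w = \<one>\<^bsub>S\<^esub>" and v: "v \<in> carrier S"
  shows "fst (w [^]\<^bsub>wreath P S\<^esub> (i::int)) v = fst w v [^]\<^bsub>P\<^esub> i"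
proof -
  interpret P: group P by fact
  interpret S: group S by fact
  interpret W: group "wreath P S" by (rule wreath_group[OF P S])
  show ?thesis
  proof (cases i)
    case (nonneg m) then show ?thesis using wreath_base_pow(2)[OF P S w v] by (simp add: int_pow_int)
  next
    case (neg m)
    have f: "fst w v \<in> carrier P" by (rule wreath_fst_closed[OF w(1) v])
    have "fst (inv\<^bsub>wreath P S\<^esub> (w [^]\<^bsub>wreath P S\<^esub> Suc m)) v = inv\<^bsub>P\<^esub> (fst w v [^]\<^bsub>P\<^esub> Suc m)"
      unfolding wreath_fst_inv(1)[OF P S W.nat_pow_closed[OF w(1)] v] wreath_base_pow(1)[OF P S w v]
      using wreath_base_pow(2)[OF P S w v, of "Suc m"] v by (simp del: W.nat_pow_Suc P.nat_pow_Suc)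
    then show ?thesis unfolding neg W.int_pow_neg_int[OF w(1)] P.int_pow_neg_int[OF f] .
  qed
qed

lemma commute_int_pow:
  fixes G (structure) and p :: nat
  assumes prime: "Factorial_Ring.prime p" and G: "group G" and ab: "a \<in> carrier G" "b \<in> carrier G" "a \<otimes> b = b \<otimes> a"
  shows "a [^] (i::int) \<otimes> b [^] (j::int) = b [^] j \<otimes> a [^] i"
proof -
  interpret group G by fact
  have one: "x \<otimes> y [^] j = y [^] j \<otimes> x" if "x \<in> carrier G" "y \<in> carrier G" "x \<otimes> y = y \<otimes> x" for x y and j :: int
  proof -
    have "x \<otimes> y \<otimes> inv x = y" using that by (simp add: m_assoc)
    then have "x \<otimes> y [^] j \<otimes> inv x = y [^] j" using conj_int_pow[OF prime G that(1,2), of j] by simp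
    then show ?thesis using that by (metis inv_solve_right int_pow_closed m_closed)
  qed
  show ?thesis using one[of "b [^] j" a i] one[of a b j] ab by simp
qed

lemma p_finite_root:
  assumes prime: "Factorial_Ring.prime p" and P: "p_finite p P" and g: "g \<in> carrier P" and n: "\<not> p dvd n"
  shows "\<exists>l::nat. (g [^]\<^bsub>P\<^esub> n) [^]\<^bsub>P\<^esub> l = g"
proof -
  interpret group P using P by (simp add: p_finite_def)
  obtain s where s: "\<And>a. a \<in> carrier P \<Longrightarrow> a [^]\<^bsub>P\<^esub> (p ^ s) = \<one>\<^bsub>P\<^esub>" using P unfolding p_finite_def by auto
  have n0: "n \<noteq> 0" using n by (cases n) auto
  have "coprime n (p ^ s)" using n prime by (metis coprime_commute prime_imp_coprime coprime_power_left_iff)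
  then obtain l q where lq: "n * l = p ^ s * q + 1" using bezout_nat[OF n0, of "p ^ s"] by auto
  have "(g [^]\<^bsub>P\<^esub> n) [^]\<^bsub>P\<^esub> l = g [^]\<^bsub>P\<^esub> (p ^ s * q) \<otimes>\<^bsub>P\<^esub> g" using g lq by (simp add: nat_pow_pow)
  also have "g [^]\<^bsub>P\<^esub> (p ^ s * q) = \<one>\<^bsub>P\<^esub>" using g s by (simp add: nat_pow_pow[symmetric])
  finally show ?thesis using g by auto
qed

lemma (in amalgamation) hom_unique:
  assumes Y: "group Y" and \<theta>: "\<theta> \<in> hom G Y" "\<theta>' \<in> hom G Y"
    and eq: "\<And>a. a \<in> carrier A \<Longrightarrow> \<theta> (\<iota>A a) = \<theta>' (\<iota>A a)" "\<And>b. b \<in> carrier B \<Longrightarrow> \<theta> (\<iota>B b) = \<theta>' (\<iota>B b)"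
    and g: "g \<in> carrier G"
  shows "\<theta> g = \<theta>' g"
proof -
  interpret Y: group Y by fact
  interpret t: group_hom G Y \<theta> by unfold_locales (rule \<theta>)
  interpret t': group_hom G Y \<theta>' by unfold_locales (rule \<theta>)
  have sub: "\<iota>A ` carrier A \<union> \<iota>B ` carrier B \<subseteq> carrier G" by auto
  have "g \<in> generate G (\<iota>A ` carrier A \<union> \<iota>B ` carrier B)" using gen g by blast
  then show ?thesis
  proof (induction rule: generate.induct)
    case (inv y) then show ?case using eq sub by (auto simp: t.hom_inv t'.hom_inv)
  next
    case (eng y z) then show ?case using G.generate_in_carrier[OF sub] by simp
  qed (use eq in auto)
qed

section \<open>Adjoining a root of degree prime to \<open>p\<close>\<close>

text \<open>The infinite cyclic group is glued to \<open>A\<close> along \<open>h = x\<^sup>n\<close>, where \<open>x\<close> is its generator \<open>1\<close>.\<close>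

locale root_adjunction = free_group_max_cyclic p A X e h w + amalgamation A integer_group G \<iota>A \<iota>Z h "int n"
  for p and A :: "('a, 'c) monoid_scheme" and X :: "'x set" and e h w
    and G :: "('g, 'cg) monoid_scheme" and \<iota>A \<iota>Z and n :: nat +
  assumes n: "\<not> p dvd n"
begin

definition "x = \<iota>Z 1"

lemma n0: "n > 0" using n by (cases n) auto

lemma x_in [simp]: "x \<in> carrier G" by (simp add: x_def)

lemma \<iota>Z_pow: "\<iota>Z j = x [^]\<^bsub>G\<^esub> j"
  using hB.hom_int_pow[of 1 j] by (simp add: x_def)

lemma x_pow_n: "x [^]\<^bsub>G\<^esub> n = \<iota>A h"
  using glue by (simp add: \<iota>Z_pow int_pow_int)

lemma extend:
  assumes Y: "group Y" "countable (carrier Y)" and \<alpha>: "\<alpha> \<in> hom A Y" and y: "y \<in> carrier Y" "y [^]\<^bsub>Y\<^esub> n = \<alpha> h"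
  shows "\<exists>\<theta>\<in>hom G Y. (\<forall>a\<in>carrier A. \<theta> (\<iota>A a) = \<alpha> a) \<and> \<theta> x = y"
proof -
  interpret Y: group Y by fact
  have "(\<lambda>j::int. y [^]\<^bsub>Y\<^esub> j) \<in> hom integer_group Y" using Y.hom_integer_group_pow[OF y(1)] .
  moreover have "\<alpha> h = y [^]\<^bsub>Y\<^esub> int n" using y by (simp add: int_pow_int)
  ultimately obtain \<theta> where \<theta>: "\<theta> \<in> hom G Y" "\<forall>a\<in>carrier A. \<theta> (\<iota>A a) = \<alpha> a"
    "\<forall>j\<in>carrier integer_group. \<theta> (\<iota>Z j) = y [^]\<^bsub>Y\<^esub> j"
    using universal[OF Y \<alpha>] by blast
  have "\<theta> x = y [^]\<^bsub>Y\<^esub> (1::int)" unfolding x_def by (rule bspec[OF \<theta>(3)]) simp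
  then have "\<theta> x = y" using y(1) by simp
  then show ?thesis using \<theta> by blast
qed

lemma extend_ut:
  assumes "\<tau> \<in> hom A (ut p r)"
  shows "\<exists>\<theta>\<in>hom G (ut p r). \<forall>a\<in>carrier A. \<theta> (\<iota>A a) = \<tau> a"
proof -
  have "\<tau> h \<in> carrier (ut p r)" using assms by (auto simp: hom_def)
  then obtain y where "y \<in> carrier (ut p r)" "y [^]\<^bsub>ut p r\<^esub> n = \<tau> h" using ut_root_exists[OF prime _ n] by blast
  then show ?thesis using extend[OF ut_group[OF prime] ut_countable[OF prime] assms] by blast
qed

text \<open>The homomorphism on the free group \<open>A\<close> is given by the elements of the basis: reading the first letter \<open>y1\<close> of \<open>w\<close>
  at a marked vertex \<open>v\<close> contributes the elementary matrix whose colour is the coset of \<open>v\<close>, reading its inverse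
  towards \<open>v\<close> contributes the inverse matrix, and all other steps contribute nothing. On a coset of \<open>\<langle>h\<rangle>\<close> with one mark
  the word \<open>w\<close> meets this mark exactly when it starts there, since the marks avoid the interior vertices. Hence going
  around the coset once yields one elementary matrix \<open>T 1\<close>, its \<open>n\<close>-th root is \<open>T (1/n)\<close>, and by
  \<open>wreath_ut_root\<close> the power \<open>x\<^sup>j\<close> acts as \<open>T (z - q j/n)\<close> with an integer \<open>z\<close>.\<close>

lemma marked_hom:
  fixes P :: "('q, 'cq) monoid_scheme" (structure) and C :: "nat \<Rightarrow> 'q set"
  assumes P: "p_finite p P" and \<rho>: "\<rho> \<in> hom G P" and D: "D \<subseteq> carrier P"
    and C: "\<And>i. Suc (Suc i) < r \<Longrightarrow> C i \<noteq> C (Suc i)"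
  defines "vert \<equiv> \<lambda>u y. u \<otimes> \<rho> (\<iota>A (ev A e y))" and "col \<equiv> cyclic_coset P (\<rho> x)"
  assumes Us: "Us \<subseteq> carrier P" and one: "\<And>u. u \<in> Us \<Longrightarrow> \<exists>d. D \<inter> col u = {d}"
    and inner: "\<And>u v t. u \<in> Us \<Longrightarrow> v \<in> col u \<Longrightarrow> 0 < t \<Longrightarrow> t < length w \<Longrightarrow> vert v (take t w) \<notin> D"
  obtains \<theta> where "\<theta> \<in> hom G (wreath (ut p r) P)" "\<forall>g\<in>carrier G. snd (\<theta> g) = \<rho> g"
    "\<forall>y\<in>words. \<forall>v\<in>carrier P. (\<forall>t\<le>length y. vert v (take t y) \<notin> D) \<longrightarrow> fst (\<theta> (\<iota>A (ev A e y))) v = \<one>\<^bsub>ut p r\<^esub>"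
    "\<forall>u\<in>Us. \<forall>j. \<not> int n dvd j \<longrightarrow> (\<exists>\<gamma>. p_integral p \<gamma> \<and> \<gamma> \<noteq> 0 \<and> fst (\<theta> (x [^]\<^bsub>G\<^esub> j)) u = colour_elem C r (col u) \<gamma>)"
proof -
  interpret P: group P using P by (simp add: p_finite_def)
  interpret \<rho>: group_hom G P \<rho> by unfold_locales (rule \<rho>)
  interpret U: group "ut p r" by (rule ut_group[OF prime])
  let ?W = "wreath (ut p r) P"
  interpret W: group ?W by (rule wreath_group[OF U.is_group P.is_group])
  have cW: "countable (carrier ?W)" using P by (intro wreath_countable ut_countable[OF prime]) (simp add: p_finite_def)
  define T where "T = colour_elem C r"
  have Tc: "T c \<gamma> \<in> carrier (ut p r)" if "p_integral p \<gamma>" for c \<gamma> unfolding T_def by (rule colour_elem_closed[OF prime that])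
  have T0: "T c 0 = \<one>\<^bsub>ut p r\<^esub>" for c unfolding T_def by (rule colour_elem_0[OF prime])
  have Tm: "T c \<gamma> \<otimes>\<^bsub>ut p r\<^esub> T c \<gamma>' = T c (\<gamma> + \<gamma>')" for c \<gamma> \<gamma>' unfolding T_def by (rule colour_elem_mult[where C = C and r = r, OF prime C])
  have Ti: "inv\<^bsub>ut p r\<^esub> T c \<gamma> = T c (- \<gamma>)" if "p_integral p \<gamma>" for c \<gamma>
    unfolding T_def by (rule colour_elem_pow(2)[where C = C and r = r, OF prime C that])
  note pi = p_integral_0[OF prime] p_integral_1[OF prime] p_integral_uminus[OF prime] p_integral_of_int[OF prime] p_integral_of_nat[OF prime]
  \<comment> \<open>The step in the finite group \<open>P\<close> that belongs to a letter.\<close>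
  define L where "L y = \<rho> (\<iota>A (letter A e y))" for y
  have Lc: "L y \<in> carrier P" if "snd y \<in> X" for y using that by (simp add: L_def)
  have Li: "L (inv_letter y) = inv (L y)" if "snd y \<in> X" for y using that by (simp add: L_def letter_inv)
  have vert_Nil: "vert v [] = v" if "v \<in> carrier P" for v using that by (simp add: vert_def)
  have vert_Cons: "vert v (y # ys) = vert (v \<otimes> L y) ys" if "v \<in> carrier P" "snd y \<in> X" "ys \<in> words" for v y ys
    using that by (simp add: vert_def L_def P.m_assoc)
  define y1 where "y1 = hd w"
  obtain w' where w': "w = y1 # w'" using w_ne unfolding y1_def by (cases w) auto
  have y1: "snd y1 \<in> X" "w' \<in> words" using hw(1) w' by (auto simp: mem_Times_iff)
  \<comment> \<open>If \<open>y1\<close> is the inverse of a basis element, then the matrix is attached to the end of the step by this basis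
    element and inverted.\<close>
  define f where "f z v = (if z \<noteq> snd y1 then \<one>\<^bsub>ut p r\<^esub> else if fst y1 then (if v \<in> D then T (col v) 1 else \<one>\<^bsub>ut p r\<^esub>)
     else if v \<otimes> L (True, z) \<in> D then T (col (v \<otimes> L (True, z))) (- 1) else \<one>\<^bsub>ut p r\<^esub>)" for z v
  have fc: "f z v \<in> carrier (ut p r)" for z v unfolding f_def using Tc pi by simp
  obtain \<alpha> where \<alpha>: "\<alpha> \<in> hom A ?W" "\<forall>z\<in>X. \<alpha> (e z) = (\<lambda>v\<in>carrier P. f z v, L (True, z))"
  proof -
    have "(\<lambda>z. (\<lambda>v\<in>carrier P. f z v, L (True, z))) \<in> X \<rightarrow> carrier ?W" using fc Lc by (auto simp: wreath_carrier)
    from free_basis_universal[OF basis W.is_group cW this] show ?thesis using that by blast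
  qed
  interpret \<alpha>: group_hom A ?W \<alpha> by unfold_locales (rule \<alpha>)
  define mark where "mark y v = (if y = y1 \<and> v \<in> D then T (col v) 1
    else if y = inv_letter y1 \<and> v \<otimes> L y \<in> D then T (col (v \<otimes> L y)) (- 1) else \<one>\<^bsub>ut p r\<^esub>)" for y v
  have letter_read: "snd (\<alpha> (letter A e y)) = L y \<and> fst (\<alpha> (letter A e y)) v = mark y v"
    if y: "snd y \<in> X" and v: "v \<in> carrier P" for y v
  proof (cases "fst y")
    case True
    then have yz: "y = (True, snd y)" by (cases y) auto
    have a: "\<alpha> (letter A e y) = (\<lambda>v\<in>carrier P. f (snd y) v, L y)" using \<alpha>(2) y yz by (simp add: letter_def True)
    have "f (snd y) v = mark y v" using yz unfolding f_def mark_def by (cases y; cases y1) (auto simp: inv_letter_def)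
    then show ?thesis using a v by simp
  next
    case False
    then have yz: "y = (False, snd y)" by (cases y) auto
    let ?z = "snd y"
    have iL: "inv (L (True, ?z)) = L y" using Li[of "(True, ?z)"] y yz by (simp add: inv_letter_def)
    have LL: "v \<otimes> L y \<otimes> L (True, ?z) = v" using v y Lc[of y] Lc[of "(True, ?z)"] iL
      by (metis P.inv_solve_right P.m_closed P.inv_inv snd_conv)
    have ez: "e ?z \<in> carrier A" using eX y by auto
    have a: "\<alpha> (letter A e y) = inv\<^bsub>?W\<^esub> (\<alpha> (e ?z))" using ez by (simp add: letter_def False)
    have "snd (\<alpha> (letter A e y)) = L y"
      unfolding a wreath_snd_inv[OF U.is_group P.is_group \<alpha>.hom_closed[OF ez]] using \<alpha>(2) y iL by simp
    moreover have "fst (\<alpha> (letter A e y)) v = inv\<^bsub>ut p r\<^esub> (f ?z (v \<otimes> L y))"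
      unfolding a wreath_fst_inv(1)[OF U.is_group P.is_group \<alpha>.hom_closed[OF ez] v] using \<alpha>(2) y v Lc[OF y] by (simp add: iL)
    moreover have "inv\<^bsub>ut p r\<^esub> (f ?z (v \<otimes> L y)) = mark y v"
      using yz unfolding f_def mark_def LL by (cases y; cases y1) (auto simp: inv_letter_def Ti pi)
    ultimately show ?thesis by simp
  qed
  have snd_word: "snd (\<alpha> (ev A e ys)) = \<rho> (\<iota>A (ev A e ys))" if "ys \<in> words" for ys
    using that
  proof (induction ys)
    case Nil then show ?case by (simp add: wreath_one)
  next
    case (Cons y ys)
    then have y: "snd y \<in> X" "ys \<in> words" by (auto simp: mem_Times_iff)
    then show ?case using Cons.IH letter_read[OF y(1) P.one_closed] by (simp add: wreath_snd_mult L_def)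
  qed
  \<comment> \<open>The end of the path may be marked, unless it is reached by the inverse of \<open>y1\<close>; this is what happens when \<open>w\<close> leads
    from one vertex of a coset to the next.\<close>
  have fst_word: "fst (\<alpha> (ev A e ys)) v = \<one>\<^bsub>ut p r\<^esub>"
    if "ys \<in> words" "v \<in> carrier P" "\<forall>t<length ys. vert v (take t ys) \<notin> D" "ys = [] \<or> last ys \<noteq> inv_letter y1 \<or> vert v ys \<notin> D" for ys v
    using that
  proof (induction ys arbitrary: v rule: list.induct)
    case Nil then show ?case by (simp add: wreath_one)
  next
    case (Cons y ys)
    then have y: "snd y \<in> X" "ys \<in> words" by (auto simp: mem_Times_iff)
    have v: "v \<in> carrier P" and vL: "v \<otimes> L y \<in> carrier P" using Cons.prems(2) Lc y by auto
    have vt: "vert (v \<otimes> L y) (take t ys) \<notin> D" if "t < length ys" for t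
    proof -
      have "take t ys \<in> words" using y(2) by (auto dest: in_set_takeD)
      then show ?thesis using Cons.prems(3) that vert_Cons[OF v y(1), of "take t ys"] by (auto dest: spec[of _ "Suc t"])
    qed
    have "v \<notin> D" using Cons.prems(3) vert_Nil[OF v] by (auto dest: spec[of _ 0])
    moreover have "v \<otimes> L y \<notin> D" if "y = inv_letter y1"
    proof (cases "ys = []")
      case True then show ?thesis using Cons.prems(4) that vert_Cons[OF v y(1), of "[]"] vert_Nil[OF vL] by simp
    next
      case False then show ?thesis using vt[of 0] vert_Nil[OF vL] by simp
    qed
    ultimately have "mark y v = \<one>\<^bsub>ut p r\<^esub>" by (auto simp: mark_def)
    moreover have "fst (\<alpha> (ev A e ys)) (v \<otimes> L y) = \<one>\<^bsub>ut p r\<^esub>"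
    proof (rule Cons.IH[OF y(2) vL])
      show "\<forall>t<length ys. vert (v \<otimes> L y) (take t ys) \<notin> D" using vt by blast
      show "ys = [] \<or> last ys \<noteq> inv_letter y1 \<or> vert (v \<otimes> L y) ys \<notin> D" using Cons.prems(4) vert_Cons[OF v y] by auto
    qed
    ultimately show ?case using y v letter_read[OF y(1) v] by (simp add: wreath_fst_mult)
  qed
  let ?x = "\<rho> x" and ?h = "\<rho> (\<iota>A h)"
  have xc: "?x \<in> carrier P" and hc: "?h \<in> carrier P" by simp_all
  have xh: "?x [^] n = ?h" using x_pow_n by (metis \<rho>.hom_nat_pow x_in)
  define g where "g = \<alpha> h"
  have g: "g \<in> carrier ?W" "snd g = ?h" using snd_word[OF hw(1)] by (simp_all add: g_def hw(3)[symmetric])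
  have col_sub: "v \<in> carrier P" if "u \<in> Us" "v \<in> col u" for u v
    using that Us cyclic_coset_subset[OF P.is_group xc] unfolding col_def by blast
  have col_eq: "col v = col u" if "u \<in> Us" "v \<in> col u" for u v
    using that Us cyclic_coset_eq[OF P.is_group xc] unfolding col_def by blast
  have col_h: "v \<otimes> ?h [^] (i::int) \<in> col u" if uv: "u \<in> Us" "v \<in> col u" for u v i
  proof -
    have v: "v \<in> carrier P" using col_sub uv by blast
    have "?h [^] i = ?x [^] (int n * i)" unfolding xh[symmetric] using xc by (simp add: P.int_pow_pow flip: int_pow_int)
    then have "cyclic_coset P ?x (v \<otimes> ?h [^] i) = cyclic_coset P ?x v" using cyclic_coset_shift[OF P.is_group xc v] by simp
    then show ?thesis using cyclic_coset_self[OF P.is_group, of "v \<otimes> ?h [^] i"] v hc col_eq[OF uv] unfolding col_def by auto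
  qed
  have col_h': "v \<otimes> ?h [^] (m::nat) \<in> col u" if "u \<in> Us" "v \<in> col u" for u v m
    using col_h[OF that, of "int m"] by (simp add: int_pow_int)
  \<comment> \<open>The last letter of \<open>w\<close> is not inverse to \<open>y1\<close>, because \<open>w\<close> is cyclically reduced.\<close>
  have h_read: "fst g v = T (col u) (if v \<in> D then 1 else 0)" if u: "u \<in> Us" "v \<in> col u" for u v
  proof -
    have v: "v \<in> carrier P" and vL: "v \<otimes> L y1 \<in> carrier P" using col_sub[OF u] Lc y1 by auto
    have "fst (\<alpha> (ev A e w')) (v \<otimes> L y1) = \<one>\<^bsub>ut p r\<^esub>"
    proof (rule fst_word[OF y1(2) vL])
      show "\<forall>t<length w'. vert (v \<otimes> L y1) (take t w') \<notin> D"
      proof (intro allI impI)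
        fix t assume t: "t < length w'"
        have "take t w' \<in> words" using y1(2) by (auto dest: in_set_takeD)
        then show "vert (v \<otimes> L y1) (take t w') \<notin> D" using inner[OF u, of "Suc t"] t vert_Cons[OF v y1(1), of "take t w'"] by (simp add: w')
      qed
      show "w' = [] \<or> last w' \<noteq> inv_letter y1 \<or> vert (v \<otimes> L y1) w' \<notin> D"
        using hw(2) w_ne unfolding reduced_append by (auto simp: w')
    qed
    moreover have "fst g v = mark y1 v \<otimes>\<^bsub>ut p r\<^esub> fst (\<alpha> (ev A e w')) (v \<otimes> L y1)"
      using letter_read[OF y1(1) v] y1 v by (simp add: g_def hw(3) w' wreath_fst_mult)
    moreover have "mark y1 v = T (col u) (if v \<in> D then 1 else 0)"
      using col_eq[OF u] T0 inv_letter_simps(4)[of y1, symmetric] by (auto simp: mark_def)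
    ultimately show ?thesis using Tc pi by simp
  qed
  have g_pow: "fst (g [^]\<^bsub>?W\<^esub> (m::nat)) v = T (col u) (of_nat (card {s. s < m \<and> v \<otimes> ?h [^] s \<in> D}))" if u: "u \<in> Us" "v \<in> col u" for u v m
  proof (induction m)
    case 0 then show ?case using col_sub[OF u] T0 by (simp add: wreath_one)
  next
    case (Suc m)
    have v: "v \<in> carrier P" using col_sub[OF u] .
    have eq: "{s. s < Suc m \<and> v \<otimes> ?h [^] s \<in> D} = (if v \<otimes> ?h [^] m \<in> D then insert m {s. s < m \<and> v \<otimes> ?h [^] s \<in> D} else {s. s < m \<and> v \<otimes> ?h [^] s \<in> D})"
      by (auto simp: less_Suc_eq)
    have "fst (g [^]\<^bsub>?W\<^esub> Suc m) v = fst (g [^]\<^bsub>?W\<^esub> m) v \<otimes>\<^bsub>ut p r\<^esub> fst g (v \<otimes> ?h [^] m)"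
      using v g wreath_snd_pow(1)[OF U.is_group P.is_group g(1), of m] by (simp add: wreath_fst_mult)
    then show ?case unfolding Suc.IH h_read[OF u(1) col_h'[OF u]] eq by (simp add: Tm add.commute)
  qed
  have g_int: "\<exists>z::int. fst (g [^]\<^bsub>?W\<^esub> (i::int)) v = T (col u) (of_int z)" if u: "u \<in> Us" "v \<in> col u" for u v i
  proof (cases i)
    case (nonneg m) then show ?thesis using g_pow[OF u, of m] by (metis int_pow_int of_int_of_nat_eq)
  next
    case (neg m)
    have v: "v \<in> carrier P" using col_sub[OF u] .
    have "inv (?h [^] Suc m) = ?h [^] i" unfolding neg using P.int_pow_neg_int[OF hc, of "Suc m"] by simp
    then have "fst (g [^]\<^bsub>?W\<^esub> i) v = inv\<^bsub>ut p r\<^esub> (fst (g [^]\<^bsub>?W\<^esub> Suc m) (v \<otimes> ?h [^] i))"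
      using wreath_fst_inv(1)[OF U.is_group P.is_group W.nat_pow_closed[OF g(1)] v, of "Suc m"] W.int_pow_neg_int[OF g(1), of "Suc m"]
        wreath_snd_pow(1)[OF U.is_group P.is_group g(1), of "Suc m"] neg g(2) by simp
    then have "fst (g [^]\<^bsub>?W\<^esub> i) v = T (col u) (- of_nat (card {s. s < Suc m \<and> v \<otimes> ?h [^] i \<otimes> ?h [^] s \<in> D}))"
      unfolding g_pow[OF u(1) col_h[OF u]] Ti[OF pi(5)] .
    then show ?thesis by (intro exI[of _ "- int (card {s. s < Suc m \<and> v \<otimes> ?h [^] i \<otimes> ?h [^] s \<in> D})"]) simp
  qed
  obtain R l q where R: "R \<in> carrier ?W" "snd R = \<one>" "R [^]\<^bsub>?W\<^esub> n = g [^]\<^bsub>?W\<^esub> P.ord ?h" "g \<otimes>\<^bsub>?W\<^esub> R = R \<otimes>\<^bsub>?W\<^esub> g"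
    and lq: "n * l = 1 + P.ord ?h * q"
    by (rule wreath_ut_root[OF prime P g(1) n, unfolded g(2)])
  let ?O = "P.ord ?h"
  obtain l' where l': "?h [^] (l'::nat) = ?x" using p_finite_root[OF prime P xc n] xh by auto
  have O0: "?O > 0" using P P.ord_ge_1[OF _ hc] by (fastforce simp: p_finite_def)
  \<comment> \<open>One turn around the coset passes the mark exactly once.\<close>
  have card1: "card {s. s < ?O \<and> v \<otimes> ?h [^] s \<in> D} = 1" if u: "u \<in> Us" "v \<in> col u" for u v
  proof -
    have v: "v \<in> carrier P" using col_sub[OF u] .
    obtain d where d: "D \<inter> col u = {d}" using one[OF u(1)] by blast
    then have "d \<in> col v" using col_eq[OF u] by blast
    then obtain i :: int where "d = v \<otimes> ?x [^] i" unfolding col_def cyclic_coset_def by blast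
    then have di: "d = v \<otimes> ?h [^] (int l' * i)" unfolding l'[symmetric] using hc by (simp add: P.int_pow_pow flip: int_pow_int)
    let ?k = "int l' * i"
    have "s < ?O \<and> v \<otimes> ?h [^] s \<in> D \<longleftrightarrow> s = nat (?k mod int ?O)" for s
    proof -
      have "v \<otimes> ?h [^] s \<in> D \<longleftrightarrow> v \<otimes> ?h [^] s = d" using d col_h'[OF u] by blast
      also have "\<dots> \<longleftrightarrow> ?h [^] (int s) = ?h [^] ?k" unfolding di using v hc by (simp add: int_pow_int)
      also have "\<dots> \<longleftrightarrow> int ?O dvd ?k - int s" by (rule P.int_pow_eq[OF hc])
      also have "\<dots> \<longleftrightarrow> ?k mod int ?O = int s mod int ?O" by (simp add: mod_eq_dvd_iff)
      finally have 1: "v \<otimes> ?h [^] s \<in> D \<longleftrightarrow> ?k mod int ?O = int s mod int ?O" .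
      show ?thesis unfolding 1 using O0 by (auto simp: nat_less_iff)
    qed
    then have "{s. s < ?O \<and> v \<otimes> ?h [^] s \<in> D} = {nat (?k mod int ?O)}" by blast
    then show ?thesis by simp
  qed
  have R_read: "fst R v = T (col u) (1 / of_nat n)" if u: "u \<in> Us" "v \<in> col u" for u v
  proof (rule ut_root_unique[OF prime])
    have v: "v \<in> carrier P" using col_sub[OF u] .
    have i: "p_integral p (1 / of_nat n)" using p_integral_divide[OF prime pi(2), of "int n"] n by simp
    show "T (col u) (1 / of_nat n) \<in> carrier (ut p r)" by (rule Tc[OF i])
    show "fst R v \<in> carrier (ut p r)" by (rule wreath_fst_closed[OF R(1) v])
    show "n > 0" by (rule n0)
    have "fst R v [^]\<^bsub>ut p r\<^esub> n = T (col u) 1"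
      using wreath_base_pow(2)[OF U.is_group P.is_group R(1,2) v, of n] R(3) g_pow[OF u, of ?O] card1[OF u] by simp
    also have "\<dots> = T (col u) (1 / of_nat n) [^]\<^bsub>ut p r\<^esub> n"
      unfolding T_def using n0 by (simp add: colour_elem_pow(1)[where C = C and r = r, OF prime C i])
    finally show "fst R v [^]\<^bsub>ut p r\<^esub> n = T (col u) (1 / of_nat n) [^]\<^bsub>ut p r\<^esub> n" .
  qed
  define \<xi> where "\<xi> = g [^]\<^bsub>?W\<^esub> (int l) \<otimes>\<^bsub>?W\<^esub> R [^]\<^bsub>?W\<^esub> (- int q)"
  have \<xi>c: "\<xi> \<in> carrier ?W" using g R by (simp add: \<xi>_def)
  have \<xi>_pow: "\<xi> [^]\<^bsub>?W\<^esub> (j::int) = g [^]\<^bsub>?W\<^esub> (int l * j) \<otimes>\<^bsub>?W\<^esub> R [^]\<^bsub>?W\<^esub> (- int q * j)" for j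
    unfolding \<xi>_def using W.int_pow_mult_distrib[OF commute_int_pow[OF prime W.is_group g(1) R(1,4)], of "int l" "- int q" j] g R
    by (simp add: W.int_pow_pow)
  have "\<xi> [^]\<^bsub>?W\<^esub> n = g"
  proof -
    have "R [^]\<^bsub>?W\<^esub> (- int q * int n) = (R [^]\<^bsub>?W\<^esub> n) [^]\<^bsub>?W\<^esub> (- int q)"
      using R(1) by (simp add: W.int_pow_pow mult.commute flip: int_pow_int)
    also have "\<dots> = g [^]\<^bsub>?W\<^esub> (int ?O * (- int q))" unfolding R(3) using g(1) by (simp only: W.int_pow_pow flip: int_pow_int)
    finally have RR: "R [^]\<^bsub>?W\<^esub> (- int q * int n) = g [^]\<^bsub>?W\<^esub> (int ?O * (- int q))" .
    have "\<xi> [^]\<^bsub>?W\<^esub> int n = g [^]\<^bsub>?W\<^esub> (int l * int n + int ?O * (- int q))"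
      unfolding \<xi>_pow RR W.int_pow_mult[OF g(1)] by (rule HOL.refl)
    also have "int l * int n + int ?O * (- int q) = 1" using lq by (simp add: algebra_simps flip: of_nat_mult of_nat_add)
    finally show ?thesis using g(1) by (simp add: int_pow_int)
  qed
  have snd\<xi>: "snd \<xi> = ?x"
  proof -
    have "?x [^] ?O = \<one>" unfolding l'[symmetric] using hc by (metis P.nat_pow_closed P.nat_pow_one P.nat_pow_pow P.pow_ord_eq_1 mult.commute)
    then have "?x = ?x [^] (1 + ?O * q)" using xc by (simp add: P.nat_pow_mult[symmetric] P.nat_pow_pow[symmetric])
    also have "\<dots> = ?x [^] (n * l)" by (simp only: lq)
    also have "\<dots> = (?x [^] n) [^] l" using xc by (simp add: P.nat_pow_pow)
    also have "\<dots> = ?h [^] l" unfolding xh ..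
    finally have "?h [^] l = ?x" by simp
    then show ?thesis unfolding \<xi>_def wreath_snd_mult wreath_snd_pow(2)[OF U.is_group P.is_group g(1)]
        wreath_snd_pow(2)[OF U.is_group P.is_group R(1)] g(2) R(2) by (simp add: int_pow_int)
  qed
  obtain \<theta> where \<theta>: "\<theta> \<in> hom G ?W" "\<forall>a\<in>carrier A. \<theta> (\<iota>A a) = \<alpha> a" "\<theta> x = \<xi>"
    using extend[OF W.is_group cW \<alpha>(1) \<xi>c] \<open>\<xi> [^]\<^bsub>?W\<^esub> n = g\<close> unfolding g_def by blast
  interpret \<theta>: group_hom G ?W \<theta> by unfold_locales (rule \<theta>(1))
  show ?thesis
  proof (rule that[OF \<theta>(1)])
    show "\<forall>y\<in>words. \<forall>v\<in>carrier P. (\<forall>t\<le>length y. vert v (take t y) \<notin> D) \<longrightarrow> fst (\<theta> (\<iota>A (ev A e y))) v = \<one>\<^bsub>ut p r\<^esub>"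
      using fst_word \<theta>(2) by (metis ev_in le_refl less_imp_le_nat take_all)
    have sh: "snd \<circ> \<theta> \<in> hom G P" by (rule Group.hom_compose[OF \<theta>(1) wreath_snd_hom[OF U.is_group P.is_group]])
    have agree_A: "(snd \<circ> \<theta>) (\<iota>A a) = \<rho> (\<iota>A a)" if a: "a \<in> carrier A" for a
    proof -
      obtain y where "y \<in> words" "a = ev A e y" using word_exists[OF a] by blast
      then show ?thesis using snd_word \<theta>(2) a by simp
    qed
    have agree_x: "snd (\<theta> (x [^]\<^bsub>G\<^esub> (j::int))) = \<rho> (x [^]\<^bsub>G\<^esub> j)" for j
      unfolding \<theta>.hom_int_pow[OF x_in] \<theta>(3) wreath_snd_pow(2)[OF U.is_group P.is_group \<xi>c] snd\<xi> \<rho>.hom_int_pow[OF x_in] by (rule HOL.refl)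
    have agree_Z: "(snd \<circ> \<theta>) (\<iota>Z j) = \<rho> (\<iota>Z j)" for j
      unfolding comp_apply by (subst (1 2) \<iota>Z_pow) (rule agree_x)
    have "(snd \<circ> \<theta>) g = \<rho> g" if "g \<in> carrier G" for g
      by (rule hom_unique[where \<theta> = "snd \<circ> \<theta>" and \<theta>' = \<rho>, OF P.is_group sh \<rho> agree_A agree_Z that])
    then show "\<forall>g\<in>carrier G. snd (\<theta> g) = \<rho> g" by simp
    show "\<forall>u\<in>Us. \<forall>j. \<not> int n dvd j \<longrightarrow> (\<exists>\<gamma>. p_integral p \<gamma> \<and> \<gamma> \<noteq> 0 \<and> fst (\<theta> (x [^]\<^bsub>G\<^esub> j)) u = colour_elem C r (col u) \<gamma>)"
    proof (intro ballI allI impI)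
      fix u j assume u: "u \<in> Us" and j: "\<not> int n dvd j"
      have uc: "u \<in> carrier P" and uu: "u \<in> col u" using u Us cyclic_coset_self[OF P.is_group] by (auto simp: col_def)
      obtain z :: int where z: "fst (g [^]\<^bsub>?W\<^esub> (int l * j)) u = T (col u) (of_int z)" using g_int[OF u uu] by blast
      let ?v = "u \<otimes> snd (g [^]\<^bsub>?W\<^esub> (int l * j))"
      have v: "?v \<in> col u" using col_h[OF u uu, of "int l * j"] wreath_snd_pow(2)[OF U.is_group P.is_group g(1), of "int l * j"] g(2) by simp
      have i: "p_integral p (1 / of_nat n)" using p_integral_divide[OF prime pi(2), of "int n"] n by simp
      let ?\<gamma> = "of_int z + of_int (- int q * j) * (1 / of_nat n) :: rat"
      have "fst (R [^]\<^bsub>?W\<^esub> (- int q * j)) ?v = T (col u) (of_int (- int q * j) * (1 / of_nat n))"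
        unfolding wreath_base_int_pow[OF U.is_group P.is_group R(1,2) col_sub[OF u v]] R_read[OF u v] T_def
        by (rule colour_elem_pow(3)[where C = C and r = r, OF prime C i])
      then have "fst (\<theta> (x [^]\<^bsub>G\<^esub> j)) u = T (col u) ?\<gamma>"
        unfolding \<theta>.hom_int_pow[OF x_in] \<theta>(3) \<xi>_pow wreath_fst_mult[OF uc] z by (simp only: Tm)
      moreover have "p_integral p ?\<gamma>" by (intro p_integral_add[OF prime] p_integral_mult[OF prime] pi i)
      moreover have "?\<gamma> \<noteq> 0"
      proof
        assume "?\<gamma> = 0"
        have nz: "(of_nat n :: rat) \<noteq> 0" using n0 by simp
        have "of_int (int n * z) = (of_int (int q * j) :: rat)" using \<open>?\<gamma> = 0\<close> nz by (simp add: field_simps)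
        then have "int n * z = int q * j" by (simp only: of_int_eq_iff)
        then have d: "int n dvd int q * j" by (metis dvd_triv_left)
        have "j = int n * (int l * j) - int ?O * (int q * j)" 
        proof -
          have "int n * int l = 1 + int ?O * int q" using lq by (metis of_nat_1 of_nat_add of_nat_mult)
          then have "int n * (int l * j) = (1 + int ?O * int q) * j" by (simp only: mult.assoc[symmetric])
          then show ?thesis by (simp add: algebra_simps)
        qed
        then have "int n dvd j" using d by (metis dvd_diff dvd_mult dvd_triv_left)
        then show False using j by simp
      qed
      ultimately show "\<exists>\<gamma>. p_integral p \<gamma> \<and> \<gamma> \<noteq> 0 \<and> fst (\<theta> (x [^]\<^bsub>G\<^esub> j)) u = colour_elem C r (col u) \<gamma>" unfolding T_def by blast
    qed
  qed
qed

end

lemma (in group) commutator_eq_one_iff: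
  assumes "a \<in> carrier G" "b \<in> carrier G"
  shows "a \<otimes> b \<otimes> inv a \<otimes> inv b = \<one> \<longleftrightarrow> a \<otimes> b = b \<otimes> a"
proof
  assume "a \<otimes> b \<otimes> inv a \<otimes> inv b = \<one>"
  then have "a \<otimes> b \<otimes> inv a = b" using assms by (metis inv_closed inv_equality inv_inv m_closed)
  then show "a \<otimes> b = b \<otimes> a" using assms by (metis inv_solve_right m_closed)
qed (use assms in \<open>simp add: m_assoc\<close>)

context root_adjunction
begin

text \<open>An element that is killed by all unitriangular representations lies in all open subgroups that these
  representations define. Those subgroups suffice to exclude finitely many elements of \<open>A\<close>.\<close>

lemma ut_undetected_avoid:
  assumes c: "c \<in> carrier G" and und: "\<And>r \<tau>. \<tau> \<in> hom G (ut p r) \<Longrightarrow> \<tau> c = \<one>\<^bsub>ut p r\<^esub>"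
    and F: "finite F" "\<And>a. a \<in> F \<Longrightarrow> a \<in> carrier A \<and> a \<noteq> \<one>\<^bsub>A\<^esub>"
  shows "\<exists>N. p_open p G N \<and> c \<in> N \<and> (\<forall>a\<in>F. \<iota>A a \<notin> N)"
  using F
proof (induction F rule: finite_induct)
  case empty then show ?case using p_open_carrier[OF G.is_group] c by blast
next
  case (insert a F)
  obtain N where N: "p_open p G N" "c \<in> N" "\<forall>a\<in>F. \<iota>A a \<notin> N" using insert.IH insert.prems by blast
  have a: "a \<in> carrier A" "a \<noteq> \<one>\<^bsub>A\<^esub>" using insert.prems by auto
  obtain r \<tau> where \<tau>: "\<tau> \<in> hom A (ut p r)" "\<tau> a \<noteq> \<one>\<^bsub>ut p r\<^esub>" using ut_separated a unfolding ut_separated_def by blast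
  obtain \<theta> where \<theta>: "\<theta> \<in> hom G (ut p r)" "\<forall>a\<in>carrier A. \<theta> (\<iota>A a) = \<tau> a" using extend_ut[OF \<tau>(1)] by blast
  have ne: "\<theta> (\<iota>A a) \<noteq> \<one>\<^bsub>ut p r\<^esub>" using \<theta>(2) \<tau>(2) a by simp
  obtain k where k: "\<iota>A a \<notin> {g \<in> carrier G. \<theta> g \<in> ut_cong p r k}"
    using ut_detects(1)[OF prime G.is_group \<theta>(1) _ ne] a by blast
  interpret K: normal "ut_cong p r k" "ut p r" using p_openD(1)[OF ut_cong_open[OF prime]] .
  have "c \<in> {g \<in> carrier G. \<theta> g \<in> ut_cong p r k}" using c und[OF \<theta>(1)] K.one_closed by simp
  moreover have "p_open p G ({g \<in> carrier G. \<theta> g \<in> ut_cong p r k} \<inter> N)"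
    by (rule p_open_Int[OF p_open_vimage[OF \<theta>(1) G.is_group ut_cong_open[OF prime]] N(1)])
  ultimately show ?case using N k by blast
qed

text \<open>If \<open>c\<close> is killed by all unitriangular representations, there is a finite \<open>p\<close>-quotient \<open>P\<close> of \<open>G\<close> in which \<open>c\<close> is
  trivial but finitely many given elements of \<open>A\<close> are not. They are chosen as follows: the commutators of the
  letters of \<open>c\<close> with \<open>h\<close> keep these letters outside \<open>\<langle>x\<rangle>\<close>; the elements \<open>h\<^sup>s\<close> and the commutators of
  \<open>W t h\<^sup>s (W t)\<^sup>-\<^sup>1\<close> with \<open>h\<close> are those required for the choice of marks. The number \<open>n0\<close> depends only on
  the lengths of the words, and not on \<open>P\<close>, so the choice is not circular. The marks avoid the paths of all
  letters from \<open>A\<close>, hence only the powers of \<open>x\<close> contribute to the coordinate of \<open>c\<close> at the identity.\<close>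

lemma reduced_pairs_detected:
  assumes a0: "a0 \<in> carrier A" and ws: "reduced_pairs ws" "ws \<noteq> []"
  defines "c \<equiv> \<iota>A a0 \<otimes>\<^bsub>G\<^esub> pairs ws"
  shows "(\<exists>r. \<exists>\<tau>\<in>hom G (ut p r). \<tau> c \<noteq> \<one>\<^bsub>ut p r\<^esub>) \<or>
    (\<exists>(P :: 'g set monoid) r. \<exists>\<theta>\<in>hom G (wreath (ut p r) P). p_finite p P \<and> snd (\<theta> c) = \<one>\<^bsub>P\<^esub> \<and> fst (\<theta> c) \<one>\<^bsub>P\<^esub> \<noteq> \<one>\<^bsub>ut p r\<^esub>)"
proof (cases "\<exists>r. \<exists>\<tau>\<in>hom G (ut p r). \<tau> c \<noteq> \<one>\<^bsub>ut p r\<^esub>")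
  case False
  have wsc: "set ws \<subseteq> carrier integer_group \<times> carrier A" using ws(1) by (simp add: reduced_pairs_def)
  have wsA: "snd y \<in> carrier A" if "y \<in> set ws" for y using wsc that by (auto simp: mem_Times_iff)
  have c: "c \<in> carrier G" using a0 wsc by (simp add: c_def)
  define wd where "wd a = (SOME y. y \<in> words \<and> a = ev A e y)" for a
  have wd: "wd a \<in> words \<and> a = ev A e (wd a)" if "a \<in> carrier A" for a
    unfolding wd_def by (rule someI_ex) (use word_exists[OF that] in blast)
  define n0 where "n0 = Suc (Suc (length (wd a0)) + (\<Sum>y\<leftarrow>ws. Suc (length (wd (snd y)))) + length ws * length w)"
  define W where "W t = ev A e (take t w)" for t
  have Wc: "W t \<in> carrier A" for t unfolding W_def by (rule ev_in) (use hw(1) set_take_subset[of t w] in auto)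
  \<comment> \<open>Elements whose commutator with \<open>h\<close> survives in \<open>P\<close> are not mapped into \<open>\<langle>x\<rangle>\<close>.\<close>
  define com where "com a = a \<otimes>\<^bsub>A\<^esub> h \<otimes>\<^bsub>A\<^esub> inv\<^bsub>A\<^esub> a \<otimes>\<^bsub>A\<^esub> inv\<^bsub>A\<^esub> h" for a
  define cj where "cj t s = W t \<otimes>\<^bsub>A\<^esub> h [^]\<^bsub>A\<^esub> (s::nat) \<otimes>\<^bsub>A\<^esub> inv\<^bsub>A\<^esub> W t" for t s
  have cjc: "cj t s \<in> carrier A" for t s using Wc by (simp add: cj_def)
  define F where "F = (\<lambda>y. com (snd y)) ` set (butlast ws) \<union> (\<lambda>s::nat. h [^]\<^bsub>A\<^esub> s) ` {0<..<n0} \<union>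
    (\<lambda>(t, s). com (cj t s)) ` ({0<..<length w} \<times> {0<..<n0})"
  have "a \<in> carrier A \<and> a \<noteq> \<one>\<^bsub>A\<^esub>" if "a \<in> F" for a
    using that unfolding F_def
  proof (elim UnE imageE)
    fix y assume y: "a = com (snd y)" "y \<in> set (butlast ws)"
    have yA: "snd y \<in> carrier A" using wsA in_set_butlastD[OF y(2)] by blast
    have "\<not> inH (snd y)" using ws(1) y(2) by (simp add: reduced_pairs_def)
    then have "snd y \<otimes>\<^bsub>A\<^esub> h \<noteq> h \<otimes>\<^bsub>A\<^esub> snd y" using centraliser[OF yA] by blast
    then show ?thesis using yA commutator_eq_one_iff[OF yA h_in] by (simp add: y(1) com_def)
  next
    fix s assume s: "a = h [^]\<^bsub>A\<^esub> (s::nat)" "s \<in> {0<..<n0}"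
    then show ?thesis using pow_ne_one[of "int s"] by (simp add: int_pow_int)
  next
    fix z assume z: "a = (\<lambda>(t, s). com (cj t s)) z" "z \<in> {0<..<length w} \<times> {0<..<n0}"
    obtain t s where ts: "a = com (cj t s)" "0 < t" "t < length w" "0 < s" using z by (cases z) auto
    have "cj t s \<otimes>\<^bsub>A\<^esub> h \<noteq> h \<otimes>\<^bsub>A\<^esub> cj t s"
    proof
      assume "cj t s \<otimes>\<^bsub>A\<^esub> h = h \<otimes>\<^bsub>A\<^esub> cj t s"
      then have "inH (W t)" using conj_commute[OF Wc, of "int s" t] ts(4) by (simp add: cj_def int_pow_int)
      then show False using proper_prefix_not_power[OF ts(2,3)] unfolding W_def by blast
    qed
    then show ?thesis using cjc commutator_eq_one_iff[OF cjc h_in] by (simp add: ts(1) com_def)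
  qed
  moreover have "finite F" by (simp add: F_def)
  ultimately obtain N where N: "p_open p G N" "c \<in> N" "\<forall>a\<in>F. \<iota>A a \<notin> N"
    using ut_undetected_avoid[OF c, of F] False by blast
  define P where "P = G Mod N"
  define \<rho> where "\<rho> = (\<lambda>g. N #>\<^bsub>G\<^esub> g)"
  have P: "p_finite p P" unfolding P_def by (rule p_finite_Mod[OF N(1)])
  interpret P: group P using P by (simp add: p_finite_def)
  have \<rho>: "\<rho> \<in> hom G P" "\<And>g. g \<in> carrier G \<Longrightarrow> \<rho> g = \<one>\<^bsub>P\<^esub> \<longleftrightarrow> g \<in> N"
    unfolding \<rho>_def P_def using Mod_hom[OF p_openD(1)[OF N(1)]] by auto
  interpret \<rho>: group_hom G P \<rho> by unfold_locales (rule \<rho>)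
  define hP where "hP = \<rho> (\<iota>A h)"
  define xP where "xP = \<rho> x"
  have xP: "xP \<in> carrier P" and hP: "hP \<in> carrier P" by (simp_all add: xP_def hP_def)
  have hx: "hP = xP [^]\<^bsub>P\<^esub> n" using x_pow_n unfolding hP_def xP_def by (metis \<rho>.hom_nat_pow x_in)
  have noncom: "\<rho> (\<iota>A a) \<noteq> xP [^]\<^bsub>P\<^esub> (i::int)" if a: "a \<in> carrier A" "com a \<in> F" for a i
  proof
    assume eq: "\<rho> (\<iota>A a) = xP [^]\<^bsub>P\<^esub> i"
    have "xP [^]\<^bsub>P\<^esub> i \<otimes>\<^bsub>P\<^esub> hP = hP \<otimes>\<^bsub>P\<^esub> xP [^]\<^bsub>P\<^esub> i"
      unfolding hx using xP by (simp add: add.commute flip: int_pow_int P.int_pow_mult)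
    then have "\<rho> (\<iota>A (com a)) = \<one>\<^bsub>P\<^esub>" using a(1) eq hP P.commutator_eq_one_iff[of "xP [^]\<^bsub>P\<^esub> i" hP] xP by (simp add: com_def hP_def)
    moreover have "com a \<in> carrier A" using a(1) by (simp add: com_def)
    ultimately show False using \<rho>(2)[of "\<iota>A (com a)"] N(3) a(2) by simp
  qed
  define col where "col = cyclic_coset P xP"
  define vert where "vert u y = u \<otimes>\<^bsub>P\<^esub> \<rho> (\<iota>A (ev A e y))" for u y
  define path where "path u a = (\<lambda>t. vert u (take t (wd a))) ` {..length (wd a)}" for u a
  define step where "step u y = u \<otimes>\<^bsub>P\<^esub> \<rho> (x [^]\<^bsub>G\<^esub> (fst y)) \<otimes>\<^bsub>P\<^esub> \<rho> (\<iota>A (snd y))" for u and y :: "int \<times> 'a"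
  \<comment> \<open>The vertices at which the powers of \<open>x\<close> are read, and the vertices that are visited by the letters from \<open>A\<close>.\<close>
  define vl where "vl = rec_list (\<lambda>_. []) (\<lambda>y _ rec u. u # rec (step u y))"
  have vl [simp]: "vl [] u = []" "vl (y # us) u = u # vl us (step u y)" for y us u by (simp_all add: vl_def)
  define Zl where "Zl = rec_list (\<lambda>_. {}) (\<lambda>y _ rec u. path (u \<otimes>\<^bsub>P\<^esub> \<rho> (x [^]\<^bsub>G\<^esub> (fst y))) (snd y) \<union> rec (step u y))"
  have Zl [simp]: "Zl [] u = {}" "Zl (y # us) u = path (u \<otimes>\<^bsub>P\<^esub> \<rho> (x [^]\<^bsub>G\<^esub> (fst y))) (snd y) \<union> Zl us (step u y)" for y us u
    by (simp_all add: Zl_def)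
  have len_vl: "length (vl us u) = length us" for us u by (induction us arbitrary: u) auto
  have path_card: "finite (path u a) \<and> card (path u a) \<le> Suc (length (wd a))" for u a
    unfolding path_def using card_image_le[of "{..length (wd a)}"] by simp
  have Zl_card: "finite (Zl us u) \<and> card (Zl us u) \<le> (\<Sum>y\<leftarrow>us. Suc (length (wd (snd y))))" for us u
  proof (induction us arbitrary: u)
    case (Cons y us)
    show ?case using Cons.IH[of "step u y"] path_card[of "u \<otimes>\<^bsub>P\<^esub> \<rho> (x [^]\<^bsub>G\<^esub> (fst y))" "snd y"]
      card_Un_le[of "path (u \<otimes>\<^bsub>P\<^esub> \<rho> (x [^]\<^bsub>G\<^esub> (fst y))) (snd y)" "Zl us (step u y)"] by simp
  qed simp
  have step_c: "step u y \<in> carrier P" if "u \<in> carrier P" "snd y \<in> carrier A" for u y using that by (simp add: step_def)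
  have vl_c: "set (vl us u) \<subseteq> carrier P" if "u \<in> carrier P" "\<And>y. y \<in> set us \<Longrightarrow> snd y \<in> carrier A" for us u
    using that by (induction us arbitrary: u) (auto simp: step_c)
  define v0 where "v0 = \<rho> (\<iota>A a0)"
  have v0: "v0 \<in> carrier P" using a0 by (simp add: v0_def)
  define Us where "Us = set (vl ws v0)"
  have Us: "finite Us" "Us \<subseteq> carrier P" using vl_c[OF v0 wsA] by (auto simp: Us_def)
  define Z where "Z = path \<one>\<^bsub>P\<^esub> a0 \<union> Zl ws v0"
  obtain D where D: "D \<subseteq> carrier P" "D \<inter> Z = {}" "\<And>u. u \<in> Us \<Longrightarrow> \<exists>d. D \<inter> cyclic_coset P xP u = {d}"
    "\<And>u v t. u \<in> Us \<Longrightarrow> v \<in> cyclic_coset P xP u \<Longrightarrow> t \<in> {0<..<length w} \<Longrightarrow> v \<otimes>\<^bsub>P\<^esub> \<rho> (\<iota>A (W t)) \<notin> D"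
  proof (rule choose_marks[OF P.is_group xP hx Us])
    show "finite Z" using path_card Zl_card by (simp add: Z_def)
    have "card Us \<le> length ws" using card_length[of "vl ws v0"] by (simp add: Us_def len_vl)
    then have "card Us * card {0<..<length w} \<le> length ws * length w" by (intro mult_le_mono) simp_all
    moreover have "card Z \<le> Suc (length (wd a0)) + (\<Sum>y\<leftarrow>ws. Suc (length (wd (snd y))))"
      unfolding Z_def using card_Un_le[of "path \<one>\<^bsub>P\<^esub> a0" "Zl ws v0"] path_card[of "\<one>\<^bsub>P\<^esub>" a0] Zl_card[of ws v0] by linarith
    ultimately show "card Z + card Us * card {0<..<length w} < n0" by (simp add: n0_def)
    show "\<rho> (\<iota>A (W t)) \<in> carrier P" for t using Wc by simp
    fix s assume s: "0 < s" "s < n0"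
    have "\<iota>A (h [^]\<^bsub>A\<^esub> s) \<notin> N" using N(3) s unfolding F_def by auto
    then have "\<rho> (\<iota>A (h [^]\<^bsub>A\<^esub> s)) \<noteq> \<one>\<^bsub>P\<^esub>" using \<rho>(2) by simp
    then show "hP [^]\<^bsub>P\<^esub> s \<noteq> \<one>\<^bsub>P\<^esub>" by (simp add: hP_def hA.hom_nat_pow \<rho>.hom_nat_pow)
    fix t i assume t: "t \<in> {0<..<length w}"
    have "com (cj t s) \<in> F" using s t unfolding F_def by auto
    then have "\<rho> (\<iota>A (cj t s)) \<noteq> xP [^]\<^bsub>P\<^esub> (i::int)" by (rule noncom[OF cjc])
    then show "\<rho> (\<iota>A (W t)) \<otimes>\<^bsub>P\<^esub> hP [^]\<^bsub>P\<^esub> s \<otimes>\<^bsub>P\<^esub> inv\<^bsub>P\<^esub> \<rho> (\<iota>A (W t)) \<noteq> xP [^]\<^bsub>P\<^esub> i"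
      using Wc by (simp add: cj_def hP_def hA.hom_nat_pow \<rho>.hom_nat_pow)
  qed auto
  have alt: "successively (\<lambda>u v. col u \<noteq> col v) (vl us u)"
    if "u \<in> carrier P" "\<And>y. y \<in> set us \<Longrightarrow> snd y \<in> carrier A" "\<And>y. y \<in> set (butlast us) \<Longrightarrow> com (snd y) \<in> F" for us u
    using that
  proof (induction us arbitrary: u)
    case (Cons y us)
    show ?case
    proof (cases us)
      case Nil then show ?thesis by simp
    next
      case us: (Cons z zs)
      have yA: "snd y \<in> carrier A" and yF: "com (snd y) \<in> F" using Cons.prems(2,3)[of y] us by auto
      have "col u \<noteq> col (step u y)"
      proof
        assume eq: "col u = col (step u y)"
        have xj: "\<rho> (x [^]\<^bsub>G\<^esub> (fst y)) = xP [^]\<^bsub>P\<^esub> (fst y)" by (simp add: xP_def \<rho>.hom_int_pow)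
        have "step u y = u \<otimes>\<^bsub>P\<^esub> (xP [^]\<^bsub>P\<^esub> (fst y) \<otimes>\<^bsub>P\<^esub> \<rho> (\<iota>A (snd y)))"
          using Cons.prems(1) yA xP by (simp add: step_def xj P.m_assoc)
        then obtain i :: int where "xP [^]\<^bsub>P\<^esub> (fst y) \<otimes>\<^bsub>P\<^esub> \<rho> (\<iota>A (snd y)) = xP [^]\<^bsub>P\<^esub> i"
          using cyclic_coset_mult[OF P.is_group xP Cons.prems(1), of "xP [^]\<^bsub>P\<^esub> (fst y) \<otimes>\<^bsub>P\<^esub> \<rho> (\<iota>A (snd y))"] eq xP yA
          unfolding col_def by auto
        then have "\<rho> (\<iota>A (snd y)) = inv\<^bsub>P\<^esub> (xP [^]\<^bsub>P\<^esub> (fst y)) \<otimes>\<^bsub>P\<^esub> xP [^]\<^bsub>P\<^esub> i"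
          using xP yA by (metis P.inv_solve_left P.int_pow_closed \<rho>.hom_closed hA.hom_closed)
        also have "\<dots> = xP [^]\<^bsub>P\<^esub> (i - fst y)" using xP by (simp add: P.int_pow_neg[symmetric] P.int_pow_mult[symmetric])
        finally show False using noncom[OF yA yF] by blast
      qed
      moreover have "successively (\<lambda>u v. col u \<noteq> col v) (vl us (step u y))"
      proof (rule Cons.IH[OF step_c[OF Cons.prems(1) yA]])
        show "snd z \<in> carrier A" if "z \<in> set us" for z using Cons.prems(2)[of z] that by simp
        show "com (snd z) \<in> F" if "z \<in> set (butlast us)" for z using Cons.prems(3)[of z] that us by simp
      qed
      ultimately show ?thesis using us by simp
    qed
  qed simp
  define r where "r = Suc (length ws)"
  define C where "C i = col (vl ws v0 ! i)" for i
  have "successively (\<lambda>u v. col u \<noteq> col v) (vl ws v0)"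
    by (rule alt[OF v0 wsA]) (auto simp: F_def)
  then have C: "C i \<noteq> C (Suc i)" if "Suc (Suc i) < r" for i
    using that by (simp add: C_def r_def successively_conv_nth len_vl)
  interpret U: group "ut p r" by (rule ut_group[OF prime])
  obtain \<theta> where \<theta>: "\<theta> \<in> hom G (wreath (ut p r) P)" "\<forall>g\<in>carrier G. snd (\<theta> g) = \<rho> g"
    "\<forall>y\<in>words. \<forall>v\<in>carrier P. (\<forall>t\<le>length y. vert v (take t y) \<notin> D) \<longrightarrow> fst (\<theta> (\<iota>A (ev A e y))) v = \<one>\<^bsub>ut p r\<^esub>"
    "\<forall>u\<in>Us. \<forall>j. \<not> int n dvd j \<longrightarrow> (\<exists>\<gamma>. p_integral p \<gamma> \<and> \<gamma> \<noteq> 0 \<and> fst (\<theta> (x [^]\<^bsub>G\<^esub> j)) u = colour_elem C r (col u) \<gamma>)"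
    unfolding vert_def col_def xP_def
    by (rule marked_hom[where C = C and r = r and D = D and Us = Us, OF P \<rho>(1) D(1) C Us(2)]) (use D(3,4) in \<open>auto simp: xP_def W_def\<close>)
  interpret WR: group "wreath (ut p r) P" by (rule wreath_group[OF U.is_group P.is_group])
  interpret \<theta>: group_hom G "wreath (ut p r) P" \<theta> by unfold_locales (rule \<theta>(1))
  have path_read: "fst (\<theta> (\<iota>A a)) v = \<one>\<^bsub>ut p r\<^esub>" if "a \<in> carrier A" "v \<in> carrier P" "path v a \<inter> D = {}" for a v
  proof -
    have w: "wd a \<in> words" "ev A e (wd a) = a" using wd[OF that(1)] by auto
    have "\<forall>t\<le>length (wd a). vert v (take t (wd a)) \<notin> D" using that(3) by (auto simp: path_def)
    then show ?thesis using \<theta>(3) w that(2) by metis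
  qed
  have reading: "\<exists>xs. map fst xs = map col (vl us u) \<and> (\<forall>y\<in>set xs. p_integral p (snd y) \<and> snd y \<noteq> 0) \<and>
      fst (\<theta> (pairs us)) u = mprod (ut p r) (map (\<lambda>(c, \<gamma>). colour_elem C r c \<gamma>) xs)"
    if "u \<in> carrier P" "set us \<subseteq> carrier integer_group \<times> carrier A" "\<And>y. y \<in> set us \<Longrightarrow> \<not> int n dvd fst y"
      "set (vl us u) \<subseteq> Us" "Zl us u \<inter> D = {}" for us u
    using that
  proof (induction us arbitrary: u)
    case Nil then show ?case by (intro exI[of _ "[]"]) (simp add: wreath_one)
  next
    case (Cons y us)
    obtain j a where y: "y = (j, a)" by (cases y)
    have c: "a \<in> carrier A" "set us \<subseteq> carrier integer_group \<times> carrier A" using Cons.prems(2) y by auto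
    have u: "u \<in> carrier P" and s: "step u y \<in> carrier P" using Cons.prems(1) step_c y c by auto
    obtain xs where xs: "map fst xs = map col (vl us (step u y))" "\<forall>y\<in>set xs. p_integral p (snd y) \<and> snd y \<noteq> 0"
      "fst (\<theta> (pairs us)) (step u y) = mprod (ut p r) (map (\<lambda>(c, \<gamma>). colour_elem C r c \<gamma>) xs)"
      using Cons.IH[OF s c(2)] Cons.prems(3-5) by auto
    have "u \<in> Us" "\<not> int n dvd j" using Cons.prems(3)[of y] Cons.prems(4) y by auto
    then obtain \<gamma> where \<gamma>: "p_integral p \<gamma>" "\<gamma> \<noteq> 0" "fst (\<theta> (x [^]\<^bsub>G\<^esub> j)) u = colour_elem C r (col u) \<gamma>"
      using \<theta>(4) by blast
    have uj: "u \<otimes>\<^bsub>P\<^esub> \<rho> (x [^]\<^bsub>G\<^esub> j) \<in> carrier P" using u by simp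
    have fa: "fst (\<theta> (\<iota>A a)) (u \<otimes>\<^bsub>P\<^esub> \<rho> (x [^]\<^bsub>G\<^esub> j)) = \<one>\<^bsub>ut p r\<^esub>"
      by (rule path_read[OF c(1) uj]) (use Cons.prems(5) y in auto)
    have pu: "pairs us \<in> carrier G" using c by simp
    have st: "step u y = u \<otimes>\<^bsub>P\<^esub> \<rho> (x [^]\<^bsub>G\<^esub> j) \<otimes>\<^bsub>P\<^esub> \<rho> (\<iota>A a)" by (simp add: step_def y)
    have "fst (\<theta> (x [^]\<^bsub>G\<^esub> j \<otimes>\<^bsub>G\<^esub> (\<iota>A a \<otimes>\<^bsub>G\<^esub> pairs us))) u
      = colour_elem C r (col u) \<gamma> \<otimes>\<^bsub>ut p r\<^esub> (\<one>\<^bsub>ut p r\<^esub> \<otimes>\<^bsub>ut p r\<^esub> fst (\<theta> (pairs us)) (step u y))"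
    proof -
      have "\<theta> (x [^]\<^bsub>G\<^esub> j \<otimes>\<^bsub>G\<^esub> (\<iota>A a \<otimes>\<^bsub>G\<^esub> pairs us)) =
        \<theta> (x [^]\<^bsub>G\<^esub> j) \<otimes>\<^bsub>wreath (ut p r) P\<^esub> (\<theta> (\<iota>A a) \<otimes>\<^bsub>wreath (ut p r) P\<^esub> \<theta> (pairs us))"
        using c pu by (simp del: \<theta>.hom_int_pow)
      moreover have "snd (\<theta> (x [^]\<^bsub>G\<^esub> j)) = \<rho> (x [^]\<^bsub>G\<^esub> j)" "snd (\<theta> (\<iota>A a)) = \<rho> (\<iota>A a)" using \<theta>(2) c by auto
      ultimately show ?thesis using u uj by (simp only: wreath_fst_mult \<gamma>(3) fa st)
    qed
    moreover have "\<one>\<^bsub>ut p r\<^esub> \<otimes>\<^bsub>ut p r\<^esub> fst (\<theta> (pairs us)) (step u y) = fst (\<theta> (pairs us)) (step u y)"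
      using wreath_fst_closed[OF \<theta>.hom_closed[OF pu] s] by simp
    ultimately show ?case using xs \<gamma>
      by (intro exI[of _ "(col u, \<gamma>) # xs"]) (simp add: y \<iota>Z_pow[of j])
  qed
  have "\<not> int n dvd fst y" if y: "y \<in> set ws" for y
  proof
    assume "int n dvd fst y"
    then obtain i where "fst y = int n * i" by blast
    then have "inK (fst y)" by (simp add: mult.commute)
    then show False using ws(1) y by (auto simp: reduced_pairs_def)
  qed
  moreover have "Zl ws v0 \<inter> D = {}" "path \<one>\<^bsub>P\<^esub> a0 \<inter> D = {}" using D(2) by (auto simp: Z_def)
  ultimately obtain xs where xs: "map fst xs = map col (vl ws v0)" "\<forall>y\<in>set xs. p_integral p (snd y) \<and> snd y \<noteq> 0"
      "fst (\<theta> (pairs ws)) v0 = mprod (ut p r) (map (\<lambda>(c, \<gamma>). colour_elem C r c \<gamma>) xs)"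
    using reading[OF v0 wsc] by (auto simp: Us_def)
  have len: "length xs = length ws" using arg_cong[OF xs(1), of length] by (simp add: len_vl)
  have "mprod (ut p r) (map (\<lambda>(c, \<gamma>). colour_elem C r c \<gamma>) xs) 0 (length xs) = (\<Prod>y\<leftarrow>xs. snd y)"
  proof (rule colour_path[OF prime])
    show "length xs < r" by (simp add: len r_def)
    show "C i = fst (xs ! i)" if "i < length xs" for i
    proof -
      have "map fst xs ! i = map col (vl ws v0) ! i" by (simp add: xs(1))
      then show ?thesis using that len len_vl by (simp add: C_def)
    qed
    show "p_integral p (snd y)" if "y \<in> set xs" for y using xs(2) that by blast
    show "xs \<noteq> []" using len ws(2) by auto
  qed
  moreover have "(\<Prod>y\<leftarrow>xs. snd y) \<noteq> 0" using xs(2) by (auto simp: prod_list_zero_iff)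
  ultimately have "fst (\<theta> (pairs ws)) v0 \<noteq> \<one>\<^bsub>ut p r\<^esub>" unfolding xs(3)[symmetric] by (auto simp: ut_one)
  moreover have "fst (\<theta> c) \<one>\<^bsub>P\<^esub> = fst (\<theta> (pairs ws)) v0"
  proof -
    have "fst (\<theta> (\<iota>A a0)) \<one>\<^bsub>P\<^esub> = \<one>\<^bsub>ut p r\<^esub>" by (rule path_read[OF a0 P.one_closed]) fact
    moreover have "snd (\<theta> (\<iota>A a0)) = v0" using \<theta>(2) a0 by (simp add: v0_def)
    moreover have "\<theta> c = \<theta> (\<iota>A a0) \<otimes>\<^bsub>wreath (ut p r) P\<^esub> \<theta> (pairs ws)" using a0 wsc by (simp add: c_def)
    ultimately show ?thesis using v0 wreath_fst_closed[OF \<theta>.hom_closed[OF pairs_closed[OF wsc]] v0] by (simp add: wreath_fst_mult)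
  qed
  ultimately have "snd (\<theta> c) = \<one>\<^bsub>P\<^esub> \<and> fst (\<theta> c) \<one>\<^bsub>P\<^esub> \<noteq> \<one>\<^bsub>ut p r\<^esub>" using \<theta>(2) c \<rho>(2)[OF c] N(2) by simp
  moreover have "p_finite p P" by (rule P)
  ultimately show ?thesis using \<theta>(1) unfolding P_def by blast
qed blast

end

section \<open>Closed cyclic subgroups and isolation\<close>

text \<open>In a finite \<open>p\<close>-group \<open>a\<close> is a power of \<open>a\<^sup>X\<close>, hence a power of \<open>x\<close>.\<close>

lemma residually_p_commute:
  fixes G (structure) and p :: nat
  assumes prime: "Factorial_Ring.prime p" and G: "group G" and rp: "residually_p p G" and ax: "a \<in> carrier G" "x \<in> carrier G"
    and X: "\<not> int p dvd X" and eq: "a [^] X = x [^] (Y::int)"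
  shows "a \<otimes> x = x \<otimes> a"
proof (rule ccontr)
  interpret group G by fact
  assume "a \<otimes> x \<noteq> x \<otimes> a"
  then have "a \<otimes> x \<otimes> inv a \<otimes> inv x \<noteq> \<one>" using commutator_eq_one_iff ax by blast
  then obtain N where N: "p_open p G N" "a \<otimes> x \<otimes> inv a \<otimes> inv x \<notin> N"
    using rp ax unfolding residually_p_def by (meson inv_closed m_closed)
  define P where "P = G Mod N"
  define \<rho> where "\<rho> = (\<lambda>g. N #> g)"
  have P: "p_finite p P" unfolding P_def by (rule p_finite_Mod[OF N(1)])
  interpret P: group P using P by (simp add: p_finite_def)
  have \<rho>: "\<rho> \<in> hom G P" "\<And>g. g \<in> carrier G \<Longrightarrow> \<rho> g = \<one>\<^bsub>P\<^esub> \<longleftrightarrow> g \<in> N"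
    unfolding \<rho>_def P_def using Mod_hom[OF p_openD(1)[OF N(1)]] by auto
  interpret \<rho>: group_hom G P \<rho> by unfold_locales (rule \<rho>)
  define X' where "X' = nat \<bar>X\<bar>"
  have X': "\<not> p dvd X'" using X by (simp add: X'_def flip: int_dvd_int_iff)
  have "\<exists>Z::int. a [^] X' = x [^] Z"
  proof (cases "X \<ge> 0")
    case True
    then have "a [^] X' = a [^] X" unfolding X'_def int_pow_int[symmetric] by simp
    then show ?thesis unfolding eq by (rule exI)
  next
    case False
    then have "a [^] X' = a [^] (- X)" unfolding X'_def int_pow_int[symmetric] by simp
    also have "\<dots> = x [^] (- Y)" using eq ax by (simp add: int_pow_neg)
    finally show ?thesis by (rule exI)
  qed
  then obtain Z :: int where Z: "a [^] X' = x [^] Z" by blast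
  obtain l where l: "(\<rho> a [^]\<^bsub>P\<^esub> X') [^]\<^bsub>P\<^esub> (l::nat) = \<rho> a"
    using p_finite_root[OF prime P \<rho>.hom_closed[OF ax(1)] X'] by blast
  have "\<rho> (a [^] X') = \<rho> (x [^] Z)" by (simp only: Z)
  then have "\<rho> a [^]\<^bsub>P\<^esub> X' = \<rho> x [^]\<^bsub>P\<^esub> Z" unfolding \<rho>.hom_nat_pow[OF ax(1)] \<rho>.hom_int_pow[OF ax(2)] .
  then have a: "\<rho> a = \<rho> x [^]\<^bsub>P\<^esub> (Z * int l)"
    using l P.int_pow_pow[OF \<rho>.hom_closed[OF ax(2)], of Z "int l"] by (simp only: int_pow_int)
  have "\<rho> a \<otimes>\<^bsub>P\<^esub> \<rho> x = \<rho> x \<otimes>\<^bsub>P\<^esub> \<rho> a"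
    unfolding a using commute_int_pow[OF prime P.is_group, of "\<rho> x" "\<rho> x" "Z * int l" 1] ax by simp
  then have "\<rho> (a \<otimes> x \<otimes> inv a \<otimes> inv x) = \<one>\<^bsub>P\<^esub>" using ax P.commutator_eq_one_iff[of "\<rho> a" "\<rho> x"] by simp
  moreover have "a \<otimes> x \<otimes> inv a \<otimes> inv x \<in> carrier G" using ax by simp
  ultimately show False using N(2) \<rho>(2) by blast
qed

text \<open>If \<open>h\<^sup>i = 1\<close>, then all powers of \<open>p\<close> divide \<open>i\<close>.\<close>

lemma central_mod_p_infinite_order:
  assumes prime: "Factorial_Ring.prime p" and c: "central_mod_p p G h" and "group G" and eq: "h [^]\<^bsub>G\<^esub> (i::int) = \<one>\<^bsub>G\<^esub>"
  shows "i = 0"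
proof (rule ccontr)
  assume i: "i \<noteq> 0"
  interpret group G by fact
  have "int p ^ nat (\<bar>i\<bar>) dvd i"
  proof -
    obtain N where N: "p_open p G N" "\<forall>j::int. h [^]\<^bsub>G\<^esub> j \<in> N \<longrightarrow> int p ^ nat \<bar>i\<bar> dvd j"
      using c unfolding central_mod_p_def by blast
    have "\<one>\<^bsub>G\<^esub> \<in> N" using p_openD(2)[OF N(1)] subgroup.one_closed by blast
    then show ?thesis using N(2) eq by metis
  qed
  then have "int p ^ nat \<bar>i\<bar> \<le> \<bar>i\<bar>" using i dvd_imp_le_int by force
  have "int (nat \<bar>i\<bar>) < int (p ^ nat \<bar>i\<bar>)"
    using power_gt_expt[OF prime_gt_Suc_0_nat[OF prime], of "nat \<bar>i\<bar>"] by (simp only: of_nat_less_iff)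
  then have "\<bar>i\<bar> < int p ^ nat \<bar>i\<bar>" by simp
  with \<open>int p ^ nat \<bar>i\<bar> \<le> \<bar>i\<bar>\<close> show False by simp
qed

lemma central_mod_p_pow:
  fixes G (structure) and p :: nat
  assumes prime: "Factorial_Ring.prime p" and G: "group G" and h: "h \<in> carrier G" and c: "central_mod_p p G h"
  shows "central_mod_p p G (h [^] (p ^ s))"
  unfolding central_mod_p_def
proof
  interpret group G by fact
  fix e
  obtain N where N: "p_open p G N" "\<forall>g\<in>carrier G. g \<otimes> h \<otimes> inv g \<otimes> inv h \<in> N"
    "\<forall>i::int. h [^] i \<in> N \<longrightarrow> int p ^ (s + e) dvd i"
    using c unfolding central_mod_p_def by blast
  define P where "P = G Mod N"
  define \<rho> where "\<rho> = (\<lambda>g. N #> g)"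
  have P: "p_finite p P" unfolding P_def by (rule p_finite_Mod[OF N(1)])
  interpret P: group P using P by (simp add: p_finite_def)
  have \<rho>: "\<rho> \<in> hom G P" "\<And>g. g \<in> carrier G \<Longrightarrow> \<rho> g = \<one>\<^bsub>P\<^esub> \<longleftrightarrow> g \<in> N"
    unfolding \<rho>_def P_def using Mod_hom[OF p_openD(1)[OF N(1)]] by auto
  interpret \<rho>: group_hom G P \<rho> by unfold_locales (rule \<rho>)
  let ?k = "h [^] (p ^ s)"
  have "g \<otimes> ?k \<otimes> inv g \<otimes> inv ?k \<in> N" if g: "g \<in> carrier G" for g
  proof -
    have "g \<otimes> h \<otimes> inv g \<otimes> inv h \<in> carrier G" "g \<otimes> ?k \<otimes> inv g \<otimes> inv ?k \<in> carrier G" using g h by simp_all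
    note \<rho>N = this[THEN \<rho>(2)]
    have "\<rho> (g \<otimes> h \<otimes> inv g \<otimes> inv h) = \<one>\<^bsub>P\<^esub>" using N(2) \<rho>N(1) g by blast
    then have "\<rho> g \<otimes>\<^bsub>P\<^esub> \<rho> h = \<rho> h \<otimes>\<^bsub>P\<^esub> \<rho> g" using g h P.commutator_eq_one_iff[of "\<rho> g" "\<rho> h"] by simp
    then have "\<rho> g \<otimes>\<^bsub>P\<^esub> \<rho> h [^]\<^bsub>P\<^esub> (p ^ s) = \<rho> h [^]\<^bsub>P\<^esub> (p ^ s) \<otimes>\<^bsub>P\<^esub> \<rho> g"
      using commute_int_pow[OF prime P.is_group, of "\<rho> g" "\<rho> h" 1 "int (p ^ s)"] g h by (simp only: int_pow_int P.int_pow_1 \<rho>.hom_closed)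
    then have "\<rho> (g \<otimes> ?k \<otimes> inv g \<otimes> inv ?k) = \<one>\<^bsub>P\<^esub>"
      using g h P.commutator_eq_one_iff[of "\<rho> g" "\<rho> h [^]\<^bsub>P\<^esub> (p ^ s)"] by (simp add: \<rho>.hom_nat_pow)
    then show ?thesis using \<rho>N(2) by blast
  qed
  moreover have "int p ^ e dvd i" if i: "?k [^] i \<in> N" for i :: int
  proof -
    have "?k [^] i = h [^] (int (p ^ s) * i)" using h by (simp only: int_pow_pow flip: int_pow_int)
    then have "int p ^ s * int p ^ e dvd int p ^ s * i" using N(3) i by (metis of_nat_power power_add)
    moreover have "int p ^ s \<noteq> 0" using prime_gt_0_nat[OF prime] by simp
    ultimately show ?thesis by (metis dvd_mult_cancel_left)
  qed
  ultimately show "\<exists>N. p_open p G N \<and> (\<forall>g\<in>carrier G. g \<otimes> ?k \<otimes> inv g \<otimes> inv ?k \<in> N) \<and> (\<forall>i::int. ?k [^] i \<in> N \<longrightarrow> int p ^ e dvd i)"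
    using N(1) by blast
qed

definition p'_closed_roots :: "nat \<Rightarrow> ('a, 'c) monoid_scheme \<Rightarrow> 'a \<Rightarrow> bool"
  where "p'_closed_roots p G h \<longleftrightarrow> (\<forall>a\<in>carrier G. \<forall>X Y::int. \<not> int p dvd X \<longrightarrow> a [^]\<^bsub>G\<^esub> X = h [^]\<^bsub>G\<^esub> Y \<longrightarrow>
    (\<exists>i::int. a = h [^]\<^bsub>G\<^esub> i))"

text \<open>Let \<open>q = p\<^sup>s\<close>. If \<open>a\<close> is in the closure of \<open>\<langle>h\<^sup>q\<rangle>\<close>, then \<open>a\<close> is some power \<open>h\<^sup>i\<close> by tameness and isolation, and the equation
  \<open>i X = q Y\<close> with \<open>p\<close> not dividing \<open>X\<close> shows that \<open>q\<close> divides \<open>i\<close>.\<close>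

lemma cyclic_closed_if_tame:
  fixes G (structure) and p :: nat
  assumes prime: "Factorial_Ring.prime p" and G: "group G" and h: "h \<in> carrier G" and c: "central_mod_p p G h"
    and iso: "p'_closed_roots p G h" and tame: "\<And>c. c \<in> carrier G \<Longrightarrow> tame_closure_at p G c"
  shows "cyclic_closed p G (h [^] (p ^ s))"
  unfolding cyclic_closed_def
proof (intro ballI impI)
  interpret group G by fact
  fix a assume a: "a \<in> carrier G" and no: "\<nexists>i::int. a = (h [^] (p ^ s)) [^] i"
  have pw: "(h [^] (p ^ s)) [^] i = h [^] (int p ^ s * i)" for i :: int
    using int_pow_pow[OF h, of "int (p ^ s)" i] unfolding int_pow_int by simp
  show "\<exists>N. p_open p G N \<and> (\<forall>i::int. a \<otimes> inv ((h [^] (p ^ s)) [^] i) \<notin> N)"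
  proof (rule ccontr)
    assume "\<not> ?thesis"
    then have "in_cyclic_closure p G (h [^] (p ^ s)) a" unfolding in_cyclic_closure_def by blast
    then obtain X Y :: int where XY: "\<not> int p dvd X" "a [^] X = h [^] (int p ^ s * Y)"
      using tame[of "h [^] (p ^ s)"] a h unfolding tame_closure_at_def pw by blast
    obtain i :: int where i: "a = h [^] i" using iso a XY unfolding p'_closed_roots_def by blast
    have "h [^] (i * X) = h [^] (int p ^ s * Y)" using XY(2) h unfolding i by (simp add: int_pow_pow)
    then have "h [^] (i * X - int p ^ s * Y) = \<one>" using h by (simp add: int_pow_diff)
    then have "i * X - int p ^ s * Y = 0" by (rule central_mod_p_infinite_order[OF prime c G])
    then have "int p ^ s dvd i * X" by simp
    moreover have "coprime (int p ^ s) X" using XY(1) prime prime_imp_coprime[of "int p" X] by simp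
    ultimately have "int p ^ s dvd i" using coprime_dvd_mult_left_iff by blast
    then obtain j where "i = int p ^ s * j" by blast
    then have "a = (h [^] (p ^ s)) [^] j" unfolding i pw by simp
    then show False using no by blast
  qed
qed

context root_adjunction
begin

lemma ut_detected_A:
  assumes a: "a \<in> carrier A" "a \<noteq> \<one>\<^bsub>A\<^esub>"
  shows "\<exists>r. \<exists>\<tau>\<in>hom G (ut p r). \<tau> (\<iota>A a) \<noteq> \<one>\<^bsub>ut p r\<^esub>"
proof -
  obtain r \<tau> where \<tau>: "\<tau> \<in> hom A (ut p r)" "\<tau> a \<noteq> \<one>\<^bsub>ut p r\<^esub>" using ut_separated a unfolding ut_separated_def by blast
  then show ?thesis using extend_ut[OF \<tau>(1)] a(1) by metis
qed

lemma ut_hom_one: "\<tau> \<in> hom G (ut p r) \<Longrightarrow> \<tau> \<one>\<^bsub>G\<^esub> = \<one>\<^bsub>ut p r\<^esub>"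
  using hom_one[OF _ G.is_group ut_group[OF prime]] .

lemma \<iota>A_inj: "a \<in> carrier A \<Longrightarrow> \<iota>A a = \<one>\<^bsub>G\<^esub> \<Longrightarrow> a = \<one>\<^bsub>A\<^esub>"
  using ut_detected_A ut_hom_one by metis

lemma reduced_pairs_nontrivial:
  assumes "a0 \<in> carrier A" "reduced_pairs ws" "ws \<noteq> []"
  shows "\<iota>A a0 \<otimes>\<^bsub>G\<^esub> pairs ws \<noteq> \<one>\<^bsub>G\<^esub>"
proof
  assume eq: "\<iota>A a0 \<otimes>\<^bsub>G\<^esub> pairs ws = \<one>\<^bsub>G\<^esub>"
  have W: "fst (\<theta> \<one>\<^bsub>G\<^esub>) \<one>\<^bsub>P\<^esub> = \<one>\<^bsub>ut p r\<^esub>" if "p_finite p P" "\<theta> \<in> hom G (wreath (ut p r) P)" for P :: "'g set monoid" and r \<theta>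
  proof -
    interpret P: group P using that by (simp add: p_finite_def)
    have "\<theta> \<one>\<^bsub>G\<^esub> = \<one>\<^bsub>wreath (ut p r) P\<^esub>" using hom_one[OF that(2) G.is_group wreath_group[OF ut_group[OF prime] P.is_group]] .
    then show ?thesis by (simp add: wreath_one)
  qed
  show False using reduced_pairs_detected[OF assms] ut_hom_one W unfolding eq by blast
qed

lemma detected:
  assumes c: "c \<in> carrier G" "c \<noteq> \<one>\<^bsub>G\<^esub>"
  shows "\<exists>N. p_open p G N \<and> c \<notin> N" and "residually_p p G \<Longrightarrow> tame_closure_at p G c"
proof -
  obtain a ws where nf: "a \<in> carrier A" "reduced_pairs ws" "c = \<iota>A a \<otimes>\<^bsub>G\<^esub> pairs ws" using normal_form[OF c(1)] by metis
  have ut: "(\<exists>N. p_open p G N \<and> c \<notin> N) \<and> (residually_p p G \<longrightarrow> tame_closure_at p G c)"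
    if \<tau>: "\<tau> \<in> hom G (ut p r)" "\<tau> c \<noteq> \<one>\<^bsub>ut p r\<^esub>" for r \<tau>
  proof -
    obtain k where "c \<notin> {g \<in> carrier G. \<tau> g \<in> ut_cong p r k}" using ut_detects(1)[OF prime G.is_group \<tau>(1) c(1) \<tau>(2)] by blast
    then have "\<exists>N. p_open p G N \<and> c \<notin> N" using p_open_vimage[OF \<tau>(1) G.is_group ut_cong_open[OF prime]] by blast
    then show ?thesis using ut_detects(2)[OF prime G.is_group \<tau>(1) c(1) \<tau>(2)] by blast
  qed
  have wr: "(\<exists>N. p_open p G N \<and> c \<notin> N) \<and> (residually_p p G \<longrightarrow> tame_closure_at p G c)"
    if P: "p_finite p P" and \<theta>: "\<theta> \<in> hom G (wreath (ut p r) P)" "snd (\<theta> c) = \<one>\<^bsub>P\<^esub>" "fst (\<theta> c) \<one>\<^bsub>P\<^esub> \<noteq> \<one>\<^bsub>ut p r\<^esub>"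
    for P :: "'g set monoid" and r \<theta>
  proof -
    have v: "\<one>\<^bsub>P\<^esub> \<in> carrier P" using P by (simp add: p_finite_def group.is_monoid monoid.one_closed)
    have 1: "c [^]\<^bsub>G\<^esub> (1::nat) = c" using c(1) by simp
    show ?thesis
      using wreath_ut_detects[OF prime G.is_group P \<theta>(1) c(1) _ v, where M = 1, unfolded 1, OF \<theta>(2,3)] by blast
  qed
  have "(\<exists>N. p_open p G N \<and> c \<notin> N) \<and> (residually_p p G \<longrightarrow> tame_closure_at p G c)"
  proof (cases "ws = []")
    case True
    then have "c = \<iota>A a" using nf by simp
    moreover have "a \<noteq> \<one>\<^bsub>A\<^esub>" using c(2) calculation by auto
    ultimately show ?thesis using ut_detected_A[OF nf(1)] ut by blast
  next
    case False
    then show ?thesis using reduced_pairs_detected[OF nf(1,2)] ut wr unfolding nf(3)[symmetric] by blast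
  qed
  then show "\<exists>N. p_open p G N \<and> c \<notin> N" "residually_p p G \<Longrightarrow> tame_closure_at p G c" by blast+
qed

lemma residually_p_root: "residually_p p G"
  using detected(1) unfolding residually_p_def by blast

lemma tame_root: "c \<in> carrier G \<Longrightarrow> tame_closure_at p G c"
  using detected(2)[OF _ _ residually_p_root] tame_at_one[OF prime G.is_group residually_p_root] by metis

text \<open>A corner representation of \<open>h\<close> extends to \<open>x\<close> by dividing the corner entry by \<open>n\<close>.\<close>

lemma central_root: "central_mod_p p G x"
proof -
  obtain r \<tau> c where \<tau>: "\<tau> \<in> hom A (ut p r)" "\<tau> h = corner r c" "p_integral p c" "c \<noteq> 0" "r \<ge> 2"
    by (rule corner_representation[OF prime is_group ut_separated h_in h1])
  have i: "p_integral p (c / of_nat n)" using p_integral_divide[OF prime \<tau>(3), of "int n"] n by simp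
  have "corner r (c / of_nat n) [^]\<^bsub>ut p r\<^esub> n = \<tau> h" unfolding corner_pow(1)[OF prime i] \<tau>(2) using n0 by simp
  then obtain \<theta> where \<theta>: "\<theta> \<in> hom G (ut p r)" "\<theta> x = corner r (c / of_nat n)"
    using extend[OF ut_group[OF prime] ut_countable[OF prime] \<tau>(1) corner_closed[OF prime i]] by blast
  show ?thesis by (rule central_if_corner[OF prime G.is_group x_in \<theta> i _ \<tau>(5)]) (use \<tau>(4) n0 in simp)
qed

lemma x_h_commute: "x [^]\<^bsub>G\<^esub> (j::int) \<otimes>\<^bsub>G\<^esub> \<iota>A h = \<iota>A h \<otimes>\<^bsub>G\<^esub> x [^]\<^bsub>G\<^esub> j"
  unfolding x_pow_n[symmetric] by (simp add: add.commute flip: int_pow_int G.int_pow_mult)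

text \<open>Write \<open>c\<close> as a power of \<open>x\<close> times an alternating product \<open>P\<close> of letters \<open>b\<close> outside \<open>\<langle>h\<rangle>\<close> and powers of \<open>x\<close>. Then
  \<open>P\<close> commutes with \<open>h\<close>. If \<open>P\<close> is not empty, conjugating \<open>h\<close> by it leads to a normal form that begins and
  ends with letters outside \<open>\<langle>h\<rangle>\<close> (the set \<open>NR\<close>): the innermost letter \<open>b h b\<^sup>-\<^sup>1\<close> is outside \<open>\<langle>h\<rangle>\<close>
  because \<open>\<langle>h\<rangle>\<close> is its own normaliser. Such an element is not equal to \<open>h\<close>.\<close>

lemma centraliser_root:
  assumes c: "c \<in> carrier G" and comm: "c \<otimes>\<^bsub>G\<^esub> \<iota>A h = \<iota>A h \<otimes>\<^bsub>G\<^esub> c"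
  shows "\<exists>i::int. c = x [^]\<^bsub>G\<^esub> i"
proof -
  interpret S: amalgamation integer_group A G \<iota>Z \<iota>A "int n" h by (rule swap)
  define NR where "NR = {\<iota>A a \<otimes>\<^bsub>G\<^esub> pairs ws | a ws. a \<in> carrier A \<and> \<not> inH a \<and> reduced_pairs ws \<and> (\<forall>y\<in>set ws. \<not> inH (snd y))}"
  have inv_inH: "inH b" if b: "b \<in> carrier A" and ib: "inH (inv\<^bsub>A\<^esub> b)" for b
  proof -
    obtain i :: int where i: "inv\<^bsub>A\<^esub> b = h [^]\<^bsub>A\<^esub> i" using ib by blast
    have "b = inv\<^bsub>A\<^esub> (inv\<^bsub>A\<^esub> b)" using b by simp
    also have "\<dots> = h [^]\<^bsub>A\<^esub> (- i)" unfolding i by (simp add: int_pow_neg)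
    finally show ?thesis by (rule exI)
  qed
  have NR_h: "\<iota>A h \<notin> NR"
  proof
    assume "\<iota>A h \<in> NR"
    then obtain a ws where a: "a \<in> carrier A" "\<not> inH a" "reduced_pairs ws" "\<iota>A h = \<iota>A a \<otimes>\<^bsub>G\<^esub> pairs ws" unfolding NR_def by blast
    have wc: "set ws \<subseteq> carrier integer_group \<times> carrier A" using a(3) by (simp add: reduced_pairs_def)
    have "\<iota>A (inv\<^bsub>A\<^esub> h \<otimes>\<^bsub>A\<^esub> a) \<otimes>\<^bsub>G\<^esub> pairs ws = inv\<^bsub>G\<^esub> \<iota>A h \<otimes>\<^bsub>G\<^esub> (\<iota>A a \<otimes>\<^bsub>G\<^esub> pairs ws)" using a(1) wc by (simp add: G.m_assoc)
    also have "\<dots> = \<one>\<^bsub>G\<^esub>" unfolding a(4)[symmetric] by simp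
    finally have e: "\<iota>A (inv\<^bsub>A\<^esub> h \<otimes>\<^bsub>A\<^esub> a) \<otimes>\<^bsub>G\<^esub> pairs ws = \<one>\<^bsub>G\<^esub>" .
    then have "ws = []" using reduced_pairs_nontrivial[of "inv\<^bsub>A\<^esub> h \<otimes>\<^bsub>A\<^esub> a" ws] a by auto
    then have "inv\<^bsub>A\<^esub> h \<otimes>\<^bsub>A\<^esub> a = \<one>\<^bsub>A\<^esub>" using e a(1) by (intro \<iota>A_inj) simp_all
    then have "a = h" using a(1) by (metis inv_equality inv_closed inv_inv h_in)
    then have "a = h [^]\<^bsub>A\<^esub> (1::int)" by simp
    then show False using a(2) by blast
  qed
  have NR_conj: "\<iota>A b \<otimes>\<^bsub>G\<^esub> (x [^]\<^bsub>G\<^esub> j \<otimes>\<^bsub>G\<^esub> (g \<otimes>\<^bsub>G\<^esub> (x [^]\<^bsub>G\<^esub> (- j) \<otimes>\<^bsub>G\<^esub> \<iota>A (inv\<^bsub>A\<^esub> b)))) \<in> NR"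
    if g: "g \<in> NR" and b: "b \<in> carrier A" "\<not> inH b" and j: "\<not> inK j" for g b and j :: int
  proof -
    obtain a ws where a: "a \<in> carrier A" "\<not> inH a" "reduced_pairs ws" "\<forall>y\<in>set ws. \<not> inH (snd y)" "g = \<iota>A a \<otimes>\<^bsub>G\<^esub> pairs ws"
      using g unfolding NR_def by blast
    let ?ws = "(j, a) # ws @ [(- j, inv\<^bsub>A\<^esub> b)]"
    have wc: "set ws \<subseteq> carrier integer_group \<times> carrier A" using a(3) by (simp add: reduced_pairs_def)
    have nj: "\<not> inK (- j)"
    proof
      assume "inK (- j)"
      then obtain i :: int where "- j = i * int n" by auto
      then have "j = (- i) * int n" by simp
      then show False using j by (metis group_int_pow_integer_group)
    qed
    have nb: "\<not> inH (inv\<^bsub>A\<^esub> b)" using inv_inH b by blast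
    have all: "\<not> inH (snd y)" if "y \<in> set ?ws" for y using that a(2,4) nb by auto
    have "reduced_pairs ?ws"
      unfolding reduced_pairs_def
    proof (intro conjI ballI)
      show "set ?ws \<subseteq> carrier integer_group \<times> carrier A" using wc a(1) b(1) by simp
      show "\<not> inK (fst y)" if "y \<in> set ?ws" for y
      proof -
        have "y = (j, a) \<or> y \<in> set ws \<or> y = (- j, inv\<^bsub>A\<^esub> b)" using that by auto
        then show ?thesis using j nj a(3) unfolding reduced_pairs_def by (elim disjE) (simp, blast, simp)
      qed
      show "\<not> inH (snd y)" if "y \<in> set (butlast ?ws)" for y by (rule all[OF in_set_butlastD[OF that]])
    qed
    moreover have "\<iota>A b \<otimes>\<^bsub>G\<^esub> (x [^]\<^bsub>G\<^esub> j \<otimes>\<^bsub>G\<^esub> (g \<otimes>\<^bsub>G\<^esub> (x [^]\<^bsub>G\<^esub> (- j) \<otimes>\<^bsub>G\<^esub> \<iota>A (inv\<^bsub>A\<^esub> b)))) = \<iota>A b \<otimes>\<^bsub>G\<^esub> pairs ?ws"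
      using a(1) b(1) wc by (simp add: a(5) pairs_append \<iota>Z_pow[of j] \<iota>Z_pow[of "- j"] G.m_assoc)
    ultimately show ?thesis unfolding NR_def using b all by blast
  qed
  have conj_NR: "S.pairs us \<otimes>\<^bsub>G\<^esub> \<iota>A h \<otimes>\<^bsub>G\<^esub> inv\<^bsub>G\<^esub> S.pairs us \<in> NR" if "S.reduced_pairs us" "us \<noteq> []" for us
    using that
  proof (induction us)
    case (Cons y us)
    obtain b j where y: "y = (b, j)" by (cases y)
    have b: "b \<in> carrier A" "\<not> inH b" "us \<noteq> [] \<longrightarrow> \<not> inK j" "S.reduced_pairs us"
      using Cons.prems(1) unfolding y S.reduced_pairs_Cons by auto
    have usc: "S.pairs us \<in> carrier G" using b(4) by (simp add: S.reduced_pairs_def)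
    let ?P = "S.pairs us"
    have inv: "inv\<^bsub>G\<^esub> S.pairs (y # us) = inv\<^bsub>G\<^esub> ?P \<otimes>\<^bsub>G\<^esub> (x [^]\<^bsub>G\<^esub> (- j) \<otimes>\<^bsub>G\<^esub> \<iota>A (inv\<^bsub>A\<^esub> b))"
      using b(1) usc by (simp add: y \<iota>Z_pow[of j] G.inv_mult_group G.int_pow_neg G.m_assoc)
    have e: "S.pairs (y # us) \<otimes>\<^bsub>G\<^esub> \<iota>A h \<otimes>\<^bsub>G\<^esub> inv\<^bsub>G\<^esub> S.pairs (y # us) =
      \<iota>A b \<otimes>\<^bsub>G\<^esub> (x [^]\<^bsub>G\<^esub> j \<otimes>\<^bsub>G\<^esub> ((?P \<otimes>\<^bsub>G\<^esub> \<iota>A h \<otimes>\<^bsub>G\<^esub> inv\<^bsub>G\<^esub> ?P) \<otimes>\<^bsub>G\<^esub> (x [^]\<^bsub>G\<^esub> (- j) \<otimes>\<^bsub>G\<^esub> \<iota>A (inv\<^bsub>A\<^esub> b))))"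
      unfolding inv using b(1) usc by (simp add: y \<iota>Z_pow[of j] G.m_assoc)
    show ?case
    proof (cases "us = []")
      case False
      then show ?thesis unfolding e using NR_conj Cons.IH b by blast
    next
      case True
      let ?a = "b \<otimes>\<^bsub>A\<^esub> h \<otimes>\<^bsub>A\<^esub> inv\<^bsub>A\<^esub> b"
      have ac: "?a \<in> carrier A" using b(1) by simp
      have "x [^]\<^bsub>G\<^esub> j \<otimes>\<^bsub>G\<^esub> (\<iota>A h \<otimes>\<^bsub>G\<^esub> (x [^]\<^bsub>G\<^esub> (- j) \<otimes>\<^bsub>G\<^esub> \<iota>A (inv\<^bsub>A\<^esub> b))) = \<iota>A h \<otimes>\<^bsub>G\<^esub> \<iota>A (inv\<^bsub>A\<^esub> b)"
      proof -
        have "x [^]\<^bsub>G\<^esub> j \<otimes>\<^bsub>G\<^esub> (\<iota>A h \<otimes>\<^bsub>G\<^esub> (x [^]\<^bsub>G\<^esub> (- j) \<otimes>\<^bsub>G\<^esub> \<iota>A (inv\<^bsub>A\<^esub> b))) =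
           (x [^]\<^bsub>G\<^esub> j \<otimes>\<^bsub>G\<^esub> \<iota>A h) \<otimes>\<^bsub>G\<^esub> (x [^]\<^bsub>G\<^esub> (- j) \<otimes>\<^bsub>G\<^esub> \<iota>A (inv\<^bsub>A\<^esub> b))" using b(1) by (simp add: G.m_assoc)
        also have "\<dots> = \<iota>A h \<otimes>\<^bsub>G\<^esub> ((x [^]\<^bsub>G\<^esub> j \<otimes>\<^bsub>G\<^esub> x [^]\<^bsub>G\<^esub> (- j)) \<otimes>\<^bsub>G\<^esub> \<iota>A (inv\<^bsub>A\<^esub> b))"
          unfolding x_h_commute using b(1) by (simp add: G.m_assoc)
        also have "x [^]\<^bsub>G\<^esub> j \<otimes>\<^bsub>G\<^esub> x [^]\<^bsub>G\<^esub> (- j) = \<one>\<^bsub>G\<^esub>" by (simp flip: G.int_pow_mult)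
        finally show ?thesis using b(1) by simp
      qed
      then have "S.pairs (y # us) \<otimes>\<^bsub>G\<^esub> \<iota>A h \<otimes>\<^bsub>G\<^esub> inv\<^bsub>G\<^esub> S.pairs (y # us) = \<iota>A ?a \<otimes>\<^bsub>G\<^esub> pairs []"
        unfolding e using True b(1) by (simp add: G.m_assoc)
      moreover have "\<not> inH ?a"
      proof
        assume "inH ?a"
        then obtain i :: int where i: "?a = h [^]\<^bsub>A\<^esub> i" by blast
        have "h \<otimes>\<^bsub>A\<^esub> ?a = ?a \<otimes>\<^bsub>A\<^esub> h" unfolding i using commute_int_pow[OF prime is_group h_in h_in HOL.refl, of 1 i] by simp
        then show False using conj_commute[OF b(1), of 1] b(2) by simp
      qed
      moreover have "reduced_pairs []" by (simp add: reduced_pairs_def)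
      ultimately show ?thesis unfolding NR_def using ac by (intro CollectI exI[of _ ?a] exI[of _ "[]"]) simp
    qed
  qed simp
  obtain l us where l: "S.reduced_pairs us" "c = \<iota>Z l \<otimes>\<^bsub>G\<^esub> S.pairs us" using S.normal_form[OF c] by metis
  have usc: "S.pairs us \<in> carrier G" using l(1) by (simp add: S.reduced_pairs_def)
  have pc: "S.pairs us = x [^]\<^bsub>G\<^esub> (- l) \<otimes>\<^bsub>G\<^esub> c" using usc by (simp add: l(2) \<iota>Z_pow[of l] G.int_pow_neg G.m_assoc[symmetric])
  have "S.pairs us \<otimes>\<^bsub>G\<^esub> \<iota>A h = \<iota>A h \<otimes>\<^bsub>G\<^esub> S.pairs us"
  proof -
    have "S.pairs us \<otimes>\<^bsub>G\<^esub> \<iota>A h = x [^]\<^bsub>G\<^esub> (- l) \<otimes>\<^bsub>G\<^esub> (c \<otimes>\<^bsub>G\<^esub> \<iota>A h)" unfolding pc using c by (simp add: G.m_assoc)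
    also have "\<dots> = (x [^]\<^bsub>G\<^esub> (- l) \<otimes>\<^bsub>G\<^esub> \<iota>A h) \<otimes>\<^bsub>G\<^esub> c" unfolding comm using c by (simp add: G.m_assoc)
    also have "\<dots> = \<iota>A h \<otimes>\<^bsub>G\<^esub> S.pairs us" unfolding x_h_commute pc using c by (simp add: G.m_assoc)
    finally show ?thesis .
  qed
  then have "S.pairs us \<otimes>\<^bsub>G\<^esub> \<iota>A h \<otimes>\<^bsub>G\<^esub> inv\<^bsub>G\<^esub> S.pairs us = \<iota>A h" using usc by (simp add: G.m_assoc)
  then have "us = []" using conj_NR[OF l(1)] NR_h by metis
  then have "c = x [^]\<^bsub>G\<^esub> l" using l(2) by (simp add: \<iota>Z_pow[of l])
  then show ?thesis by blast
qed

lemma p'_closed_roots_root: "p'_closed_roots p G x"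
  unfolding p'_closed_roots_def
proof (intro ballI allI impI)
  fix a and X Y :: int assume a: "a \<in> carrier G" and X: "\<not> int p dvd X" and eq: "a [^]\<^bsub>G\<^esub> X = x [^]\<^bsub>G\<^esub> Y"
  have "a \<otimes>\<^bsub>G\<^esub> x = x \<otimes>\<^bsub>G\<^esub> a" by (rule residually_p_commute[OF prime G.is_group residually_p_root a x_in X eq])
  then have "a \<otimes>\<^bsub>G\<^esub> \<iota>A h = \<iota>A h \<otimes>\<^bsub>G\<^esub> a"
    using commute_int_pow[OF prime G.is_group a x_in, of 1 "int n"] a unfolding int_pow_int x_pow_n by simp
  then show "\<exists>i::int. a = x [^]\<^bsub>G\<^esub> i" by (rule centraliser_root[OF a])
qed

end

section \<open>Amalgamated products of free groups\<close>

text \<open>The properties shared by a free group with a maximal cyclic subgroup and by the group obtained from it by adjoining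
  a root.\<close>

definition tame_pair :: "nat \<Rightarrow> ('a, 'c) monoid_scheme \<Rightarrow> 'a \<Rightarrow> bool"
  where "tame_pair p A h \<longleftrightarrow> group A \<and> h \<in> carrier A \<and> residually_p p A \<and> (\<forall>c\<in>carrier A. tame_closure_at p A c) \<and>
    central_mod_p p A h \<and> p'_closed_roots p A h"

lemma tame_pair_power:
  fixes p :: nat
  assumes prime: "Factorial_Ring.prime p" and "tame_pair p A h"
  shows "residually_p p A" "\<And>c. c \<in> carrier A \<Longrightarrow> tame_closure_at p A c"
    "central_mod_p p A (h [^]\<^bsub>A\<^esub> (p ^ s))" "cyclic_closed p A (h [^]\<^bsub>A\<^esub> (p ^ s))"
proof -
  note t = assms(2)[unfolded tame_pair_def]
  show "residually_p p A" "\<And>c. c \<in> carrier A \<Longrightarrow> tame_closure_at p A c" using t by blast+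
  show "central_mod_p p A (h [^]\<^bsub>A\<^esub> (p ^ s))" by (rule central_mod_p_pow[OF prime]) (use t in blast)+
  show "cyclic_closed p A (h [^]\<^bsub>A\<^esub> (p ^ s))" by (rule cyclic_closed_if_tame[OF prime]) (use t in blast)+
qed

lemma tame_along_powers:
  fixes p :: nat
  assumes prime: "Factorial_Ring.prime p" and A: "tame_pair p A h" and B: "tame_pair p B k"
    and am: "amalgamation A B G \<iota>A \<iota>B (h [^]\<^bsub>A\<^esub> (p ^ s)) (k [^]\<^bsub>B\<^esub> (p ^ t))" and g: "g \<in> carrier G"
  shows "tame_closure_at p G g"
proof -
  interpret amalgamation A B G \<iota>A \<iota>B "h [^]\<^bsub>A\<^esub> (p ^ s)" "k [^]\<^bsub>B\<^esub> (p ^ t)" by fact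
  interpret tame_amalgamation p A B G \<iota>A \<iota>B "h [^]\<^bsub>A\<^esub> (p ^ s)" "k [^]\<^bsub>B\<^esub> (p ^ t)"
    by unfold_locales (rule prime | rule tame_pair_power[OF prime A] tame_pair_power[OF prime B] | assumption)+
  show ?thesis by (rule tame[OF g])
qed

lemma free_group_instance:
  fixes A :: "'a monoid" and p :: nat
  assumes prime: "Factorial_Ring.prime p" and A: "free_group A" and h: "h \<in> carrier A" "h \<noteq> \<one>\<^bsub>A\<^esub>"
    and mx: "maximal_cyclic_subgroup (generate A {h}) A"
  obtains X :: "'a set" and e w where "free_group_max_cyclic p A X e h w"
proof -
  obtain X :: "'a set" and e where F: "free_basis A X e" by (rule free_group_basis[OF A])
  obtain e' v where v: "free_basis A X e'" "v \<in> lists (UNIV \<times> X)" "reduced (v @ v)" "h = ev A e' v"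
    by (rule cyclically_reduced_basis[OF prime F h(1)])
  have "free_group_max_cyclic p A X e' h v"
    unfolding free_group_max_cyclic_def free_group_max_cyclic_axioms_def free_group_basis_def
    using prime v h(2) mx by blast
  then show ?thesis by (rule that)
qed

lemma free_group_ut_separated:
  fixes A :: "'a monoid" and p :: nat
  assumes prime: "Factorial_Ring.prime p" and A: "free_group A"
  shows "ut_separated p A"
proof -
  obtain X :: "'a set" and e where F: "free_basis A X e" by (rule free_group_basis[OF A])
  interpret free_group_basis p A X e by unfold_locales (fact prime F)+
  show ?thesis by (rule ut_separated)
qed

lemma tame_pair_free:
  fixes A :: "'a monoid" and p :: nat
  assumes prime: "Factorial_Ring.prime p" and A: "free_group A" and h: "h \<in> carrier A" "h \<noteq> \<one>\<^bsub>A\<^esub>"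
    and mx: "maximal_cyclic_subgroup (generate A {h}) A"
  shows "tame_pair p A h"
proof -
  obtain X :: "'a set" and e w where "free_group_max_cyclic p A X e h w" by (rule free_group_instance[OF prime A h mx])
  then interpret free_group_max_cyclic p A X e h w .
  obtain r \<tau> c where \<tau>: "\<tau> \<in> hom A (ut p r)" "\<tau> h = corner r c" "p_integral p c" "c \<noteq> 0" "r \<ge> 2"
    by (rule corner_representation[OF prime is_group ut_separated h_in h1])
  have "p'_closed_roots p A h" unfolding p'_closed_roots_def using isolated by (metis dvd_0_right)
  then show ?thesis unfolding tame_pair_def
    using is_group h_in ut_separated_residually_p[OF prime is_group ut_separated] ut_separated_tame[OF prime is_group ut_separated]
      central_if_corner[OF prime is_group h_in \<tau>] by blast
qed

lemma tame_pair_root: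
  fixes A :: "'a monoid" and p :: nat
  assumes prime: "Factorial_Ring.prime p" and A: "free_group A" and h: "h \<in> carrier A" "h \<noteq> \<one>\<^bsub>A\<^esub>"
    and mx: "maximal_cyclic_subgroup (generate A {h}) A" and n: "\<not> p dvd n"
    and am: "amalgamation A integer_group G \<iota>A \<iota>Z h (int n)"
  shows "tame_pair p G (\<iota>Z 1)"
proof -
  obtain X :: "'a set" and e w where "free_group_max_cyclic p A X e h w" by (rule free_group_instance[OF prime A h mx])
  then interpret root_adjunction p A X e h w G \<iota>A \<iota>Z n
    using am n unfolding root_adjunction_def root_adjunction_axioms_def by blast
  show ?thesis unfolding tame_pair_def x_def[symmetric]
    using G.is_group x_in residually_p_root tame_root central_root p'_closed_roots_root by blast
qed

text \<open>Write \<open>N = p\<^sup>t n\<close> with \<open>p\<close> not dividing \<open>n\<close>, and let \<open>A1\<close> be the group obtained from \<open>A\<close> by adjoining an \<open>n\<close>-th root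
  \<open>x\<close> of \<open>h\<close>. Mapping \<open>x\<close> to the power of \<open>k\<close> with exponent \<open>p\<^sup>t\<close> makes \<open>G\<close> an amalgamated product of \<open>A1\<close> and \<open>B\<close>, as is
  verified by the universal properties.\<close>

lemma tame_along_generator:
  fixes A :: "'a monoid" and B :: "'b monoid" and p :: nat
  assumes prime: "Factorial_Ring.prime p"
    and A: "free_group A" and h': "h \<in> carrier A" "h \<noteq> \<one>\<^bsub>A\<^esub>" and mA: "maximal_cyclic_subgroup (generate A {h}) A"
    and B: "free_group B" and k': "k \<in> carrier B" "k \<noteq> \<one>\<^bsub>B\<^esub>" and mB: "maximal_cyclic_subgroup (generate B {k}) B"
    and N: "N > 0" and am: "amalgamation A B G \<iota>A \<iota>B h (k [^]\<^bsub>B\<^esub> (N::nat))" and g: "g \<in> carrier G"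
  shows "tame_closure_at p G g"
proof -
  interpret amalgamation A B G \<iota>A \<iota>B h "k [^]\<^bsub>B\<^esub> N" by fact
  obtain n where n: "N = p ^ multiplicity p N * n" "\<not> p dvd n"
    using multiplicity_decompose'[of N p] N prime by (metis not_prime_unit not_less0)
  define t where "t = multiplicity p N"
  have hA_pair: "tame_pair p A h" by (rule tame_pair_free[OF prime A h' mA])
  have h_ord: "i = 0" if "h [^]\<^bsub>A\<^esub> (i::int) = \<one>\<^bsub>A\<^esub>" for i
    using central_mod_p_infinite_order[OF prime _ A.is_group that] hA_pair unfolding tame_pair_def by blast
  define H where "H = generate A {h}"
  have H: "H = {h [^]\<^bsub>A\<^esub> i | i. i \<in> (UNIV :: int set)}" unfolding H_def by (rule A.generate_pow[OF h'(1)])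
  define \<psi> where "\<psi> a = int n * (THE i. a = h [^]\<^bsub>A\<^esub> i)" for a
  have \<psi>: "\<psi> (h [^]\<^bsub>A\<^esub> i) = int n * i" for i :: int
  proof -
    have "(THE j. h [^]\<^bsub>A\<^esub> i = h [^]\<^bsub>A\<^esub> j) = i"
    proof (rule the_equality)
      fix j :: int assume "h [^]\<^bsub>A\<^esub> i = h [^]\<^bsub>A\<^esub> j"
      then have "h [^]\<^bsub>A\<^esub> (i - j) = \<one>\<^bsub>A\<^esub>" using h'(1) by (simp add: A.int_pow_diff)
      then show "j = i" using h_ord by fastforce
    qed (rule HOL.refl)
    then show ?thesis by (simp add: \<psi>_def)
  qed
  have HA: "H \<subseteq> carrier A" using h'(1) by (auto simp: H)
  have \<psi>h: "\<psi> h = int n" using \<psi>[of 1] h'(1) by simp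
  have "\<psi> \<in> hom (A\<lparr>carrier := H\<rparr>) integer_group"
  proof (rule homI)
    fix a b assume "a \<in> carrier (A\<lparr>carrier := H\<rparr>)" "b \<in> carrier (A\<lparr>carrier := H\<rparr>)"
    then obtain i j :: int where "a = h [^]\<^bsub>A\<^esub> i" "b = h [^]\<^bsub>A\<^esub> j" by (auto simp: H)
    then show "\<psi> (a \<otimes>\<^bsub>A\<lparr>carrier := H\<rparr>\<^esub> b) = \<psi> a \<otimes>\<^bsub>integer_group\<^esub> \<psi> b"
      using h'(1) by (simp add: \<psi> distrib_left flip: A.int_pow_mult)
  qed simp
  interpret Z: group integer_group by (rule group_integer_group)
  interpret D: amalgam_data A integer_group H \<psi> by unfold_locales (use HA in auto)
  define A1 where "A1 = amalgam A integer_group H \<psi>"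
  have am1: "amalgamation A integer_group A1 D.inA D.inB h (int n)"
    using D.amalgam_amalgamation[OF h'(1) H_def \<open>\<psi> \<in> hom (A\<lparr>carrier := H\<rparr>) integer_group\<close>] by (simp add: \<psi>h A1_def)
  interpret R: amalgamation A integer_group A1 D.inA D.inB h "int n" by (rule am1)
  define x where "x = D.inB 1"
  have x: "x \<in> carrier A1" by (simp add: x_def)
  have inB: "D.inB j = x [^]\<^bsub>A1\<^esub> j" for j using R.hB.hom_int_pow[of 1 j] by (simp add: x_def)
  have xn: "x [^]\<^bsub>A1\<^esub> n = D.inA h" using R.glue inB[of "int n"] by (simp add: int_pow_int)
  have pair1: "tame_pair p A1 x" unfolding x_def by (rule tame_pair_root[OF prime A h' mA n(2) am1])
  have pairB: "tame_pair p B k" by (rule tame_pair_free[OF prime B k' mB])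
  let ?k = "k [^]\<^bsub>B\<^esub> (p ^ t)"
  have kc: "?k \<in> carrier B" using k'(1) by simp
  have kn: "?k [^]\<^bsub>B\<^esub> n = k [^]\<^bsub>B\<^esub> N" using k'(1) n(1) by (simp add: B.nat_pow_pow t_def)
  let ?y = "\<iota>B ?k"
  have y: "?y \<in> carrier G" using kc by simp
  have yn: "?y [^]\<^bsub>G\<^esub> n = \<iota>A h" unfolding hB.hom_nat_pow[OF kc, symmetric] kn glue ..
  have "(\<lambda>j::int. ?y [^]\<^bsub>G\<^esub> j) \<in> hom integer_group G" using G.hom_integer_group_pow[OF y] .
  moreover have "\<iota>A a = ?y [^]\<^bsub>G\<^esub> \<psi> a" if "a \<in> H" for a
  proof -
    obtain i :: int where i: "a = h [^]\<^bsub>A\<^esub> i" using \<open>a \<in> H\<close> H by blast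
    have "?y [^]\<^bsub>G\<^esub> (int n * i) = (?y [^]\<^bsub>G\<^esub> n) [^]\<^bsub>G\<^esub> i" using G.int_pow_pow[OF y, of "int n" i] by (simp only: int_pow_int)
    also have "\<dots> = \<iota>A a" unfolding yn i using hA.hom_int_pow[OF h'(1)] by simp
    finally show ?thesis unfolding i \<psi> by simp
  qed
  ultimately obtain \<iota>1 where \<iota>1: "\<iota>1 \<in> hom A1 G" "\<forall>a\<in>carrier A. \<iota>1 (D.inA a) = \<iota>A a"
    "\<forall>j\<in>carrier integer_group. \<iota>1 (D.inB j) = ?y [^]\<^bsub>G\<^esub> j"
    using D.amalgam_universal[OF G.is_group homA, of "\<lambda>j. ?y [^]\<^bsub>G\<^esub> j"] unfolding A1_def D.amalgam_Q by blast
  have \<iota>1x: "\<iota>1 x = ?y" using bspec[OF \<iota>1(3), of 1] y by (simp add: x_def)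
  have "amalgamation A1 B G \<iota>1 \<iota>B x ?k"
  proof
    show "\<iota>1 \<in> hom A1 G" by (rule \<iota>1(1))
    show "\<iota>B \<in> hom B G" by (rule homB)
    show "x \<in> carrier A1" "?k \<in> carrier B" by (rule x, rule kc)
    show "\<iota>1 x = \<iota>B ?k" by (rule \<iota>1x)
    have "\<iota>A a \<in> \<iota>1 ` carrier A1" if a: "a \<in> carrier A" for a
    proof -
      have "\<iota>A a = \<iota>1 (D.inA a)" using \<iota>1(2) a by simp
      then show ?thesis using R.hA.hom_closed[OF a] by (rule image_eqI)
    qed
    then have "\<iota>A ` carrier A \<subseteq> \<iota>1 ` carrier A1" by (rule image_subsetI)
    then have "generate G (\<iota>A ` carrier A \<union> \<iota>B ` carrier B) \<subseteq> generate G (\<iota>1 ` carrier A1 \<union> \<iota>B ` carrier B)"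
      by (intro G.mono_generate Un_mono subset_refl)
    then show "carrier G \<subseteq> generate G (\<iota>1 ` carrier A1 \<union> \<iota>B ` carrier B)" by (rule subset_trans[OF gen])
    fix Y :: "nat monoid" and \<alpha> \<beta>
    assume Y: "group Y" and \<alpha>: "\<alpha> \<in> hom A1 Y" and \<beta>: "\<beta> \<in> hom B Y" and eq: "\<alpha> x = \<beta> ?k"
    interpret Y: group Y by fact
    interpret al: group_hom A1 Y \<alpha> by unfold_locales (rule \<alpha>)
    interpret be: group_hom B Y \<beta> by unfold_locales (rule \<beta>)
    have \<alpha>A: "\<alpha> \<circ> D.inA \<in> hom A Y" by (rule Group.hom_compose[OF R.homA \<alpha>])
    have "(\<alpha> \<circ> D.inA) h = \<alpha> x [^]\<^bsub>Y\<^esub> n" unfolding comp_apply xn[symmetric] al.hom_nat_pow[OF x] ..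
    also have "\<dots> = \<beta> (k [^]\<^bsub>B\<^esub> N)" unfolding eq be.hom_nat_pow[OF kc, symmetric] kn ..
    finally obtain \<theta> where \<theta>: "\<theta> \<in> hom G Y" "\<forall>a\<in>carrier A. \<theta> (\<iota>A a) = (\<alpha> \<circ> D.inA) a" "\<forall>b\<in>carrier B. \<theta> (\<iota>B b) = \<beta> b"
      using universal_nat[OF Y \<alpha>A \<beta>] by blast
    interpret th: group_hom G Y \<theta> by unfold_locales (rule \<theta>(1))
    have \<theta>1: "\<theta> \<circ> \<iota>1 \<in> hom A1 Y" by (rule Group.hom_compose[OF \<iota>1(1) \<theta>(1)])
    have agree_A: "(\<theta> \<circ> \<iota>1) (D.inA a) = \<alpha> (D.inA a)" if "a \<in> carrier A" for a using \<iota>1(2) \<theta>(2) that by simp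
    have agree_Z: "(\<theta> \<circ> \<iota>1) (D.inB j) = \<alpha> (D.inB j)" for j
    proof -
      have "\<iota>1 (D.inB j) = ?y [^]\<^bsub>G\<^esub> j" by (rule bspec[OF \<iota>1(3)]) simp
      then have "(\<theta> \<circ> \<iota>1) (D.inB j) = \<theta> ?y [^]\<^bsub>Y\<^esub> j" unfolding comp_apply using th.hom_int_pow[OF y] by simp
      also have "\<theta> ?y = \<alpha> x" using \<theta>(3) kc eq by simp
      also have "\<alpha> x [^]\<^bsub>Y\<^esub> j = \<alpha> (x [^]\<^bsub>A1\<^esub> j)" using al.hom_int_pow[OF x] by simp
      finally show ?thesis unfolding inB[of j] .
    qed
    have "(\<theta> \<circ> \<iota>1) a = \<alpha> a" if "a \<in> carrier A1" for a
      by (rule R.hom_unique[where \<theta> = "\<theta> \<circ> \<iota>1" and \<theta>' = \<alpha>, OF Y \<theta>1 \<alpha> agree_A agree_Z that])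
    then show "\<exists>\<theta>\<in>hom G Y. (\<forall>a\<in>carrier A1. \<theta> (\<iota>1 a) = \<alpha> a) \<and> (\<forall>b\<in>carrier B. \<theta> (\<iota>B b) = \<beta> b)"
      using \<theta>(1,3) by (intro bexI[of _ \<theta>]) auto
  qed
  moreover have "x [^]\<^bsub>A1\<^esub> (p ^ 0) = x" using x by simp
  ultimately have "amalgamation A1 B G \<iota>1 \<iota>B (x [^]\<^bsub>A1\<^esub> (p ^ 0)) (k [^]\<^bsub>B\<^esub> (p ^ t))" by simp
  then show ?thesis by (rule tame_along_powers[OF prime pair1 pairB _ g])
qed

text \<open>The other factor maps onto \<open>G\<close>, and its representations extend to \<open>G\<close>.\<close>

lemma tame_trivial_factor:
  fixes p :: nat
  assumes prime: "Factorial_Ring.prime p" and B: "ut_separated p B" and am: "amalgamation A B G \<iota>A \<iota>B \<one>\<^bsub>A\<^esub> \<one>\<^bsub>B\<^esub>"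
    and A: "carrier A = {\<one>\<^bsub>A\<^esub>}" and g: "g \<in> carrier G"
  shows "tame_closure_at p G g"
proof -
  interpret amalgamation A B G \<iota>A \<iota>B "\<one>\<^bsub>A\<^esub>" "\<one>\<^bsub>B\<^esub>" by fact
  have sub: "subgroup (\<iota>B ` carrier B) G" using hB.img_is_subgroup .
  have surj: "c \<in> \<iota>B ` carrier B" if "c \<in> carrier G" for c
  proof -
    have "\<iota>A ` carrier A \<union> \<iota>B ` carrier B \<subseteq> \<iota>B ` carrier B" using A subgroup.one_closed[OF sub] by auto
    then show ?thesis using gen that G.generate_subgroup_incl[OF _ sub] by blast
  qed
  have "ut_separated p G" unfolding ut_separated_def
  proof (intro ballI impI)
    fix c assume c: "c \<in> carrier G" "c \<noteq> \<one>\<^bsub>G\<^esub>"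
    obtain b where b: "b \<in> carrier B" "c = \<iota>B b" using surj[OF c(1)] by blast
    then have "b \<noteq> \<one>\<^bsub>B\<^esub>" using c(2) by auto
    then obtain r \<tau> where \<tau>: "\<tau> \<in> hom B (ut p r)" "\<tau> b \<noteq> \<one>\<^bsub>ut p r\<^esub>" using B b(1) unfolding ut_separated_def by blast
    interpret U: group "ut p r" by (rule ut_group[OF prime])
    have tr: "(\<lambda>a. \<one>\<^bsub>ut p r\<^esub>) \<in> hom A (ut p r)" by (rule homI) simp_all
    have "\<tau> \<one>\<^bsub>B\<^esub> = \<one>\<^bsub>ut p r\<^esub>" by (rule hom_one[OF \<tau>(1) B.is_group U.is_group])
    then obtain \<theta> where "\<theta> \<in> hom G (ut p r)" "\<forall>b\<in>carrier B. \<theta> (\<iota>B b) = \<tau> b"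
      using universal[OF U.is_group ut_countable[OF prime] tr \<tau>(1)] by auto
    then show "\<exists>r. \<exists>\<tau>\<in>hom G (ut p r). \<tau> c \<noteq> \<one>\<^bsub>ut p r\<^esub>" using \<tau>(2) b by metis
  qed
  then show ?thesis by (rule ut_separated_tame[OF prime G.is_group _ g])
qed

text \<open>The trivial subgroup is properly contained in every other cyclic subgroup.\<close>

lemma maximal_trivial:
  assumes G: "group G" and "maximal_cyclic_subgroup (generate G {\<one>\<^bsub>G\<^esub>}) G"
  shows "carrier G = {\<one>\<^bsub>G\<^esub>}"
proof -
  interpret group G by fact
  have "generate G {\<one>\<^bsub>G\<^esub>} = {\<one>\<^bsub>G\<^esub>}" using generate_pow[OF one_closed] by auto
  moreover have "a = \<one>\<^bsub>G\<^esub>" if a: "a \<in> carrier G" for a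
  proof (rule ccontr)
    assume ne: "a \<noteq> \<one>\<^bsub>G\<^esub>"
    have "cyclic_subgroup (generate G {a}) G" using a by (auto simp: cyclic_subgroup_def)
    moreover have "a \<in> generate G {a}" "\<one>\<^bsub>G\<^esub> \<in> generate G {a}" by (auto intro: generate.intros)
    then have "{\<one>\<^bsub>G\<^esub>} \<subset> generate G {a}" using ne by blast
    ultimately show False using assms(2) \<open>generate G {\<one>\<^bsub>G\<^esub>} = {\<one>\<^bsub>G\<^esub>}\<close> unfolding maximal_cyclic_subgroup_def by metis
  qed
  ultimately show ?thesis by auto
qed

text \<open>Two generators of an infinite cyclic group differ at most by inversion, which is moved from the power to \<open>k\<close>.\<close>

lemma generator_of_power:
  assumes G: "group G" and k: "k \<in> carrier G" and ord: "\<And>i::int. k [^]\<^bsub>G\<^esub> i = \<one>\<^bsub>G\<^esub> \<Longrightarrow> i = 0"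
    and k': "k' \<in> generate G {k [^]\<^bsub>G\<^esub> (n::int)}" "k [^]\<^bsub>G\<^esub> n \<in> generate G {k'}" and n: "n \<noteq> 0"
  obtains k0 where "k0 \<in> carrier G" "generate G {k0} = generate G {k}" "k' = k0 [^]\<^bsub>G\<^esub> nat \<bar>n\<bar>"
proof -
  interpret group G by fact
  have kn: "k [^]\<^bsub>G\<^esub> n \<in> carrier G" using k by simp
  obtain i :: int where i: "k' = k [^]\<^bsub>G\<^esub> (n * i)" using k'(1) generate_pow[OF kn] k by (auto simp: int_pow_pow)
  then have k'c: "k' \<in> carrier G" using k by simp
  obtain j :: int where j: "k [^]\<^bsub>G\<^esub> n = k [^]\<^bsub>G\<^esub> (n * i * j)" using k'(2) generate_pow[OF k'c] k by (auto simp: i int_pow_pow)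
  have "k [^]\<^bsub>G\<^esub> (n * i * j - n) = \<one>\<^bsub>G\<^esub>" using j k by (simp add: int_pow_diff)
  then have "n * i * j - n = 0" by (rule ord)
  then have "n * (i * j - 1) = 0" by (simp add: algebra_simps)
  then have "i * j = 1" using n by simp
  then have "i = 1 \<or> i = - 1" by (metis zmult_eq_1_iff)
  then have "n * i = int (nat \<bar>n\<bar>) \<or> n * i = - int (nat \<bar>n\<bar>)" by auto
  then show ?thesis
  proof
    assume "n * i = int (nat \<bar>n\<bar>)"
    then show ?thesis using that[of k] i k by (simp add: int_pow_int del: int_nat_eq)
  next
    assume e: "n * i = - int (nat \<bar>n\<bar>)"
    have "generate G {inv\<^bsub>G\<^esub> k} = generate G {k}"
    proof -
      have "(inv\<^bsub>G\<^esub> k) [^]\<^bsub>G\<^esub> l = k [^]\<^bsub>G\<^esub> (- l)" for l :: int using k by (simp add: int_pow_inv int_pow_neg)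
      then have "{(inv\<^bsub>G\<^esub> k) [^]\<^bsub>G\<^esub> l | l. l \<in> (UNIV :: int set)} = {k [^]\<^bsub>G\<^esub> l | l. l \<in> (UNIV :: int set)}"
        by (auto, metis minus_minus) 
      then show ?thesis using generate_pow[OF k] generate_pow[OF inv_closed[OF k]] by simp
    qed
    moreover have "k' = (inv\<^bsub>G\<^esub> k) [^]\<^bsub>G\<^esub> nat \<bar>n\<bar>"
      unfolding i e int_pow_neg_int[OF k] by (rule nat_pow_inv[OF k, symmetric])
    ultimately show ?thesis using that[of "inv\<^bsub>G\<^esub> k"] k by simp
  qed
qed

theorem corollary2p5:
  fixes p :: nat
    and A :: "'a monoid" and B :: "'b monoid"
    and h :: 'a and k :: 'b
    and m n :: int
    and H :: "'a set" and K :: "'b set"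
    and \<phi> :: "'a \<Rightarrow> 'b"
    and G :: "('a + 'b) list set monoid"
  assumes "Factorial_Ring.prime p"
    and "free_group A" and "free_group B"
    and "h \<in> carrier A" and "maximal_cyclic_subgroup (generate A {h}) A"
    and "k \<in> carrier B" and "maximal_cyclic_subgroup (generate B {k}) B"
    and "H = generate A {h [^]\<^bsub>A\<^esub> m}"
    and "K = generate B {k [^]\<^bsub>B\<^esub> n}"
    and "\<phi> \<in> iso (A\<lparr>carrier := H\<rparr>) (B\<lparr>carrier := K\<rparr>)"
    and "G = amalgam A B H \<phi>"
    and "m = 1 \<or> n = 1 \<or> (p_number p m \<and> p_number p n)"
  shows "\<forall>C. cyclic_subgroup C G \<and> p'_isolated p C G \<longrightarrow> p_separable p C G"
proof -
  note prime = assms(1)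
  interpret A: group A using assms(2) by (simp add: free_group_def)
  interpret B: group B using assms(3) by (simp add: free_group_def)
  let ?h = "h [^]\<^bsub>A\<^esub> m"
  define k' where "k' = \<phi> ?h"
  have hc: "?h \<in> carrier A" and kc: "k [^]\<^bsub>B\<^esub> n \<in> carrier B" using assms(4,6) by simp_all
  have HA: "subgroup H A" unfolding assms(8) by (rule A.generate_is_subgroup) (use hc in simp)
  have KB: "subgroup K B" unfolding assms(9) by (rule B.generate_is_subgroup) (use kc in simp)
  have hH: "?h \<in> H" unfolding assms(8) by (rule generate.incl) simp
  have \<phi>: "\<phi> \<in> hom (A\<lparr>carrier := H\<rparr>) (B\<lparr>carrier := K\<rparr>)" "bij_betw \<phi> H K" using assms(10) by (auto simp: iso_def)
  then have \<phi>B: "\<phi> \<in> hom (A\<lparr>carrier := H\<rparr>) B" using subgroup.subset[OF KB] by (auto simp: hom_def)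
  interpret HG: group "A\<lparr>carrier := H\<rparr>" by (rule subgroup.subgroup_is_group[OF HA A.is_group])
  interpret f: group_hom "A\<lparr>carrier := H\<rparr>" B \<phi> by unfold_locales (rule \<phi>B)
  interpret D: amalgam_data A B H \<phi> by unfold_locales (use subgroup.subset[OF HA] \<phi>B in \<open>auto simp: hom_def\<close>)
  have am: "amalgamation A B G D.inA D.inB ?h k'"
    unfolding assms(11) k'_def by (rule D.amalgam_amalgamation[OF hc assms(8) \<phi>B])
  interpret amalgamation A B G D.inA D.inB ?h k' by (rule am)
  have pow: "\<phi> (?h [^]\<^bsub>A\<^esub> i) = k' [^]\<^bsub>B\<^esub> i" for i :: int
  proof -
    have "?h [^]\<^bsub>A\<lparr>carrier := H\<rparr>\<^esub> i = ?h [^]\<^bsub>A\<^esub> i" using A.int_pow_consistent[OF HA hH] by simp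
    then show ?thesis using f.hom_int_pow[of ?h i] hH by (simp add: k'_def)
  qed
  have kK: "k' \<in> K" using \<phi>(2) hH unfolding k'_def bij_betw_def by blast
  have k'c: "k' \<in> carrier B" by (rule k)
  have Kk: "k [^]\<^bsub>B\<^esub> n \<in> generate B {k'}"
  proof -
    have "k [^]\<^bsub>B\<^esub> n \<in> K" unfolding assms(9) by (rule generate.incl) simp
    then obtain a where "a \<in> H" "k [^]\<^bsub>B\<^esub> n = \<phi> a" using \<phi>(2) unfolding bij_betw_def by blast
    then obtain i :: int where "k [^]\<^bsub>B\<^esub> n = k' [^]\<^bsub>B\<^esub> i" using A.generate_pow[OF hc] pow unfolding assms(8) by auto
    then show ?thesis using B.generate_pow[OF k'c] by auto
  qed
  have "tame_closure_at p G g" if g: "g \<in> carrier G" for g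
  proof (cases "h = \<one>\<^bsub>A\<^esub> \<or> k = \<one>\<^bsub>B\<^esub>")
    case True
    have one: "?h = \<one>\<^bsub>A\<^esub> \<longleftrightarrow> k' = \<one>\<^bsub>B\<^esub>"
    proof
      assume "?h = \<one>\<^bsub>A\<^esub>" then show "k' = \<one>\<^bsub>B\<^esub>" using f.hom_one by (simp add: k'_def)
    next
      assume "k' = \<one>\<^bsub>B\<^esub>"
      then have "\<phi> ?h = \<phi> \<one>\<^bsub>A\<^esub>" using f.hom_one by (simp add: k'_def)
      then show "?h = \<one>\<^bsub>A\<^esub>" using \<phi>(2) hH subgroup.one_closed[OF HA] unfolding bij_betw_def inj_on_def by blast
    qed
    show ?thesis
    proof (cases "h = \<one>\<^bsub>A\<^esub>")
      case True
      then have "?h = \<one>\<^bsub>A\<^esub>" by simp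
      moreover have "carrier A = {\<one>\<^bsub>A\<^esub>}" using maximal_trivial[OF A.is_group] assms(5) True by simp
      ultimately show ?thesis
        using tame_trivial_factor[OF prime free_group_ut_separated[OF prime assms(3)], of A G D.inA D.inB g] am one g by simp
    next
      case False
      then have k1: "k = \<one>\<^bsub>B\<^esub>" using \<open>h = \<one>\<^bsub>A\<^esub> \<or> k = \<one>\<^bsub>B\<^esub>\<close> by blast
      then have "carrier B = {\<one>\<^bsub>B\<^esub>}" using maximal_trivial[OF B.is_group] assms(7) by simp
      moreover from this have "k' = \<one>\<^bsub>B\<^esub>" using k'c by simp
      ultimately show ?thesis
        using tame_trivial_factor[OF prime free_group_ut_separated[OF prime assms(2)], of B G D.inB D.inA g] swap one g by simp
    qed
  next
    case False
    then have ne: "h \<noteq> \<one>\<^bsub>A\<^esub>" "k \<noteq> \<one>\<^bsub>B\<^esub>" by auto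
    have pA: "tame_pair p A h" by (rule tame_pair_free[OF prime assms(2,4) ne(1) assms(5)])
    have pB: "tame_pair p B k" by (rule tame_pair_free[OF prime assms(3,6) ne(2) assms(7)])
    have ordA: "i = 0" if "h [^]\<^bsub>A\<^esub> i = \<one>\<^bsub>A\<^esub>" for i :: int
      using central_mod_p_infinite_order[OF prime _ A.is_group that] pA unfolding tame_pair_def by blast
    have ordB: "i = 0" if "k [^]\<^bsub>B\<^esub> i = \<one>\<^bsub>B\<^esub>" for i :: int
      using central_mod_p_infinite_order[OF prime _ B.is_group that] pB unfolding tame_pair_def by blast
    have mn: "m \<noteq> 0 \<and> n \<noteq> 0"
    proof -
      have "?h = \<one>\<^bsub>A\<^esub> \<longleftrightarrow> k [^]\<^bsub>B\<^esub> n = \<one>\<^bsub>B\<^esub>"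
      proof
        assume "?h = \<one>\<^bsub>A\<^esub>"
        then have "k' = \<one>\<^bsub>B\<^esub>" using f.hom_one by (simp add: k'_def)
        then show "k [^]\<^bsub>B\<^esub> n = \<one>\<^bsub>B\<^esub>" using Kk B.generate_pow[OF B.one_closed] by auto
      next
        assume "k [^]\<^bsub>B\<^esub> n = \<one>\<^bsub>B\<^esub>"
        then have "k' = \<one>\<^bsub>B\<^esub>" using kK B.generate_pow[OF B.one_closed] unfolding assms(9) by auto
        then have "\<phi> ?h = \<phi> \<one>\<^bsub>A\<^esub>" using f.hom_one by (simp add: k'_def)
        then show "?h = \<one>\<^bsub>A\<^esub>" using \<phi>(2) hH subgroup.one_closed[OF HA] unfolding bij_betw_def inj_on_def by blast
      qed
      then have "m = 0 \<longleftrightarrow> n = 0" using ordA[of m] ordB[of n] by auto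
      moreover have "p_number p 0 \<Longrightarrow> False" using prime_gt_0_nat[OF prime] by (auto simp: p_number_def)
      ultimately show ?thesis using assms(12) by auto
    qed
    have genh: "?h \<in> generate A {?h}" by (rule generate.incl) simp
    obtain h0 where h0: "h0 \<in> carrier A" "generate A {h0} = generate A {h}" "?h = h0 [^]\<^bsub>A\<^esub> nat \<bar>m\<bar>"
      by (rule generator_of_power[OF A.is_group assms(4) ordA genh genh]) (use mn in auto)
    obtain k0 where k0: "k0 \<in> carrier B" "generate B {k0} = generate B {k}" "k' = k0 [^]\<^bsub>B\<^esub> nat \<bar>n\<bar>"
      by (rule generator_of_power[OF B.is_group assms(6) ordB kK[unfolded assms(9)] Kk]) (use mn in auto)
    have h0ne: "h0 \<noteq> \<one>\<^bsub>A\<^esub>"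
    proof
      assume "h0 = \<one>\<^bsub>A\<^esub>"
      then have "?h = \<one>\<^bsub>A\<^esub>" using h0(3) by simp
      then show False using ordA mn by blast
    qed
    have k0ne: "k0 \<noteq> \<one>\<^bsub>B\<^esub>"
    proof
      assume "k0 = \<one>\<^bsub>B\<^esub>"
      then have "k \<in> {\<one>\<^bsub>B\<^esub>}" using k0(2) B.generate_pow[OF B.one_closed] generate.incl[of k "{k}" B] by auto
      then show False using ne(2) by simp
    qed
    have mh0: "maximal_cyclic_subgroup (generate A {h0}) A" and mk0: "maximal_cyclic_subgroup (generate B {k0}) B"
      using assms(5,7) h0(2) k0(2) by simp_all
    have am0: "amalgamation A B G D.inA D.inB (h0 [^]\<^bsub>A\<^esub> nat \<bar>m\<bar>) (k0 [^]\<^bsub>B\<^esub> nat \<bar>n\<bar>)" using am h0(3) k0(3) by simp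
    have pos: "nat \<bar>m\<bar> > 0" "nat \<bar>n\<bar> > 0" using mn by auto
    from assms(12) show ?thesis
    proof (elim disjE conjE)
      assume "m = 1"
      then have "h0 [^]\<^bsub>A\<^esub> nat \<bar>m\<bar> = h0" using h0(1) by simp
      then have "amalgamation A B G D.inA D.inB h0 (k0 [^]\<^bsub>B\<^esub> nat \<bar>n\<bar>)" using am0 by simp
      then show ?thesis by (rule tame_along_generator[OF prime assms(2) h0(1) h0ne mh0 assms(3) k0(1) k0ne mk0 pos(2) _ g])
    next
      assume "n = 1"
      then have "k0 [^]\<^bsub>B\<^esub> nat \<bar>n\<bar> = k0" using k0(1) by simp
      then have "amalgamation B A G D.inB D.inA k0 (h0 [^]\<^bsub>A\<^esub> nat \<bar>m\<bar>)" using amalgamation.swap[OF am0] by simp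
      then show ?thesis by (rule tame_along_generator[OF prime assms(3) k0(1) k0ne mk0 assms(2) h0(1) h0ne mh0 pos(1) _ g])
    next
      assume pn: "p_number p m" "p_number p n"
      then obtain s t where st: "nat \<bar>m\<bar> = p ^ s" "nat \<bar>n\<bar> = p ^ t" by (auto simp: p_number_def nat_power_eq)
      show ?thesis
        by (rule tame_along_powers[OF prime tame_pair_free[OF prime assms(2) h0(1) h0ne mh0]
            tame_pair_free[OF prime assms(3) k0(1) k0ne mk0] am0[unfolded st] g])
    qed
  qed
  then show ?thesis using p_separable_if_tame[OF prime G.is_group] by blast
qed

end
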